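(* Let $p/n\to\gamma\in(0,\infty)$ and $m/\sqrt n\to\beta\in(0,\infty)$. Let $f:\mathbb{R}\to\mathbb{R}$ be odd, everywhere continuous, and twice differentiable except at finitely many points, and assume there is some $c>0$ such that $|f(x)|,|f'(x)|,|f''(x)|\le ce^{c|x|}$ whenever they exist. With $\tau:=\tau(f,\beta,\lambda)$, define $$\boldsymbol A(f):=a_1(\boldsymbol Y-\boldsymbol I_p)+\tau\,\boldsymbol v\boldsymbol v^\top+\boldsymbol K_0(f-a_1h_1).$$ Then $\|\boldsymbol K(f)-\boldsymbol A(f)\|_2\to0$ almost surely as $n\to\infty$.
   Context: Setting. For each $n$ let $p=p(n)$ and $m=m(n)\le p$ be positive integers. Let $\lambda\ge1$ be fixed, and let $\boldsymbol v=\boldsymbol v^{(n)}\in\mathbb{R}^p$ be deterministic with $\sqrt m\,v_i\in\{-1,1\}$ for $1\le i\le m$ and $v_i=0$ for $i>m$. Let $\boldsymbol Z\in\mathbb{R}^{n\times p}$ have i.i.d. $\mathcal N(0,1)$ entries (all $n$ on a common probability space), $\boldsymbol\Sigma:=(\lambda-1)\boldsymbol v\boldsymbol v^\top+\boldsymbol I_p$, $\boldsymbol S:=n^{-1}\boldsymbol Z^\top\boldsymbol Z$, $\boldsymbol Y:=\boldsymbol\Sigma^{1/2}\boldsymbol S\boldsymbol\Sigma^{1/2}$. Kernel matrices. For $f:\mathbb{R}\to\mathbb{R}$, $\boldsymbol K(f),\boldsymbol K_0(f)\in\mathbb{R}^{p\times p}$ have zero diagonal and off-diagonal entries $(\boldsymbol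 K(f))_{ij}=n^{-1/2}f(\sqrt n\,\boldsymbol Y_{ij})$ and $(\boldsymbol K_0(f))_{ij}=n^{-1/2}f(\sqrt n\,\boldsymbol S_{ij})$, $i\ne j$. Hermite notation. $\phi(z)=(2\pi)^{-1/2}e^{-z^2/2}$, $\langle f,g\rangle_\phi=\int fg\,\phi$, $\{h_k\}$ are the Hermite polynomials normalized so that $\langle h_k,h_\ell\rangle_\phi=\mathbf 1_{k=\ell}$ (positive leading coefficient; $h_1(x)=x$), $a_k:=\langle f,h_k\rangle_\phi$, and $$\tau(f,\beta,\lambda):=\sum_{\ell=3}^\infty\frac{a_\ell(\lambda-1)^\ell}{\sqrt{\ell!}\,\beta^{\ell-1}}.$$ $\|\cdot\|_2$ is the operator norm. *)

theory Defs
  imports "HOL-Probability.Probability" "Jordan_Normal_Form.Matrix"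
begin

no_notation vec_nth (infixl \<open>$\<close> 90)
unbundle no inner_syntax

text \<open>Matrices and vectors carry their dimension as a value, and are indexed from \<open>0\<close>.\<close>

definition vec_norm2 :: "real vec \<Rightarrow> real" where
  "vec_norm2 x = sqrt (x \<bullet> x)"

definition op_norm :: "real mat \<Rightarrow> real" where
  "op_norm A = (SUP x\<in>{x \<in> carrier_vec (dim_col A). vec_norm2 x \<le> 1}. vec_norm2 (A *\<^sub>v x))"

definition psd :: "real mat \<Rightarrow> bool" where
  "psd A \<longleftrightarrow> square_mat A \<and> A\<^sup>T = A \<and> (\<forall>x\<in>carrier_vec (dim_row A). 0 \<le> x \<bullet> (A *\<^sub>v x))"

text \<open>The square root is characterised by its uniqueness among positive semidefinite matrices;
  the definition is meaningful only for a positive semidefinite argument.\<close>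

definition psd_sqrt :: "real mat \<Rightarrow> real mat" where
  "psd_sqrt A = (THE B. B \<in> carrier_mat (dim_row A) (dim_row A) \<and> psd B \<and> B * B = A)"

definition outer_square :: "real vec \<Rightarrow> real mat" where
  "outer_square v = mat (dim_vec v) (dim_vec v) (\<lambda>(i, j). v $ i * v $ j)"

definition spike_cov :: "real \<Rightarrow> real vec \<Rightarrow> real mat" where
  "spike_cov lam v = (lam - 1) \<cdot>\<^sub>m outer_square v + 1\<^sub>m (dim_vec v)"

definition sample_cov :: "real mat \<Rightarrow> real mat" where
  "sample_cov Z = (1 / real (dim_row Z)) \<cdot>\<^sub>m (Z\<^sup>T * Z)"

definition spiked_sample_cov :: "real \<Rightarrow> real vec \<Rightarrow> real mat \<Rightarrow> real mat" where
  "spiked_sample_cov lam v Z =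
     psd_sqrt (spike_cov lam v) * sample_cov Z * psd_sqrt (spike_cov lam v)"

definition kernel_mat :: "nat \<Rightarrow> (real \<Rightarrow> real) \<Rightarrow> real mat \<Rightarrow> real mat" where
  "kernel_mat n f X = mat (dim_row X) (dim_col X)
     (\<lambda>(i, j). if i = j then 0 else f (sqrt (real n) * X $$ (i, j)) / sqrt (real n))"

definition inner_gauss :: "(real \<Rightarrow> real) \<Rightarrow> (real \<Rightarrow> real) \<Rightarrow> real" where
  "inner_gauss f g = (\<integral>x. f x * g x * std_normal_density x \<partial>lborel)"

text \<open>The monic (probabilists') Hermite polynomials, by the recursion
  \<open>He\<^sub>k\<^sub>+\<^sub>1(x) = x He\<^sub>k(x) - He\<^sub>k'(x)\<close>, which is Rodrigues' formula.\<close>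

primrec hermite_monic :: "nat \<Rightarrow> real poly" where
  "hermite_monic 0 = 1"
| "hermite_monic (Suc k) = [:0, 1:] * hermite_monic k - pderiv (hermite_monic k)"

definition hermite :: "nat \<Rightarrow> real \<Rightarrow> real" where
  "hermite k x = poly (hermite_monic k) x / sqrt (fact k)"

definition hermite_coeff :: "(real \<Rightarrow> real) \<Rightarrow> nat \<Rightarrow> real" where
  "hermite_coeff f k = inner_gauss f (hermite k)"

text \<open>The summation index is shifted: \<open>\<ell> = k + 3\<close>, hence \<open>\<ell> - 1 = k + 2\<close>.\<close>

definition tau :: "(real \<Rightarrow> real) \<Rightarrow> real \<Rightarrow> real \<Rightarrow> real" where
  "tau f \<beta> lam =
     (\<Sum>k. hermite_coeff f (k + 3) * (lam - 1) ^ (k + 3) / (sqrt (fact (k + 3)) * \<beta> ^ (k + 2)))"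

lemma hermite_1: "hermite 1 x = x"
  by (simp add: hermite_def)

text \<open>The normalization: \<open>hermite\<close> is orthonormal for \<open>inner_gauss\<close>, of degree \<open>k\<close> and with positive
  leading coefficient.\<close>

lemma hermite_monic_degree: "degree (hermite_monic k) = k \<and> lead_coeff (hermite_monic k) = 1"
proof (induction k)
  case (Suc k)
  let ?p = "hermite_monic k"
  have p0: "?p \<noteq> 0" using Suc by auto
  have d1: "degree ([:0, 1:] * ?p) = Suc k"
    using Suc p0 by (simp add: degree_mult_eq)
  have d2: "degree (pderiv ?p) < Suc k"
    using Suc by (simp add: degree_pderiv)
  have d: "degree (hermite_monic (Suc k)) = Suc k"
    using degree_add_eq_left[of "- pderiv ?p" "[:0, 1:] * ?p"] d1 d2 by simp
  have "coeff (pderiv ?p) (Suc k) = 0"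
    using d2 by (rule coeff_eq_0)
  moreover have "coeff ?p k = 1"
    using Suc by metis
  then have "coeff ([:0, 1:] * ?p) (Suc k) = 1" by simp
  ultimately have "coeff (hermite_monic (Suc k)) (Suc k) = 1" by simp
  with d show ?case by simp
qed simp

lemma poly_gauss_integrable: "integrable lborel (\<lambda>x. std_normal_density x * poly p x)"
proof -
  have "integrable lborel (\<lambda>x. \<Sum>i\<le>degree p. coeff p i * (std_normal_density x * x ^ i))"
    by (intro Bochner_Integration.integrable_sum integrable_mult_right integrable_std_normal_moment)
  also have "(\<lambda>x. \<Sum>i\<le>degree p. coeff p i * (std_normal_density x * x ^ i)) =
      (\<lambda>x. std_normal_density x * poly p x)"
    by (auto simp: poly_altdef sum_distrib_left mult_ac)
  finally show ?thesis .
qed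

lemma gauss_moment_recurrence:
  "(\<integral>x. std_normal_density x * x ^ Suc k \<partial>lborel) =
     real k * (\<integral>x. std_normal_density x * x ^ (k - 1) \<partial>lborel)"
proof (cases "even k")
  case True
  then obtain j where j: "k = 2 * j" by (elim evenE)
  show ?thesis
  proof (cases j)
    case 0
    then show ?thesis using integral_std_normal_moment_odd[of 0] j by simp
  next
    case (Suc i)
    then show ?thesis
      using integral_std_normal_moment_odd[of i] integral_std_normal_moment_odd[of j] j by simp
  qed
next
  case False
  then obtain j where j: "k = 2 * j + 1" by (elim oddE)
  have e: "Suc k = 2 * Suc j" and k1: "k - 1 = 2 * j" using j by simp_all
  show ?thesis
    unfolding e k1 integral_std_normal_moment_even
    by (simp add: j divide_simps del: of_nat_Suc) (simp add: algebra_simps)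
qed

lemma gauss_add:
  "(\<integral>x. std_normal_density x * poly (p + q) x \<partial>lborel) =
     (\<integral>x. std_normal_density x * poly p x \<partial>lborel) +
     (\<integral>x. std_normal_density x * poly q x \<partial>lborel)"
  using Bochner_Integration.integral_add[OF poly_gauss_integrable[of p] poly_gauss_integrable[of q]]
  by (simp add: distrib_left)

lemma gauss_diff:
  "(\<integral>x. std_normal_density x * poly (p - q) x \<partial>lborel) =
     (\<integral>x. std_normal_density x * poly p x \<partial>lborel) -
     (\<integral>x. std_normal_density x * poly q x \<partial>lborel)"
  using Bochner_Integration.integral_diff[OF poly_gauss_integrable[of p] poly_gauss_integrable[of q]]
  by (simp add: right_diff_distrib)

lemma gauss_integration_by_parts:
  "(\<integral>x. std_normal_density x * poly ([:0, 1:] * p) x \<partial>lborel) =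
     (\<integral>x. std_normal_density x * poly (pderiv p) x \<partial>lborel)" (is "?P p")
proof -
  have monom: "?P (monom c k)" for c k
  proof -
    have "(\<integral>x. std_normal_density x * poly ([:0, 1:] * monom c k) x \<partial>lborel) =
        (\<integral>x. c * (std_normal_density x * x ^ Suc k) \<partial>lborel)"
      by (simp add: poly_monom mult_ac)
    also have "\<dots> = c * (real k * (\<integral>x. std_normal_density x * x ^ (k - 1) \<partial>lborel))"
      using gauss_moment_recurrence[of k] by (simp del: power_Suc)
    also have "\<dots> = (\<integral>x. (real k * c) * (std_normal_density x * x ^ (k - 1)) \<partial>lborel)"
      by simp
    also have "\<dots> = (\<integral>x. std_normal_density x * poly (pderiv (monom c k)) x \<partial>lborel)"
      by (simp add: poly_monom pderiv_monom mult_ac)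
    finally show ?thesis .
  qed
  have "?P (\<Sum>i\<le>n. monom (coeff p i) i)" for n
  proof (induction n)
    case 0
    show ?case using monom[of "coeff p 0" 0] by simp
  next
    case (Suc n)
    then show ?case
      by (simp only: sum.atMost_Suc distrib_left pderiv_add gauss_add monom)
  qed
  from this[of "degree p"] show ?thesis by (simp only: poly_as_sum_of_monoms)
qed

lemma inner_hermite_monic:
  "(\<integral>x. std_normal_density x * poly (hermite_monic k * q) x \<partial>lborel) =
     (\<integral>x. std_normal_density x * poly ((pderiv ^^ k) q) x \<partial>lborel)"
proof (induction k arbitrary: q)
  case (Suc k)
  let ?p = "hermite_monic k"
  have "hermite_monic (Suc k) * q = [:0, 1:] * (?p * q) - pderiv ?p * q"
    by (simp add: algebra_simps)
  moreover have "pderiv (?p * q) = pderiv ?p * q + ?p * pderiv q"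
    by (simp add: pderiv_mult algebra_simps)
  ultimately have "(\<integral>x. std_normal_density x * poly (hermite_monic (Suc k) * q) x \<partial>lborel) =
      (\<integral>x. std_normal_density x * poly (?p * pderiv q) x \<partial>lborel)"
    by (simp only: gauss_diff gauss_add gauss_integration_by_parts)
  then show ?case using Suc.IH[of "pderiv q"] by (simp only: funpow_Suc_right o_apply)
qed simp

lemma funpow_pderiv_monic:
  fixes q :: "real poly"
  assumes "degree q \<le> k"
  shows "(pderiv ^^ k) q = [:fact k * coeff q k:]"
proof -
  have d: "degree ((pderiv ^^ j) q) \<le> k - j" for j
    using assms by (induction j) (auto simp: degree_pderiv)
  have c: "coeff ((pderiv ^^ j) q) i = (fact (i + j) / fact i) * coeff q (i + j)" for i j
  proof (induction j arbitrary: i)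
    case (Suc j)
    have "coeff ((pderiv ^^ Suc j) q) i = real (Suc i) * coeff ((pderiv ^^ j) q) (Suc i)"
      by (simp add: coeff_pderiv)
    also have "\<dots> = real (Suc i) * (fact (Suc i + j) / fact (Suc i)) * coeff q (Suc i + j)"
      by (simp only: Suc.IH mult.assoc)
    also have "real (Suc i) * (fact (Suc i + j) / fact (Suc i)) = fact (i + Suc j) / fact i"
      by (simp add: divide_simps del: of_nat_Suc)
    finally show ?case by simp
  qed simp
  from d[of k] obtain a where a: "(pderiv ^^ k) q = [:a:]"
    using degree_0_id by (metis degree_eq_zeroE diff_self_eq_0 le_zero_eq)
  then show ?thesis using c[of k 0] by simp
qed

lemma hermite_orthonormal: "inner_gauss (hermite k) (hermite l) = (if k = l then 1 else 0)"
proof -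
  have *: "inner_gauss (hermite k) (hermite l) = (if k = l then 1 else 0)" if "l \<le> k" for k l
  proof -
    have c: "coeff (hermite_monic l) k = (if k = l then 1 else 0)"
      using hermite_monic_degree[of l] that by (auto simp: coeff_eq_0)
    have "inner_gauss (hermite k) (hermite l) = (\<integral>x. std_normal_density x *
        poly (hermite_monic k * hermite_monic l) x / (sqrt (fact k) * sqrt (fact l)) \<partial>lborel)"
      by (simp add: inner_gauss_def hermite_def mult_ac)
    also have "\<dots> = (\<integral>x. std_normal_density x * poly (hermite_monic k * hermite_monic l) x \<partial>lborel)
        / (sqrt (fact k) * sqrt (fact l))"
      by simp
    also have "\<dots> = (\<integral>x. (fact k * coeff (hermite_monic l) k) * (std_normal_density x * x ^ 0) \<partial>lborel)
        / (sqrt (fact k) * sqrt (fact l))"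
      using funpow_pderiv_monic[of "hermite_monic l" k] hermite_monic_degree[of l] that
      by (simp only: inner_hermite_monic) (simp add: mult_ac)
    also have "\<dots> = fact k * coeff (hermite_monic l) k / (sqrt (fact k) * sqrt (fact l))"
      using integral_std_normal_moment_even[of 0] by simp
    also have "\<dots> = (if k = l then 1 else 0)"
      using c by simp
    finally show ?thesis .
  qed
  have "inner_gauss (hermite k) (hermite l) = inner_gauss (hermite l) (hermite k)"
    by (simp add: inner_gauss_def mult_ac)
  then show ?thesis using *[of l k] *[of k l] by (cases "l \<le> k") auto
qed

definition twice_differentiable_at :: "(real \<Rightarrow> real) \<Rightarrow> real \<Rightarrow> bool" where
  "twice_differentiable_at f x \<longleftrightarrow>
     (\<forall>\<^sub>F y in nhds x. f differentiable (at y)) \<and> deriv f differentiable (at x)"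

end

theory Submission
  imports Defs "HOL-Real_Asymp.Real_Asymp"
begin

text \<open>
  Let \<open>\<mu> = \<surd>\<lambda> - 1\<close>, so that \<open>\<Sigma>\<^sup>1\<^sup>/\<^sup>2 = I + \<mu> v v\<^sup>T\<close> and, with \<open>u = S v\<close> and \<open>Q = v\<^sup>T S v\<close>,
  \<open>Y = S + \<mu> (v u\<^sup>T + u v\<^sup>T) + \<mu>\<^sup>2 Q v v\<^sup>T\<close>. Since \<open>K(f) - A(f)\<close> is linear in the kernel, only
  \<open>g = f - a\<^sub>1 h\<^sub>1\<close> matters off the diagonal.

  On the block of the support of \<open>v\<close>, \<open>\<surd>n Y\<^sub>i\<^sub>j\<close> is \<open>\<surd>n S\<^sub>i\<^sub>j + \<theta> \<sigma>\<^sub>i\<^sub>j\<close> with \<open>\<sigma>\<^sub>i\<^sub>j = m v\<^sub>i v\<^sub>j = \<plusminus>1\<close> and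
  \<open>\<theta> = (\<lambda> - 1) \<surd>n / m\<close>, up to an error that is small in Frobenius norm because \<open>u\<close> is close to \<open>v\<close>.
  As \<open>g\<close> is odd, the Gaussian mean of \<open>g (x + \<theta> \<sigma>)\<close> is \<open>\<sigma> \<Phi> \<theta>\<close>, where \<open>\<Phi>\<close> is the mean of the shifted \<open>g\<close>; this part is
  \<open>(m / \<surd>n) \<Phi> \<theta>\<close> times \<open>v v\<^sup>T\<close>, and the Hermite expansion of \<open>\<Phi>\<close> identifies the limit of the factor
  with \<open>\<tau>\<close>. The rest of the block is a kernel matrix with centred entries. On the cross block of rows in and columns outside the support,
  the shift is of order \<open>n powr (-1/4)\<close>, and \<open>\<Phi>\<close> vanishes to second order at \<open>0\<close>, because \<open>g\<close> is
  orthogonal to \<open>1\<close> and \<open>h\<^sub>1\<close>.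

  The operator norms of the two remaining random blocks are controlled through their Gram matrices \<open>B B\<^sup>T\<close>.
  Given the Gaussian columns \<open>z\<^sub>i\<close> and \<open>z\<^sub>k\<close>, the entry \<open>(B B\<^sup>T)\<^sub>i\<^sub>k\<close> is a sum of independent terms, which are
  nearly centred when \<open>z\<^sub>i\<close> and \<open>z\<^sub>k\<close> are nearly orthogonal. Its sixth moment gives summable
  bounds, and Borel--Cantelli applies to each size separately, so no relation between the matrices of
  different \<open>n\<close> is needed.
\<close>

section \<open>Gaussian vectors\<close>

text \<open>The exponent six is forced. In a block with about \<open>sqrt n\<close> rows and columns
  and entries of order \<open>1 / sqrt n\<close>, an off-diagonal Gram entry has
  \<open>2k\<close>-th moment of order \<open>n powr (-3k/2)\<close>. Recovering the Frobenius norm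
  from \<open>2k\<close>-th powers and summing over pairs costs \<open>m ^ (2k)\<close>, so
  \<open>n powr (-k/2)\<close> is left, and Borel--Cantelli asks for \<open>k = 3\<close>. On the
  cross block there are up to order \<open>n\<close> columns. With a shift of size \<epsilon>, about
  \<open>n powr (-1/4)\<close>, a bias of order \<epsilon> squared in each product would leave no
  decay at all; third order is just enough. It is reached although all rows are shifted along one
  common direction, that of \<open>Z v\<close>: the component of each new column along it is
  conditioned upon first, and only the rest is compared with independent variables. The good event
  allows kernel arguments of size \<eta> times \<open>ln n\<close>. Exponential growth of
  \<open>f\<close> then costs a power of \<open>n\<close> proportional to \<eta>. Hence \<eta> is
  kept as a parameter and fixed at the very end, small enough for the rate \<open>r n\<close> to
  absorb this power.\<close>

abbreviation gam :: "real measure" where "gam \<equiv> std_normal_distribution"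

lemma prob_space_gam: "prob_space gam"
  using prob_space_normal_density[of 1 0] by simp

lemma sigma_finite_gam: "sigma_finite_measure gam"
  using prob_space_gam prob_space_imp_sigma_finite by blast

interpretation gam: prob_space gam by (rule prob_space_gam)

lemma emeasure_gam_UNIV [simp]: "emeasure gam UNIV = 1"
  using gam.emeasure_space_1 by simp

interpretation gam_pair: pair_sigma_finite gam gam
  by (simp add: pair_sigma_finite.intro sigma_finite_gam)

interpretation PG: product_sigma_finite "\<lambda>_::nat. gam"
  by (simp add: product_sigma_finite_def sigma_finite_gam)

abbreviation gauss :: "nat set \<Rightarrow> (nat \<Rightarrow> real) measure" where
  "gauss I \<equiv> Pi\<^sub>M I (\<lambda>_. gam)"

definition dot :: "nat set \<Rightarrow> (nat \<Rightarrow> real) \<Rightarrow> (nat \<Rightarrow> real) \<Rightarrow> real" where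
  "dot I x y = (\<Sum>r\<in>I. x r * y r)"

lemma prob_space_gauss: "prob_space (gauss I)"
  by (intro prob_space_PiM prob_space_gam)

interpretation gauss: prob_space "gauss I" for I
  by (rule prob_space_gauss)

lemma borel_gam [measurable_cong, simp]: "sets gam = sets borel" by simp

lemma measurable_dot [measurable]: "dot I x \<in> borel_measurable (gauss I)"
  unfolding dot_def by measurable

text \<open>A rotation is split into two substitutions that change one coordinate each, so
  one-dimensional affine changes of variable and Fubini suffice. Their factors
  \<open>\<bar>c\<bar>\<close> and \<open>1 / \<bar>c\<bar>\<close> cancel; for \<open>c = 0\<close>
  the rotation is a swap with a sign.\<close>

lemma nn_integral_lborel_rotate:
  fixes K :: "real \<times> real \<Rightarrow> ennreal"
  assumes [measurable]: "K \<in> borel_measurable (borel \<Otimes>\<^sub>M borel)" and cs: "c\<^sup>2 + s\<^sup>2 = 1"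
  shows "(\<integral>\<^sup>+x. \<integral>\<^sup>+y. K (c * x + s * y, - s * x + c * y) \<partial>lborel \<partial>lborel) =
    (\<integral>\<^sup>+x. \<integral>\<^sup>+y. K (x, y) \<partial>lborel \<partial>lborel)"
proof -
  note [measurable_cong] = sets_lborel
  show ?thesis
  proof (cases "c = 0")
    case True
    then have s: "s = 1 \<or> s = -1" using cs by (simp add: power2_eq_1_iff)
    then have sa: "\<bar>s\<bar> = 1" "s \<noteq> 0" by auto
    have "(\<integral>\<^sup>+x. \<integral>\<^sup>+y. K (c * x + s * y, - s * x + c * y) \<partial>lborel \<partial>lborel) =
        (\<integral>\<^sup>+x. \<integral>\<^sup>+y. K (y, - s * x) \<partial>lborel \<partial>lborel)"
    proof (rule nn_integral_cong)
      fix x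
      show "(\<integral>\<^sup>+y. K (c * x + s * y, - s * x + c * y) \<partial>lborel) = (\<integral>\<^sup>+y. K (y, - s * x) \<partial>lborel)"
        using nn_integral_real_affine[of "\<lambda>y. K (y, - s * x)" s 0] sa True by simp
    qed
    also have "\<dots> = (\<integral>\<^sup>+y. \<integral>\<^sup>+x. K (y, - s * x) \<partial>lborel \<partial>lborel)"
      by (rule lborel_pair.Fubini') measurable
    also have "\<dots> = (\<integral>\<^sup>+y. \<integral>\<^sup>+x. K (y, x) \<partial>lborel \<partial>lborel)"
    proof (rule nn_integral_cong)
      fix y
      show "(\<integral>\<^sup>+x. K (y, - s * x) \<partial>lborel) = (\<integral>\<^sup>+x. K (y, x) \<partial>lborel)"
        using nn_integral_real_affine[of "\<lambda>x. K (y, x)" "-s" 0] sa by simp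
    qed
    finally show ?thesis .
  next
    case False
    \<comment> \<open>With the second new coordinate \<open>v = - s * x + c * y\<close> as variable
      in place of \<open>y\<close>, the first one becomes \<open>(x + s * v) / c\<close>.\<close>
    have cx: "(x + s * (- s * x + c * y)) / c = c * x + s * y" for x y
    proof -
      have "x + s * (- s * x + c * y) = x * (1 - s\<^sup>2) + s * c * y"
        by (simp add: algebra_simps power2_eq_square)
      also have "1 - s\<^sup>2 = c\<^sup>2" using cs by simp
      finally show ?thesis using False by (simp add: field_simps power2_eq_square)
    qed
    have 1: "ennreal \<bar>c\<bar> * (\<integral>\<^sup>+y. K (c * x + s * y, - s * x + c * y) \<partial>lborel) =
      (\<integral>\<^sup>+v. K ((x + s * v) / c, v) \<partial>lborel)" for x
    proof -
      have "(\<integral>\<^sup>+v. K ((x + s * v) / c, v) \<partial>lborel) =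
          ennreal \<bar>c\<bar> * (\<integral>\<^sup>+y. K ((x + s * (- s * x + c * y)) / c, - s * x + c * y) \<partial>lborel)"
        by (rule nn_integral_real_affine) (use False in measurable)
      then show ?thesis by (simp only: cx)
    qed
    have 2: "(\<integral>\<^sup>+x. K ((x + s * v) / c, v) \<partial>lborel) = ennreal \<bar>c\<bar> * (\<integral>\<^sup>+u. K (u, v) \<partial>lborel)" for v
    proof -
      have "(\<integral>\<^sup>+u. K (u, v) \<partial>lborel) = ennreal \<bar>1 / c\<bar> * (\<integral>\<^sup>+x. K (s * v / c + 1 / c * x, v) \<partial>lborel)"
        by (rule nn_integral_real_affine) (measurable, simp add: False)
      moreover have "s * v / c + 1 / c * x = (x + s * v) / c" for x
        using False by (simp add: field_simps)
      ultimately have "ennreal \<bar>c\<bar> * (\<integral>\<^sup>+u. K (u, v) \<partial>lborel) =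
          ennreal \<bar>c\<bar> * ennreal \<bar>1 / c\<bar> * (\<integral>\<^sup>+x. K ((x + s * v) / c, v) \<partial>lborel)"
        by (simp add: mult.assoc)
      also have "ennreal \<bar>c\<bar> * ennreal \<bar>1 / c\<bar> = 1"
        using False by (simp flip: ennreal_mult)
      finally show ?thesis by simp
    qed
    have "ennreal \<bar>c\<bar> * (\<integral>\<^sup>+x. \<integral>\<^sup>+y. K (c * x + s * y, - s * x + c * y) \<partial>lborel \<partial>lborel) =
        (\<integral>\<^sup>+x. \<integral>\<^sup>+v. K ((x + s * v) / c, v) \<partial>lborel \<partial>lborel)"
      by (subst nn_integral_cmult[symmetric]) (simp_all only: 1, measurable)
    also have "\<dots> = (\<integral>\<^sup>+v. \<integral>\<^sup>+x. K ((x + s * v) / c, v) \<partial>lborel \<partial>lborel)"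
      by (rule lborel_pair.Fubini') (use False in measurable)
    also have "\<dots> = ennreal \<bar>c\<bar> * (\<integral>\<^sup>+v. \<integral>\<^sup>+u. K (u, v) \<partial>lborel \<partial>lborel)"
      by (simp only: 2) (rule nn_integral_cmult, measurable)
    also have "(\<integral>\<^sup>+v. \<integral>\<^sup>+u. K (u, v) \<partial>lborel \<partial>lborel) = (\<integral>\<^sup>+u. \<integral>\<^sup>+v. K (u, v) \<partial>lborel \<partial>lborel)"
      by (rule lborel_pair.Fubini') measurable
    finally show ?thesis
      using False by (simp add: ennreal_mult_cancel_left)
  qed
qed

lemma std_normal_density_rotate:
  assumes "c\<^sup>2 + s\<^sup>2 = 1"
  shows "std_normal_density (c * x + s * y) * std_normal_density (- s * x + c * y) =
    std_normal_density x * std_normal_density y"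
proof -
  have "(c * x + s * y)\<^sup>2 + (- s * x + c * y)\<^sup>2 = (c\<^sup>2 + s\<^sup>2) * (x\<^sup>2 + y\<^sup>2)"
    by (simp add: algebra_simps power2_eq_square)
  then have "exp (- (c * x + s * y)\<^sup>2 / 2) * exp (- (- s * x + c * y)\<^sup>2 / 2) = exp (- x\<^sup>2 / 2) * exp (- y\<^sup>2 / 2)"
    using assms by (simp add: field_simps flip: exp_add)
  then show ?thesis by (simp add: std_normal_density_def)
qed

lemma nn_integral_gam:
  "F \<in> borel_measurable borel \<Longrightarrow>
    (\<integral>\<^sup>+x. F x \<partial>gam) = (\<integral>\<^sup>+x. ennreal (std_normal_density x) * F x \<partial>lborel)"
  by (simp add: nn_integral_density)

lemma nn_integral_gam_rotate:
  fixes F :: "real \<times> real \<Rightarrow> ennreal"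
  assumes [measurable]: "F \<in> borel_measurable (borel \<Otimes>\<^sub>M borel)" and cs: "c\<^sup>2 + s\<^sup>2 = 1"
  shows "(\<integral>\<^sup>+x. \<integral>\<^sup>+y. F (c * x + s * y, - s * x + c * y) \<partial>gam \<partial>gam) =
    (\<integral>\<^sup>+x. \<integral>\<^sup>+y. F (x, y) \<partial>gam \<partial>gam)"
proof -
  let ?d = "\<lambda>x. ennreal (std_normal_density x)"
  have *: "(\<integral>\<^sup>+x. \<integral>\<^sup>+y. G (x, y) \<partial>gam \<partial>gam) =
    (\<integral>\<^sup>+x. \<integral>\<^sup>+y. ?d x * ?d y * G (x, y) \<partial>lborel \<partial>lborel)"
    if [measurable]: "G \<in> borel_measurable (borel \<Otimes>\<^sub>M borel)" for G :: "real \<times> real \<Rightarrow> ennreal"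
  proof -
    have [measurable]: "(\<lambda>x. \<integral>\<^sup>+y. G (x, y) \<partial>gam) \<in> borel_measurable borel"
      by measurable
    show ?thesis
      by (simp add: nn_integral_gam nn_integral_cmult[symmetric] mult.assoc del: nn_integral_cmult)
  qed
  have "(\<integral>\<^sup>+x. \<integral>\<^sup>+y. F (c * x + s * y, - s * x + c * y) \<partial>gam \<partial>gam) =
    (\<integral>\<^sup>+x. \<integral>\<^sup>+y. ?d x * ?d y * F (c * x + s * y, - s * x + c * y) \<partial>lborel \<partial>lborel)"
    using *[of "\<lambda>(x, y). F (c * x + s * y, - s * x + c * y)"] by simp
  also have "\<dots> = (\<integral>\<^sup>+x. \<integral>\<^sup>+y. (\<lambda>(x, y). ?d x * ?d y * F (x, y)) (c * x + s * y, - s * x + c * y) \<partial>lborel \<partial>lborel)"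
    using std_normal_density_rotate[OF cs] by (simp flip: ennreal_mult)
  also have "\<dots> = (\<integral>\<^sup>+x. \<integral>\<^sup>+y. (\<lambda>(x, y). ?d x * ?d y * F (x, y)) (x, y) \<partial>lborel \<partial>lborel)"
    by (rule nn_integral_lborel_rotate[OF _ cs]) measurable
  also have "\<dots> = (\<integral>\<^sup>+x. \<integral>\<^sup>+y. F (x, y) \<partial>gam \<partial>gam)"
    by (simp add: *)
  finally show ?thesis .
qed

lemma nn_integral_gam_uminus:
  assumes [measurable]: "F \<in> borel_measurable borel"
  shows "(\<integral>\<^sup>+x. F (- x) \<partial>gam) = (\<integral>\<^sup>+x. F x \<partial>gam)"
proof -
  have "(\<integral>\<^sup>+x. F x \<partial>gam) = (\<integral>\<^sup>+x. ennreal (std_normal_density x) * F x \<partial>lborel)"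
    by (simp add: nn_integral_gam)
  also have "\<dots> = (\<integral>\<^sup>+x. ennreal (std_normal_density (- x)) * F (- x) \<partial>lborel)"
    using nn_integral_real_affine[of "\<lambda>x. ennreal (std_normal_density x) * F x" "-1" 0] by simp
  also have "\<dots> = (\<integral>\<^sup>+x. ennreal (std_normal_density x) * F (- x) \<partial>lborel)"
    by (simp add: normal_density_def)
  also have "\<dots> = (\<integral>\<^sup>+x. F (- x) \<partial>gam)"
    by (simp add: nn_integral_gam)
  finally show ?thesis by simp
qed

lemma measurable_fun_upd_gauss:
  assumes "a \<in> I" "f \<in> gauss I \<rightarrow>\<^sub>M gauss I" "h \<in> borel_measurable (gauss I)"
  shows "(\<lambda>x. (f x)(a := h x)) \<in> gauss I \<rightarrow>\<^sub>M gauss I"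
  by (rule measurable_fun_upd[where J=I]) (use assms in auto)

text \<open>Fubini isolates the two coordinates \<open>a\<close> and \<open>b\<close>, and the
  planar case applies. Such plane rotations generate all the invariance that is used, so no general
  orthogonal matrix appears.\<close>

lemma nn_integral_gauss_rotate:
  assumes "finite I" "a \<in> I" "b \<in> I" "a \<noteq> b" and cs: "c\<^sup>2 + s\<^sup>2 = 1"
    and F [measurable]: "F \<in> borel_measurable (gauss I)"
  shows "(\<integral>\<^sup>+\<zeta>. F (\<zeta>(a := c * \<zeta> a + s * \<zeta> b, b := - s * \<zeta> a + c * \<zeta> b)) \<partial>gauss I) = (\<integral>\<^sup>+\<zeta>. F \<zeta> \<partial>gauss I)"
proof -
  define J where "J = I - {a, b}"
  have I: "I = insert a (insert b J)" and J: "finite J" "a \<notin> J" "b \<notin> J" "a \<notin> insert b J"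
    using assms by (auto simp: J_def)
  have *: "(\<integral>\<^sup>+\<zeta>. G \<zeta> \<partial>gauss I) = (\<integral>\<^sup>+x. \<integral>\<^sup>+z. \<integral>\<^sup>+y. G (x(b := z, a := y)) \<partial>gam \<partial>gam \<partial>gauss J)"
    if [measurable]: "G \<in> borel_measurable (gauss I)" for G
  proof -
    have [measurable]: "G \<in> borel_measurable (gauss (insert a (insert b J)))" using that I by simp
    have "(\<integral>\<^sup>+\<zeta>. G \<zeta> \<partial>gauss I) = (\<integral>\<^sup>+x. \<integral>\<^sup>+y. G (x(a := y)) \<partial>gam \<partial>gauss (insert b J))"
      unfolding I using J by (intro PG.product_nn_integral_insert) auto
    also have "\<dots> = (\<integral>\<^sup>+x. \<integral>\<^sup>+z. \<integral>\<^sup>+y. G (x(b := z, a := y)) \<partial>gam \<partial>gam \<partial>gauss J)"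
      using J by (intro PG.product_nn_integral_insert) auto
    finally show ?thesis .
  qed
  have [measurable]: "F \<in> borel_measurable (gauss (insert a (insert b J)))" using F I by simp
  have FF [measurable]: "(\<lambda>\<zeta>. F (\<zeta>(a := c * \<zeta> a + s * \<zeta> b, b := - s * \<zeta> a + c * \<zeta> b))) \<in> borel_measurable (gauss I)"
    using assms by (intro measurable_compose[OF _ F] measurable_fun_upd_gauss) measurable
  have "(\<integral>\<^sup>+\<zeta>. F (\<zeta>(a := c * \<zeta> a + s * \<zeta> b, b := - s * \<zeta> a + c * \<zeta> b)) \<partial>gauss I) =
    (\<integral>\<^sup>+x. \<integral>\<^sup>+z. \<integral>\<^sup>+y. F (x(b := - s * y + c * z, a := c * y + s * z)) \<partial>gam \<partial>gam \<partial>gauss J)"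
    by (subst *[OF FF], intro nn_integral_cong arg_cong[where f=F]) (use assms(4) in \<open>auto simp: fun_eq_iff\<close>)
  also have "\<dots> = (\<integral>\<^sup>+x. \<integral>\<^sup>+z. \<integral>\<^sup>+y. F (x(b := z, a := y)) \<partial>gam \<partial>gam \<partial>gauss J)"
  proof (rule nn_integral_cong)
    fix x assume x: "x \<in> space (gauss J)"
    have m: "(\<lambda>(y, z). F (x(b := z, a := y))) \<in> borel_measurable (borel \<Otimes>\<^sub>M borel)"
      using x by measurable
    have m2: "(\<lambda>(z, y). F (x(b := z, a := y))) \<in> borel_measurable (gam \<Otimes>\<^sub>M gam)"
      using x by measurable
    have m3: "(\<lambda>(z, y). F (x(b := - s * y + c * z, a := c * y + s * z))) \<in> borel_measurable (gam \<Otimes>\<^sub>M gam)"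
      using x by measurable
    have "(\<integral>\<^sup>+z. \<integral>\<^sup>+y. F (x(b := - s * y + c * z, a := c * y + s * z)) \<partial>gam \<partial>gam) =
      (\<integral>\<^sup>+y. \<integral>\<^sup>+z. F (x(b := - s * y + c * z, a := c * y + s * z)) \<partial>gam \<partial>gam)"
      using m3 by (rule gam_pair.Fubini'[symmetric])
    also have "\<dots> = (\<integral>\<^sup>+y. \<integral>\<^sup>+z. F (x(b := z, a := y)) \<partial>gam \<partial>gam)"
      using nn_integral_gam_rotate[OF m cs] by simp
    also have "\<dots> = (\<integral>\<^sup>+z. \<integral>\<^sup>+y. F (x(b := z, a := y)) \<partial>gam \<partial>gam)"
      using m2 by (rule gam_pair.Fubini')
    finally show "(\<integral>\<^sup>+z. \<integral>\<^sup>+y. F (x(b := - s * y + c * z, a := c * y + s * z)) \<partial>gam \<partial>gam) =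
       (\<integral>\<^sup>+z. \<integral>\<^sup>+y. F (x(b := z, a := y)) \<partial>gam \<partial>gam)" .
  qed
  also have "\<dots> = (\<integral>\<^sup>+\<zeta>. F \<zeta> \<partial>gauss I)" by (rule *[symmetric]) fact
  finally show ?thesis .
qed

text \<open>Replaces the component of \<open>\<zeta>\<close> along the unit vector \<open>e\<close> by \<open>g\<close>. For independent standard Gaussian
  \<open>\<zeta>\<close> and \<open>g\<close> the law is unchanged, which disintegrates \<open>gauss I\<close> along \<open>e\<close>.\<close>

definition resample :: "nat set \<Rightarrow> (nat \<Rightarrow> real) \<Rightarrow> (nat \<Rightarrow> real) \<Rightarrow> real \<Rightarrow> nat \<Rightarrow> real" where
  "resample I e \<zeta> g = (\<lambda>r\<in>I. \<zeta> r + (g - dot I e \<zeta>) * e r)"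

lemma measurable_resample [measurable]:
  "(\<lambda>(\<zeta>, g). resample I e \<zeta> g) \<in> gauss I \<Otimes>\<^sub>M gam \<rightarrow>\<^sub>M gauss I"
  unfolding resample_def dot_def case_prod_beta by measurable

text \<open>Induction on the number of nonzero coordinates of \<open>e\<close>: a rotation in the
  plane of two of them moves all their mass to one. When a single coordinate is left it equals 1 or
  -1, and resampling replaces that coordinate by a fresh Gaussian.\<close>

lemma nn_integral_gauss_resample:
  assumes "finite I" and "(\<Sum>r\<in>I. (e r)\<^sup>2) = 1" and [measurable]: "F \<in> borel_measurable (gauss I)"
  shows "(\<integral>\<^sup>+\<zeta>. \<integral>\<^sup>+g. F (resample I e \<zeta> g) \<partial>gam \<partial>gauss I) = (\<integral>\<^sup>+\<zeta>. F \<zeta> \<partial>gauss I)"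
  using assms
proof (induction "card {r\<in>I. e r \<noteq> 0}" arbitrary: e F rule: less_induct)
  case less
  note fin = less.prems(1) and e1 = less.prems(2) and [measurable] = less.prems(3)
  have "\<exists>a\<in>I. e a \<noteq> 0"
  proof (rule ccontr)
    assume "\<not> ?thesis" then have "(\<Sum>r\<in>I. (e r)\<^sup>2) = 0" by simp
    then show False using e1 by simp
  qed
  then obtain a where a: "a \<in> I" "e a \<noteq> 0" by auto
  show ?case
  proof (cases "\<exists>b\<in>I. b \<noteq> a \<and> e b \<noteq> 0")
    case False
    define J where "J = I - {a}"
    have I: "I = insert a J" and J: "finite J" "a \<notin> J" using a fin by (auto simp: J_def)
    have e0: "e b = 0" if "b \<in> J" for b using False that I J by auto
    have ea: "e a * e a = 1"
    proof -
      have "(\<Sum>r\<in>I. (e r)\<^sup>2) = (e a)\<^sup>2 + (\<Sum>r\<in>J. (e r)\<^sup>2)" using I J by simp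
      then show ?thesis using e1 e0 by (simp add: power2_eq_square)
    qed
    have d: "dot I e \<zeta> = e a * \<zeta> a" for \<zeta>
      unfolding dot_def I using J e0 by simp
    have r: "resample I e \<zeta> g = \<zeta>(a := e a * g)" if "\<zeta> \<in> space (gauss I)" for \<zeta> g
    proof
      fix i
      have "\<zeta> i = undefined" if "i \<notin> I" using \<open>\<zeta> \<in> space (gauss I)\<close> that
        by (auto simp: space_PiM PiE_def extensional_def)
      moreover have "\<zeta> a + (g - e a * \<zeta> a) * e a = e a * g + \<zeta> a * (1 - e a * e a)"
        by (simp add: algebra_simps)
      moreover have "i = a \<or> i \<in> J \<and> i \<in> I \<and> i \<noteq> a \<or> i \<notin> I" using I J by auto
      ultimately show "resample I e \<zeta> g i = (\<zeta>(a := e a * g)) i"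
        using e0 a ea unfolding resample_def d by auto
    qed
    have [measurable]: "F \<in> borel_measurable (gauss (insert a J))" using less.prems(3) I by simp
    have "(\<integral>\<^sup>+\<zeta>. \<integral>\<^sup>+g. F (resample I e \<zeta> g) \<partial>gam \<partial>gauss I) = (\<integral>\<^sup>+\<zeta>. \<integral>\<^sup>+g. F (\<zeta>(a := e a * g)) \<partial>gam \<partial>gauss I)"
      by (intro nn_integral_cong) (simp add: r)
    also have "\<dots> = (\<integral>\<^sup>+x. \<integral>\<^sup>+y. \<integral>\<^sup>+g. F ((x(a := y))(a := e a * g)) \<partial>gam \<partial>gam \<partial>gauss J)"
      unfolding I
    proof (rule PG.product_nn_integral_insert)
      have "(\<lambda>(\<zeta>, g). \<zeta>(a := e a * g)) \<in> gauss (insert a J) \<Otimes>\<^sub>M gam \<rightarrow>\<^sub>M gauss (insert a J)"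
        unfolding case_prod_beta by (rule measurable_fun_upd[where J="insert a J"]) auto
      then have "(\<lambda>p. F (case p of (\<zeta>, g) \<Rightarrow> \<zeta>(a := e a * g))) \<in> borel_measurable (gauss (insert a J) \<Otimes>\<^sub>M gam)"
        by (rule measurable_compose) fact
      then show "(\<lambda>\<zeta>. \<integral>\<^sup>+g. F (\<zeta>(a := e a * g)) \<partial>gam) \<in> borel_measurable (gauss (insert a J))"
        by (intro gam.borel_measurable_nn_integral) (simp add: case_prod_beta')
    qed (use J in auto)
    also have "\<dots> = (\<integral>\<^sup>+x. \<integral>\<^sup>+g. F (x(a := e a * g)) \<partial>gam \<partial>gauss J)"
      by simp
    also have "\<dots> = (\<integral>\<^sup>+x. \<integral>\<^sup>+g. F (x(a := g)) \<partial>gam \<partial>gauss J)"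
    proof (rule nn_integral_cong)
      fix x assume x: "x \<in> space (gauss J)"
      have m: "(\<lambda>g. F (x(a := g))) \<in> borel_measurable borel" using x by measurable
      \<comment> \<open>The sign is absorbed by the symmetry of the Gaussian law.\<close>
      have "e a = 1 \<or> e a = -1" using ea by (simp add: square_eq_1_iff)
      then show "(\<integral>\<^sup>+g. F (x(a := e a * g)) \<partial>gam) = (\<integral>\<^sup>+g. F (x(a := g)) \<partial>gam)"
        using nn_integral_gam_uminus[OF m] by auto
    qed
    also have "\<dots> = (\<integral>\<^sup>+\<zeta>. F \<zeta> \<partial>gauss I)"
      unfolding I using J by (intro PG.product_nn_integral_insert[symmetric]) auto
    finally show ?thesis .
  next
    case True
    then obtain b where b: "b \<in> I" "b \<noteq> a" "e b \<noteq> 0" by auto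
    define \<rho> where "\<rho> = sqrt ((e a)\<^sup>2 + (e b)\<^sup>2)"
    define c where "c = e a / \<rho>" define s where "s = e b / \<rho>"
    \<comment> \<open>The vector that the rotation \<open>Q\<close> carries to \<open>e\<close>. It
      has the same norm and one nonzero coordinate less.\<close>
    define e' where "e' = e(a := \<rho>, b := 0)"
    define Q where "Q \<zeta> = \<zeta>(a := c * \<zeta> a + (- s) * \<zeta> b, b := - (- s) * \<zeta> a + c * \<zeta> b)" for \<zeta> :: "nat \<Rightarrow> real"
    have pos: "(e a)\<^sup>2 + (e b)\<^sup>2 > 0" using a by (simp add: sum_power2_gt_zero_iff)
    then have rho: "\<rho> > 0" "\<rho>\<^sup>2 = (e a)\<^sup>2 + (e b)\<^sup>2" by (auto simp: \<rho>_def)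
    have cs: "c\<^sup>2 + s\<^sup>2 = 1" "c\<^sup>2 + (-s)\<^sup>2 = 1"
      using rho by (auto simp: c_def s_def power_divide simp flip: add_divide_distrib)
    have ec: "e a = c * \<rho>" "e b = s * \<rho>" using rho by (auto simp: c_def s_def)
    have split: "(\<Sum>r\<in>I. h r) = h a + h b + (\<Sum>r\<in>I - {a, b}. h r)" for h :: "nat \<Rightarrow> real"
    proof -
      have "I = insert a (insert b (I - {a, b}))" using a b by auto
      then have "sum h I = sum h (insert a (insert b (I - {a, b})))" by simp
      then show ?thesis using fin b by (simp add: add.assoc)
    qed
    have e'1: "(\<Sum>r\<in>I. (e' r)\<^sup>2) = 1"
      using e1 b rho by (simp add: split e'_def)
    have dQ: "dot I e (Q \<zeta>) = dot I e' \<zeta>" for \<zeta>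
    proof -
      have "e a * (c * \<zeta> a + (- s) * \<zeta> b) + e b * (s * \<zeta> a + c * \<zeta> b) = \<rho> * (c\<^sup>2 + s\<^sup>2) * \<zeta> a"
        unfolding ec by (simp add: algebra_simps power2_eq_square)
      then have *: "e a * (c * \<zeta> a + (- s) * \<zeta> b) + e b * (s * \<zeta> a + c * \<zeta> b) = \<rho> * \<zeta> a" using cs by simp
      show ?thesis unfolding dot_def split using b * by (simp add: Q_def e'_def)
    qed
    \<comment> \<open>Resampling along \<open>e'\<close> and then rotating is the same as rotating
      and then resampling along \<open>e\<close>; invariance under \<open>Q\<close> is therefore
      enough for the induction step.\<close>
    have rQ: "Q (resample I e' \<zeta> g) = resample I e (Q \<zeta>) g" if "\<zeta> \<in> space (gauss I)" for \<zeta> g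
    proof
      fix i
      have "\<zeta> i = undefined" if "i \<notin> I" using \<open>\<zeta> \<in> space (gauss I)\<close> that
        by (auto simp: space_PiM PiE_def extensional_def)
      then show "Q (resample I e' \<zeta> g) i = resample I e (Q \<zeta>) g i"
        using a b unfolding resample_def dQ
        by (simp add: Q_def e'_def ec) (auto simp: algebra_simps ec)
    qed
    have Qm [measurable]: "Q \<in> gauss I \<rightarrow>\<^sub>M gauss I"
      unfolding Q_def using a b by (intro measurable_fun_upd_gauss) measurable
    have lt: "card {r\<in>I. e' r \<noteq> 0} < card {r\<in>I. e r \<noteq> 0}"
      using fin a b by (intro psubset_card_mono) (auto simp: e'_def)
    have "(\<integral>\<^sup>+\<zeta>. F \<zeta> \<partial>gauss I) = (\<integral>\<^sup>+\<zeta>. F (Q \<zeta>) \<partial>gauss I)"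
      unfolding Q_def using fin a b cs by (intro nn_integral_gauss_rotate[symmetric]) auto
    also have "\<dots> = (\<integral>\<^sup>+\<zeta>. \<integral>\<^sup>+g. F (Q (resample I e' \<zeta> g)) \<partial>gam \<partial>gauss I)"
      by (rule less.hyps[OF lt fin e'1, symmetric]) measurable
    also have "\<dots> = (\<integral>\<^sup>+\<zeta>. (\<integral>\<^sup>+g. F (resample I e (Q \<zeta>) g) \<partial>gam) \<partial>gauss I)"
      by (intro nn_integral_cong) (simp add: rQ)
    also have "\<dots> = (\<integral>\<^sup>+\<zeta>. (\<integral>\<^sup>+g. F (resample I e \<zeta> g) \<partial>gam) \<partial>gauss I)"
      unfolding Q_def using fin a b cs
      by (intro nn_integral_gauss_rotate[of I a b c "- s" "\<lambda>\<zeta>. \<integral>\<^sup>+g. F (resample I e \<zeta> g) \<partial>gam"]) auto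
    finally show ?thesis by simp
  qed
qed

text \<open>A linear functional sees the fresh variable \<open>g\<close> only through the component
  of \<open>x\<close> along \<open>e\<close>. When \<open>e\<close> is a unit vector, the other
  coefficient vector is the projection of \<open>x\<close> off \<open>e\<close>.\<close>

lemma resample_dot:
  assumes "finite I"
  shows "dot I x (resample I e \<zeta> g) = dot I (\<lambda>r. x r - dot I x e * e r) \<zeta> + dot I x e * g"
proof -
  have "dot I x (resample I e \<zeta> g) = dot I x \<zeta> + (g - dot I e \<zeta>) * dot I x e"
    by (simp add: dot_def resample_def algebra_simps sum.distrib sum_subtractf sum_distrib_left sum_distrib_right)
  moreover have "dot I (\<lambda>r. x r - dot I x e * e r) \<zeta> = dot I x \<zeta> - dot I x e * dot I e \<zeta>"
    by (simp add: dot_def[of I _ \<zeta>] algebra_simps sum_subtractf sum_distrib_left)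
  ultimately show ?thesis by (simp add: algebra_simps)
qed

section \<open>Inner products and the laws of linear functionals\<close>

lemma dot_commute: "dot I x y = dot I y x"
  by (simp add: dot_def mult.commute)

lemma dot_self_nonneg: "dot I x x \<ge> 0"
  by (simp add: dot_def sum_nonneg)

lemma dot_add_left: "dot I (\<lambda>r. x r + y r) z = dot I x z + dot I y z"
  by (simp add: dot_def distrib_right sum.distrib)

lemma dot_diff_left: "dot I (\<lambda>r. x r - y r) z = dot I x z - dot I y z"
  by (simp add: dot_def left_diff_distrib sum_subtractf)

lemma dot_scale_left: "dot I (\<lambda>r. c * x r) z = c * dot I x z"
  by (simp add: dot_def sum_distrib_left mult.assoc)

lemma dot_divide_left: "dot I (\<lambda>r. x r / c) z = dot I x z / c"
  by (simp add: dot_def sum_divide_distrib)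

lemma dot_sum_left: "dot I (\<lambda>r. \<Sum>k\<in>K. x k r) z = (\<Sum>k\<in>K. dot I (x k) z)"
  unfolding dot_def by (subst sum.swap) (simp add: sum_distrib_right)

lemma dot_eq_0_imp: 
  assumes "finite I" "dot I x x = 0" "r \<in> I" shows "x r = 0"
  using assms by (auto simp: dot_def sum_nonneg_eq_0_iff)

lemma law_dot:
  assumes fin: "finite I" and [measurable]: "h \<in> borel_measurable borel"
  shows "(\<integral>\<^sup>+\<zeta>. h (dot I y \<zeta>) \<partial>gauss I) = (\<integral>\<^sup>+r. h (sqrt (dot I y y) * r) \<partial>gam)"
proof (cases "dot I y y = 0")
  case True
  then have "dot I y \<zeta> = 0" for \<zeta>
    using dot_eq_0_imp[OF fin True] by (simp add: dot_def)
  then show ?thesis using True by (simp add: gauss.emeasure_space_1)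
next
  case False
  define q where "q = sqrt (dot I y y)"
  have q: "q > 0" "q * q = dot I y y" using False dot_self_nonneg[of I y] by (auto simp: q_def)
  define e where "e r = y r / q" for r
  have e1: "(\<Sum>r\<in>I. (e r)\<^sup>2) = 1"
  proof -
    have "(\<Sum>r\<in>I. (e r)\<^sup>2) = dot I y y / (q * q)"
      by (simp add: e_def dot_def power2_eq_square sum_divide_distrib)
    then show ?thesis using q False by simp
  qed
  have ye: "dot I y e = q"
    using q unfolding dot_commute[of I y e] e_def dot_divide_left by (simp add: field_simps)
  have y0: "y r - dot I y e * e r = 0" for r using q by (simp add: ye) (simp add: e_def)
  have "dot I y (resample I e \<zeta> g) = q * g" for \<zeta> g
    unfolding resample_dot[OF fin] y0 by (simp add: dot_def ye[unfolded dot_def])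
  moreover have "(\<lambda>\<zeta>. h (dot I y \<zeta>)) \<in> borel_measurable (gauss I)" by measurable
  ultimately show ?thesis
    using nn_integral_gauss_resample[OF fin e1, of "\<lambda>\<zeta>. h (dot I y \<zeta>)"]
    by (simp add: q_def gauss.emeasure_space_1)
qed

text \<open>Gram--Schmidt: resampling along \<open>x\<close> leaves \<open>y\<close> with component
  \<rho> along \<open>x\<close> and an orthogonal rest of norm \<kappa>. In the result
  \<open>r\<close> is the coordinate along \<open>x\<close> and \<open>s\<close> an independent
  one.\<close>

lemma law_dot_pair:
  fixes x y :: "nat \<Rightarrow> real"
  assumes fin: "finite I" and [measurable]: "h \<in> borel_measurable (borel \<Otimes>\<^sub>M borel)" 
    and x: "dot I x x > 0"
  defines "\<rho> \<equiv> dot I x y / sqrt (dot I x x)"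
  defines "\<kappa> \<equiv> sqrt (dot I y y - \<rho>\<^sup>2)"
  shows "(\<integral>\<^sup>+\<zeta>. h (dot I x \<zeta>, dot I y \<zeta>) \<partial>gauss I) =
    (\<integral>\<^sup>+r. \<integral>\<^sup>+s. h (sqrt (dot I x x) * r, \<kappa> * s + \<rho> * r) \<partial>gam \<partial>gam)"
    and "\<rho>\<^sup>2 \<le> dot I y y"
proof -
  define q where "q = sqrt (dot I x x)"
  have q: "q > 0" "q * q = dot I x x" using x by (auto simp: q_def)
  define e where "e r = x r / q" for r
  have e1: "(\<Sum>r\<in>I. (e r)\<^sup>2) = 1"
  proof -
    have "(\<Sum>r\<in>I. (e r)\<^sup>2) = dot I x x / (q * q)"
      by (simp add: e_def dot_def power2_eq_square sum_divide_distrib)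
    then show ?thesis using q x by simp
  qed
  have xe: "dot I x e = q"
    using q unfolding dot_commute[of I x e] e_def dot_divide_left by (simp add: field_simps)
  have ye: "dot I y e = \<rho>"
    unfolding dot_commute[of I y e] by (simp add: e_def[abs_def] dot_divide_left \<rho>_def q_def)
  have x0: "x r - dot I x e * e r = 0" for r using q by (simp add: xe) (simp add: e_def)
  have dx: "dot I x (resample I e \<zeta> g) = q * g" for \<zeta> g
    unfolding resample_dot[OF fin] x0 by (simp add: dot_def xe[unfolded dot_def])
  define y' where "y' = (\<lambda>r. y r - \<rho> * e r)"
  have dy: "dot I y (resample I e \<zeta> g) = dot I y' \<zeta> + \<rho> * g" for \<zeta> g
    unfolding resample_dot[OF fin] ye y'_def ..
  have ee: "dot I e e = 1" using e1 by (simp add: dot_def power2_eq_square)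
  have ey: "dot I e y = \<rho>" using ye by (simp add: dot_commute)
  have yy: "dot I y' y' = dot I y y - \<rho>\<^sup>2"
  proof -
    have "dot I y' y' = dot I y y' - \<rho> * dot I e y'"
      by (simp add: y'_def dot_diff_left dot_scale_left)
    also have "dot I y y' = dot I y' y" by (rule dot_commute)
    also have "dot I e y' = dot I y' e" by (rule dot_commute)
    finally show ?thesis
      by (simp add: y'_def dot_diff_left dot_scale_left ee ey ye power2_eq_square)
  qed
  show "\<rho>\<^sup>2 \<le> dot I y y" using dot_self_nonneg[of I y'] yy by simp
  interpret P: pair_sigma_finite "gauss I" gam
    by (simp add: pair_sigma_finite.intro sigma_finite_gam gauss.sigma_finite_measure_axioms)
  have "(\<integral>\<^sup>+\<zeta>. h (dot I x \<zeta>, dot I y \<zeta>) \<partial>gauss I) =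
      (\<integral>\<^sup>+\<zeta>. \<integral>\<^sup>+g. h (q * g, dot I y' \<zeta> + \<rho> * g) \<partial>gam \<partial>gauss I)"
    using nn_integral_gauss_resample[OF fin e1, of "\<lambda>\<zeta>. h (dot I x \<zeta>, dot I y \<zeta>)"]
    by (simp add: dx dy)
  also have "\<dots> = (\<integral>\<^sup>+g. \<integral>\<^sup>+\<zeta>. h (q * g, dot I y' \<zeta> + \<rho> * g) \<partial>gauss I \<partial>gam)"
    by (rule P.Fubini'[symmetric]) measurable
  also have "\<dots> = (\<integral>\<^sup>+g. \<integral>\<^sup>+s. h (q * g, \<kappa> * s + \<rho> * g) \<partial>gam \<partial>gam)"
    using law_dot[OF fin, of "\<lambda>t. h (q * g, t + \<rho> * g)" y' for g]
    by (simp add: yy \<kappa>_def)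
  finally show "(\<integral>\<^sup>+\<zeta>. h (dot I x \<zeta>, dot I y \<zeta>) \<partial>gauss I) =
    (\<integral>\<^sup>+r. \<integral>\<^sup>+s. h (sqrt (dot I x x) * r, \<kappa> * s + \<rho> * r) \<partial>gam \<partial>gam)"
    unfolding q_def .
qed

text \<open>Adding one independent centred term at a time, the binomial expansion loses every
  product with a first moment. The constant 15 is the sixth moment of a standard Gaussian, which the
  bound approaches for sums of many terms.\<close>

lemma (in prob_space) sixth_moment_sum_le:
  fixes X :: "'i \<Rightarrow> 'a \<Rightarrow> real"
  assumes "finite J" and "indep_vars (\<lambda>_. borel) X J"
    and "\<And>j. j \<in> J \<Longrightarrow> integrable M (\<lambda>\<omega>. X j \<omega> ^ 6)"
    and "\<And>j. j \<in> J \<Longrightarrow> expectation (X j) = 0"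
    and "B \<ge> 0" and "\<And>j. j \<in> J \<Longrightarrow> expectation (\<lambda>\<omega>. X j \<omega> ^ 6) \<le> B ^ 6"
  shows "integrable M (\<lambda>\<omega>. (\<Sum>j\<in>J. X j \<omega>) ^ 6) \<and>
    expectation (\<lambda>\<omega>. (\<Sum>j\<in>J. X j \<omega>) ^ 6) \<le> 15 * real (card J) ^ 3 * B ^ 6"
proof -
  have low: "integrable M (\<lambda>\<omega>. Y \<omega> ^ k)" if "integrable M (\<lambda>\<omega>. Y \<omega> ^ 6)" "Y \<in> borel_measurable M" "k \<le> 6" 
    for Y :: "'a \<Rightarrow> real" and k
  proof (rule Bochner_Integration.integrable_bound[of M "\<lambda>\<omega>. 1 + Y \<omega> ^ 6"])
    show "integrable M (\<lambda>\<omega>. 1 + Y \<omega> ^ 6)" using that by auto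
    show "(\<lambda>\<omega>. Y \<omega> ^ k) \<in> borel_measurable M" using that by measurable
    show "AE \<omega> in M. norm (Y \<omega> ^ k) \<le> norm (1 + Y \<omega> ^ 6)"
    proof (rule AE_I2)
      fix \<omega>
      have "\<bar>Y \<omega>\<bar> ^ k \<le> 1 + \<bar>Y \<omega>\<bar> ^ 6"
      proof (cases "\<bar>Y \<omega>\<bar> \<le> 1")
        case True then show ?thesis by (simp add: power_le_one add_increasing2)
      next
        case False then have "\<bar>Y \<omega>\<bar> ^ k \<le> \<bar>Y \<omega>\<bar> ^ 6" using that(3) by (intro power_increasing) auto
        then show ?thesis by simp
      qed
      then show "norm (Y \<omega> ^ k) \<le> norm (1 + Y \<omega> ^ 6)" by (simp add: power_abs)
    qed
  qed
  \<comment> \<open>Weighted arithmetic-geometric mean inequality between 1 and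
    \<open>t ^ 6\<close>, with weights that sum to 1; each case is a factored polynomial.\<close>
  have pw: "\<bar>t\<bar> ^ k \<le> real (6 - k) / 6 * 1 + real k / 6 * t ^ 6" if "k \<in> {2,3,4}" for k and t :: real
  proof -
    have p0: "\<bar>t\<bar> ^ 2 \<le> 2/3 + 1/3 * t ^ 6"
    proof -
      have "0 \<le> (t\<^sup>2 - 1)\<^sup>2 * (t\<^sup>2 + 2)" by simp
      also have "\<dots> = t ^ 6 - 3 * t\<^sup>2 + 2" by (simp add: algebra_simps power2_eq_square power_numeral_reduce)
      finally show ?thesis by simp
    qed
    have p3: "\<bar>t\<bar> ^ 3 \<le> 1/2 + 1/2 * t ^ 6"
    proof -
      have "0 \<le> (\<bar>t\<bar> ^ 3 - 1)\<^sup>2" by simp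
      also have "\<dots> = \<bar>t\<bar> ^ 6 - 2 * \<bar>t\<bar> ^ 3 + 1" by (simp add: algebra_simps power2_eq_square power_numeral_reduce)
      finally show ?thesis by simp
    qed
    have p4: "\<bar>t\<bar> ^ 4 \<le> 1/3 + 2/3 * t ^ 6"
    proof -
      have "0 \<le> (t\<^sup>2 - 1)\<^sup>2 * (2 * t\<^sup>2 + 1)" by simp
      also have "\<dots> = 2 * t ^ 6 - 3 * t ^ 4 + 1" by (simp add: algebra_simps power2_eq_square power_numeral_reduce)
      finally show ?thesis by simp
    qed
    show ?thesis using that p0 p3 p4 by auto
  qed
  have mom: "expectation (\<lambda>\<omega>. \<bar>Y \<omega>\<bar> ^ k) \<le> B ^ k"
    if Y: "integrable M (\<lambda>\<omega>. Y \<omega> ^ 6)" "Y \<in> borel_measurable M" and le: "expectation (\<lambda>\<omega>. Y \<omega> ^ 6) \<le> B ^ 6"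
      and k: "k \<in> {2,3,4}" for Y :: "'a \<Rightarrow> real" and k
  proof -
    have I: "integrable M (\<lambda>\<omega>. \<bar>Y \<omega>\<bar> ^ k)"
      using low[OF Y, of k, THEN integrable_abs] k by (auto simp: power_abs)
    show ?thesis
    \<comment> \<open>The comparison of moments is done after division by \<open>B\<close>, so a
      vanishing \<open>B\<close> is separate: then \<open>Y\<close> is almost surely 0.\<close>
    proof (cases "B = 0")
      case True
      then have "expectation (\<lambda>\<omega>. Y \<omega> ^ 6) = 0"
        using le by (simp add: antisym integral_nonneg_AE)
      then have "AE \<omega> in M. Y \<omega> ^ 6 = 0"
        using Y by (subst (asm) integral_nonneg_eq_0_iff_AE) auto
      then have "expectation (\<lambda>\<omega>. \<bar>Y \<omega>\<bar> ^ k) = expectation (\<lambda>\<omega>. 0)"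
        using I k by (intro integral_cong_AE) (auto elim!: AE_mp)
      then show ?thesis using True k by auto
    next
      case False
      then have B: "B > 0" using assms(5) by simp
      have "expectation (\<lambda>\<omega>. \<bar>Y \<omega>\<bar> ^ k) = B ^ k * expectation (\<lambda>\<omega>. \<bar>Y \<omega> / B\<bar> ^ k)"
        using B by (simp add: power_divide)
      also have "expectation (\<lambda>\<omega>. \<bar>Y \<omega> / B\<bar> ^ k) \<le> expectation (\<lambda>\<omega>. real (6 - k) / 6 * 1 + real k / 6 * (Y \<omega> / B) ^ 6)"
      proof (rule integral_mono)
        show "integrable M (\<lambda>\<omega>. \<bar>Y \<omega> / B\<bar> ^ k)" using I B by (simp add: power_divide)
        show "integrable M (\<lambda>\<omega>. real (6 - k) / 6 * 1 + real k / 6 * (Y \<omega> / B) ^ 6)"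
          using Y by (simp add: power_divide)
      qed (rule pw[OF k])
      also have "\<dots> = real (6 - k) / 6 + real k / 6 * (expectation (\<lambda>\<omega>. Y \<omega> ^ 6) / B ^ 6)"
        using Y by (simp add: power_divide prob_space)
      also have "\<dots> \<le> real (6 - k) / 6 + real k / 6 * 1"
        using le B by (intro add_left_mono mult_left_mono) auto
      also have "\<dots> = 1" using k by auto
      finally show ?thesis using B by (simp add: mult_left_le)
    qed
  qed
  \<comment> \<open>The induction must carry the mean and the moments of order 2, 3 and 4 of the
    partial sum, because they multiply moments of the new term in the expansion of the sixth
    power.\<close>
  have "integrable M (\<lambda>\<omega>. (\<Sum>j\<in>J. X j \<omega>) ^ 6) \<and> expectation (\<lambda>\<omega>. \<Sum>j\<in>J. X j \<omega>) = 0 \<and>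
    expectation (\<lambda>\<omega>. (\<Sum>j\<in>J. X j \<omega>) ^ 2) \<le> real (card J) * B ^ 2 \<and>
    \<bar>expectation (\<lambda>\<omega>. (\<Sum>j\<in>J. X j \<omega>) ^ 3)\<bar> \<le> real (card J) * B ^ 3 \<and>
    expectation (\<lambda>\<omega>. (\<Sum>j\<in>J. X j \<omega>) ^ 4) \<le> 3 * real (card J) ^ 2 * B ^ 4 \<and>
    expectation (\<lambda>\<omega>. (\<Sum>j\<in>J. X j \<omega>) ^ 6) \<le> 15 * real (card J) ^ 3 * B ^ 6"
    using assms
  proof (induction J rule: finite_induct)
    case empty
    then show ?case by simp
  next
    case (insert a J)
    define S where "S \<omega> = (\<Sum>j\<in>J. X j \<omega>)" for \<omega>
    define Y where "Y = X a"
    have sum: "(\<Sum>j\<in>insert a J. X j \<omega>) = Y \<omega> + S \<omega>" for \<omega>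
      using insert.hyps by (simp add: S_def Y_def)
    have ind: "indep_vars (\<lambda>_. borel) X J"
      using insert.prems(1) by (rule indep_vars_subset) auto
    have IH: "integrable M (\<lambda>\<omega>. S \<omega> ^ 6)" "expectation S = 0"
      "expectation (\<lambda>\<omega>. S \<omega> ^ 2) \<le> real (card J) * B ^ 2"
      "\<bar>expectation (\<lambda>\<omega>. S \<omega> ^ 3)\<bar> \<le> real (card J) * B ^ 3"
      "expectation (\<lambda>\<omega>. S \<omega> ^ 4) \<le> 3 * real (card J) ^ 2 * B ^ 4"
      "expectation (\<lambda>\<omega>. S \<omega> ^ 6) \<le> 15 * real (card J) ^ 3 * B ^ 6"
      using insert.IH[OF ind insert.prems(2-5)] unfolding S_def by simp_all
    have mX: "X j \<in> borel_measurable M" if "j \<in> insert a J" for j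
      using insert.prems(1) that by (auto simp: indep_vars_def)
    have mS [measurable]: "S \<in> borel_measurable M" using mX unfolding S_def by measurable
    have mY [measurable]: "Y \<in> borel_measurable M" using mX unfolding Y_def by auto
    have Y6: "integrable M (\<lambda>\<omega>. Y \<omega> ^ 6)" "expectation Y = 0" "expectation (\<lambda>\<omega>. Y \<omega> ^ 6) \<le> B ^ 6"
      using insert.prems unfolding Y_def by auto
    have ivar: "indep_var borel Y borel S"
      unfolding Y_def S_def[abs_def] using insert.hyps insert.prems(1) by (intro indep_vars_sum) auto
    have iS: "integrable M (\<lambda>\<omega>. S \<omega> ^ k)" and iY: "integrable M (\<lambda>\<omega>. Y \<omega> ^ k)" if "k \<le> 6" for k
      using low[OF IH(1) mS that] low[OF Y6(1) mY that] by auto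
    have ipow: "indep_var borel (\<lambda>\<omega>. Y \<omega> ^ k) borel (\<lambda>\<omega>. S \<omega> ^ l)" for k l
      using indep_var_compose[OF ivar, of "\<lambda>t. t ^ k" borel "\<lambda>t. t ^ l" borel] by (simp add: comp_def)
    have E: "expectation (\<lambda>\<omega>. Y \<omega> ^ k * S \<omega> ^ l) = expectation (\<lambda>\<omega>. Y \<omega> ^ k) * expectation (\<lambda>\<omega>. S \<omega> ^ l)"
      "integrable M (\<lambda>\<omega>. Y \<omega> ^ k * S \<omega> ^ l)" if "k \<le> 6" "l \<le> 6" for k l
      using indep_var_lebesgue_integral[OF ipow iY iS] indep_var_integrable[OF ipow iY iS] that by auto
    have binom: "(Y \<omega> + S \<omega>) ^ k = (\<Sum>i\<le>k. real (k choose i) * (Y \<omega> ^ i * S \<omega> ^ (k - i)))" for k \<omega>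
      by (simp add: binomial_ring mult.assoc)
    have Ek: "expectation (\<lambda>\<omega>. (Y \<omega> + S \<omega>) ^ k) =
       (\<Sum>i\<le>k. real (k choose i) * (expectation (\<lambda>\<omega>. Y \<omega> ^ i) * expectation (\<lambda>\<omega>. S \<omega> ^ (k - i))))"
      "integrable M (\<lambda>\<omega>. (Y \<omega> + S \<omega>) ^ k)" if "k \<le> 6" for k
    proof -
      have "expectation (\<lambda>\<omega>. (Y \<omega> + S \<omega>) ^ k) = (\<Sum>i\<le>k. expectation (\<lambda>\<omega>. real (k choose i) * (Y \<omega> ^ i * S \<omega> ^ (k - i))))"
        unfolding binom using that by (intro Bochner_Integration.integral_sum integrable_mult_right E(2)) auto
      also have "\<dots> = (\<Sum>i\<le>k. real (k choose i) * (expectation (\<lambda>\<omega>. Y \<omega> ^ i) * expectation (\<lambda>\<omega>. S \<omega> ^ (k - i))))"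
        using that by (intro sum.cong) (auto simp: E(1))
      finally show "expectation (\<lambda>\<omega>. (Y \<omega> + S \<omega>) ^ k) =
         (\<Sum>i\<le>k. real (k choose i) * (expectation (\<lambda>\<omega>. Y \<omega> ^ i) * expectation (\<lambda>\<omega>. S \<omega> ^ (k - i))))" .
      show "integrable M (\<lambda>\<omega>. (Y \<omega> + S \<omega>) ^ k)"
        unfolding binom using that by (intro Bochner_Integration.integrable_sum integrable_mult_right E(2)) auto
    qed
    define n where "n = real (card J)"
    have n0: "n \<ge> 0" by (simp add: n_def)
    have cn: "real (card (insert a J)) = n + 1" using insert.hyps by (simp add: n_def)
    define y2 y3 y4 y6 s2 s3 s4 s6 where
      "y2 = expectation (\<lambda>\<omega>. Y \<omega> ^ 2)" "y3 = expectation (\<lambda>\<omega>. Y \<omega> ^ 3)"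
      "y4 = expectation (\<lambda>\<omega>. Y \<omega> ^ 4)" "y6 = expectation (\<lambda>\<omega>. Y \<omega> ^ 6)"
      "s2 = expectation (\<lambda>\<omega>. S \<omega> ^ 2)" "s3 = expectation (\<lambda>\<omega>. S \<omega> ^ 3)"
      "s4 = expectation (\<lambda>\<omega>. S \<omega> ^ 4)" "s6 = expectation (\<lambda>\<omega>. S \<omega> ^ 6)"
    note d = this
    have yb: "y2 \<le> B ^ 2" "\<bar>y3\<bar> \<le> B ^ 3" "y4 \<le> B ^ 4" "y6 \<le> B ^ 6"
    proof -
      show "y2 \<le> B ^ 2" using mom[OF Y6(1) mY Y6(3), of 2] by (simp add: d)
      show "y4 \<le> B ^ 4" using mom[OF Y6(1) mY Y6(3), of 4] by (simp add: d)
      show "y6 \<le> B ^ 6" using Y6 by (simp add: d)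
      have "\<bar>y3\<bar> \<le> expectation (\<lambda>\<omega>. \<bar>Y \<omega> ^ 3\<bar>)" unfolding d by (rule integral_abs_bound)
      then show "\<bar>y3\<bar> \<le> B ^ 3" using mom[OF Y6(1) mY Y6(3), of 3] by (simp add: power_abs)
    qed
    have y0: "y2 \<ge> 0" "y4 \<ge> 0" "s2 \<ge> 0" "s4 \<ge> 0" by (simp_all add: d)
    have sb: "s2 \<le> n * B ^ 2" "\<bar>s3\<bar> \<le> n * B ^ 3" "s4 \<le> 3 * n ^ 2 * B ^ 4" "s6 \<le> 15 * n ^ 3 * B ^ 6"
      using IH unfolding d n_def by auto
    have e1: "expectation (\<lambda>\<omega>. Y \<omega> + S \<omega>) = 0"
      using Ek(1)[of 1] Y6(2) IH(2) by (simp add: numeral_eq_Suc atMost_Suc prob_space)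
    have e2: "expectation (\<lambda>\<omega>. (Y \<omega> + S \<omega>) ^ 2) = s2 + y2"
      using Ek(1)[of 2] Y6(2) IH(2) by (simp add: d numeral_eq_Suc atMost_Suc prob_space)
    have e3: "expectation (\<lambda>\<omega>. (Y \<omega> + S \<omega>) ^ 3) = s3 + y3"
      using Ek(1)[of 3] Y6(2) IH(2) by (simp add: d numeral_eq_Suc atMost_Suc prob_space)
    have e4: "expectation (\<lambda>\<omega>. (Y \<omega> + S \<omega>) ^ 4) = s4 + 6 * (y2 * s2) + y4"
      using Ek(1)[of 4] Y6(2) IH(2) by (simp add: d numeral_eq_Suc atMost_Suc prob_space)
    have e6: "expectation (\<lambda>\<omega>. (Y \<omega> + S \<omega>) ^ 6) = s6 + 15 * (y2 * s4) + 20 * (y3 * s3) + 15 * (y4 * s2) + y6"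
      using Ek(1)[of 6] Y6(2) IH(2) by (simp add: d numeral_eq_Suc atMost_Suc prob_space)
    have m1: "y2 * s2 \<le> n * B ^ 4"
      using mult_mono[OF yb(1) sb(1)] y0 assms(5) by (simp add: algebra_simps power_numeral_reduce)
    have m2: "y2 * s4 \<le> 3 * n ^ 2 * B ^ 6"
      using mult_mono[OF yb(1) sb(3)] y0 assms(5) by (simp add: algebra_simps power_numeral_reduce)
    have m3: "y3 * s3 \<le> n * B ^ 6"
    proof -
      have "y3 * s3 \<le> \<bar>y3\<bar> * \<bar>s3\<bar>" by (metis abs_ge_self abs_mult)
      also have "\<dots> \<le> B ^ 3 * (n * B ^ 3)" using yb(2) sb(2) assms(5) by (intro mult_mono) auto
      finally show ?thesis by (simp add: algebra_simps power_numeral_reduce)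
    qed
    have m4: "y4 * s2 \<le> n * B ^ 6"
      using mult_mono[OF yb(3) sb(1)] y0 assms(5) by (simp add: algebra_simps power_numeral_reduce)
    have B0: "B ^ 4 \<ge> 0" "B ^ 6 \<ge> 0" using assms(5) by auto
    have f4: "s4 + 6 * (y2 * s2) + y4 \<le> 3 * (n + 1) ^ 2 * B ^ 4"
    proof -
      have "s4 + 6 * (y2 * s2) + y4 \<le> (3 * n ^ 2 + 6 * n + 1) * B ^ 4"
        using sb(3) m1 yb(3) by (simp add: algebra_simps)
      also have "\<dots> \<le> 3 * (n + 1) ^ 2 * B ^ 4"
        using B0 n0 by (intro mult_right_mono) (auto simp: power2_eq_square algebra_simps)
      finally show ?thesis .
    qed
    have f6: "s6 + 15 * (y2 * s4) + 20 * (y3 * s3) + 15 * (y4 * s2) + y6 \<le> 15 * (n + 1) ^ 3 * B ^ 6"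
    proof -
      \<comment> \<open>The coefficients are 45 from \<open>15 * 3\<close>, and 35 from
        \<open>20 + 15\<close>. The result stays below the expansion of
        \<open>15 * (n + 1) ^ 3\<close>, whose lower coefficients are 45, 45 and 15.\<close>
      have "s6 + 15 * (y2 * s4) + 20 * (y3 * s3) + 15 * (y4 * s2) + y6 \<le>
          (15 * n ^ 3 + 45 * n ^ 2 + 35 * n + 1) * B ^ 6"
        using sb(4) m2 m3 m4 yb(4) by (simp add: algebra_simps)
      also have "\<dots> \<le> 15 * (n + 1) ^ 3 * B ^ 6"
        using B0 n0 by (intro mult_right_mono) (auto simp: power_numeral_reduce algebra_simps)
      finally show ?thesis .
    qed
    have f2: "s2 + y2 \<le> (n + 1) * B ^ 2" using sb(1) yb(1) by (simp add: algebra_simps)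
    have f3: "\<bar>s3 + y3\<bar> \<le> (n + 1) * B ^ 3" using sb(2) yb(2) by (simp add: algebra_simps)
    show ?case
      unfolding sum cn e1 e2 e3 e4 e6 using f2 f3 f4 f6 Ek(2)[of 6] by simp
  qed
  then show ?thesis by simp
qed

section \<open>Functions of exponential growth\<close>

text \<open>Growth of the function and of its difference quotients in one predicate. Kinks are
  allowed, and the class is closed under shifts and differences, which is how all the kernels below
  arise from \<open>f\<close>.\<close>

definition exp_lip :: "real \<Rightarrow> real \<Rightarrow> (real \<Rightarrow> real) \<Rightarrow> bool" where
  "exp_lip A c H \<longleftrightarrow> (\<forall>x. \<bar>H x\<bar> \<le> A * exp (c * \<bar>x\<bar>)) \<and>
     (\<forall>x y. \<bar>H x - H y\<bar> \<le> A * \<bar>x - y\<bar> * exp (c * (\<bar>x\<bar> + \<bar>y\<bar>)))"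

lemma exp_lipD:
  assumes "exp_lip A c H"
  shows "\<bar>H x\<bar> \<le> A * exp (c * \<bar>x\<bar>)" "\<bar>H x - H y\<bar> \<le> A * \<bar>x - y\<bar> * exp (c * (\<bar>x\<bar> + \<bar>y\<bar>))"
  using assms by (auto simp: exp_lip_def)

lemma exp_lip_nonneg: "exp_lip A c H \<Longrightarrow> A \<ge> 0"
  using exp_lipD(1)[of A c H 0] by simp

lemma exp_lip_continuous: "exp_lip A c H \<Longrightarrow> continuous_on UNIV H"
proof -
  assume H: "exp_lip A c H"
  have "isCont H x" for x
  proof -
    have "((\<lambda>y. H y - H x) \<longlongrightarrow> 0) (at x)"
    proof (rule Lim_null_comparison)
      show "\<forall>\<^sub>F y in at x. norm (H y - H x) \<le> A * \<bar>y - x\<bar> * exp (c * (\<bar>y\<bar> + \<bar>x\<bar>))"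
        using exp_lipD(2)[OF H] by simp
      have "((\<lambda>y. A * \<bar>y - x\<bar> * exp (c * (\<bar>y\<bar> + \<bar>x\<bar>))) \<longlongrightarrow> A * \<bar>x - x\<bar> * exp (c * (\<bar>x\<bar> + \<bar>x\<bar>))) (at x)"
        by (intro tendsto_intros)
      then show "((\<lambda>y. A * \<bar>y - x\<bar> * exp (c * (\<bar>y\<bar> + \<bar>x\<bar>))) \<longlongrightarrow> 0) (at x)" by simp
    qed
    then show ?thesis by (simp add: isCont_def LIM_zero_iff)
  qed
  then show ?thesis by (simp add: continuous_at_imp_continuous_on)
qed

lemma exp_lip_measurable: "exp_lip A c H \<Longrightarrow> H \<in> borel_measurable borel"
  using exp_lip_continuous borel_measurable_continuous_onI by blast

lemma integral_bound_nn:
  fixes f :: "'a \<Rightarrow> real"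
  assumes "f \<in> borel_measurable M" "(\<integral>\<^sup>+x. ennreal \<bar>f x\<bar> \<partial>M) \<le> ennreal K" "K \<ge> 0"
  shows "integrable M f" "\<bar>\<integral>x. f x \<partial>M\<bar> \<le> K"
proof -
  show I: "integrable M f"
    using assms(1) le_less_trans[OF assms(2), of \<infinity>] by (intro integrableI_bounded) auto
  have "ennreal (norm (\<integral>x. f x \<partial>M)) \<le> (\<integral>\<^sup>+x. ennreal (norm (f x)) \<partial>M)"
    by (rule integral_norm_bound_ennreal[OF I])
  also have "\<dots> \<le> ennreal K" using assms(2) by simp
  finally show "\<bar>\<integral>x. f x \<partial>M\<bar> \<le> K" using assms(3) by simp
qed

text \<open>Identities of laws are first proved for nonnegative integrands, where Fubini asks for no
  integrability. Turning them into equalities of measures makes them available for signed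
  integrals.\<close>

lemma distr_eqI_nn_integral:
  assumes [measurable]: "X \<in> M \<rightarrow>\<^sub>M N" "Y \<in> M' \<rightarrow>\<^sub>M N"
    and eq: "\<And>h. h \<in> borel_measurable N \<Longrightarrow> (\<integral>\<^sup>+x. h (X x) \<partial>M) = (\<integral>\<^sup>+x. h (Y x) \<partial>M')"
  shows "distr M N X = distr M' N Y"
proof (rule measure_eqI)
  fix A assume "A \<in> sets (distr M N X)"
  then have [measurable]: "A \<in> sets N" by simp
  have "emeasure (distr M N X) A = (\<integral>\<^sup>+x. indicator A x \<partial>distr M N X)" by simp
  also have "\<dots> = (\<integral>\<^sup>+x. indicator A (X x) \<partial>M)" by (rule nn_integral_distr) measurable
  also have "\<dots> = (\<integral>\<^sup>+x. indicator A (Y x) \<partial>M')" by (rule eq) measurable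
  also have "\<dots> = (\<integral>\<^sup>+x. indicator A x \<partial>distr M' N Y)" by (rule nn_integral_distr[symmetric]) measurable
  finally show "emeasure (distr M N X) A = emeasure (distr M' N Y) A" by simp
qed simp

section \<open>Exponential moments of Gaussian variables\<close>

lemma nn_integral_gam_exp: "(\<integral>\<^sup>+r. ennreal (exp (k * r)) \<partial>gam) = ennreal (exp (k\<^sup>2 / 2))"
proof -
  have *: "std_normal_density r * exp (k * r) = exp (k\<^sup>2 / 2) * normal_density k 1 r" for r
    by (simp add: normal_density_def field_simps power2_eq_square flip: exp_add)
  have "(\<integral>\<^sup>+r. ennreal (exp (k * r)) \<partial>gam) = (\<integral>\<^sup>+r. ennreal (exp (k\<^sup>2 / 2)) * ennreal (normal_density k 1 r) \<partial>lborel)"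
    by (simp add: nn_integral_gam * flip: ennreal_mult)
  also have "\<dots> = ennreal (exp (k\<^sup>2 / 2)) * (\<integral>\<^sup>+r. ennreal (normal_density k 1 r) \<partial>lborel)"
    by (rule nn_integral_cmult) measurable
  also have "(\<integral>\<^sup>+r. ennreal (normal_density k 1 r) \<partial>lborel) = 1"
    using prob_space.emeasure_space_1[OF prob_space_normal_density[of 1 k]]
    by (simp add: emeasure_density)
  finally show ?thesis by simp
qed

lemma nn_integral_gam_exp_abs: "(\<integral>\<^sup>+r. ennreal (exp (k * \<bar>r\<bar>)) \<partial>gam) \<le> ennreal (2 * exp (k\<^sup>2 / 2))"
proof -
  have "(\<integral>\<^sup>+r. ennreal (exp (k * \<bar>r\<bar>)) \<partial>gam) \<le>
      (\<integral>\<^sup>+r. ennreal (exp (k * r)) + ennreal (exp ((- k) * r)) \<partial>gam)"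
    by (intro nn_integral_mono) (auto simp: abs_if simp flip: ennreal_plus)
  also have "\<dots> = (\<integral>\<^sup>+r. ennreal (exp (k * r)) \<partial>gam) + (\<integral>\<^sup>+r. ennreal (exp ((- k) * r)) \<partial>gam)"
    by (rule nn_integral_add) auto
  also have "\<dots> = ennreal (2 * exp (k\<^sup>2 / 2))"
    unfolding nn_integral_gam_exp by (simp flip: ennreal_plus)
  finally show ?thesis .
qed

lemma nn_integral_dot_exp:
  assumes "finite I"
  shows "(\<integral>\<^sup>+\<zeta>. ennreal (exp (k * \<bar>dot I x \<zeta>\<bar>)) \<partial>gauss I) \<le> ennreal (2 * exp (k\<^sup>2 * dot I x x / 2))"
proof -
  have "(\<integral>\<^sup>+\<zeta>. ennreal (exp (k * \<bar>dot I x \<zeta>\<bar>)) \<partial>gauss I) =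
      (\<integral>\<^sup>+r. ennreal (exp (k * sqrt (dot I x x) * \<bar>r\<bar>)) \<partial>gam)"
    using law_dot[OF assms, of "\<lambda>t. ennreal (exp (k * \<bar>t\<bar>))" x] dot_self_nonneg[of I x]
    by (simp add: abs_mult mult.assoc)
  also have "\<dots> \<le> ennreal (2 * exp ((k * sqrt (dot I x x))\<^sup>2 / 2))"
    by (rule nn_integral_gam_exp_abs)
  finally show ?thesis using dot_self_nonneg[of I x] by (simp add: power_mult_distrib)
qed

lemma integrable_gam_bound:
  assumes [measurable]: "H \<in> borel_measurable borel" and H: "\<And>x. \<bar>H x\<bar> \<le> A * exp (c * \<bar>x\<bar>)"
  shows "integrable gam H" "\<bar>\<integral>r. H r \<partial>gam\<bar> \<le> A * (2 * exp (c\<^sup>2 / 2))"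
proof -
  have A: "A \<ge> 0" using H[of 0] by simp
  have "(\<integral>\<^sup>+r. ennreal \<bar>H r\<bar> \<partial>gam) \<le> (\<integral>\<^sup>+r. ennreal A * ennreal (exp (c * \<bar>r\<bar>)) \<partial>gam)"
    using H A by (intro nn_integral_mono) (simp flip: ennreal_mult)
  also have "\<dots> = ennreal A * (\<integral>\<^sup>+r. ennreal (exp (c * \<bar>r\<bar>)) \<partial>gam)" by (rule nn_integral_cmult) measurable
  also have "\<dots> \<le> ennreal A * ennreal (2 * exp (c\<^sup>2 / 2))"
    by (intro mult_left_mono nn_integral_gam_exp_abs) simp
  finally have "(\<integral>\<^sup>+r. ennreal \<bar>H r\<bar> \<partial>gam) \<le> ennreal (A * (2 * exp (c\<^sup>2 / 2)))"
    using A by (simp flip: ennreal_mult)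
  then show "integrable gam H" "\<bar>\<integral>r. H r \<partial>gam\<bar> \<le> A * (2 * exp (c\<^sup>2 / 2))"
    using integral_bound_nn[of H gam "A * (2 * exp (c\<^sup>2 / 2))"] A by auto
qed

lemma abs_sqrt_minus_1_le: "t \<ge> 0 \<Longrightarrow> \<bar>sqrt t - 1\<bar> \<le> \<bar>t - 1\<bar>"
proof -
  assume "t \<ge> 0"
  then have "t - 1 = (sqrt t - 1) * (sqrt t + 1)" by (simp add: algebra_simps)
  then have "\<bar>t - 1\<bar> = \<bar>sqrt t - 1\<bar> * (sqrt t + 1)" using \<open>t \<ge> 0\<close> by (simp add: abs_mult)
  moreover have "\<bar>sqrt t - 1\<bar> * 1 \<le> \<bar>sqrt t - 1\<bar> * (sqrt t + 1)"
    using \<open>t \<ge> 0\<close> by (intro mult_left_mono) auto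
  ultimately show ?thesis by simp
qed

lemma abs_le_exp: "\<bar>x\<bar> \<le> exp \<bar>x\<bar>" for x :: real
  using exp_ge_add_one_self[of "\<bar>x\<bar>"] by linarith

text \<open>Replacing a weakly correlated second factor by an independent one costs a Lipschitz error.\<close>

lemma gauss_covariance_bound:
  assumes fin: "finite I" and c: "c \<ge> 0"
    and x: "1 / 2 \<le> dot I x x" "dot I x x \<le> 2" and y: "dot I y y \<le> 2"
    and [measurable]: "F \<in> borel_measurable borel" and F: "\<And>u. \<bar>F u\<bar> \<le> A * exp (c * \<bar>u\<bar>)"
    and G: "exp_lip B c G"
  shows "\<bar>\<integral>\<zeta>. F (dot I x \<zeta>) * G (dot I y \<zeta>) \<partial>gauss I\<bar> \<le>
    A * (24 * exp ((4 * c + 1)\<^sup>2)) * (B * (\<bar>dot I y y - 1\<bar> + \<bar>dot I x y\<bar>) + \<bar>\<integral>r. G r \<partial>gam\<bar>)"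
proof -
  have A: "A \<ge> 0" using F[of 0] by simp
  have B: "B \<ge> 0" using G by (rule exp_lip_nonneg)
  have [measurable]: "G \<in> borel_measurable borel" using G by (rule exp_lip_measurable)
  define q where "q = sqrt (dot I x x)"
  \<comment> \<open>Coordinates of \<open>y\<close>: \<rho> along \<open>x\<close> and \<kappa>
    orthogonal to it. Under the exact law the pair is
    \<open>(q * r, \<kappa> * s + \<rho> * r)\<close>; an independent second factor of unit variance
    would have \<rho> = 0 and \<kappa> = 1.\<close>
  define \<rho> where "\<rho> = dot I x y / q"
  define \<kappa> where "\<kappa> = sqrt (dot I y y - \<rho>\<^sup>2)"
  have \<rho>2: "\<rho>\<^sup>2 \<le> dot I y y"
    using law_dot_pair(2)[OF fin _ , of "\<lambda>_. 0" x y] x by (simp add: \<rho>_def q_def)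
  have q: "q \<ge> 1 / 2" "q \<le> 2"
  proof -
    have "sqrt ((1/2)\<^sup>2) \<le> sqrt (dot I x x)" using x by (intro real_sqrt_le_mono) (simp add: power2_eq_square)
    then show "q \<ge> 1 / 2" by (simp add: q_def)
    have "sqrt (dot I x x) \<le> sqrt (2\<^sup>2)" using x by (intro real_sqrt_le_mono) (simp add: power2_eq_square)
    then show "q \<le> 2" by (simp add: q_def)
  qed
  have \<rho>a: "\<bar>\<rho>\<bar> \<le> 2"
  proof (rule abs_le_square_iff[THEN iffD2, of _ 2, simplified])
    show "\<rho>\<^sup>2 \<le> 4" using \<rho>2 y by simp
  qed
  have \<rho>b: "\<bar>\<rho>\<bar> \<le> 2 * \<bar>dot I x y\<bar>"
  proof -
    have "\<bar>\<rho>\<bar> = \<bar>dot I x y\<bar> / q" using q by (simp add: \<rho>_def abs_divide)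
    also have "\<dots> \<le> \<bar>dot I x y\<bar> / (1 / 2)" using q by (intro divide_left_mono) auto
    finally show ?thesis by simp
  qed
  have \<kappa>: "\<kappa> \<ge> 0" "\<kappa> \<le> 2"
  proof -
    show "\<kappa> \<ge> 0" using \<rho>2 by (simp add: \<kappa>_def)
    have "dot I y y - \<rho>\<^sup>2 \<le> 2 * 2" using y zero_le_power2[of \<rho>] by linarith
    then have "sqrt (dot I y y - \<rho>\<^sup>2) \<le> sqrt (2\<^sup>2)" by (intro real_sqrt_le_mono) simp
    then show "\<kappa> \<le> 2" by (simp add: \<kappa>_def)
  qed
  have arith: "a + r \<le> 6 * (u + w)" if "a \<le> u + 2 * r" "r \<le> 2 * w" "0 \<le> u" for a r u w :: real
    using that by (auto simp: algebra_simps intro: add_mono)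
  \<comment> \<open>Distance of (\<kappa>, \<rho>) from (1, 0), hence a bound for the displacement
    of the second argument in units of \<open>\<bar>r\<bar> + \<bar>s\<bar>\<close>.\<close>
  define d where "d = \<bar>\<kappa> - 1\<bar> + \<bar>\<rho>\<bar>"
  have d: "d \<le> 6 * (\<bar>dot I y y - 1\<bar> + \<bar>dot I x y\<bar>)" "d \<ge> 0"
  proof -
    have "\<bar>\<kappa> - 1\<bar> \<le> \<bar>dot I y y - \<rho>\<^sup>2 - 1\<bar>"
      unfolding \<kappa>_def using \<rho>2 by (intro abs_sqrt_minus_1_le) simp
    also have "\<dots> \<le> \<bar>dot I y y - 1\<bar> + \<rho>\<^sup>2" using zero_le_power2[of \<rho>] by linarith
    also have "\<rho>\<^sup>2 \<le> 2 * \<bar>\<rho>\<bar>" using \<rho>a mult_right_mono[of "\<bar>\<rho>\<bar>" 2 "\<bar>\<rho>\<bar>"] by (simp add: power2_eq_square)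
    finally have "\<bar>\<kappa> - 1\<bar> \<le> \<bar>dot I y y - 1\<bar> + 2 * \<bar>\<rho>\<bar>" by simp
    then show "d \<le> 6 * (\<bar>dot I y y - 1\<bar> + \<bar>dot I x y\<bar>)" unfolding d_def using \<rho>b abs_ge_zero[of "dot I y y - 1"] by (rule arith)
  qed (simp add: d_def)
  have law: "distr (gauss I) (borel \<Otimes>\<^sub>M borel) (\<lambda>\<zeta>. (dot I x \<zeta>, dot I y \<zeta>)) =
      distr (gam \<Otimes>\<^sub>M gam) (borel \<Otimes>\<^sub>M borel) (\<lambda>(r, s). (q * r, \<kappa> * s + \<rho> * r))"
  proof (rule distr_eqI_nn_integral)
    fix h :: "real \<times> real \<Rightarrow> ennreal" assume h [measurable]: "h \<in> borel_measurable (borel \<Otimes>\<^sub>M borel)"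
    have "(\<integral>\<^sup>+\<zeta>. h (dot I x \<zeta>, dot I y \<zeta>) \<partial>gauss I) =
      (\<integral>\<^sup>+r. \<integral>\<^sup>+s. h (q * r, \<kappa> * s + \<rho> * r) \<partial>gam \<partial>gam)"
      using law_dot_pair(1)[OF fin h, of x y] x unfolding q_def \<rho>_def \<kappa>_def by simp
    also have "\<dots> = (\<integral>\<^sup>+p. h (case p of (r, s) \<Rightarrow> (q * r, \<kappa> * s + \<rho> * r)) \<partial>(gam \<Otimes>\<^sub>M gam))"
      by (subst gam.nn_integral_fst[symmetric]) auto
    finally show "(\<integral>\<^sup>+\<zeta>. h (dot I x \<zeta>, dot I y \<zeta>) \<partial>gauss I) =
      (\<integral>\<^sup>+p. h (case p of (r, s) \<Rightarrow> (q * r, \<kappa> * s + \<rho> * r)) \<partial>(gam \<Otimes>\<^sub>M gam))" .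
  qed measurable
  have E1: "(\<integral>\<zeta>. F (dot I x \<zeta>) * G (dot I y \<zeta>) \<partial>gauss I) =
      (\<integral>(r, s). F (q * r) * G (\<kappa> * s + \<rho> * r) \<partial>(gam \<Otimes>\<^sub>M gam))"
  proof -
    have "(\<integral>\<zeta>. F (dot I x \<zeta>) * G (dot I y \<zeta>) \<partial>gauss I) = 
      (\<integral>p. F (fst p) * G (snd p) \<partial>distr (gauss I) (borel \<Otimes>\<^sub>M borel) (\<lambda>\<zeta>. (dot I x \<zeta>, dot I y \<zeta>)))"
      by (subst integral_distr) auto
    also have "\<dots> = (\<integral>(r, s). F (q * r) * G (\<kappa> * s + \<rho> * r) \<partial>(gam \<Otimes>\<^sub>M gam))"
      unfolding law by (subst integral_distr) (auto simp: case_prod_beta')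
    finally show ?thesis .
  qed
  have qabs: "\<bar>q * r\<bar> \<le> 2 * \<bar>r\<bar>" for r
    using q by (auto simp: abs_mult intro!: mult_right_mono)
  have F2: "\<bar>F (q * r)\<bar> \<le> A * exp (2 * c * \<bar>r\<bar>)" for r
  proof -
    have "\<bar>F (q * r)\<bar> \<le> A * exp (c * \<bar>q * r\<bar>)" by (rule F)
    also have "\<dots> \<le> A * exp (c * (2 * \<bar>r\<bar>))"
      using A c qabs[of r] by (intro mult_left_mono) (auto intro: mult_left_mono)
    finally show ?thesis by (simp add: mult_ac)
  qed
  have IF: "integrable gam (\<lambda>r. F (q * r))" and EF: "\<bar>\<integral>r. F (q * r) \<partial>gam\<bar> \<le> A * (2 * exp ((2 * c)\<^sup>2 / 2))"
    using integrable_gam_bound[of "\<lambda>r. F (q * r)", OF _ F2] by auto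
  have IG: "integrable gam G" using integrable_gam_bound(1)[of G, OF _ exp_lipD(1)[OF G]] by simp
  \<comment> \<open>The exponent is at most \<open>2 * c\<close> from \<open>F\<close>, as
    \<open>q\<close> is at most 2, plus \<open>2 * c\<close> in \<open>r\<close> or
    \<open>3 * c\<close> in \<open>s\<close> from the Lipschitz factor. The 1 absorbs the linear
    factor \<open>\<bar>r\<bar> + \<bar>s\<bar>\<close>.\<close>
  define k where "k = 4 * c + 1"
  define D where "D = A * B * d"
  have D0: "D \<ge> 0" using A B d by (simp add: D_def)
  have diff: "\<bar>F (q * r) * (G (\<kappa> * s + \<rho> * r) - G s)\<bar> \<le> D * (exp (k * \<bar>r\<bar>) * exp (k * \<bar>s\<bar>))" for r s
  proof -
    have 1: "\<bar>\<kappa> * s + \<rho> * r - s\<bar> \<le> d * (\<bar>r\<bar> + \<bar>s\<bar>)"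
    proof -
      have "\<bar>\<kappa> * s + \<rho> * r - s\<bar> = \<bar>(\<kappa> - 1) * s + \<rho> * r\<bar>" by (simp add: algebra_simps)
      also have "\<dots> \<le> \<bar>\<kappa> - 1\<bar> * \<bar>s\<bar> + \<bar>\<rho>\<bar> * \<bar>r\<bar>" by (metis abs_mult abs_triangle_ineq)
      also have "\<dots> \<le> d * \<bar>s\<bar> + d * \<bar>r\<bar>"
        by (intro add_mono mult_right_mono) (auto simp: d_def)
      finally show ?thesis by (simp add: algebra_simps)
    qed
    have 2: "\<bar>\<kappa> * s + \<rho> * r\<bar> + \<bar>s\<bar> \<le> 3 * \<bar>s\<bar> + 2 * \<bar>r\<bar>"
    proof -
      have "\<bar>\<kappa> * s + \<rho> * r\<bar> \<le> \<kappa> * \<bar>s\<bar> + \<bar>\<rho>\<bar> * \<bar>r\<bar>" using \<kappa> by (metis abs_mult abs_of_nonneg abs_triangle_ineq)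
      also have "\<dots> \<le> 2 * \<bar>s\<bar> + 2 * \<bar>r\<bar>" using \<kappa> \<rho>a by (intro add_mono mult_right_mono) auto
      finally show ?thesis by simp
    qed
    have "\<bar>G (\<kappa> * s + \<rho> * r) - G s\<bar> \<le> B * \<bar>\<kappa> * s + \<rho> * r - s\<bar> * exp (c * (\<bar>\<kappa> * s + \<rho> * r\<bar> + \<bar>s\<bar>))"
      by (rule exp_lipD[OF G])
    also have "\<dots> \<le> B * (d * (\<bar>r\<bar> + \<bar>s\<bar>)) * exp (c * (3 * \<bar>s\<bar> + 2 * \<bar>r\<bar>))"
      using 1 2 B c d by (intro mult_mono) (auto intro: mult_left_mono)
    finally have "\<bar>F (q * r) * (G (\<kappa> * s + \<rho> * r) - G s)\<bar> \<le>
       (A * exp (2 * c * \<bar>r\<bar>)) * (B * (d * (\<bar>r\<bar> + \<bar>s\<bar>)) * exp (c * (3 * \<bar>s\<bar> + 2 * \<bar>r\<bar>)))"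
      unfolding abs_mult using A by (intro mult_mono F2) auto
    also have "\<dots> = D * ((\<bar>r\<bar> + \<bar>s\<bar>) * exp (4 * c * \<bar>r\<bar> + 3 * c * \<bar>s\<bar>))"
      by (simp add: D_def algebra_simps flip: exp_add)
    also have "\<dots> \<le> D * (exp (\<bar>r\<bar> + \<bar>s\<bar>) * exp (4 * c * \<bar>r\<bar> + 4 * c * \<bar>s\<bar>))"
      using D0 c abs_le_exp[of "\<bar>r\<bar> + \<bar>s\<bar>"] by (intro mult_left_mono mult_mono) (auto intro: mult_right_mono)
    also have "\<dots> = D * (exp (k * \<bar>r\<bar>) * exp (k * \<bar>s\<bar>))"
      by (simp add: k_def algebra_simps flip: exp_add)
    finally show ?thesis .
  qed
  have nn: "(\<integral>\<^sup>+p. ennreal \<bar>case p of (r, s) \<Rightarrow> F (q * r) * (G (\<kappa> * s + \<rho> * r) - G s)\<bar> \<partial>(gam \<Otimes>\<^sub>M gam))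
      \<le> ennreal (D * (4 * exp (k\<^sup>2)))"
  proof -
    have "(\<integral>\<^sup>+p. ennreal \<bar>case p of (r, s) \<Rightarrow> F (q * r) * (G (\<kappa> * s + \<rho> * r) - G s)\<bar> \<partial>(gam \<Otimes>\<^sub>M gam)) \<le>
      (\<integral>\<^sup>+p. (case p of (r, s) \<Rightarrow> ennreal D * (ennreal (exp (k * \<bar>r\<bar>)) * ennreal (exp (k * \<bar>s\<bar>)))) \<partial>(gam \<Otimes>\<^sub>M gam))"
      using diff D0 by (intro nn_integral_mono) (auto simp flip: ennreal_mult)
    also have "\<dots> = (\<integral>\<^sup>+r. \<integral>\<^sup>+s. ennreal D * (ennreal (exp (k * \<bar>r\<bar>)) * ennreal (exp (k * \<bar>s\<bar>))) \<partial>gam \<partial>gam)"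
      by (subst gam.nn_integral_fst[symmetric]) auto
    also have "\<dots> = ennreal D * ((\<integral>\<^sup>+r. ennreal (exp (k * \<bar>r\<bar>)) \<partial>gam) * (\<integral>\<^sup>+s. ennreal (exp (k * \<bar>s\<bar>)) \<partial>gam))"
      by (simp add: nn_integral_cmult nn_integral_multc)
    also have "\<dots> \<le> ennreal D * (ennreal (2 * exp (k\<^sup>2 / 2)) * ennreal (2 * exp (k\<^sup>2 / 2)))"
      by (intro mult_left_mono mult_mono nn_integral_gam_exp_abs) auto
    also have "\<dots> = ennreal (D * (4 * exp (k\<^sup>2)))"
      using D0 by (simp add: algebra_simps flip: ennreal_mult exp_add)
    finally show ?thesis .
  qed
  have ID: "integrable (gam \<Otimes>\<^sub>M gam) (\<lambda>(r, s). F (q * r) * (G (\<kappa> * s + \<rho> * r) - G s))"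
    and ED: "\<bar>\<integral>(r, s). F (q * r) * (G (\<kappa> * s + \<rho> * r) - G s) \<partial>(gam \<Otimes>\<^sub>M gam)\<bar> \<le> D * (4 * exp (k\<^sup>2))"
    using D0 by (intro integral_bound_nn[OF _ nn]; simp)+
  have IP: "integrable (gam \<Otimes>\<^sub>M gam) (\<lambda>(r, s). F (q * r) * G s)"
    using IF IG integrable_norm[OF IF] integrable_norm[OF IG]
    by (intro gam_pair.Fubini_integrable) (auto simp: abs_mult)
  \<comment> \<open>With independent arguments the integral factorises, so this part contributes
    only through the mean of \<open>G\<close>. In the final constant, 24 is 6 from the bound on
    \<open>d\<close> times 4 from the two exponential moments.\<close>
  have EP: "(\<integral>(r, s). F (q * r) * G s \<partial>(gam \<Otimes>\<^sub>M gam)) = (\<integral>r. F (q * r) \<partial>gam) * (\<integral>s. G s \<partial>gam)"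
    using gam_pair.integral_fst'[OF IP] by simp
  have "(\<integral>(r, s). F (q * r) * G (\<kappa> * s + \<rho> * r) \<partial>(gam \<Otimes>\<^sub>M gam)) =
     (\<integral>p. (case p of (r, s) \<Rightarrow> F (q * r) * (G (\<kappa> * s + \<rho> * r) - G s)) + (case p of (r, s) \<Rightarrow> F (q * r) * G s) \<partial>(gam \<Otimes>\<^sub>M gam))"
    by (rule Bochner_Integration.integral_cong) (auto simp: algebra_simps)
  also have "\<dots> = (\<integral>(r, s). F (q * r) * (G (\<kappa> * s + \<rho> * r) - G s) \<partial>(gam \<Otimes>\<^sub>M gam)) + (\<integral>(r, s). F (q * r) * G s \<partial>(gam \<Otimes>\<^sub>M gam))"
    by (rule Bochner_Integration.integral_add[OF ID IP])
  finally have "\<bar>\<integral>\<zeta>. F (dot I x \<zeta>) * G (dot I y \<zeta>) \<partial>gauss I\<bar> \<le> D * (4 * exp (k\<^sup>2)) +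
      \<bar>\<integral>r. F (q * r) \<partial>gam\<bar> * \<bar>\<integral>s. G s \<partial>gam\<bar>"
    unfolding E1 EP using ED by (simp flip: abs_mult)
  also have "D * (4 * exp (k\<^sup>2)) \<le> A * B * (6 * (\<bar>dot I y y - 1\<bar> + \<bar>dot I x y\<bar>)) * (4 * exp (k\<^sup>2))"
    unfolding D_def using A B d by (intro mult_right_mono mult_left_mono) auto
  also have "\<bar>\<integral>r. F (q * r) \<partial>gam\<bar> * \<bar>\<integral>s. G s \<partial>gam\<bar> \<le> A * (24 * exp (k\<^sup>2)) * \<bar>\<integral>s. G s \<partial>gam\<bar>"
  proof (intro mult_right_mono)
    have "exp ((2 * c)\<^sup>2 / 2) \<le> exp (k\<^sup>2)" using c by (simp add: k_def power2_eq_square algebra_simps)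
    then have "2 * exp ((2 * c)\<^sup>2 / 2) \<le> 24 * exp (k\<^sup>2)" using exp_ge_zero[of "k\<^sup>2"] by linarith
    then have "A * (2 * exp ((2 * c)\<^sup>2 / 2)) \<le> A * (24 * exp (k\<^sup>2))"
      using A by (rule mult_left_mono)
    then show "\<bar>\<integral>r. F (q * r) \<partial>gam\<bar> \<le> A * (24 * exp (k\<^sup>2))" using EF by linarith
  qed simp
  finally show ?thesis by (simp add: k_def algebra_simps)
qed

section \<open>Sixth moments of Gram entries\<close>

lemma indep_vars_PiM_coordinates:
  assumes N: "prob_space N" and "finite P"
  shows "prob_space.indep_vars (Pi\<^sub>M P (\<lambda>_. N)) (\<lambda>_. N) (\<lambda>i z. z i) P"
proof (cases "P = {}")
  case True
  interpret prob_space "Pi\<^sub>M P (\<lambda>_. N)" by (intro prob_space_PiM N)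
  have "indep_vars (\<lambda>_. N) (\<lambda>i z. z i) {}" by (simp add: indep_vars_def indep_sets_def)
  then show ?thesis using True by simp
next
  case False
  interpret prob_space "Pi\<^sub>M P (\<lambda>_. N)" by (intro prob_space_PiM N)
  have "distr (Pi\<^sub>M P (\<lambda>_. N)) (Pi\<^sub>M P (\<lambda>_. N)) (\<lambda>x. \<lambda>i\<in>P. x i) = distr (Pi\<^sub>M P (\<lambda>_. N)) (Pi\<^sub>M P (\<lambda>_. N)) (\<lambda>x. x)"
    by (intro distr_cong) (auto simp: space_PiM PiE_def extensional_restrict)
  also have "\<dots> = Pi\<^sub>M P (\<lambda>_. N)" by simp
  also have "\<dots> = Pi\<^sub>M P (\<lambda>i. distr (Pi\<^sub>M P (\<lambda>_. N)) N (\<lambda>x. x i))"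
    by (intro PiM_cong refl distr_PiM_component[symmetric] N)
  finally show ?thesis
    by (subst indep_vars_iff_distr_eq_PiM'[OF False]) auto
qed

lemma add_power6_le: "(a + b) ^ 6 \<le> 32 * (a ^ 6 + b ^ 6)" for a b :: real
proof -
  have sq: "(x + y)\<^sup>2 \<le> 2 * (x\<^sup>2 + y\<^sup>2)" for x y :: real
    using zero_le_power2[of "x - y"] by (simp add: power2_eq_square algebra_simps)
  have cu: "(x + y) ^ 3 \<le> 4 * (x ^ 3 + y ^ 3)" if "x \<ge> 0" "y \<ge> 0" for x y :: real
  proof -
    have "0 \<le> 3 * ((x + y) * (x - y)\<^sup>2)" using that by simp
    also have "\<dots> = 4 * (x ^ 3 + y ^ 3) - (x + y) ^ 3"
      by (simp add: power2_eq_square power3_eq_cube algebra_simps)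
    finally show ?thesis by simp
  qed
  have "(a + b) ^ 6 = ((a + b)\<^sup>2) ^ 3" by (simp flip: power_mult)
  also have "\<dots> \<le> (2 * (a\<^sup>2 + b\<^sup>2)) ^ 3" by (intro power_mono sq) simp
  also have "\<dots> = 8 * (a\<^sup>2 + b\<^sup>2) ^ 3" by (subst power_mult_distrib) simp
  also have "\<dots> \<le> 8 * (4 * ((a\<^sup>2) ^ 3 + (b\<^sup>2) ^ 3))" by (intro mult_left_mono cu) auto
  finally show ?thesis by (simp flip: power_mult)
qed

lemma nn_integral_PiM_component:
  assumes "prob_space N" "j \<in> P" "h \<in> borel_measurable N"
  shows "(\<integral>\<^sup>+z. h (z j) \<partial>Pi\<^sub>M P (\<lambda>_. N)) = (\<integral>\<^sup>+x. h x \<partial>N)"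
proof -
  have "(\<integral>\<^sup>+x. h x \<partial>N) = (\<integral>\<^sup>+x. h x \<partial>distr (Pi\<^sub>M P (\<lambda>_. N)) N (\<lambda>z. z j))"
    by (subst distr_PiM_component[where M="\<lambda>_. N"]) (use assms in auto)
  also have "\<dots> = (\<integral>\<^sup>+z. h (z j) \<partial>Pi\<^sub>M P (\<lambda>_. N))"
    using assms by (intro nn_integral_distr) auto
  finally show ?thesis by simp
qed

text \<open>The sum is split into its mean, of size at most \<open>card J * b\<close>, and a centred
  part. The constant 30720 is \<open>32 * 15 * 64\<close>: the splitting of a sixth power, the
  moment bound for centred sums, and \<open>2 ^ 6\<close> because centring may double
  \<open>B\<close>.\<close>

lemma sixth_moment_PiM_sum:
  fixes F :: "'i \<Rightarrow> 'b \<Rightarrow> real"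
  assumes N: "prob_space N" and P: "finite P" "J \<subseteq> P"
    and F [measurable]: "\<And>j. j \<in> J \<Longrightarrow> F j \<in> borel_measurable N"
    and B: "B \<ge> 0" "\<And>j. j \<in> J \<Longrightarrow> (\<integral>\<^sup>+\<zeta>. ennreal (F j \<zeta> ^ 6) \<partial>N) \<le> ennreal (B ^ 6)"
    and b: "\<And>j. j \<in> J \<Longrightarrow> \<bar>\<integral>\<zeta>. F j \<zeta> \<partial>N\<bar> \<le> b"
  shows "(\<integral>\<^sup>+z. ennreal ((\<Sum>j\<in>J. F j (z j)) ^ 6) \<partial>Pi\<^sub>M P (\<lambda>_. N)) \<le>
    ennreal (32 * (real (card J) * b) ^ 6 + 30720 * real (card J) ^ 3 * B ^ 6)"
proof -
  interpret N: prob_space N by fact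
  interpret PP: prob_space "Pi\<^sub>M P (\<lambda>_. N)" by (intro prob_space_PiM N)
  have J: "finite J" using P finite_subset by auto
  have b0: "b \<ge> 0 \<or> J = {}" using b abs_ge_zero order_trans by blast
  define e where "e j = (\<integral>\<zeta>. F j \<zeta> \<partial>N)" for j
  define X where "X j z = F j (z j) - e j" for j and z :: "'i \<Rightarrow> 'b"
  have F6: "integrable N (\<lambda>\<zeta>. F j \<zeta> ^ 6)" "(\<integral>\<zeta>. F j \<zeta> ^ 6 \<partial>N) \<le> B ^ 6" if j: "j \<in> J" for j
  proof -
    have "(\<integral>\<^sup>+\<zeta>. ennreal \<bar>F j \<zeta> ^ 6\<bar> \<partial>N) \<le> ennreal (B ^ 6)" using B(2)[OF j] by simp
    from integral_bound_nn[OF _ this] show "integrable N (\<lambda>\<zeta>. F j \<zeta> ^ 6)" "(\<integral>\<zeta>. F j \<zeta> ^ 6 \<partial>N) \<le> B ^ 6"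
      using B(1) j by auto
  qed
  have F1: "integrable N (F j)" if j: "j \<in> J" for j
  proof (rule Bochner_Integration.integrable_bound[of N "\<lambda>\<zeta>. 1 + F j \<zeta> ^ 6"])
    show "AE \<zeta> in N. norm (F j \<zeta>) \<le> norm (1 + F j \<zeta> ^ 6)"
    proof (rule AE_I2)
      fix \<zeta>
      have "\<bar>t\<bar> \<le> 1 + t ^ 6" for t :: real
      proof (cases "\<bar>t\<bar> \<le> 1")
        case True have "0 \<le> t ^ 6" by simp
        then show ?thesis using True by linarith
      next
        case False then have "\<bar>t\<bar> ^ 1 \<le> \<bar>t\<bar> ^ 6" by (intro power_increasing) auto
        then show ?thesis by simp
      qed
      then show "norm (F j \<zeta>) \<le> norm (1 + F j \<zeta> ^ 6)" by simp
    qed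
  qed (use F6 j in auto)
  \<comment> \<open>Jensen for the convex function \<open>t ^ 6\<close>. It makes the centred
    variables satisfy the same moment hypothesis with \<open>2 * B\<close>.\<close>
  have eB: "e j ^ 6 \<le> B ^ 6" if j: "j \<in> J" for j
  proof -
    have "e j ^ 6 \<le> (\<integral>\<zeta>. F j \<zeta> ^ 6 \<partial>N)"
      unfolding e_def
      by (rule N.jensens_inequality[where I=UNIV]) (use F1[OF j] F6[OF j] in \<open>auto intro: convex_power_even\<close>)
    then show ?thesis using F6(2)[OF j] by linarith
  qed
  have comp: "distr (Pi\<^sub>M P (\<lambda>_. N)) N (\<lambda>z. z j) = N" if "j \<in> J" for j
    using that P by (intro distr_PiM_component[where M="\<lambda>_. N"] N) auto
  have mX: "(\<lambda>\<zeta>. F j \<zeta> - e j) \<in> borel_measurable N" if "j \<in> J" for j using that by simp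
  have ind: "PP.indep_vars (\<lambda>_. borel) X J"
  proof -
    have "PP.indep_vars (\<lambda>_. N) (\<lambda>i z. z i) J"
      using indep_vars_PiM_coordinates[OF N P(1)] P(2) by (rule PP.indep_vars_subset)
    from PP.indep_vars_compose2[OF this, of "\<lambda>j \<zeta>. F j \<zeta> - e j" "\<lambda>_. borel"] mX
    show ?thesis unfolding X_def[abs_def] by blast
  qed
  have pos: "(\<integral>z. h (z j) \<partial>Pi\<^sub>M P (\<lambda>_. N)) = (\<integral>\<zeta>. h \<zeta> \<partial>N)"
    "integrable (Pi\<^sub>M P (\<lambda>_. N)) (\<lambda>z. h (z j)) \<longleftrightarrow> integrable N h"
    if j: "j \<in> J" and h: "h \<in> borel_measurable N" for j and h :: "'b \<Rightarrow> real"
  proof -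
    have m: "(\<lambda>z. z j) \<in> Pi\<^sub>M P (\<lambda>_. N) \<rightarrow>\<^sub>M N" using j P by auto
    show "(\<integral>z. h (z j) \<partial>Pi\<^sub>M P (\<lambda>_. N)) = (\<integral>\<zeta>. h \<zeta> \<partial>N)"
      using integral_distr[OF m h] comp[OF j] by simp
    show "integrable (Pi\<^sub>M P (\<lambda>_. N)) (\<lambda>z. h (z j)) \<longleftrightarrow> integrable N h"
      using integrable_distr_eq[OF m h] comp[OF j] by simp
  qed
  have c6: "integrable N (\<lambda>\<zeta>. (F j \<zeta> - e j) ^ 6)" "(\<integral>\<zeta>. (F j \<zeta> - e j) ^ 6 \<partial>N) \<le> (2 * B) ^ 6" if j: "j \<in> J" for j
  proof -
    have le: "(F j \<zeta> - e j) ^ 6 \<le> 32 * (F j \<zeta> ^ 6 + e j ^ 6)" for \<zeta>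
      using add_power6_le[of "F j \<zeta>" "- e j"] by simp
    show I: "integrable N (\<lambda>\<zeta>. (F j \<zeta> - e j) ^ 6)"
    proof (rule Bochner_Integration.integrable_bound)
      show "integrable N (\<lambda>\<zeta>. 32 * (F j \<zeta> ^ 6 + e j ^ 6))" using F6(1)[OF j] by simp
      show "(\<lambda>\<zeta>. (F j \<zeta> - e j) ^ 6) \<in> borel_measurable N" using mX[OF j] by (rule borel_measurable_power)
      show "AE \<zeta> in N. norm ((F j \<zeta> - e j) ^ 6) \<le> norm (32 * (F j \<zeta> ^ 6 + e j ^ 6))"
      proof (rule AE_I2)
        fix \<zeta>
        have "0 \<le> (F j \<zeta> - e j) ^ 6" by simp
        then show "norm ((F j \<zeta> - e j) ^ 6) \<le> norm (32 * (F j \<zeta> ^ 6 + e j ^ 6))"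
          using le[of \<zeta>] by simp
      qed
    qed
    have "(\<integral>\<zeta>. (F j \<zeta> - e j) ^ 6 \<partial>N) \<le> (\<integral>\<zeta>. 32 * (F j \<zeta> ^ 6 + e j ^ 6) \<partial>N)"
      by (rule integral_mono[OF I _ le]) (use F6(1)[OF j] in simp)
    also have "\<dots> = 32 * ((\<integral>\<zeta>. F j \<zeta> ^ 6 \<partial>N) + e j ^ 6)" using F6(1)[OF j] by (simp add: N.prob_space)
    also have "\<dots> \<le> 32 * (B ^ 6 + B ^ 6)" using F6(2)[OF j] eB[OF j] by simp
    finally show "(\<integral>\<zeta>. (F j \<zeta> - e j) ^ 6 \<partial>N) \<le> (2 * B) ^ 6" by (simp add: power_mult_distrib)
  qed
  have "integrable (Pi\<^sub>M P (\<lambda>_. N)) (\<lambda>z. (\<Sum>j\<in>J. X j z) ^ 6) \<and>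
    PP.expectation (\<lambda>z. (\<Sum>j\<in>J. X j z) ^ 6) \<le> 15 * real (card J) ^ 3 * (2 * B) ^ 6"
  proof (rule PP.sixth_moment_sum_le[OF J ind])
    fix j assume j: "j \<in> J"
    have m6: "(\<lambda>\<zeta>. (F j \<zeta> - e j) ^ 6) \<in> borel_measurable N" using mX[OF j] by (rule borel_measurable_power)
    show "integrable (Pi\<^sub>M P (\<lambda>_. N)) (\<lambda>z. X j z ^ 6)"
      unfolding X_def pos(2)[OF j m6] by (rule c6[OF j])
    show "PP.expectation (\<lambda>z. X j z ^ 6) \<le> (2 * B) ^ 6"
      unfolding X_def pos(1)[OF j m6] by (rule c6[OF j])
    have "PP.expectation (X j) = (\<integral>\<zeta>. F j \<zeta> - e j \<partial>N)"
      unfolding X_def by (rule pos(1)[OF j mX[OF j]])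
    then show "PP.expectation (X j) = 0"
      using F1[OF j] by (simp add: N.prob_space e_def)
  qed (use B in auto)
  then have S: "integrable (Pi\<^sub>M P (\<lambda>_. N)) (\<lambda>z. (\<Sum>j\<in>J. X j z) ^ 6)"
    "PP.expectation (\<lambda>z. (\<Sum>j\<in>J. X j z) ^ 6) \<le> 15 * real (card J) ^ 3 * (2 * B) ^ 6" by auto
  define E where "E = (\<Sum>j\<in>J. e j)"
  have E: "E ^ 6 \<le> (real (card J) * b) ^ 6"
  proof -
    have "\<bar>E\<bar> \<le> (\<Sum>j\<in>J. b)" unfolding E_def
      by (rule order_trans[OF sum_abs sum_mono]) (use b in \<open>auto simp: e_def\<close>)
    then have "\<bar>E\<bar> ^ 6 \<le> (real (card J) * b) ^ 6" by (intro power_mono) auto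
    then show ?thesis by simp
  qed
  have le: "(\<Sum>j\<in>J. F j (z j)) ^ 6 \<le> 32 * (E ^ 6 + (\<Sum>j\<in>J. X j z) ^ 6)" for z
    using add_power6_le[of E "\<Sum>j\<in>J. X j z"] by (simp add: X_def E_def sum_subtractf)
  have "(\<integral>\<^sup>+z. ennreal ((\<Sum>j\<in>J. F j (z j)) ^ 6) \<partial>Pi\<^sub>M P (\<lambda>_. N)) \<le>
      (\<integral>\<^sup>+z. ennreal (32 * (E ^ 6 + (\<Sum>j\<in>J. X j z) ^ 6)) \<partial>Pi\<^sub>M P (\<lambda>_. N))"
    using le by (intro nn_integral_mono ennreal_leI)
  also have "\<dots> = ennreal (PP.expectation (\<lambda>z. 32 * (E ^ 6 + (\<Sum>j\<in>J. X j z) ^ 6)))"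
    using S(1) by (intro nn_integral_eq_integral) auto
  also have "PP.expectation (\<lambda>z. 32 * (E ^ 6 + (\<Sum>j\<in>J. X j z) ^ 6)) = 32 * (E ^ 6 + PP.expectation (\<lambda>z. (\<Sum>j\<in>J. X j z) ^ 6))"
    using S(1) by (simp add: PP.prob_space)
  also have "ennreal \<dots> \<le> ennreal (32 * (real (card J) * b) ^ 6 + 30720 * real (card J) ^ 3 * B ^ 6)"
    using E S(2) by (intro ennreal_leI) (simp add: power_mult_distrib)
  finally show ?thesis .
qed

lemma nn_integral_dot_power:
  assumes fin: "finite I" and [measurable]: "F \<in> borel_measurable borel"
    and F: "\<And>u. \<bar>F u\<bar> \<le> A * exp (c * \<bar>u\<bar>)" and x: "dot I x x \<le> 2"
  shows "(\<integral>\<^sup>+\<zeta>. ennreal (\<bar>F (dot I x \<zeta>)\<bar> ^ k) \<partial>gauss I) \<le> ennreal (A ^ k * (2 * exp ((real k * c)\<^sup>2)))"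
proof -
  have A: "A \<ge> 0" using F[of 0] by simp
  have "(\<integral>\<^sup>+\<zeta>. ennreal (\<bar>F (dot I x \<zeta>)\<bar> ^ k) \<partial>gauss I) \<le>
      (\<integral>\<^sup>+\<zeta>. ennreal (A ^ k) * ennreal (exp ((real k * c) * \<bar>dot I x \<zeta>\<bar>)) \<partial>gauss I)"
  proof (intro nn_integral_mono)
    fix \<zeta>
    have "\<bar>F (dot I x \<zeta>)\<bar> ^ k \<le> (A * exp (c * \<bar>dot I x \<zeta>\<bar>)) ^ k" by (intro power_mono F) simp
    also have "\<dots> = A ^ k * exp ((real k * c) * \<bar>dot I x \<zeta>\<bar>)"
      by (simp add: power_mult_distrib exp_of_nat_mult[symmetric] mult.assoc)
    finally show "ennreal (\<bar>F (dot I x \<zeta>)\<bar> ^ k) \<le> ennreal (A ^ k) * ennreal (exp ((real k * c) * \<bar>dot I x \<zeta>\<bar>))"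
      using A by (simp add: ennreal_leI flip: ennreal_mult)
  qed
  also have "\<dots> = ennreal (A ^ k) * (\<integral>\<^sup>+\<zeta>. ennreal (exp ((real k * c) * \<bar>dot I x \<zeta>\<bar>)) \<partial>gauss I)"
    by (rule nn_integral_cmult) measurable
  also have "\<dots> \<le> ennreal (A ^ k) * ennreal (2 * exp ((real k * c)\<^sup>2))"
  proof (intro mult_left_mono)
    have "(\<integral>\<^sup>+\<zeta>. ennreal (exp ((real k * c) * \<bar>dot I x \<zeta>\<bar>)) \<partial>gauss I) \<le> ennreal (2 * exp ((real k * c)\<^sup>2 * dot I x x / 2))"
      by (rule nn_integral_dot_exp[OF fin])
    also have "\<dots> \<le> ennreal (2 * exp ((real k * c)\<^sup>2))"
      using mult_left_mono[OF x, of "(real k * c)\<^sup>2"] by (intro ennreal_leI) simp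
    finally show "(\<integral>\<^sup>+\<zeta>. ennreal (exp ((real k * c) * \<bar>dot I x \<zeta>\<bar>)) \<partial>gauss I) \<le> ennreal (2 * exp ((real k * c)\<^sup>2))" .
  qed simp
  finally show ?thesis using A by (simp flip: ennreal_mult)
qed

text \<open>A polynomial in the entries that dominates the twelfth power of the operator norm up to
  a constant, so its expectation can be taken term by term. The weight \<open>card U ^ 4\<close>
  comes from the power mean inequality over at most \<open>card U ^ 2\<close> off-diagonal
  pairs.\<close>

definition gram_bound :: "nat set \<Rightarrow> nat set \<Rightarrow> (nat \<Rightarrow> nat \<Rightarrow> real) \<Rightarrow> real" where
  "gram_bound U J M = (\<Sum>i\<in>U. (\<Sum>j\<in>J. M i j * M i j) ^ 6) +
     real (card U) ^ 4 * (\<Sum>i\<in>U. \<Sum>k\<in>U - {i}. (\<Sum>j\<in>J. M i j * M k j) ^ 6)"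

text \<open>One constant for two purposes: the factor 48 and \<open>(4 * c + 1)\<^sup>2\<close>
  serve the covariance bound, while \<open>24 * c\<^sup>2\<close> is a sixth of the exponent
  \<open>(12 * c)\<^sup>2\<close> of the twelfth moments.\<close>

definition row_const :: "real \<Rightarrow> real \<Rightarrow> real" where
  "row_const A c = 48 * A\<^sup>2 * exp ((4 * c + 1)\<^sup>2 + 24 * c\<^sup>2)"

lemma row_const_nonneg: "row_const A c \<ge> 0" by (simp add: row_const_def)

text \<open>The two rows are frozen as \<open>x\<close> and \<open>y\<close>, so the summands are
  independent functions of the columns. Since \<open>G j\<close> has Gaussian mean 0, the covariance
  bound leaves a bias of order \<delta> in each summand.\<close>

lemma gram_entry_sixth_moment:
  assumes fin: "finite I" and c: "c \<ge> 0" and P: "finite P" "J \<subseteq> P" and s: "s > 0"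
    and x: "\<bar>dot I x x - 1\<bar> \<le> \<delta>" and y: "\<bar>dot I y y - 1\<bar> \<le> \<delta>" and xy: "\<bar>dot I x y\<bar> \<le> \<delta>" and \<delta>: "\<delta> \<le> 1 / 2"
    and F: "\<And>j. j \<in> J \<Longrightarrow> exp_lip A c (F j)" and G: "\<And>j. j \<in> J \<Longrightarrow> exp_lip A c (G j)"
    and G0: "\<And>j. j \<in> J \<Longrightarrow> (\<integral>r. G j r \<partial>gam) = 0"
  shows "(\<integral>\<^sup>+z. ennreal ((\<Sum>j\<in>J. F j (dot I x (z j)) / s * (G j (dot I y (z j)) / s)) ^ 6) \<partial>Pi\<^sub>M P (\<lambda>_. gauss I)) \<le>
    ennreal (32 * (real (card J) * (row_const A c * \<delta> / s\<^sup>2)) ^ 6 + 30720 * real (card J) ^ 3 * (row_const A c / s\<^sup>2) ^ 6)"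
proof (rule sixth_moment_PiM_sum[OF prob_space_gauss P])
  have x2: "1 / 2 \<le> dot I x x" "dot I x x \<le> 2" and y2: "dot I y y \<le> 2" using x y \<delta> by auto
  have d0: "\<delta> \<ge> 0" using x by simp
  show "row_const A c / s\<^sup>2 \<ge> 0" by (simp add: row_const_nonneg)
  fix j assume j: "j \<in> J"
  have A: "A \<ge> 0" using F[OF j] by (rule exp_lip_nonneg)
  have [measurable]: "F j \<in> borel_measurable borel" "G j \<in> borel_measurable borel"
    using F[OF j] G[OF j] exp_lip_measurable by auto
  show "(\<lambda>\<zeta>. F j (dot I x \<zeta>) / s * (G j (dot I y \<zeta>) / s)) \<in> borel_measurable (gauss I)" by measurable
  have K: "2 * A\<^sup>2 * exp (24 * c\<^sup>2) \<le> row_const A c"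
    unfolding row_const_def by (intro mult_mono) auto
  show "(\<integral>\<^sup>+\<zeta>. ennreal ((F j (dot I x \<zeta>) / s * (G j (dot I y \<zeta>) / s)) ^ 6) \<partial>gauss I) \<le> ennreal ((row_const A c / s\<^sup>2) ^ 6)"
  proof -
    have "(\<integral>\<^sup>+\<zeta>. ennreal ((F j (dot I x \<zeta>) / s * (G j (dot I y \<zeta>) / s)) ^ 6) \<partial>gauss I) \<le>
      (\<integral>\<^sup>+\<zeta>. ennreal (1 / (s\<^sup>2) ^ 6) * (ennreal (\<bar>F j (dot I x \<zeta>)\<bar> ^ 12) + ennreal (\<bar>G j (dot I y \<zeta>)\<bar> ^ 12)) \<partial>gauss I)"
    proof (intro nn_integral_mono)
      fix \<zeta>
      \<comment> \<open>Separates the two correlated factors, so that only moments of a single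
        linear functional occur.\<close>
      have "(a * b) ^ 6 \<le> \<bar>a\<bar> ^ 12 + \<bar>b\<bar> ^ 12" for a b :: real
      proof -
        have "0 \<le> (a ^ 6 - b ^ 6)\<^sup>2" "0 \<le> a ^ 12 + b ^ 12" by auto
        moreover have "(a ^ 6 - b ^ 6)\<^sup>2 = a ^ 12 + b ^ 12 - 2 * (a * b) ^ 6"
          by (simp add: power2_diff power_mult_distrib flip: power_mult)
        ultimately have "(a * b) ^ 6 \<le> a ^ 12 + b ^ 12" by linarith
        then show ?thesis by simp
      qed
      from this[of "F j (dot I x \<zeta>)" "G j (dot I y \<zeta>)"]
      have "(F j (dot I x \<zeta>) * G j (dot I y \<zeta>)) ^ 6 / (s\<^sup>2) ^ 6 \<le>
          (\<bar>F j (dot I x \<zeta>)\<bar> ^ 12 + \<bar>G j (dot I y \<zeta>)\<bar> ^ 12) / (s\<^sup>2) ^ 6"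
        by (rule divide_right_mono) simp
      also have "(F j (dot I x \<zeta>) * G j (dot I y \<zeta>)) ^ 6 / (s\<^sup>2) ^ 6 = (F j (dot I x \<zeta>) / s * (G j (dot I y \<zeta>) / s)) ^ 6"
        by (simp add: power_divide power2_eq_square)
      finally show "ennreal ((F j (dot I x \<zeta>) / s * (G j (dot I y \<zeta>) / s)) ^ 6) \<le>
        ennreal (1 / (s\<^sup>2) ^ 6) * (ennreal (\<bar>F j (dot I x \<zeta>)\<bar> ^ 12) + ennreal (\<bar>G j (dot I y \<zeta>)\<bar> ^ 12))"
        by (simp add: ennreal_leI flip: ennreal_mult ennreal_plus)
    qed
    also have "\<dots> = ennreal (1 / (s\<^sup>2) ^ 6) * ((\<integral>\<^sup>+\<zeta>. ennreal (\<bar>F j (dot I x \<zeta>)\<bar> ^ 12) \<partial>gauss I) + (\<integral>\<^sup>+\<zeta>. ennreal (\<bar>G j (dot I y \<zeta>)\<bar> ^ 12) \<partial>gauss I))"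
      by (simp add: nn_integral_cmult nn_integral_add)
    also have "\<dots> \<le> ennreal (1 / (s\<^sup>2) ^ 6) * (ennreal (A ^ 12 * (2 * exp ((real 12 * c)\<^sup>2))) + ennreal (A ^ 12 * (2 * exp ((real 12 * c)\<^sup>2))))"
      using exp_lipD(1)[OF F[OF j]] exp_lipD(1)[OF G[OF j]] x2 y2
      by (intro mult_left_mono add_mono nn_integral_dot_power fin) auto
    also have "\<dots> = ennreal ((4 * (A ^ 12 * exp (144 * c\<^sup>2))) / (s\<^sup>2) ^ 6)"
      by (simp add: power_mult_distrib flip: ennreal_mult ennreal_plus)
    also have "\<dots> \<le> ennreal ((row_const A c / s\<^sup>2) ^ 6)"
    proof (rule ennreal_leI)
      have "4 * (A ^ 12 * exp (144 * c\<^sup>2)) \<le> 64 * (A ^ 12 * exp (144 * c\<^sup>2))" by simp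
      also have "\<dots> = (2 * A\<^sup>2 * exp (24 * c\<^sup>2)) ^ 6"
        by (simp add: power_mult_distrib exp_of_nat_mult[symmetric] flip: power_mult)
      also have "\<dots> \<le> row_const A c ^ 6" using K by (intro power_mono) auto
      finally show "4 * (A ^ 12 * exp (144 * c\<^sup>2)) / (s\<^sup>2) ^ 6 \<le> (row_const A c / s\<^sup>2) ^ 6"
        by (simp add: power_divide divide_right_mono)
    qed
    finally show ?thesis .
  qed
  \<comment> \<open>Both the deviation of the norm of \<open>y\<close> and the inner product with
    \<open>x\<close> are at most \<delta>; this doubles the constant 24 to 48.\<close>
  have "\<bar>\<integral>\<zeta>. F j (dot I x \<zeta>) * G j (dot I y \<zeta>) \<partial>gauss I\<bar> \<le>
      A * (24 * exp ((4 * c + 1)\<^sup>2)) * (A * (\<bar>dot I y y - 1\<bar> + \<bar>dot I x y\<bar>) + \<bar>\<integral>r. G j r \<partial>gam\<bar>)"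
    by (rule gauss_covariance_bound[OF fin c x2 y2 _ exp_lipD(1)[OF F[OF j]] G[OF j]]) measurable
  also have "\<dots> \<le> A * (24 * exp ((4 * c + 1)\<^sup>2)) * (A * (\<delta> + \<delta>))"
    using A y xy by (intro mult_left_mono) (auto simp: G0[OF j] intro!: mult_left_mono)
  also have "\<dots> = 48 * A\<^sup>2 * exp ((4 * c + 1)\<^sup>2) * \<delta>" by (simp add: power2_eq_square)
  also have "\<dots> \<le> row_const A c * \<delta>"
    unfolding row_const_def using d0 by (intro mult_right_mono mult_left_mono) auto
  finally have le: "\<bar>\<integral>\<zeta>. F j (dot I x \<zeta>) * G j (dot I y \<zeta>) \<partial>gauss I\<bar> \<le> row_const A c * \<delta>" .
  have "\<bar>\<integral>\<zeta>. F j (dot I x \<zeta>) / s * (G j (dot I y \<zeta>) / s) \<partial>gauss I\<bar> = \<bar>\<integral>\<zeta>. F j (dot I x \<zeta>) * G j (dot I y \<zeta>) \<partial>gauss I\<bar> / s\<^sup>2"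
    by (simp add: power2_eq_square abs_divide)
  then show "\<bar>\<integral>\<zeta>. F j (dot I x \<zeta>) / s * (G j (dot I y \<zeta>) / s) \<partial>gauss I\<bar> \<le> row_const A c * \<delta> / s\<^sup>2"
    using le s by (simp add: power2_eq_square divide_right_mono)
qed

text \<open>A diagonal Gram entry is a sum of squares, so there is no cancellation and the bias has
  the full size \<open>row_const A c / s\<^sup>2\<close>. Smallness comes only from the number of
  summands being small against \<open>s\<^sup>2\<close>.\<close>

lemma gram_diagonal_sixth_moment:
  assumes fin: "finite I" and c: "c \<ge> 0" and P: "finite P" "J \<subseteq> P" and s: "s > 0"
    and x: "dot I x x \<le> 2"
    and F: "\<And>j. j \<in> J \<Longrightarrow> exp_lip A c (F j)"
  shows "(\<integral>\<^sup>+z. ennreal ((\<Sum>j\<in>J. F j (dot I x (z j)) / s * (F j (dot I x (z j)) / s)) ^ 6) \<partial>Pi\<^sub>M P (\<lambda>_. gauss I)) \<le>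
    ennreal (32 * (real (card J) * (row_const A c / s\<^sup>2)) ^ 6 + 30720 * real (card J) ^ 3 * (row_const A c / s\<^sup>2) ^ 6)"
proof (rule sixth_moment_PiM_sum[OF prob_space_gauss P])
  show "row_const A c / s\<^sup>2 \<ge> 0" by (simp add: row_const_nonneg)
  fix j assume j: "j \<in> J"
  have A: "A \<ge> 0" using F[OF j] by (rule exp_lip_nonneg)
  have [measurable]: "F j \<in> borel_measurable borel"
    using F[OF j] exp_lip_measurable by auto
  show "(\<lambda>\<zeta>. F j (dot I x \<zeta>) / s * (F j (dot I x \<zeta>) / s)) \<in> borel_measurable (gauss I)" by measurable
  have K: "2 * A\<^sup>2 * exp (24 * c\<^sup>2) \<le> row_const A c"
    unfolding row_const_def by (intro mult_mono) auto
  have mom: "(\<integral>\<^sup>+\<zeta>. ennreal (\<bar>F j (dot I x \<zeta>)\<bar> ^ (2 * k)) \<partial>gauss I) \<le> ennreal (2 * A ^ (2 * k) * exp (4 * real k ^ 2 * c\<^sup>2))" for k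
    using nn_integral_dot_power[OF fin _ exp_lipD(1)[OF F[OF j]] x, of "2 * k"] by (simp add: power_mult_distrib mult_ac)
  show "(\<integral>\<^sup>+\<zeta>. ennreal ((F j (dot I x \<zeta>) / s * (F j (dot I x \<zeta>) / s)) ^ 6) \<partial>gauss I) \<le> ennreal ((row_const A c / s\<^sup>2) ^ 6)"
  proof -
    have "(\<integral>\<^sup>+\<zeta>. ennreal ((F j (dot I x \<zeta>) / s * (F j (dot I x \<zeta>) / s)) ^ 6) \<partial>gauss I) =
      (\<integral>\<^sup>+\<zeta>. ennreal (1 / (s\<^sup>2) ^ 6) * ennreal (\<bar>F j (dot I x \<zeta>)\<bar> ^ (2 * 6)) \<partial>gauss I)"
      by (simp add: power_divide power2_eq_square power_mult_distrib flip: ennreal_mult power_add)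
    also have "\<dots> = ennreal (1 / (s\<^sup>2) ^ 6) * (\<integral>\<^sup>+\<zeta>. ennreal (\<bar>F j (dot I x \<zeta>)\<bar> ^ (2 * 6)) \<partial>gauss I)"
      by (rule nn_integral_cmult) measurable
    also have "\<dots> \<le> ennreal (1 / (s\<^sup>2) ^ 6) * ennreal (2 * A ^ (2 * 6) * exp (4 * real 6 ^ 2 * c\<^sup>2))"
      by (intro mult_left_mono mom) simp
    also have "\<dots> = ennreal ((2 * (A ^ 12 * exp (144 * c\<^sup>2))) / (s\<^sup>2) ^ 6)"
      by (simp flip: ennreal_mult)
    also have "\<dots> \<le> ennreal ((row_const A c / s\<^sup>2) ^ 6)"
    proof (rule ennreal_leI)
      have "2 * (A ^ 12 * exp (144 * c\<^sup>2)) \<le> 64 * (A ^ 12 * exp (144 * c\<^sup>2))" by simp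
      also have "\<dots> = (2 * A\<^sup>2 * exp (24 * c\<^sup>2)) ^ 6"
        by (simp add: power_mult_distrib exp_of_nat_mult[symmetric] flip: power_mult)
      also have "\<dots> \<le> row_const A c ^ 6" using K by (intro power_mono) auto
      finally show "2 * (A ^ 12 * exp (144 * c\<^sup>2)) / (s\<^sup>2) ^ 6 \<le> (row_const A c / s\<^sup>2) ^ 6"
        by (simp add: power_divide divide_right_mono)
    qed
    finally show ?thesis .
  qed
  have nn: "(\<integral>\<^sup>+\<zeta>. ennreal \<bar>(F j (dot I x \<zeta>))\<^sup>2\<bar> \<partial>gauss I) \<le> ennreal (row_const A c)"
  proof -
    have "(\<integral>\<^sup>+\<zeta>. ennreal \<bar>(F j (dot I x \<zeta>))\<^sup>2\<bar> \<partial>gauss I) \<le> ennreal (2 * A\<^sup>2 * exp (4 * c\<^sup>2))"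
      using mom[of 1] by simp
    also have "\<dots> \<le> ennreal (row_const A c)"
      using K by (intro ennreal_leI order_trans[OF _ K] mult_left_mono) auto
    finally show ?thesis .
  qed
  have "\<bar>\<integral>\<zeta>. (F j (dot I x \<zeta>))\<^sup>2 \<partial>gauss I\<bar> \<le> row_const A c"
    by (rule integral_bound_nn(2)[OF _ nn row_const_nonneg]) measurable
  moreover have "\<bar>\<integral>\<zeta>. F j (dot I x \<zeta>) / s * (F j (dot I x \<zeta>) / s) \<partial>gauss I\<bar> = \<bar>\<integral>\<zeta>. (F j (dot I x \<zeta>))\<^sup>2 \<partial>gauss I\<bar> / s\<^sup>2"
    by (simp add: power2_eq_square abs_divide)
  ultimately show "\<bar>\<integral>\<zeta>. F j (dot I x \<zeta>) / s * (F j (dot I x \<zeta>) / s) \<partial>gauss I\<bar> \<le> row_const A c / s\<^sup>2"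
    using s by (simp add: divide_right_mono)
qed

lemma nn_integral_PiM_le_insert:
  assumes N: "prob_space N" and P: "finite P" "i \<in> P"
    and \<Phi>: "\<Phi> \<in> borel_measurable (Pi\<^sub>M P (\<lambda>_. N))"
    and le: "\<And>a. a \<in> space N \<Longrightarrow> (\<integral>\<^sup>+y. \<Phi> (y(i := a)) \<partial>Pi\<^sub>M (P - {i}) (\<lambda>_. N)) \<le> C"
  shows "(\<integral>\<^sup>+z. \<Phi> z \<partial>Pi\<^sub>M P (\<lambda>_. N)) \<le> C"
proof -
  interpret N: prob_space N by fact
  interpret product_sigma_finite "\<lambda>_. N"
    by (simp add: product_sigma_finite_def N.sigma_finite_measure_axioms)
  have ins: "insert i (P - {i}) = P" using P by auto
  have "(\<integral>\<^sup>+z. \<Phi> z \<partial>Pi\<^sub>M P (\<lambda>_. N)) = (\<integral>\<^sup>+a. \<integral>\<^sup>+y. \<Phi> (y(i := a)) \<partial>Pi\<^sub>M (P - {i}) (\<lambda>_. N) \<partial>N)"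
    using product_nn_integral_insert_rev[of "P - {i}" i \<Phi>, unfolded ins] P \<Phi> by simp
  also have "\<dots> \<le> (\<integral>\<^sup>+a. C \<partial>N)" using le by (intro nn_integral_mono)
  also have "\<dots> = C" by (simp add: N.emeasure_space_1)
  finally show ?thesis .
qed

lemma measurable_upd_const:
  assumes "\<Phi> \<in> borel_measurable (Pi\<^sub>M P (\<lambda>_. N))" "a \<in> space N" "i \<in> P"
  shows "(\<lambda>y. \<Phi> (y(i := a))) \<in> borel_measurable (Pi\<^sub>M (P - {i}) (\<lambda>_. N))"
proof -
  have "(\<lambda>y. y(i := a)) \<in> Pi\<^sub>M (P - {i}) (\<lambda>_. N) \<rightarrow>\<^sub>M Pi\<^sub>M P (\<lambda>_. N)"
    by (rule measurable_fun_upd[where J="P - {i}"]) (use assms in auto)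
  then show ?thesis using assms(1) by (rule measurable_compose)
qed

lemma nn_integral_PiM_le_insert2:
  assumes N: "prob_space N" and P: "finite P" "i \<in> P" "k \<in> P" "i \<noteq> k"
    and \<Phi>: "\<Phi> \<in> borel_measurable (Pi\<^sub>M P (\<lambda>_. N))"
    and le: "\<And>a b. a \<in> space N \<Longrightarrow> b \<in> space N \<Longrightarrow>
      (\<integral>\<^sup>+y. \<Phi> (y(k := b, i := a)) \<partial>Pi\<^sub>M (P - {i, k}) (\<lambda>_. N)) \<le> C"
  shows "(\<integral>\<^sup>+z. \<Phi> z \<partial>Pi\<^sub>M P (\<lambda>_. N)) \<le> C"
proof (rule nn_integral_PiM_le_insert[OF N P(1,2) \<Phi>])
  fix a assume a: "a \<in> space N"
  have e: "P - {i} - {k} = P - {i, k}" by auto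
  show "(\<integral>\<^sup>+y. \<Phi> (y(i := a)) \<partial>Pi\<^sub>M (P - {i}) (\<lambda>_. N)) \<le> C"
    by (rule nn_integral_PiM_le_insert[OF N, where i=k])
       (use P a le measurable_upd_const[OF \<Phi> a P(2)] in \<open>auto simp: e\<close>)
qed

text \<open>The off-diagonal part has fewer than \<open>card U ^ 2\<close> terms and carries the
  weight \<open>card U ^ 4\<close>, whence the sixth power of \<open>card U\<close> in front of
  \<open>D2\<close>.\<close>

lemma gram_bound_expectation:
  assumes U: "finite U" and G: "G \<in> sets Q"
    and M [measurable]: "\<And>i j. i \<in> U \<Longrightarrow> j \<in> J \<Longrightarrow> (\<lambda>z. M z i j) \<in> borel_measurable Q"
    and D: "D1 \<ge> 0" "D2 \<ge> 0"
    and D1: "\<And>i. i \<in> U \<Longrightarrow> (\<integral>\<^sup>+z. ennreal ((\<Sum>j\<in>J. M z i j * M z i j) ^ 6) * indicator G z \<partial>Q) \<le> ennreal D1"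
    and D2: "\<And>i k. i \<in> U \<Longrightarrow> k \<in> U \<Longrightarrow> i \<noteq> k \<Longrightarrow>
      (\<integral>\<^sup>+z. ennreal ((\<Sum>j\<in>J. M z i j * M z k j) ^ 6) * indicator G z \<partial>Q) \<le> ennreal D2"
  shows "(\<integral>\<^sup>+z. ennreal (gram_bound U J (M z)) * indicator G z \<partial>Q) \<le>
    ennreal (real (card U) * D1 + real (card U) ^ 6 * D2)"
proof -
  note [measurable] = G
  let ?t = "\<lambda>z i k. (\<Sum>j\<in>J. M z i j * M z k j) ^ 6"
  let ?m = "real (card U)"
  have tm: "(\<lambda>z. ?t z i k) \<in> borel_measurable Q" if "i \<in> U" "k \<in> U" for i k
    using M that by measurable
  have "ennreal (gram_bound U J (M z)) * indicator G z =
      (\<Sum>i\<in>U. ennreal (?t z i i) * indicator G z) +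
      ennreal (?m ^ 4) * (\<Sum>i\<in>U. \<Sum>k\<in>U - {i}. ennreal (?t z i k) * indicator G z)" for z
    by (simp add: gram_bound_def indicator_def sum_nonneg ennreal_mult ennreal_plus sum_ennreal)
  note eq = this
  have tm': "(\<lambda>z. ennreal (?t z i k) * indicator G z) \<in> borel_measurable Q" if "i \<in> U" "k \<in> U" for i k
    using tm[OF that] by measurable
  have inner: "(\<integral>\<^sup>+z. (\<Sum>k\<in>U - {i}. ennreal (?t z i k) * indicator G z) \<partial>Q) =
      (\<Sum>k\<in>U - {i}. \<integral>\<^sup>+z. ennreal (?t z i k) * indicator G z \<partial>Q)" if "i \<in> U" for i
    using that tm' by (intro nn_integral_sum) auto
  have mi: "(\<lambda>z. \<Sum>k\<in>U - {i}. ennreal (?t z i k) * indicator G z) \<in> borel_measurable Q" if "i \<in> U" for i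
    using that tm' by (intro borel_measurable_sum) auto
  have "(\<integral>\<^sup>+z. ennreal (gram_bound U J (M z)) * indicator G z \<partial>Q) =
     (\<integral>\<^sup>+z. (\<Sum>i\<in>U. ennreal (?t z i i) * indicator G z) \<partial>Q) +
     (\<integral>\<^sup>+z. ennreal (?m ^ 4) * (\<Sum>i\<in>U. \<Sum>k\<in>U - {i}. ennreal (?t z i k) * indicator G z) \<partial>Q)"
    unfolding eq using tm' mi by (intro nn_integral_add) (auto intro!: borel_measurable_sum borel_measurable_times)
  also have "(\<integral>\<^sup>+z. ennreal (?m ^ 4) * (\<Sum>i\<in>U. \<Sum>k\<in>U - {i}. ennreal (?t z i k) * indicator G z) \<partial>Q) =
     ennreal (?m ^ 4) * (\<integral>\<^sup>+z. (\<Sum>i\<in>U. \<Sum>k\<in>U - {i}. ennreal (?t z i k) * indicator G z) \<partial>Q)"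
    using mi by (intro nn_integral_cmult borel_measurable_sum) auto
  also have "(\<integral>\<^sup>+z. (\<Sum>i\<in>U. \<Sum>k\<in>U - {i}. ennreal (?t z i k) * indicator G z) \<partial>Q) =
     (\<Sum>i\<in>U. \<Sum>k\<in>U - {i}. \<integral>\<^sup>+z. ennreal (?t z i k) * indicator G z \<partial>Q)"
    using mi inner by (subst nn_integral_sum) auto
  also have "(\<integral>\<^sup>+z. (\<Sum>i\<in>U. ennreal (?t z i i) * indicator G z) \<partial>Q) =
     (\<Sum>i\<in>U. \<integral>\<^sup>+z. ennreal (?t z i i) * indicator G z \<partial>Q)"
    using tm' by (intro nn_integral_sum) auto
  finally have "(\<integral>\<^sup>+z. ennreal (gram_bound U J (M z)) * indicator G z \<partial>Q) =
    (\<Sum>i\<in>U. \<integral>\<^sup>+z. ennreal (?t z i i) * indicator G z \<partial>Q) +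
     ennreal (?m ^ 4) * (\<Sum>i\<in>U. \<Sum>k\<in>U - {i}. \<integral>\<^sup>+z. ennreal (?t z i k) * indicator G z \<partial>Q)" .
  also have "\<dots> \<le> (\<Sum>i\<in>U. ennreal D1) + ennreal (?m ^ 4) * (\<Sum>i\<in>U. \<Sum>k\<in>U - {i}. ennreal D2)"
    using D1 D2 by (intro add_mono sum_mono mult_left_mono) auto
  also have "\<dots> \<le> (\<Sum>i\<in>U. ennreal D1) + ennreal (?m ^ 4) * (\<Sum>i\<in>U. \<Sum>k\<in>U. ennreal D2)"
    using U by (intro add_mono sum_mono mult_left_mono sum_mono2) auto
  also have "\<dots> = ennreal (?m * D1 + ?m ^ 6 * D2)"
  proof -
    have c: "(\<Sum>i\<in>U. ennreal D) = ennreal (?m * D)" if "D \<ge> 0" for D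
      using that by (subst sum_ennreal) auto
    have "ennreal (?m ^ 4) * ennreal (?m * (?m * D2)) = ennreal (?m ^ 6 * D2)"
      using D by (simp add: power_numeral_reduce mult_ac flip: ennreal_mult)
    then show ?thesis using D by (simp only: c mult_nonneg_nonneg of_nat_0_le_iff ennreal_plus[symmetric] zero_le_power)
  qed
  finally show ?thesis .
qed

text \<open>Matrices are stored by columns \<open>z j\<close>; the scale \<open>s\<close> stands for \<open>\<surd>n\<close>.\<close>

definition gram_good :: "nat set \<Rightarrow> real \<Rightarrow> nat set \<Rightarrow> real \<Rightarrow> (nat \<Rightarrow> nat \<Rightarrow> real) \<Rightarrow> bool" where
  "gram_good I s V \<delta> z \<longleftrightarrow>
     (\<forall>i\<in>V. \<forall>k\<in>V. \<bar>dot I (z i) (z k) / s\<^sup>2 - (if i = k then 1 else 0)\<bar> \<le> \<delta>)"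

abbreviation gaussian_matrix :: "nat set \<Rightarrow> nat set \<Rightarrow> (nat \<Rightarrow> nat \<Rightarrow> real) measure" where
  "gaussian_matrix I P \<equiv> Pi\<^sub>M P (\<lambda>_. gauss I)"

lemma measurable_dot_columns [measurable (raw)]:
  assumes "i \<in> P" "j \<in> P"
  shows "(\<lambda>z. dot I (z i) (z j)) \<in> borel_measurable (gaussian_matrix I P)"
proof -
  have "(\<lambda>z. z i r) \<in> borel_measurable (gaussian_matrix I P)" if i: "i \<in> P" and r: "r \<in> I" for i r
  proof -
    have "(\<lambda>z. z i) \<in> gaussian_matrix I P \<rightarrow>\<^sub>M gauss I" using i by (rule measurable_component_singleton)
    moreover have "(\<lambda>x. x r) \<in> borel_measurable (gauss I)" using r by measurable
    ultimately show ?thesis by (rule measurable_compose)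
  qed
  then show ?thesis unfolding dot_def using assms by measurable
qed

lemma sets_gram_good:
  assumes "V \<subseteq> P" "finite V"
  shows "{z \<in> space (gaussian_matrix I P). gram_good I s V \<delta> z} \<in> sets (gaussian_matrix I P)"
  unfolding gram_good_def
proof (intro sets.sets_Collect_finite_All assms(2))
  fix i k assume "i \<in> V" "k \<in> V"
  then have [measurable]: "(\<lambda>z. dot I (z i) (z k)) \<in> borel_measurable (gaussian_matrix I P)"
    using assms by (intro measurable_dot_columns) auto
  show "{z \<in> space (gaussian_matrix I P). \<bar>dot I (z i) (z k) / s\<^sup>2 - (if i = k then 1 else 0)\<bar> \<le> \<delta>} \<in> sets (gaussian_matrix I P)"
    by measurable
qed

text \<open>The kernel may vary with the position, since the centred block functions depend on the
  sign of the product of two spike entries. With \<open>s\<close> the root of \<open>n\<close>, the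
  argument is \<open>s\<close> times the sample covariance.\<close>

definition offdiag_kernel :: "nat set \<Rightarrow> real \<Rightarrow> (nat \<Rightarrow> nat \<Rightarrow> real \<Rightarrow> real) \<Rightarrow> (nat \<Rightarrow> nat \<Rightarrow> real) \<Rightarrow> nat \<Rightarrow> nat \<Rightarrow> real" where
  "offdiag_kernel I s H z i j = (if i = j then 0 else H i j (dot I (z i) (z j) / s) / s)"

lemma measurable_offdiag_kernel:
  assumes "i \<in> P" "j \<in> P" "H i j \<in> borel_measurable borel"
  shows "(\<lambda>z. offdiag_kernel I s H z i j) \<in> borel_measurable (gaussian_matrix I P)"
  unfolding offdiag_kernel_def using assms by measurable

text \<open>For the Gram entry at \<open>i\<close> and \<open>k\<close> only the columns
  \<open>i\<close> and \<open>k\<close> are frozen. The good event enters solely through what it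
  says about these two columns, so that the remaining columns stay independent.\<close>

lemma offdiag_kernel_expectation:
  assumes I: "finite I" and c: "c \<ge> 0" and P: "finite P" "V \<subseteq> P" and s: "s > 0" and \<delta>: "0 \<le> \<delta>" "\<delta> \<le> 1 / 2"
    and H: "\<And>i j. i \<in> V \<Longrightarrow> j \<in> V \<Longrightarrow> exp_lip A c (H i j)"
    and H0: "\<And>i j. i \<in> V \<Longrightarrow> j \<in> V \<Longrightarrow> (\<integral>r. H i j r \<partial>gam) = 0"
  defines "m \<equiv> real (card V)" and "K \<equiv> row_const A c / s\<^sup>2"
  shows "(\<integral>\<^sup>+z. ennreal (gram_bound V V (offdiag_kernel I s H z)) *
      indicator {z \<in> space (gaussian_matrix I P). gram_good I s V \<delta> z} z \<partial>gaussian_matrix I P) \<le>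
    ennreal (m * (32 * (m * K) ^ 6 + 30720 * m ^ 3 * K ^ 6) + m ^ 6 * (32 * (m * (K * \<delta>)) ^ 6 + 30720 * m ^ 3 * K ^ 6))"
proof -
  have V: "finite V" using P finite_subset by auto
  have K: "K \<ge> 0" by (simp add: K_def row_const_nonneg)
  have m0: "m \<ge> 0" by (simp add: m_def)
  let ?G = "{z \<in> space (gaussian_matrix I P). gram_good I s V \<delta> z}"
  let ?M = "offdiag_kernel I s H"
  have G: "?G \<in> sets (gaussian_matrix I P)" by (rule sets_gram_good[OF P(2) V])
  have mM: "(\<lambda>z. ?M z i j) \<in> borel_measurable (gaussian_matrix I P)" if "i \<in> V" "j \<in> V" for i j
    using that P H exp_lip_measurable by (intro measurable_offdiag_kernel) auto
  have dx: "dot I a b / s = dot I (\<lambda>r. a r / s) b" for a b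
    by (simp add: dot_divide_left)
  have dxx: "dot I (\<lambda>r. a r / s) (\<lambda>r. b r / s) = dot I a b / s\<^sup>2" for a b
    by (simp add: dot_divide_left dot_commute[of I a "\<lambda>r. b r / s"] dot_commute[of I b a] power2_eq_square)
  have diag: "(\<integral>\<^sup>+z. ennreal ((\<Sum>j\<in>V. ?M z i j * ?M z i j) ^ 6) * indicator ?G z \<partial>gaussian_matrix I P) \<le>
     ennreal (32 * (m * K) ^ 6 + 30720 * m ^ 3 * K ^ 6)" if iV: "i \<in> V" for i
  proof -
    let ?\<Phi> = "\<lambda>z. ennreal ((\<Sum>j\<in>V. ?M z i j * ?M z i j) ^ 6) * indicator ?G z"
    have \<Phi>: "?\<Phi> \<in> borel_measurable (gaussian_matrix I P)" using G mM[OF iV] by measurable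
    have i: "i \<in> P" using iV P by auto
    show ?thesis
    proof (rule nn_integral_PiM_le_insert[OF prob_space_gauss P(1) i \<Phi>])
      fix a assume "a \<in> space (gauss I)"
      show "(\<integral>\<^sup>+y. ?\<Phi> (y(i := a)) \<partial>gaussian_matrix I (P - {i})) \<le> ennreal (32 * (m * K) ^ 6 + 30720 * m ^ 3 * K ^ 6)"
      proof (cases "\<bar>dot I a a / s\<^sup>2 - 1\<bar> \<le> \<delta>")
        case False
        then have "?\<Phi> (y(i := a)) = 0" for y
          using iV by (auto simp: gram_good_def indicator_def intro!: bexI[of _ i])
        then have "(\<integral>\<^sup>+y. ?\<Phi> (y(i := a)) \<partial>gaussian_matrix I (P - {i})) = (\<integral>\<^sup>+y. 0 \<partial>gaussian_matrix I (P - {i}))"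
          by (intro nn_integral_cong)
        then show ?thesis by simp
      next
        case True
        define x where "x = (\<lambda>r. a r / s)"
        have x: "dot I x x \<le> 2" using True \<delta> by (simp add: x_def dxx)
        have c1: "real (card (V - {i})) \<le> m" using V unfolding m_def by (intro of_nat_mono card_mono) auto
        have "(\<integral>\<^sup>+y. ?\<Phi> (y(i := a)) \<partial>gaussian_matrix I (P - {i})) \<le>
          (\<integral>\<^sup>+y. ennreal ((\<Sum>j\<in>V - {i}. H i j (dot I x (y j)) / s * (H i j (dot I x (y j)) / s)) ^ 6) \<partial>gaussian_matrix I (P - {i}))"
        proof (intro nn_integral_mono)
          fix y
          have "(\<Sum>j\<in>V. ?M (y(i := a)) i j * ?M (y(i := a)) i j) =
              (\<Sum>j\<in>V - {i}. H i j (dot I x (y j)) / s * (H i j (dot I x (y j)) / s))"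
            using V iV by (intro sum.mono_neutral_cong_right) (auto simp: offdiag_kernel_def dx x_def)
          then show "?\<Phi> (y(i := a)) \<le> ennreal ((\<Sum>j\<in>V - {i}. H i j (dot I x (y j)) / s * (H i j (dot I x (y j)) / s)) ^ 6)"
            by (auto simp: indicator_def)
        qed
        also have "\<dots> \<le> ennreal (32 * (real (card (V - {i})) * K) ^ 6 + 30720 * real (card (V - {i})) ^ 3 * K ^ 6)"
          unfolding K_def using P H iV by (intro gram_diagonal_sixth_moment I c s x) auto
        also have "\<dots> \<le> ennreal (32 * (m * K) ^ 6 + 30720 * m ^ 3 * K ^ 6)"
          using c1 K by (intro ennreal_leI add_mono mult_left_mono mult_right_mono power_mono) auto
        finally show ?thesis .
      qed
    qed
  qed
  have offdiag: "(\<integral>\<^sup>+z. ennreal ((\<Sum>j\<in>V. ?M z i j * ?M z k j) ^ 6) * indicator ?G z \<partial>gaussian_matrix I P) \<le>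
     ennreal (32 * (m * (K * \<delta>)) ^ 6 + 30720 * m ^ 3 * K ^ 6)" if ikV: "i \<in> V" "k \<in> V" "i \<noteq> k" for i k
  proof -
    let ?\<Phi> = "\<lambda>z. ennreal ((\<Sum>j\<in>V. ?M z i j * ?M z k j) ^ 6) * indicator ?G z"
    have \<Phi>: "?\<Phi> \<in> borel_measurable (gaussian_matrix I P)" using G mM ikV by measurable
    have ik: "i \<in> P" "k \<in> P" using ikV P by auto
    show ?thesis
    proof (rule nn_integral_PiM_le_insert2[OF prob_space_gauss P(1) ik ikV(3) \<Phi>])
      fix a b assume "a \<in> space (gauss I)" "b \<in> space (gauss I)"
      show "(\<integral>\<^sup>+y. ?\<Phi> (y(k := b, i := a)) \<partial>gaussian_matrix I (P - {i, k})) \<le>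
        ennreal (32 * (m * (K * \<delta>)) ^ 6 + 30720 * m ^ 3 * K ^ 6)"
      proof (cases "\<bar>dot I a a / s\<^sup>2 - 1\<bar> \<le> \<delta> \<and> \<bar>dot I b b / s\<^sup>2 - 1\<bar> \<le> \<delta> \<and> \<bar>dot I a b / s\<^sup>2\<bar> \<le> \<delta>")
        case False
        have "?\<Phi> (y(k := b, i := a)) = 0" for y
        proof -
          have "\<not> gram_good I s V \<delta> (y(k := b, i := a))"
          proof
            assume g: "gram_good I s V \<delta> (y(k := b, i := a))"
            have g': "\<bar>dot I ((y(k := b, i := a)) i') ((y(k := b, i := a)) k') / s\<^sup>2 - (if i' = k' then 1 else 0)\<bar> \<le> \<delta>"
              if "i' \<in> V" "k' \<in> V" for i' k'
              using g that unfolding gram_good_def by blast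
            show False using False g'[of i i] g'[of k k] g'[of i k] ikV by simp
          qed
          then show ?thesis by simp
        qed
        then have "(\<integral>\<^sup>+y. ?\<Phi> (y(k := b, i := a)) \<partial>gaussian_matrix I (P - {i, k})) = (\<integral>\<^sup>+y. 0 \<partial>gaussian_matrix I (P - {i, k}))"
          by (intro nn_integral_cong)
        then show ?thesis by simp
      next
        case True
        define x where "x = (\<lambda>r. a r / s)"
        define x' where "x' = (\<lambda>r. b r / s)"
        have x: "\<bar>dot I x x - 1\<bar> \<le> \<delta>" "\<bar>dot I x' x' - 1\<bar> \<le> \<delta>" "\<bar>dot I x x'\<bar> \<le> \<delta>"
          using True by (simp_all add: x_def x'_def dxx)
        have c1: "real (card (V - {i, k})) \<le> m" using V unfolding m_def by (intro of_nat_mono card_mono) auto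
        have "(\<integral>\<^sup>+y. ?\<Phi> (y(k := b, i := a)) \<partial>gaussian_matrix I (P - {i, k})) \<le>
          (\<integral>\<^sup>+y. ennreal ((\<Sum>j\<in>V - {i, k}. H i j (dot I x (y j)) / s * (H k j (dot I x' (y j)) / s)) ^ 6) \<partial>gaussian_matrix I (P - {i, k}))"
        proof (intro nn_integral_mono)
          fix y
          have "(\<Sum>j\<in>V. ?M (y(k := b, i := a)) i j * ?M (y(k := b, i := a)) k j) =
              (\<Sum>j\<in>V - {i, k}. H i j (dot I x (y j)) / s * (H k j (dot I x' (y j)) / s))"
            using V ikV by (intro sum.mono_neutral_cong_right) (auto simp: offdiag_kernel_def dx x_def x'_def)
          then show "?\<Phi> (y(k := b, i := a)) \<le> ennreal ((\<Sum>j\<in>V - {i, k}. H i j (dot I x (y j)) / s * (H k j (dot I x' (y j)) / s)) ^ 6)"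
            by (auto simp: indicator_def)
        qed
        also have "\<dots> \<le> ennreal (32 * (real (card (V - {i, k})) * (row_const A c * \<delta> / s\<^sup>2)) ^ 6 + 30720 * real (card (V - {i, k})) ^ 3 * (row_const A c / s\<^sup>2) ^ 6)"
          using P H H0 ikV \<delta> by (intro gram_entry_sixth_moment I c s x) auto
        also have "row_const A c * \<delta> / s\<^sup>2 = K * \<delta>" by (simp add: K_def)
        also have "row_const A c / s\<^sup>2 = K" by (simp add: K_def)
        also have "ennreal (32 * (real (card (V - {i, k})) * (K * \<delta>)) ^ 6 + 30720 * real (card (V - {i, k})) ^ 3 * K ^ 6) \<le>
            ennreal (32 * (m * (K * \<delta>)) ^ 6 + 30720 * m ^ 3 * K ^ 6)"
          using c1 K \<delta> by (intro ennreal_leI add_mono mult_left_mono mult_right_mono power_mono) auto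
        finally show ?thesis .
      qed
    qed
  qed
  show ?thesis
    unfolding m_def by (rule gram_bound_expectation[OF V G])
      (use mM diag offdiag K m0 \<delta> in \<open>auto simp: m_def\<close>)
qed

section \<open>Bounds for bilinear forms\<close>

text \<open>An operator norm bound for a block, tested on arbitrary functions on the naturals.
  Blocks with different index sets, their transposes and their extensions by zero are then treated
  without changing the type or taking suprema.\<close>

definition bilin_le :: "nat set \<Rightarrow> nat set \<Rightarrow> (nat \<Rightarrow> nat \<Rightarrow> real) \<Rightarrow> real \<Rightarrow> bool" where
  "bilin_le I J M b \<longleftrightarrow>
     (\<forall>y x. \<bar>\<Sum>i\<in>I. \<Sum>j\<in>J. y i * M i j * x j\<bar> \<le> b * (L2_set y I * L2_set x J))"

lemma bilin_leI:
  "(\<And>y x. \<bar>\<Sum>i\<in>I. \<Sum>j\<in>J. y i * M i j * x j\<bar> \<le> b * (L2_set y I * L2_set x J)) \<Longrightarrow> bilin_le I J M b"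
  by (simp add: bilin_le_def)

lemma bilin_leD:
  "bilin_le I J M b \<Longrightarrow> \<bar>\<Sum>i\<in>I. \<Sum>j\<in>J. y i * M i j * x j\<bar> \<le> b * (L2_set y I * L2_set x J)"
  by (simp add: bilin_le_def)

lemma bilin_le_cong:
  "(\<And>i j. i \<in> I \<Longrightarrow> j \<in> J \<Longrightarrow> M i j = M' i j) \<Longrightarrow> bilin_le I J M b \<longleftrightarrow> bilin_le I J M' b"
  by (simp add: bilin_le_def)

lemma bilin_le_add:
  assumes "bilin_le I J M b" "bilin_le I J M' b'"
  shows "bilin_le I J (\<lambda>i j. M i j + M' i j) (b + b')"
proof (rule bilin_leI)
  fix y x
  have "(\<Sum>i\<in>I. \<Sum>j\<in>J. y i * (M i j + M' i j) * x j) =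
      (\<Sum>i\<in>I. \<Sum>j\<in>J. y i * M i j * x j) + (\<Sum>i\<in>I. \<Sum>j\<in>J. y i * M' i j * x j)"
    by (simp add: algebra_simps sum.distrib)
  then show "\<bar>\<Sum>i\<in>I. \<Sum>j\<in>J. y i * (M i j + M' i j) * x j\<bar> \<le> (b + b') * (L2_set y I * L2_set x J)"
    using bilin_leD[OF assms(1), of y x] bilin_leD[OF assms(2), of y x] by (simp add: distrib_right)
qed

lemma bilin_le_transpose:
  assumes "bilin_le I J M b"
  shows "bilin_le J I (\<lambda>j i. M i j) b"
proof (rule bilin_leI)
  fix y x
  have "(\<Sum>i\<in>J. \<Sum>j\<in>I. y i * M j i * x j) = (\<Sum>j\<in>I. \<Sum>i\<in>J. x j * M j i * y i)"
    by (subst sum.swap) (simp add: mult_ac)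
  then show "\<bar>\<Sum>i\<in>J. \<Sum>j\<in>I. y i * M j i * x j\<bar> \<le> b * (L2_set y J * L2_set x I)"
    using bilin_leD[OF assms, of x y] by (simp add: mult.commute)
qed

lemma bilin_le_extend:
  assumes "bilin_le I' J' M b" "I' \<subseteq> I" "J' \<subseteq> J" "finite I" "finite J" "b \<ge> 0"
    and "\<And>i j. i \<in> I \<Longrightarrow> j \<in> J \<Longrightarrow> i \<notin> I' \<or> j \<notin> J' \<Longrightarrow> M i j = 0"
  shows "bilin_le I J M b"
proof (rule bilin_leI)
  fix y x
  have "(\<Sum>i\<in>I. \<Sum>j\<in>J. y i * M i j * x j) = (\<Sum>i\<in>I'. \<Sum>j\<in>J. y i * M i j * x j)"
    using assms by (intro sum.mono_neutral_right) (auto intro!: sum.neutral)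
  also have "\<dots> = (\<Sum>i\<in>I'. \<Sum>j\<in>J'. y i * M i j * x j)"
    using assms by (intro sum.cong refl sum.mono_neutral_right) auto
  also have "\<bar>\<dots>\<bar> \<le> b * (L2_set y I' * L2_set x J')"
    by (rule bilin_leD[OF assms(1)])
  also have "\<dots> \<le> b * (L2_set y I * L2_set x J)"
    using assms unfolding L2_set_def
    by (intro mult_left_mono mult_mono real_sqrt_le_mono sum_mono2) (auto intro: sum_nonneg)
  finally show "\<bar>\<Sum>i\<in>I. \<Sum>j\<in>J. y i * M i j * x j\<bar> \<le> b * (L2_set y I * L2_set x J)" .
qed

lemma bilin_le_diagonal:
  assumes "finite I" "\<And>i. i \<in> I \<Longrightarrow> \<bar>d i\<bar> \<le> b"
  shows "bilin_le I I (\<lambda>i j. if i = j then d i else 0) b"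
proof (rule bilin_leI)
  fix y x
  show "\<bar>\<Sum>i\<in>I. \<Sum>j\<in>I. y i * (if i = j then d i else 0) * x j\<bar> \<le> b * (L2_set y I * L2_set x I)"
  proof (cases "I = {}")
    case False
    then have b: "b \<ge> 0" using assms(2) abs_ge_zero order_trans by blast
    have "(\<Sum>i\<in>I. \<Sum>j\<in>I. y i * (if i = j then d i else 0) * x j) = (\<Sum>i\<in>I. \<Sum>j\<in>I. if i = j then y i * d i * x j else 0)"
      by (intro sum.cong) auto
    also have "\<dots> = (\<Sum>i\<in>I. y i * d i * x i)" using assms(1) by simp
    also have "\<bar>\<dots>\<bar> \<le> (\<Sum>i\<in>I. b * (\<bar>y i\<bar> * \<bar>x i\<bar>))"
    proof (rule order_trans[OF sum_abs sum_mono])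
      fix i assume "i \<in> I"
      then have "\<bar>d i\<bar> * (\<bar>y i\<bar> * \<bar>x i\<bar>) \<le> b * (\<bar>y i\<bar> * \<bar>x i\<bar>)"
        using assms(2) by (intro mult_right_mono) auto
      then show "\<bar>y i * d i * x i\<bar> \<le> b * (\<bar>y i\<bar> * \<bar>x i\<bar>)" by (simp add: abs_mult mult_ac)
    qed
    also have "\<dots> = b * (\<Sum>i\<in>I. \<bar>y i\<bar> * \<bar>x i\<bar>)" by (simp add: sum_distrib_left)
    also have "\<dots> \<le> b * (L2_set y I * L2_set x I)"
      using b by (intro mult_left_mono L2_set_mult_ineq)
    finally show ?thesis .
  qed simp
qed

lemma abs_sum_mult_le_L2: "\<bar>\<Sum>i\<in>I. f i * g i\<bar> \<le> L2_set f I * L2_set g I"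
proof -
  have "\<bar>\<Sum>i\<in>I. f i * g i\<bar> \<le> (\<Sum>i\<in>I. \<bar>f i\<bar> * \<bar>g i\<bar>)"
    by (rule order_trans[OF sum_abs]) (simp add: abs_mult)
  also have "\<dots> \<le> L2_set f I * L2_set g I" by (rule L2_set_mult_ineq)
  finally show ?thesis .
qed

lemma bilin_le_rank_one:
  assumes "\<bar>\<kappa>\<bar> * (L2_set u I * L2_set w J) \<le> b"
  shows "bilin_le I J (\<lambda>i j. \<kappa> * u i * w j) b"
proof (rule bilin_leI)
  fix y x
  have "(\<Sum>i\<in>I. \<Sum>j\<in>J. y i * (\<kappa> * u i * w j) * x j) = \<kappa> * ((\<Sum>i\<in>I. y i * u i) * (\<Sum>j\<in>J. w j * x j))"
    by (simp add: sum_product sum_distrib_left mult_ac) (rule sum.swap)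
  also have "\<bar>\<dots>\<bar> \<le> \<bar>\<kappa>\<bar> * ((L2_set y I * L2_set u I) * (L2_set w J * L2_set x J))"
    unfolding abs_mult by (intro mult_left_mono mult_mono abs_sum_mult_le_L2) auto
  also have "\<dots> = (\<bar>\<kappa>\<bar> * (L2_set u I * L2_set w J)) * (L2_set y I * L2_set x J)" by simp
  also have "\<dots> \<le> b * (L2_set y I * L2_set x J)" using assms by (intro mult_right_mono) auto
  finally show "\<bar>\<Sum>i\<in>I. \<Sum>j\<in>J. y i * (\<kappa> * u i * w j) * x j\<bar> \<le> b * (L2_set y I * L2_set x J)" .
qed

lemma bilin_le_frobenius:
  assumes b: "b \<ge> 0" "(\<Sum>i\<in>I. \<Sum>j\<in>J. (M i j)\<^sup>2) \<le> b\<^sup>2"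
  shows "bilin_le I J M b"
proof (rule bilin_leI)
  fix y x
  define r where "r i = L2_set (M i) J" for i
  have "L2_set r I = sqrt (\<Sum>i\<in>I. \<Sum>j\<in>J. (M i j)\<^sup>2)"
    by (simp add: L2_set_def r_def sum_nonneg)
  also have "\<dots> \<le> b" using b by (intro real_le_lsqrt) (auto intro: sum_nonneg)
  finally have r: "L2_set r I \<le> b" .
  have "\<bar>\<Sum>i\<in>I. \<Sum>j\<in>J. y i * M i j * x j\<bar> = \<bar>\<Sum>i\<in>I. y i * (\<Sum>j\<in>J. M i j * x j)\<bar>"
    by (simp add: sum_distrib_left mult.assoc)
  also have "\<dots> \<le> (\<Sum>i\<in>I. \<bar>y i\<bar> * (r i * L2_set x J))"
    by (rule order_trans[OF sum_abs sum_mono]) (auto simp: abs_mult r_def intro!: mult_left_mono abs_sum_mult_le_L2)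
  also have "\<dots> = (\<Sum>i\<in>I. \<bar>y i\<bar> * \<bar>r i\<bar>) * L2_set x J"
    by (simp add: sum_distrib_right r_def mult.assoc)
  also have "\<dots> \<le> (L2_set y I * L2_set r I) * L2_set x J"
    by (intro mult_right_mono L2_set_mult_ineq) auto
  also have "\<dots> \<le> (L2_set y I * b) * L2_set x J"
    using r by (intro mult_right_mono mult_left_mono) auto
  finally show "\<bar>\<Sum>i\<in>I. \<Sum>j\<in>J. y i * M i j * x j\<bar> \<le> b * (L2_set y I * L2_set x J)"
    by (simp add: mult_ac)
qed

text \<open>The power mean inequality from two uses of Cauchy--Schwarz: the square of the sum
  against the sum of squares, and the square of the latter against the product of the sum and the
  sum of cubes.\<close>

lemma sum_cube_le:
  fixes t :: "'a \<Rightarrow> real"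
  assumes "\<And>a. a \<in> A \<Longrightarrow> t a \<ge> 0"
  shows "(\<Sum>a\<in>A. t a) ^ 3 \<le> real (card A) ^ 2 * (\<Sum>a\<in>A. t a ^ 3)"
proof (cases "(\<Sum>a\<in>A. t a) = 0")
  case True
  then show ?thesis using assms by (simp add: sum_nonneg)
next
  case False
  define S where "S = (\<Sum>a\<in>A. t a)"
  have S: "S > 0" using False sum_nonneg[of A t] assms by (simp add: S_def order_less_le)
  have 1: "S\<^sup>2 \<le> real (card A) * (\<Sum>a\<in>A. (t a)\<^sup>2)"
    using Cauchy_Schwarz_ineq_sum[of "\<lambda>_. 1" t A] by (simp add: S_def)
  have 2: "(\<Sum>a\<in>A. (t a)\<^sup>2)\<^sup>2 \<le> S * (\<Sum>a\<in>A. t a ^ 3)"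
  proof -
    have "(\<Sum>a\<in>A. sqrt (t a) * (t a * sqrt (t a)))\<^sup>2 \<le> (\<Sum>a\<in>A. (sqrt (t a))\<^sup>2) * (\<Sum>a\<in>A. (t a * sqrt (t a))\<^sup>2)"
      by (rule Cauchy_Schwarz_ineq_sum)
    moreover have "(\<Sum>a\<in>A. sqrt (t a) * (t a * sqrt (t a))) = (\<Sum>a\<in>A. (t a)\<^sup>2)"
      using assms by (intro sum.cong) (auto simp: power2_eq_square algebra_simps)
    moreover have "(\<Sum>a\<in>A. (t a * sqrt (t a))\<^sup>2) = (\<Sum>a\<in>A. t a ^ 3)"
      using assms by (intro sum.cong) (auto simp: power_mult_distrib power2_eq_square power3_eq_cube)
    moreover have "(\<Sum>a\<in>A. (sqrt (t a))\<^sup>2) = S"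
      using assms unfolding S_def by (intro sum.cong) auto
    ultimately show ?thesis by simp
  qed
  have "S * S ^ 3 = (S\<^sup>2)\<^sup>2" by (simp add: power2_eq_square power3_eq_cube)
  also have "\<dots> \<le> (real (card A) * (\<Sum>a\<in>A. (t a)\<^sup>2))\<^sup>2" using 1 by (intro power_mono) auto
  also have "\<dots> = real (card A) ^ 2 * (\<Sum>a\<in>A. (t a)\<^sup>2)\<^sup>2" by (simp add: power_mult_distrib)
  also have "\<dots> \<le> real (card A) ^ 2 * (S * (\<Sum>a\<in>A. t a ^ 3))" using 2 by (intro mult_left_mono) auto
  also have "\<dots> = S * (real (card A) ^ 2 * (\<Sum>a\<in>A. t a ^ 3))" by simp
  finally show ?thesis using S by (simp add: S_def)
qed

text \<open>The operator norm is controlled through the Gram matrix: its diagonal entrywise,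
  its off-diagonal part by the Frobenius norm.\<close>

lemma bilin_le_gram:
  assumes fin: "finite U" "finite J" and b: "b \<ge> 0" and R: "64 * gram_bound U J M \<le> b ^ 12"
  shows "bilin_le U J M b"
proof (rule bilin_leI)
  fix y x :: "nat \<Rightarrow> real"
  define T where "T i k = (\<Sum>j\<in>J. M i j * M k j)" for i k
  \<comment> \<open>Half of \<open>b\<^sup>2\<close> is reserved for the diagonal and half for the
    off-diagonal part of the Gram matrix; 64 is \<open>2 ^ 6\<close>, the price of this
    halving.\<close>
  define \<beta> where "\<beta> = b\<^sup>2 / 2"
  have \<beta>0: "\<beta> \<ge> 0" by (simp add: \<beta>_def)
  have \<beta>: "gram_bound U J M \<le> \<beta> ^ 6"
    using R by (simp add: \<beta>_def power_divide flip: power_mult)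
  define A where "A = (SIGMA i:U. U - {i})"
  have finA: "finite A" using fin by (simp add: A_def)
  have sA: "(\<Sum>i\<in>U. \<Sum>k\<in>U - {i}. h i k) = (\<Sum>(i, k)\<in>A. h i k)" for h :: "nat \<Rightarrow> nat \<Rightarrow> real"
    unfolding A_def using fin by (intro sum.Sigma) auto
  have cA: "real (card A) \<le> real (card U) ^ 2"
  proof -
    have "card A \<le> card (U \<times> U)" using fin by (intro card_mono) (auto simp: A_def)
    then have "real (card A) \<le> real (card U * card U)" by (simp only: card_cartesian_product of_nat_le_iff)
    then show ?thesis by (simp add: power2_eq_square)
  qed
  have gb: "gram_bound U J M = (\<Sum>i\<in>U. T i i ^ 6) + real (card U) ^ 4 * (\<Sum>(i, k)\<in>A. T i k ^ 6)"
    unfolding gram_bound_def T_def[symmetric] sA ..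
  have even6: "(\<Sum>i\<in>U. T i i ^ 6) \<ge> 0" "(\<Sum>(i, k)\<in>A. T i k ^ 6) \<ge> 0"
    by (auto intro!: sum_nonneg)
  have diag: "T i i \<le> \<beta>" if "i \<in> U" for i
  proof -
    have "T i i ^ 6 \<le> (\<Sum>i\<in>U. T i i ^ 6)"
      using fin that by (intro member_le_sum) auto
    also have "\<dots> \<le> gram_bound U J M" unfolding gb using even6 by simp
    also have "\<dots> \<le> \<beta> ^ 6" by (rule \<beta>)
    finally show ?thesis using power_le_imp_le_base[of "T i i" 5 \<beta>] \<beta>0 by simp
  qed
  \<comment> \<open>The cube of the squared Frobenius norm is bounded by the sum of sixth powers
    times the square of the number of pairs, and that square is at most
    \<open>card U ^ 4\<close>.\<close>
  have off: "(\<Sum>(i, k)\<in>A. (T i k)\<^sup>2) \<le> \<beta>\<^sup>2"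
  proof -
    have "(\<Sum>(i, k)\<in>A. (T i k)\<^sup>2) ^ 3 = (\<Sum>p\<in>A. (T (fst p) (snd p))\<^sup>2) ^ 3" by (simp add: case_prod_beta)
    also have "\<dots> \<le> real (card A) ^ 2 * (\<Sum>p\<in>A. ((T (fst p) (snd p))\<^sup>2) ^ 3)" by (rule sum_cube_le) simp
    also have "\<dots> = real (card A) ^ 2 * (\<Sum>(i, k)\<in>A. T i k ^ 6)" by (simp add: case_prod_beta flip: power_mult)
    also have "\<dots> \<le> (real (card U) ^ 2) ^ 2 * (\<Sum>(i, k)\<in>A. T i k ^ 6)"
      using cA even6 by (intro mult_right_mono power_mono) auto
    also have "\<dots> \<le> gram_bound U J M" unfolding gb using even6 by (simp flip: power_mult)
    also have "\<dots> \<le> (\<beta>\<^sup>2) ^ 3" using \<beta> by (simp flip: power_mult)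
    finally show ?thesis using power_le_imp_le_base[of "\<Sum>(i, k)\<in>A. (T i k)\<^sup>2" 2 "\<beta>\<^sup>2"] by simp
  qed
  \<comment> \<open>The squared norm of \<open>w\<close> is the quadratic form of the Gram matrix
    \<open>T\<close> at \<open>y\<close>.\<close>
  define w where "w j = (\<Sum>i\<in>U. y i * M i j)" for j
  define Y where "Y = (\<Sum>i\<in>U. (y i)\<^sup>2)"
  have Y0: "Y \<ge> 0" by (simp add: Y_def sum_nonneg)
  have "(\<Sum>j\<in>J. (w j)\<^sup>2) = (\<Sum>i\<in>U. \<Sum>k\<in>U. y i * y k * T i k)"
  proof -
    have "(\<Sum>j\<in>J. (w j)\<^sup>2) = (\<Sum>j\<in>J. \<Sum>i\<in>U. \<Sum>k\<in>U. y i * M i j * (y k * M k j))"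
      by (simp add: w_def power2_eq_square sum_product)
    also have "\<dots> = (\<Sum>i\<in>U. \<Sum>k\<in>U. \<Sum>j\<in>J. y i * M i j * (y k * M k j))"
      by (subst sum.swap, intro sum.cong refl sum.swap)
    finally show ?thesis by (simp add: T_def sum_distrib_left mult_ac)
  qed
  also have "\<dots> = (\<Sum>i\<in>U. y i * y i * T i i + (\<Sum>k\<in>U - {i}. y i * y k * T i k))"
    using fin by (intro sum.cong refl) (simp add: sum.remove)
  also have "\<dots> = (\<Sum>i\<in>U. (y i)\<^sup>2 * T i i) + (\<Sum>(i, k)\<in>A. y i * y k * T i k)"
    by (simp add: sum.distrib sA power2_eq_square)
  also have "(\<Sum>i\<in>U. (y i)\<^sup>2 * T i i) \<le> Y * \<beta>"
    unfolding Y_def sum_distrib_right using diag by (intro sum_mono mult_left_mono) auto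
  also have "(\<Sum>(i, k)\<in>A. y i * y k * T i k) \<le> Y * \<beta>"
  proof -
    have "(\<Sum>(i, k)\<in>A. y i * y k * T i k) = (\<Sum>p\<in>A. (y (fst p) * y (snd p)) * T (fst p) (snd p))"
      by (simp add: case_prod_beta)
    also have "\<dots> \<le> L2_set (\<lambda>p. y (fst p) * y (snd p)) A * L2_set (\<lambda>p. T (fst p) (snd p)) A"
      by (rule abs_le_D1[OF abs_sum_mult_le_L2])
    also have "\<dots> \<le> Y * \<beta>"
    proof (intro mult_mono)
      have "(\<Sum>p\<in>A. (y (fst p) * y (snd p))\<^sup>2) \<le> (\<Sum>p\<in>U \<times> U. (y (fst p) * y (snd p))\<^sup>2)"
        using fin by (intro sum_mono2) (auto simp: A_def)
      also have "\<dots> = Y\<^sup>2"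
      proof -
        have "Y\<^sup>2 = (\<Sum>i\<in>U. \<Sum>k\<in>U. (y i)\<^sup>2 * (y k)\<^sup>2)"
          unfolding Y_def power2_eq_square[of "\<Sum>i\<in>U. (y i)\<^sup>2"] by (rule sum_product)
        also have "\<dots> = (\<Sum>p\<in>U \<times> U. (y (fst p) * y (snd p))\<^sup>2)"
          unfolding sum.cartesian_product by (simp add: case_prod_beta power_mult_distrib)
        finally show ?thesis by simp
      qed
      finally show "L2_set (\<lambda>p. y (fst p) * y (snd p)) A \<le> Y"
        unfolding L2_set_def using Y0 by (intro real_le_lsqrt) (auto intro: sum_nonneg)
      show "L2_set (\<lambda>p. T (fst p) (snd p)) A \<le> \<beta>"
        unfolding L2_set_def using \<beta>0 off by (intro real_le_lsqrt) (auto intro: sum_nonneg simp: case_prod_beta)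
    qed (use Y0 in auto)
    finally show ?thesis .
  qed
  also have "Y * \<beta> + Y * \<beta> = (b * L2_set y U)\<^sup>2"
    using Y0 by (simp add: \<beta>_def power_mult_distrib L2_set_def Y_def)
  finally have "(\<Sum>j\<in>J. (w j)\<^sup>2) \<le> (b * L2_set y U)\<^sup>2" by simp
  then have wle: "L2_set w J \<le> b * L2_set y U"
    unfolding L2_set_def[of w] using b by (intro real_le_lsqrt) (auto intro: sum_nonneg)
  have "(\<Sum>i\<in>U. \<Sum>j\<in>J. y i * M i j * x j) = (\<Sum>j\<in>J. w j * x j)"
    unfolding w_def by (subst sum.swap) (simp add: sum_distrib_right)
  also have "\<bar>\<dots>\<bar> \<le> L2_set w J * L2_set x J" by (rule abs_sum_mult_le_L2)
  also have "\<dots> \<le> b * L2_set y U * L2_set x J" using wle by (intro mult_right_mono) auto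
  finally show "\<bar>\<Sum>i\<in>U. \<Sum>j\<in>J. y i * M i j * x j\<bar> \<le> b * (L2_set y U * L2_set x J)"
    by (simp add: mult.assoc)
qed

section \<open>From bilinear forms to the operator norm\<close>

lemma vec_norm2_L2_set: "vec_norm2 x = L2_set (\<lambda>i. x $ i) {..<dim_vec x}"
  by (simp add: vec_norm2_def L2_set_def scalar_prod_def power2_eq_square atLeast0LessThan)

text \<open>Testing the form with the image \<open>A x\<close> bounds the square of its norm by
  \<open>b\<close> times its norm. The same bound makes the supremum one over a bounded set; without
  that its value would be unspecified, and even nonnegativity would not follow.\<close>

lemma op_norm_le:
  assumes A: "A \<in> carrier_mat n n" and b: "b \<ge> 0" and le: "bilin_le {..<n} {..<n} (\<lambda>i j. A $$ (i, j)) b"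
  shows "0 \<le> op_norm A" "op_norm A \<le> b"
proof -
  let ?S = "{x \<in> carrier_vec (dim_col A). vec_norm2 x \<le> 1}"
  have bd: "vec_norm2 (A *\<^sub>v x) \<le> b" if x: "x \<in> ?S" for x
  proof -
    define y where "y i = (A *\<^sub>v x) $ i" for i
    have dx: "dim_vec x = n" using x A by auto
    have yi: "y i = (\<Sum>j<n. A $$ (i, j) * x $ j)" if "i < n" for i
      using that A dx by (simp add: y_def scalar_prod_def atLeast0LessThan)
    have ny: "vec_norm2 (A *\<^sub>v x) = L2_set y {..<n}"
      using A by (simp add: vec_norm2_L2_set y_def[abs_def])
    have nx: "L2_set (\<lambda>j. x $ j) {..<n} \<le> 1" using x dx by (simp add: vec_norm2_L2_set)
    have "(L2_set y {..<n})\<^sup>2 = (\<Sum>i<n. y i * y i)"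
      by (simp add: L2_set_def sum_nonneg power2_eq_square)
    also have "\<dots> = (\<Sum>i<n. \<Sum>j<n. y i * A $$ (i, j) * x $ j)"
      by (intro sum.cong refl) (simp add: yi sum_distrib_left mult.assoc)
    also have "\<dots> \<le> b * (L2_set y {..<n} * L2_set (\<lambda>j. x $ j) {..<n})"
      using bilin_leD[OF le, of y "\<lambda>j. x $ j"] by simp
    also have "\<dots> \<le> b * (L2_set y {..<n} * 1)"
      using nx b by (intro mult_left_mono) auto
    finally have "L2_set y {..<n} * L2_set y {..<n} \<le> b * L2_set y {..<n}" by (simp add: power2_eq_square)
    then have "L2_set y {..<n} \<le> b"
      using b L2_set_nonneg[of y "{..<n}"] by (cases "L2_set y {..<n} = 0") (auto simp: mult_le_cancel_right)
    then show ?thesis by (simp add: ny)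
  qed
  have z: "0\<^sub>v (dim_col A) \<in> ?S" by (simp add: vec_norm2_def)
  show "op_norm A \<le> b" unfolding op_norm_def
    by (rule cSUP_least) (use z in blast, rule bd)
  have "vec_norm2 (A *\<^sub>v 0\<^sub>v (dim_col A)) \<le> op_norm A" unfolding op_norm_def
    by (rule cSUP_upper[OF z]) (use bd in \<open>auto intro!: bdd_aboveI\<close>)
  moreover have "vec_norm2 (A *\<^sub>v 0\<^sub>v (dim_col A)) \<ge> 0" by (simp add: vec_norm2_L2_set)
  ultimately show "0 \<le> op_norm A" by linarith
qed

section \<open>Concentration of the Gram matrix\<close>

text \<open>The integral is exactly \<open>exp (- a) / sqrt (1 - 2 * a)\<close>. Its logarithm has
  no linear term in \<open>a\<close>, and for \<open>\<bar>a\<bar>\<close> at most 1/4 the remainder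
  of the logarithm is at most \<open>4 * a\<^sup>2\<close>.\<close>

lemma nn_integral_gam_exp_square:
  assumes "\<bar>a\<bar> \<le> 1 / 4"
  shows "(\<integral>\<^sup>+r. ennreal (exp (a * (r\<^sup>2 - 1))) \<partial>gam) \<le> ennreal (exp (4 * a\<^sup>2))"
proof -
  \<comment> \<open>Standard deviation of the Gaussian obtained by tilting with
    \<open>exp (a * r\<^sup>2)\<close>.\<close>
  define \<sigma> where "\<sigma> = 1 / sqrt (1 - 2 * a)"
  have a1: "1 - 2 * a > 0" using assms by auto
  have \<sigma>: "\<sigma> > 0" "\<sigma>\<^sup>2 = 1 / (1 - 2 * a)" using a1 by (auto simp: \<sigma>_def power_divide)
  have eq: "std_normal_density r * exp (a * (r\<^sup>2 - 1)) = (exp (- a) * \<sigma>) * normal_density 0 \<sigma> r" for r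
  proof -
    have "normal_density 0 \<sigma> r = 1 / (sqrt (2 * pi) * \<sigma>) * exp (- (r\<^sup>2 * (1 - 2 * a) / 2))"
    proof -
      have "sqrt (2 * pi * \<sigma>\<^sup>2) = sqrt (2 * pi) * \<sigma>" using \<sigma>(1) by (simp only: real_sqrt_mult real_sqrt_abs abs_of_pos)
      moreover have "- (r - 0)\<^sup>2 / (2 * \<sigma>\<^sup>2) = - (r\<^sup>2 * (1 - 2 * a) / 2)" unfolding \<sigma>(2) using a1 by simp
      ultimately show ?thesis unfolding normal_density_def by presburger
    qed
    moreover have "exp (- r\<^sup>2 / 2) * exp (a * (r\<^sup>2 - 1)) = exp (- a) * exp (- (r\<^sup>2 * (1 - 2 * a) / 2))"
    proof -
      have "- r\<^sup>2 / 2 + a * (r\<^sup>2 - 1) = - a + - (r\<^sup>2 * (1 - 2 * a) / 2)" by (simp add: field_simps)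
      then show ?thesis by (simp only: exp_add[symmetric])
    qed
    ultimately show ?thesis using \<sigma>(1) by (simp add: std_normal_density_def field_simps)
  qed
  have "(\<integral>\<^sup>+r. ennreal (exp (a * (r\<^sup>2 - 1))) \<partial>gam) = (\<integral>\<^sup>+r. ennreal (exp (- a) * \<sigma>) * ennreal (normal_density 0 \<sigma> r) \<partial>lborel)"
    using \<sigma>(1) eq by (subst nn_integral_gam) (simp_all flip: ennreal_mult)
  also have "\<dots> = ennreal (exp (- a) * \<sigma>) * (\<integral>\<^sup>+r. ennreal (normal_density 0 \<sigma> r) \<partial>lborel)"
    by (rule nn_integral_cmult) measurable
  also have "(\<integral>\<^sup>+r. ennreal (normal_density 0 \<sigma> r) \<partial>lborel) = 1"
    using prob_space.emeasure_space_1[OF prob_space_normal_density[OF \<sigma>(1), of 0]]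
    by (simp add: emeasure_density)
  also have "ennreal (exp (- a) * \<sigma>) * 1 \<le> ennreal (exp (4 * a\<^sup>2))"
  proof -
    have "\<bar>ln (1 + (- 2 * a)) - (- 2 * a)\<bar> \<le> 2 * (- 2 * a)\<^sup>2"
      using assms by (intro abs_ln_one_plus_x_minus_x_bound) auto
    then have "- ln (1 - 2 * a) / 2 - a \<le> 4 * a\<^sup>2" by (simp add: power2_eq_square abs_le_iff)
    then have "exp (- a + - ln (1 - 2 * a) / 2) \<le> exp (4 * a\<^sup>2)" by (subst exp_le_cancel_iff) simp
    moreover have "\<sigma> = exp (- ln (1 - 2 * a) / 2)"
    proof -
      have "exp (ln (1 - 2 * a) / 2) = sqrt (1 - 2 * a)" using a1 by (simp add: ln_sqrt[symmetric])
      then show ?thesis by (simp add: \<sigma>_def exp_minus inverse_eq_divide)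
    qed
    ultimately show ?thesis unfolding exp_add by (simp only: mult_1_right ennreal_leI)
  qed
  finally show ?thesis .
qed

lemma borel_measurable_indicator_Collect:
  "Measurable.pred M Q \<Longrightarrow> (\<lambda>z. indicator {z. Q z} z :: ennreal) \<in> borel_measurable M"
  by (simp add: indicator_def)

text \<open>Chernoff bound for a chi-square variable with exponents \<open>t / s\<close> and
  \<open>- t / s\<close>. There are \<open>s\<^sup>2\<close> coordinates, each contributing
  \<open>4 * (t / s)\<^sup>2\<close>, and \<open>t \<le> s / 4\<close> keeps the exponent in the
  admissible range.\<close>

lemma gauss_norm_deviation:
  assumes I: "finite I" and s: "s > 0" "s\<^sup>2 = real (card I)" and t: "0 \<le> t" "t \<le> s / 4"
  shows "(\<integral>\<^sup>+\<zeta>. indicator {\<zeta>. \<delta> < \<bar>dot I \<zeta> \<zeta> / s\<^sup>2 - 1\<bar>} \<zeta> \<partial>gauss I) \<le> ennreal (2 * exp (4 * t\<^sup>2 - t * \<delta> * s))"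
proof -
  have E: "(\<integral>\<^sup>+\<zeta>. ennreal (exp (a * (dot I \<zeta> \<zeta> - s\<^sup>2))) \<partial>gauss I) \<le> ennreal (exp (4 * t\<^sup>2))"
    if a: "\<bar>a\<bar> = t / s" for a
  proof -
    have "(\<integral>\<^sup>+\<zeta>. ennreal (exp (a * (dot I \<zeta> \<zeta> - s\<^sup>2))) \<partial>gauss I) =
        (\<integral>\<^sup>+\<zeta>. (\<Prod>r\<in>I. ennreal (exp (a * ((\<zeta> r)\<^sup>2 - 1)))) \<partial>gauss I)"
    proof (rule nn_integral_cong)
      fix \<zeta>
      have "a * (dot I \<zeta> \<zeta> - s\<^sup>2) = (\<Sum>r\<in>I. a * ((\<zeta> r)\<^sup>2 - 1))"
        unfolding s(2) dot_def sum_distrib_left[symmetric] sum_subtractf by (simp add: power2_eq_square)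
      then show "ennreal (exp (a * (dot I \<zeta> \<zeta> - s\<^sup>2))) = (\<Prod>r\<in>I. ennreal (exp (a * ((\<zeta> r)\<^sup>2 - 1))))"
        using I by (simp add: exp_sum prod_ennreal)
    qed
    also have "\<dots> = (\<Prod>r\<in>I. \<integral>\<^sup>+x. ennreal (exp (a * (x\<^sup>2 - 1))) \<partial>gam)"
      using I by (intro PG.product_nn_integral_prod) auto
    also have "\<dots> \<le> (\<Prod>r\<in>I. ennreal (exp (4 * a\<^sup>2)))"
    proof -
      have "\<bar>a\<bar> \<le> 1 / 4" using a s(1) t by (simp add: divide_le_eq)
      then show ?thesis by (intro prod_mono_ennreal nn_integral_gam_exp_square)
    qed
    also have "\<dots> = ennreal (exp (real (card I) * (4 * a\<^sup>2)))"
      by (simp add: ennreal_power exp_of_nat_mult)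
    also have "real (card I) * (4 * a\<^sup>2) = 4 * t\<^sup>2"
    proof -
      have "a\<^sup>2 = (t / s)\<^sup>2" using a by (metis power2_abs)
      then show ?thesis unfolding s(2)[symmetric] using s(1) by (simp add: power_divide)
    qed
    finally show ?thesis .
  qed
  have "(\<integral>\<^sup>+\<zeta>. indicator {\<zeta>. \<delta> < \<bar>dot I \<zeta> \<zeta> / s\<^sup>2 - 1\<bar>} \<zeta> \<partial>gauss I) \<le>
     (\<integral>\<^sup>+\<zeta>. ennreal (exp (- (t * \<delta> * s))) * (ennreal (exp (t / s * (dot I \<zeta> \<zeta> - s\<^sup>2))) + ennreal (exp (- t / s * (dot I \<zeta> \<zeta> - s\<^sup>2)))) \<partial>gauss I)"
  proof (rule nn_integral_mono)
    fix \<zeta>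
    define X where "X = t / s * (dot I \<zeta> \<zeta> - s\<^sup>2)"
    show "indicator {\<zeta>. \<delta> < \<bar>dot I \<zeta> \<zeta> / s\<^sup>2 - 1\<bar>} \<zeta> \<le>
      ennreal (exp (- (t * \<delta> * s))) * (ennreal (exp (t / s * (dot I \<zeta> \<zeta> - s\<^sup>2))) + ennreal (exp (- t / s * (dot I \<zeta> \<zeta> - s\<^sup>2))))"
    proof (cases "\<delta> < \<bar>dot I \<zeta> \<zeta> / s\<^sup>2 - 1\<bar>")
      case True
      have "dot I \<zeta> \<zeta> / s\<^sup>2 - 1 = (dot I \<zeta> \<zeta> - s\<^sup>2) / s\<^sup>2" using s(1) by (simp add: field_simps)
      then have "X = t * s * (dot I \<zeta> \<zeta> / s\<^sup>2 - 1)" using s(1) by (simp add: X_def power2_eq_square)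
      then have "\<bar>X\<bar> = t * s * \<bar>dot I \<zeta> \<zeta> / s\<^sup>2 - 1\<bar>" using s t by (simp add: abs_mult)
      then have "t * \<delta> * s \<le> \<bar>X\<bar>" using True s t mult_left_mono[of \<delta> "\<bar>dot I \<zeta> \<zeta> / s\<^sup>2 - 1\<bar>" "t * s"] by (simp add: mult_ac)
      then have "1 \<le> exp (- (t * \<delta> * s)) * exp \<bar>X\<bar>" by (simp flip: exp_add)
      also have "\<dots> \<le> exp (- (t * \<delta> * s)) * (exp X + exp (- X))" by (intro mult_left_mono) (auto simp: abs_if)
      finally have "ennreal 1 \<le> ennreal (exp (- (t * \<delta> * s)) * (exp X + exp (- X)))" by (rule ennreal_leI)
      then show ?thesis using True by (simp add: X_def ennreal_mult flip: ennreal_plus)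
    qed simp
  qed
  also have "\<dots> = ennreal (exp (- (t * \<delta> * s))) * ((\<integral>\<^sup>+\<zeta>. ennreal (exp (t / s * (dot I \<zeta> \<zeta> - s\<^sup>2))) \<partial>gauss I) + (\<integral>\<^sup>+\<zeta>. ennreal (exp (- t / s * (dot I \<zeta> \<zeta> - s\<^sup>2))) \<partial>gauss I))"
  proof -
    have [measurable]: "(\<lambda>\<zeta>. dot I \<zeta> \<zeta>) \<in> borel_measurable (gauss I)" unfolding dot_def by measurable
    show ?thesis by (simp add: nn_integral_cmult nn_integral_add)
  qed
  also have "\<dots> \<le> ennreal (exp (- (t * \<delta> * s))) * (ennreal (exp (4 * t\<^sup>2)) + ennreal (exp (4 * t\<^sup>2)))"
    using s t by (intro mult_left_mono add_mono E) auto
  also have "\<dots> = ennreal (exp (- (t * \<delta> * s)) * (exp (4 * t\<^sup>2) + exp (4 * t\<^sup>2)))"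
    by (simp only: ennreal_plus ennreal_mult exp_ge_zero add_nonneg_nonneg)
  also have "exp (- (t * \<delta> * s)) * (exp (4 * t\<^sup>2) + exp (4 * t\<^sup>2)) = 2 * exp (4 * t\<^sup>2 - t * \<delta> * s)"
    by (simp add: exp_diff exp_minus divide_inverse)
  finally show ?thesis .
qed

text \<open>Given the first column, the inner product is a centred Gaussian whose variance is
  controlled by the norm of that column; the bound is Chernoff's.\<close>

lemma gauss_product_deviation:
  assumes I: "finite I" and s: "s > 0" and t: "0 \<le> t" and a: "dot I a a / s\<^sup>2 \<le> 2"
  shows "(\<integral>\<^sup>+\<zeta>. indicator {\<zeta>. \<delta> < \<bar>dot I a \<zeta> / s\<^sup>2\<bar>} \<zeta> \<partial>gauss I) \<le> ennreal (2 * exp (t\<^sup>2 - t * \<delta> * s))"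
proof -
  define x where "x = (\<lambda>r. a r / s)"
  have xz: "dot I x \<zeta> = dot I a \<zeta> / s" for \<zeta> by (simp add: x_def dot_divide_left)
  have xx: "dot I x x = dot I a a / s\<^sup>2"
    unfolding xz by (subst dot_commute) (simp add: xz power2_eq_square)
  have "(\<integral>\<^sup>+\<zeta>. indicator {\<zeta>. \<delta> < \<bar>dot I a \<zeta> / s\<^sup>2\<bar>} \<zeta> \<partial>gauss I) \<le>
      (\<integral>\<^sup>+\<zeta>. ennreal (exp (- (t * \<delta> * s))) * ennreal (exp (t * \<bar>dot I x \<zeta>\<bar>)) \<partial>gauss I)"
  proof (rule nn_integral_mono)
    fix \<zeta>
    show "indicator {\<zeta>. \<delta> < \<bar>dot I a \<zeta> / s\<^sup>2\<bar>} \<zeta> \<le> ennreal (exp (- (t * \<delta> * s))) * ennreal (exp (t * \<bar>dot I x \<zeta>\<bar>))"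
    proof (cases "\<delta> < \<bar>dot I a \<zeta> / s\<^sup>2\<bar>")
      case True
      then have "\<delta> * s \<le> \<bar>dot I a \<zeta> / s\<^sup>2\<bar> * s" using s by (intro mult_right_mono) auto
      also have "\<dots> = \<bar>dot I x \<zeta>\<bar>" using s by (simp add: xz abs_divide power2_eq_square)
      finally have "t * (\<delta> * s) \<le> t * \<bar>dot I x \<zeta>\<bar>" using t by (rule mult_left_mono)
      then have "1 \<le> exp (- (t * \<delta> * s)) * exp (t * \<bar>dot I x \<zeta>\<bar>)" by (simp add: mult.assoc flip: exp_add)
      then have "ennreal 1 \<le> ennreal (exp (- (t * \<delta> * s)) * exp (t * \<bar>dot I x \<zeta>\<bar>))" by (rule ennreal_leI)
      then show ?thesis using True by (simp add: ennreal_mult)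
    qed simp
  qed
  also have "\<dots> = ennreal (exp (- (t * \<delta> * s))) * (\<integral>\<^sup>+\<zeta>. ennreal (exp (t * \<bar>dot I x \<zeta>\<bar>)) \<partial>gauss I)"
    by (rule nn_integral_cmult) measurable
  also have "\<dots> \<le> ennreal (exp (- (t * \<delta> * s))) * ennreal (2 * exp (t\<^sup>2))"
  proof (intro mult_left_mono)
    have "(\<integral>\<^sup>+\<zeta>. ennreal (exp (t * \<bar>dot I x \<zeta>\<bar>)) \<partial>gauss I) \<le> ennreal (2 * exp (t\<^sup>2 * dot I x x / 2))"
      by (rule nn_integral_dot_exp[OF I])
    also have "\<dots> \<le> ennreal (2 * exp (t\<^sup>2))"
      using mult_left_mono[OF a, of "t\<^sup>2"] by (intro ennreal_leI) (simp add: xx)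
    finally show "(\<integral>\<^sup>+\<zeta>. ennreal (exp (t * \<bar>dot I x \<zeta>\<bar>)) \<partial>gauss I) \<le> ennreal (2 * exp (t\<^sup>2))" .
  qed simp
  also have "\<dots> = ennreal (exp (- (t * \<delta> * s)) * (2 * exp (t\<^sup>2)))"
    by (rule ennreal_mult[symmetric]) auto
  also have "exp (- (t * \<delta> * s)) * (2 * exp (t\<^sup>2)) = 2 * exp (t\<^sup>2 - t * \<delta> * s)"
    by (simp add: exp_diff exp_minus divide_inverse)
  finally show ?thesis .
qed

text \<open>A union bound over norms and pairs. The pair event contains the bound 2 on the norm of
  its first column, so that the conditional variance is controlled. If that bound fails, \<delta>
  \<le> 1 puts the outcome into the norm event anyway.\<close>

lemma not_gram_good_probability:
  assumes I: "finite I" and s: "s > 0" "s\<^sup>2 = real (card I)" and t: "0 \<le> t" "t \<le> s / 4"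
    and P: "finite P" and \<delta>: "\<delta> \<le> 1"
  shows "(\<integral>\<^sup>+z. indicator {z. \<not> gram_good I s P \<delta> z} z \<partial>gaussian_matrix I P) \<le>
    ennreal (4 * real (card P) ^ 2 * exp (4 * t\<^sup>2 - t * \<delta> * s))"
proof -
  let ?Q = "gaussian_matrix I P"
  let ?A = "\<lambda>i. {z. \<delta> < \<bar>dot I (z i) (z i) / s\<^sup>2 - 1\<bar>}"
  let ?B = "\<lambda>i k. {z. dot I (z i) (z i) / s\<^sup>2 \<le> 2 \<and> \<delta> < \<bar>dot I (z i) (z k) / s\<^sup>2\<bar>}"
  define e where "e = 2 * exp (4 * t\<^sup>2 - t * \<delta> * s)"
  have e0: "e \<ge> 0" by (simp add: e_def)
  have dm: "(\<lambda>z. dot I (z i) (z k)) \<in> borel_measurable ?Q" if "i \<in> P" "k \<in> P" for i k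
    using that by (rule measurable_dot_columns)
  have mA: "(\<lambda>z. indicator (?A i) z :: ennreal) \<in> borel_measurable ?Q" if "i \<in> P" for i
    by (rule borel_measurable_indicator_Collect) (use dm[OF that that] in measurable)
  have mB: "(\<lambda>z. indicator (?B i k) z :: ennreal) \<in> borel_measurable ?Q" if "i \<in> P" "k \<in> P" for i k
    by (rule borel_measurable_indicator_Collect) (use dm[OF that] dm[OF that(1) that(1)] in measurable)
  have A: "(\<integral>\<^sup>+z. indicator (?A i) z \<partial>?Q) \<le> ennreal e" if "i \<in> P" for i
  proof -
    have [measurable]: "(\<lambda>\<zeta>. dot I \<zeta> \<zeta>) \<in> borel_measurable (gauss I)" unfolding dot_def by measurable
    have "(\<integral>\<^sup>+z. indicator (?A i) z \<partial>?Q) = (\<integral>\<^sup>+z. indicator {\<zeta>. \<delta> < \<bar>dot I \<zeta> \<zeta> / s\<^sup>2 - 1\<bar>} (z i) \<partial>?Q)"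
      by (intro nn_integral_cong) (simp add: indicator_def)
    also have "\<dots> = (\<integral>\<^sup>+\<zeta>. indicator {\<zeta>. \<delta> < \<bar>dot I \<zeta> \<zeta> / s\<^sup>2 - 1\<bar>} \<zeta> \<partial>gauss I)"
      by (rule nn_integral_PiM_component[OF prob_space_gauss that, of "\<lambda>\<zeta>. indicator {\<zeta>. \<delta> < \<bar>dot I \<zeta> \<zeta> / s\<^sup>2 - 1\<bar>} \<zeta>"], rule borel_measurable_indicator_Collect) measurable
    also have "\<dots> \<le> ennreal e" unfolding e_def by (rule gauss_norm_deviation[OF I s t])
    finally show ?thesis .
  qed
  have B: "(\<integral>\<^sup>+z. indicator (?B i k) z \<partial>?Q) \<le> ennreal e" if ik: "i \<in> P" "k \<in> P" "i \<noteq> k" for i k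
  proof (rule nn_integral_PiM_le_insert[OF prob_space_gauss P ik(1) mB[OF ik(1,2)]])
    fix a assume "a \<in> space (gauss I)"
    show "(\<integral>\<^sup>+y. indicator (?B i k) (y(i := a)) \<partial>gaussian_matrix I (P - {i})) \<le> ennreal e"
    proof (cases "dot I a a / s\<^sup>2 \<le> 2")
      case False
      then show ?thesis by simp
    next
      case True
      have "(\<integral>\<^sup>+y. indicator (?B i k) (y(i := a)) \<partial>gaussian_matrix I (P - {i})) =
        (\<integral>\<^sup>+y. indicator {\<zeta>. \<delta> < \<bar>dot I a \<zeta> / s\<^sup>2\<bar>} (y k) \<partial>gaussian_matrix I (P - {i}))"
        using True ik by (intro nn_integral_cong) (simp add: indicator_def)
      also have "\<dots> = (\<integral>\<^sup>+\<zeta>. indicator {\<zeta>. \<delta> < \<bar>dot I a \<zeta> / s\<^sup>2\<bar>} \<zeta> \<partial>gauss I)"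
        by (rule nn_integral_PiM_component[OF prob_space_gauss, of k "P - {i}" "\<lambda>\<zeta>. indicator {\<zeta>. \<delta> < \<bar>dot I a \<zeta> / s\<^sup>2\<bar>} \<zeta>"], use ik in blast, rule borel_measurable_indicator_Collect) measurable
      also have "\<dots> \<le> ennreal (2 * exp (t\<^sup>2 - t * \<delta> * s))" by (rule gauss_product_deviation[OF I s(1) t(1) True])
      also have "\<dots> \<le> ennreal e" unfolding e_def by (intro ennreal_leI) simp
      finally show ?thesis .
    qed
  qed
  have "(\<integral>\<^sup>+z. indicator {z. \<not> gram_good I s P \<delta> z} z \<partial>?Q) \<le>
     (\<integral>\<^sup>+z. (\<Sum>i\<in>P. indicator (?A i) z) + (\<Sum>i\<in>P. \<Sum>k\<in>P - {i}. indicator (?B i k) z) \<partial>?Q)"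
  proof (rule nn_integral_mono)
    fix z
    show "indicator {z. \<not> gram_good I s P \<delta> z} z \<le> (\<Sum>i\<in>P. indicator (?A i) z) + (\<Sum>i\<in>P. \<Sum>k\<in>P - {i}. indicator (?B i k) z :: ennreal)"
    proof (cases "gram_good I s P \<delta> z")
      case False
      then obtain i k where ik: "i \<in> P" "k \<in> P" "\<delta> < \<bar>dot I (z i) (z k) / s\<^sup>2 - (if i = k then 1 else 0)\<bar>"
        unfolding gram_good_def by (auto simp: not_le)
      have one: "1 \<le> (\<Sum>i\<in>P. indicator (?A i) z :: ennreal)" if "i \<in> P" "z \<in> ?A i" for i
      proof -
        have "1 = (indicator (?A i) z :: ennreal)" using that(2) by (simp only: indicator_simps)
        also have "\<dots> \<le> (\<Sum>i\<in>P. indicator (?A i) z :: ennreal)"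
          by (rule member_le_sum[OF that(1) _ P]) (rule zero_le)
        finally show ?thesis .
      qed
      show ?thesis
      proof (cases "z \<in> ?A i")
        case True
        have "1 \<le> (\<Sum>i\<in>P. indicator (?A i) z :: ennreal)" by (rule one[OF ik(1) True])
        also have "\<dots> \<le> (\<Sum>i\<in>P. indicator (?A i) z) + (\<Sum>i\<in>P. \<Sum>k\<in>P - {i}. indicator (?B i k) z)"
          by (rule add_increasing2[OF zero_le order_refl])
        finally show ?thesis using False by simp
      next
        case nA: False
        then have d: "dot I (z i) (z i) / s\<^sup>2 \<le> 2" using \<delta> by auto
        have "i \<noteq> k" using ik nA by auto
        then have zB: "z \<in> ?B i k" using ik d by auto
        have "1 = (indicator (?B i k) z :: ennreal)" using zB by (simp only: indicator_simps)
        also have "\<dots> \<le> (\<Sum>k\<in>P - {i}. indicator (?B i k) z)"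
          by (rule member_le_sum, use ik \<open>i \<noteq> k\<close> in blast, rule zero_le, use P in blast)
        also have "\<dots> \<le> (\<Sum>i\<in>P. \<Sum>k\<in>P - {i}. indicator (?B i k) z)"
          by (rule member_le_sum[OF ik(1) _ P, of "\<lambda>i. \<Sum>k\<in>P - {i}. indicator (?B i k) z"]) (rule zero_le)
        also have "\<dots> \<le> (\<Sum>i\<in>P. indicator (?A i) z) + (\<Sum>i\<in>P. \<Sum>k\<in>P - {i}. indicator (?B i k) z)"
          by (rule add_increasing[OF zero_le order_refl])
        finally show ?thesis using False by simp
      qed
    qed simp
  qed
  also have "\<dots> = (\<Sum>i\<in>P. \<integral>\<^sup>+z. indicator (?A i) z \<partial>?Q) + (\<Sum>i\<in>P. \<Sum>k\<in>P - {i}. \<integral>\<^sup>+z. indicator (?B i k) z \<partial>?Q)"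
  proof -
    have inner: "(\<integral>\<^sup>+z. (\<Sum>k\<in>P - {i}. indicator (?B i k) z) \<partial>?Q) = (\<Sum>k\<in>P - {i}. \<integral>\<^sup>+z. indicator (?B i k) z \<partial>?Q)"
      if "i \<in> P" for i using that mB by (intro nn_integral_sum) auto
    have m: "(\<lambda>z. \<Sum>k\<in>P - {i}. indicator (?B i k) z :: ennreal) \<in> borel_measurable ?Q" if "i \<in> P" for i
      using that mB by (intro borel_measurable_sum) auto
    have "(\<integral>\<^sup>+z. (\<Sum>i\<in>P. indicator (?A i) z) + (\<Sum>i\<in>P. \<Sum>k\<in>P - {i}. indicator (?B i k) z) \<partial>?Q) =
      (\<integral>\<^sup>+z. (\<Sum>i\<in>P. indicator (?A i) z) \<partial>?Q) + (\<integral>\<^sup>+z. (\<Sum>i\<in>P. \<Sum>k\<in>P - {i}. indicator (?B i k) z) \<partial>?Q)"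
      using mA m by (intro nn_integral_add borel_measurable_sum) auto
    moreover have "(\<integral>\<^sup>+z. (\<Sum>i\<in>P. indicator (?A i) z) \<partial>?Q) = (\<Sum>i\<in>P. \<integral>\<^sup>+z. indicator (?A i) z \<partial>?Q)"
      using mA by (intro nn_integral_sum) auto
    moreover have "(\<integral>\<^sup>+z. (\<Sum>i\<in>P. \<Sum>k\<in>P - {i}. indicator (?B i k) z) \<partial>?Q) =
       (\<Sum>i\<in>P. \<integral>\<^sup>+z. (\<Sum>k\<in>P - {i}. indicator (?B i k) z) \<partial>?Q)"
      using m by (intro nn_integral_sum) auto
    ultimately show ?thesis using inner by simp
  qed
  also have "\<dots> \<le> (\<Sum>i\<in>P. ennreal e) + (\<Sum>i\<in>P. \<Sum>k\<in>P. ennreal e)"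
  proof (intro add_mono sum_mono A)
    fix i assume i: "i \<in> P"
    have "(\<Sum>k\<in>P - {i}. \<integral>\<^sup>+z. indicator (?B i k) z \<partial>?Q) \<le> (\<Sum>k\<in>P - {i}. ennreal e)"
      using i by (intro sum_mono B) auto
    also have "\<dots> \<le> (\<Sum>k\<in>P. ennreal e)" using P by (intro sum_mono2) auto
    finally show "(\<Sum>k\<in>P - {i}. \<integral>\<^sup>+z. indicator (?B i k) z \<partial>?Q) \<le> (\<Sum>k\<in>P. ennreal e)" .
  qed
  also have "\<dots> = ennreal (real (card P) * e + real (card P) * (real (card P) * e))"
  proof -
    have c: "(\<Sum>i\<in>P. ennreal D) = ennreal (real (card P) * D)" if "D \<ge> 0" for D
      using that by (subst sum_ennreal) auto
    show ?thesis using e0 by (simp only: c mult_nonneg_nonneg of_nat_0_le_iff ennreal_plus[symmetric])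
  qed
  also have "\<dots> \<le> ennreal (4 * real (card P) ^ 2 * exp (4 * t\<^sup>2 - t * \<delta> * s))"
  proof (rule ennreal_leI)
    have "real (card P) \<le> real (card P) ^ 2"
      using self_le_power[of "real (card P)" 2] by (cases "card P = 0") auto
    then have "real (card P) * e \<le> real (card P) ^ 2 * e" using e0 by (rule mult_right_mono)
    then show "real (card P) * e + real (card P) * (real (card P) * e) \<le> 4 * real (card P) ^ 2 * exp (4 * t\<^sup>2 - t * \<delta> * s)"
      by (simp add: e_def power2_eq_square)
  qed
  finally show ?thesis .
qed

section \<open>Small perturbations of the arguments of a kernel\<close>

text \<open>Resampling for signed integrands, with the component along \<open>e\<close> as the outer
  variable: the inner integral is the conditional mean given that component.\<close>

lemma integral_gauss_resample:
  fixes F :: "(nat \<Rightarrow> real) \<Rightarrow> real"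
  assumes "finite I" and "(\<Sum>r\<in>I. (e r)\<^sup>2) = 1" and F: "integrable (gauss I) F"
  shows "(\<integral>\<zeta>. F \<zeta> \<partial>gauss I) = (\<integral>g. \<integral>\<zeta>. F (resample I e \<zeta> g) \<partial>gauss I \<partial>gam)"
    and "integrable gam (\<lambda>g. \<integral>\<zeta>. F (resample I e \<zeta> g) \<partial>gauss I)"
proof -
  interpret P: pair_sigma_finite "gauss I" gam
    by (simp add: pair_sigma_finite.intro sigma_finite_gam gauss.sigma_finite_measure_axioms)
  have Fm [measurable]: "F \<in> borel_measurable (gauss I)" using F by auto
  have law: "distr (gauss I \<Otimes>\<^sub>M gam) (gauss I) (\<lambda>(\<zeta>, g). resample I e \<zeta> g) = distr (gauss I) (gauss I) (\<lambda>\<zeta>. \<zeta>)"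
  proof (rule distr_eqI_nn_integral)
    fix h :: "(nat \<Rightarrow> real) \<Rightarrow> ennreal" assume h [measurable]: "h \<in> borel_measurable (gauss I)"
    have "(\<integral>\<^sup>+p. h (case p of (\<zeta>, g) \<Rightarrow> resample I e \<zeta> g) \<partial>(gauss I \<Otimes>\<^sub>M gam)) =
        (\<integral>\<^sup>+\<zeta>. \<integral>\<^sup>+g. h (resample I e \<zeta> g) \<partial>gam \<partial>gauss I)"
      by (subst gam.nn_integral_fst[symmetric]) auto
    also have "\<dots> = (\<integral>\<^sup>+\<zeta>. h \<zeta> \<partial>gauss I)" by (rule nn_integral_gauss_resample[OF assms(1,2) h])
    finally show "(\<integral>\<^sup>+p. h (case p of (\<zeta>, g) \<Rightarrow> resample I e \<zeta> g) \<partial>(gauss I \<Otimes>\<^sub>M gam)) = (\<integral>\<^sup>+\<zeta>. h \<zeta> \<partial>gauss I)" .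
  qed auto
  have "integrable (distr (gauss I \<Otimes>\<^sub>M gam) (gauss I) (\<lambda>(\<zeta>, g). resample I e \<zeta> g)) F"
    unfolding law using F by simp
  then have IP: "integrable (gauss I \<Otimes>\<^sub>M gam) (\<lambda>(\<zeta>, g). F (resample I e \<zeta> g))"
    by (subst (asm) integrable_distr_eq) (auto simp: case_prod_beta')
  have "(\<integral>\<zeta>. F \<zeta> \<partial>gauss I) = (\<integral>\<zeta>. F \<zeta> \<partial>distr (gauss I \<Otimes>\<^sub>M gam) (gauss I) (\<lambda>(\<zeta>, g). resample I e \<zeta> g))"
    unfolding law by simp
  also have "\<dots> = (\<integral>(\<zeta>, g). F (resample I e \<zeta> g) \<partial>(gauss I \<Otimes>\<^sub>M gam))"
    by (subst integral_distr) (auto simp: case_prod_beta')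
  also have "\<dots> = (\<integral>g. \<integral>\<zeta>. F (resample I e \<zeta> g) \<partial>gauss I \<partial>gam)"
    by (rule P.integral_snd[OF IP, symmetric])
  finally show "(\<integral>\<zeta>. F \<zeta> \<partial>gauss I) = (\<integral>g. \<integral>\<zeta>. F (resample I e \<zeta> g) \<partial>gauss I \<partial>gam)" .
  show "integrable gam (\<lambda>g. \<integral>\<zeta>. F (resample I e \<zeta> g) \<partial>gauss I)"
    by (rule P.integrable_snd[OF IP])
qed

lemma dot_project:
  assumes "dot I e e = 1"
  shows "dot I (\<lambda>r. x r - dot I x e * e r) (\<lambda>r. y r - dot I y e * e r) = dot I x y - dot I x e * dot I y e"
proof -
  have "dot I (\<lambda>r. x r - dot I x e * e r) (\<lambda>r. y r - dot I y e * e r) =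
      dot I x (\<lambda>r. y r - dot I y e * e r) - dot I x e * dot I e (\<lambda>r. y r - dot I y e * e r)"
    by (simp only: dot_diff_left dot_scale_left)
  also have "dot I x (\<lambda>r. y r - dot I y e * e r) = dot I x y - dot I y e * dot I x e"
    unfolding dot_commute[of I x] by (simp only: dot_diff_left dot_scale_left dot_commute)
  also have "dot I e (\<lambda>r. y r - dot I y e * e r) = 0"
    unfolding dot_commute[of I e] by (simp only: dot_diff_left dot_scale_left assms)
  finally show ?thesis by simp
qed

text \<open>The 6 is three exponential moments bounded by 2 each. The 216 is
  \<open>9 * 12 ^ 2 / 6\<close>, because a twelfth moment is taken and then a sixth root.\<close>

definition cross_moment_const :: "real \<Rightarrow> real \<Rightarrow> real" where
  "cross_moment_const A c = 6 * A\<^sup>2 * exp (216 * (1 + c\<^sup>2))"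

text \<open>The covariance bound at growth rate \<open>2 * c\<close>, hence
  \<open>8 * c + 1\<close>, followed by a Gaussian integral over the component along
  \<open>e\<close>. \<open>8 * A\<close> comes from the correlation of the rows,
  \<open>16 * C0\<close> from the mean of the shifted kernel.\<close>

definition cross_bias_const :: "real \<Rightarrow> real \<Rightarrow> real \<Rightarrow> real \<Rightarrow> real" where
  "cross_bias_const A c C0 c0 = A * (24 * exp ((8 * c + 1)\<^sup>2)) * (8 * A + 16 * C0) * (2 * exp ((2 + 4 * c + c0)\<^sup>2 / 2))"

context
  fixes I :: "nat set" and e :: "nat \<Rightarrow> real" and A c C0 c0 \<epsilon> :: real and g :: "real \<Rightarrow> real"
  assumes I: "finite I" and e1: "(\<Sum>r\<in>I. (e r)\<^sup>2) = 1" and c: "c \<ge> 0" and c0: "c0 \<ge> 0"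
    and g: "exp_lip A c g" and \<epsilon>: "\<epsilon> \<le> 1 / 2"
    and \<Phi>: "\<And>\<theta>. \<bar>\<integral>r. g (r + \<theta>) \<partial>gam\<bar> \<le> C0 * \<theta>\<^sup>2 * exp (c0 * \<bar>\<theta>\<bar>)"
begin

text \<open>Here \<open>x\<close> is a row of the cross block and \<open>e\<close> the direction
  common to all rows; only the amount \<open>t\<close> of the shift depends on the row.\<close>

definition "shift_diff x t \<zeta> = g (dot I (\<lambda>r. x r + t * e r) \<zeta>) - g (dot I x \<zeta>)"

private lemma A_nonneg: "A \<ge> 0" using g by (rule exp_lip_nonneg)

private lemma e_dot: "dot I e e = 1" using e1 by (simp add: dot_def power2_eq_square)

private lemma measurable_g [measurable]: "g \<in> borel_measurable borel" using g by (rule exp_lip_measurable)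

lemma measurable_shift_diff: "shift_diff x t \<in> borel_measurable (gauss I)" unfolding shift_diff_def[abs_def] by measurable

text \<open>The difference gains a factor \<epsilon> from the Lipschitz bound. The product of three
  exponentials is at most the sum of their cubes, and each cube is an exponential moment of one
  linear functional.\<close>

lemma shift_diff_power_moment:
  assumes x: "\<bar>dot I x x - 1\<bar> \<le> \<epsilon>\<^sup>2" and \<alpha>: "\<bar>dot I x e\<bar> \<le> \<epsilon>" and t: "\<bar>t\<bar> \<le> \<epsilon>"
  shows "(\<integral>\<^sup>+\<zeta>. ennreal (\<bar>shift_diff x t \<zeta>\<bar> ^ k) \<partial>gauss I) \<le> ennreal ((A * \<epsilon>) ^ k * (6 * exp (9 * (real k)\<^sup>2 * (1 + c\<^sup>2))))"
proof -
  have \<epsilon>0: "\<epsilon> \<ge> 0" using t by simp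
  have \<epsilon>2: "\<epsilon>\<^sup>2 \<le> 1 / 4" using power_mono[OF \<epsilon> \<epsilon>0, of 2] by (simp add: power2_eq_square)
  define y where "y = (\<lambda>r. x r + t * e r)"
  have xx: "dot I x x \<le> 2" using x \<epsilon>2 by linarith
  have yy: "dot I y y \<le> 2"
  proof -
    have "dot I y y = dot I x y + t * dot I e y" by (simp only: y_def dot_add_left dot_scale_left)
    also have "dot I x y = dot I x x + t * dot I x e"
      unfolding dot_commute[of I x y] unfolding y_def by (simp only: dot_add_left dot_scale_left dot_commute)
    also have "dot I e y = dot I x e + t"
      unfolding dot_commute[of I e y] unfolding y_def by (simp only: dot_add_left dot_scale_left e_dot)
    finally have eq: "dot I y y = dot I x x + 2 * (t * dot I x e) + t\<^sup>2" by (simp add: algebra_simps power2_eq_square)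
    have "\<bar>t * dot I x e\<bar> \<le> \<epsilon> * \<epsilon>" unfolding abs_mult using t \<alpha> \<epsilon>0 by (intro mult_mono) auto
    moreover have "t\<^sup>2 \<le> \<epsilon>\<^sup>2" using t by (metis abs_ge_zero power2_abs power_mono)
    ultimately show ?thesis using x \<epsilon>2 unfolding eq power2_eq_square by linarith
  qed
  let ?E = "\<lambda>l u \<zeta>. exp (l * \<bar>dot I u \<zeta>\<bar>)"
  have ptw: "\<bar>shift_diff x t \<zeta>\<bar> ^ k \<le> (A * \<epsilon>) ^ k * (?E (3 * real k) e \<zeta> + ?E (3 * real k * c) x \<zeta> + ?E (3 * real k * c) y \<zeta>)" for \<zeta>
  proof -
    define a where "a = \<bar>dot I e \<zeta>\<bar>" define b where "b = c * \<bar>dot I x \<zeta>\<bar>" define d where "d = c * \<bar>dot I y \<zeta>\<bar>"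
    have "dot I y \<zeta> - dot I x \<zeta> = t * dot I e \<zeta>" by (simp add: y_def dot_add_left dot_scale_left)
    then have "\<bar>shift_diff x t \<zeta>\<bar> \<le> A * \<bar>t * dot I e \<zeta>\<bar> * exp (c * (\<bar>dot I y \<zeta>\<bar> + \<bar>dot I x \<zeta>\<bar>))"
      using exp_lipD(2)[OF g, of "dot I y \<zeta>" "dot I x \<zeta>"] by (simp add: shift_diff_def y_def)
    also have "\<dots> \<le> A * (\<epsilon> * exp a) * exp (d + b)"
    proof -
      have "\<bar>t * dot I e \<zeta>\<bar> \<le> \<epsilon> * exp a"
        unfolding abs_mult a_def using t \<epsilon>0 by (intro mult_mono abs_le_exp) auto
      then show ?thesis using A_nonneg unfolding b_def d_def by (intro mult_mono) (auto simp: algebra_simps)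
    qed
    also have "\<dots> = A * \<epsilon> * exp (a + b + d)" by (simp add: exp_add)
    finally have "\<bar>shift_diff x t \<zeta>\<bar> ^ k \<le> (A * \<epsilon> * exp (a + b + d)) ^ k" by (intro power_mono) auto
    also have "\<dots> = (A * \<epsilon>) ^ k * exp (k * (a + b + d))" by (simp add: power_mult_distrib exp_of_nat_mult)
    also have "exp (k * (a + b + d)) \<le> exp (3 * k * a) + exp (3 * k * b) + exp (3 * k * d)"
    proof -
      have *: "exp (u + v + w) \<le> exp (3 * u) + exp (3 * v) + exp (3 * w)" for u v w :: real
      proof -
        have "u + v + w \<le> 3 * u \<or> u + v + w \<le> 3 * v \<or> u + v + w \<le> 3 * w" by linarith
        then have "exp (u + v + w) \<le> exp (3 * u) \<or> exp (u + v + w) \<le> exp (3 * v) \<or> exp (u + v + w) \<le> exp (3 * w)" by simp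
        moreover have "0 < exp (3 * u)" "0 < exp (3 * v)" "0 < exp (3 * w)" by auto
        ultimately show ?thesis by linarith
      qed
      show ?thesis using *[of "k * a" "k * b" "k * d"] by (simp add: distrib_left mult.assoc)
    qed
    finally show ?thesis using A_nonneg \<epsilon>0 by (simp add: a_def b_def d_def mult_left_mono mult.assoc)
  qed
  have E: "(\<integral>\<^sup>+\<zeta>. ennreal (?E l u \<zeta>) \<partial>gauss I) \<le> ennreal (2 * exp (9 * (real k)\<^sup>2 * (1 + c\<^sup>2)))"
    if u: "dot I u u \<le> 2" and l: "l\<^sup>2 \<le> 9 * (real k)\<^sup>2 * (1 + c\<^sup>2)" for l u
  proof -
    have "(\<integral>\<^sup>+\<zeta>. ennreal (?E l u \<zeta>) \<partial>gauss I) \<le> ennreal (2 * exp (l\<^sup>2 * dot I u u / 2))" by (rule nn_integral_dot_exp[OF I])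
    also have "\<dots> \<le> ennreal (2 * exp (9 * (real k)\<^sup>2 * (1 + c\<^sup>2)))"
    proof -
      have "l\<^sup>2 * dot I u u \<le> l\<^sup>2 * 2" using u by (intro mult_left_mono) auto
      then have "l\<^sup>2 * dot I u u / 2 \<le> 9 * (real k)\<^sup>2 * (1 + c\<^sup>2)" using l by linarith
      then show ?thesis by (intro ennreal_leI) simp
    qed
    finally show ?thesis .
  qed
  let ?e = "2 * exp (9 * (real k)\<^sup>2 * (1 + c\<^sup>2))"
  have "(\<integral>\<^sup>+\<zeta>. ennreal (\<bar>shift_diff x t \<zeta>\<bar> ^ k) \<partial>gauss I) \<le>
     (\<integral>\<^sup>+\<zeta>. ennreal ((A * \<epsilon>) ^ k) * (ennreal (?E (3 * real k) e \<zeta>) + ennreal (?E (3 * real k * c) x \<zeta>) + ennreal (?E (3 * real k * c) y \<zeta>)) \<partial>gauss I)"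
    using ptw A_nonneg \<epsilon>0 by (intro nn_integral_mono) (simp add: ennreal_leI flip: ennreal_mult ennreal_plus)
  also have "\<dots> = ennreal ((A * \<epsilon>) ^ k) * ((\<integral>\<^sup>+\<zeta>. ennreal (?E (3 * real k) e \<zeta>) \<partial>gauss I) + (\<integral>\<^sup>+\<zeta>. ennreal (?E (3 * real k * c) x \<zeta>) \<partial>gauss I) + (\<integral>\<^sup>+\<zeta>. ennreal (?E (3 * real k * c) y \<zeta>) \<partial>gauss I))"
    by (simp add: nn_integral_cmult nn_integral_add)
  also have "\<dots> \<le> ennreal ((A * \<epsilon>) ^ k) * (ennreal ?e + ennreal ?e + ennreal ?e)"
  proof (intro mult_left_mono add_mono E xx yy)
    show "dot I e e \<le> 2" by (simp add: e_dot)
    show "(3 * real k)\<^sup>2 \<le> 9 * (real k)\<^sup>2 * (1 + c\<^sup>2)" by (simp add: power_mult_distrib algebra_simps)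
    show "(3 * real k * c)\<^sup>2 \<le> 9 * (real k)\<^sup>2 * (1 + c\<^sup>2)" "(3 * real k * c)\<^sup>2 \<le> 9 * (real k)\<^sup>2 * (1 + c\<^sup>2)" by (simp_all add: power_mult_distrib algebra_simps)
  qed simp
  also have "\<dots> = ennreal ((A * \<epsilon>) ^ k * (?e + ?e + ?e))"
  proof -
    have eq: "ennreal a * (ennreal q + ennreal q + ennreal q) = ennreal (a * (q + q + q))" if "a \<ge> 0" "q \<ge> 0" for a q
      using that by (simp only: ennreal_plus ennreal_mult add_nonneg_nonneg)
    show ?thesis using A_nonneg \<epsilon>0 by (intro eq) simp_all
  qed
  finally show ?thesis by simp
qed

text \<open>Both differences depend on the same component of \<zeta> along \<open>e\<close>, so that
  component is fixed first. What remains of the two rows is almost orthogonal, and the covariance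
  bound gives \<epsilon> from the size of the first factor times \<epsilon> squared from the
  near-orthogonality and from the mean of the second.\<close>

lemma shift_diff_bias:
  assumes x: "\<bar>dot I x x - 1\<bar> \<le> \<epsilon>\<^sup>2" and x': "\<bar>dot I x' x' - 1\<bar> \<le> \<epsilon>\<^sup>2" and xx': "\<bar>dot I x x'\<bar> \<le> \<epsilon>\<^sup>2"
    and \<alpha>: "\<bar>dot I x e\<bar> \<le> \<epsilon>" "\<bar>dot I x' e\<bar> \<le> \<epsilon>" and t: "\<bar>t\<bar> \<le> \<epsilon>" "\<bar>t'\<bar> \<le> \<epsilon>"
  shows "\<bar>\<integral>\<zeta>. shift_diff x t \<zeta> * shift_diff x' t' \<zeta> \<partial>gauss I\<bar> \<le> cross_bias_const A c C0 c0 * \<epsilon> ^ 3"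
proof -
  have \<epsilon>0: "\<epsilon> \<ge> 0" using t by simp
  have \<epsilon>2: "\<epsilon>\<^sup>2 \<le> 1 / 4" using power_mono[OF \<epsilon> \<epsilon>0, of 2] by (simp add: power2_eq_square)
  have C0: "C0 \<ge> 0"
  proof -
    have "0 \<le> C0 * (1::real)\<^sup>2 * exp (c0 * \<bar>1\<bar>)" using \<Phi>[of 1] abs_ge_zero order_trans by blast
    then show ?thesis by (simp add: zero_le_mult_iff)
  qed
  define \<alpha>1 where "\<alpha>1 = dot I x e" define \<alpha>2 where "\<alpha>2 = dot I x' e"
  define u where "u = (\<lambda>r. x r - dot I x e * e r)" define u' where "u' = (\<lambda>r. x' r - dot I x' e * e r)"
  \<comment> \<open>The shift difference as a function of the orthogonal part \<open>y\<close>, for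
    a fixed value \<open>s\<close> of the component along \<open>e\<close>: \<alpha> is the part of
    the row along \<open>e\<close>, to which the shift adds \<open>t\<close>.\<close>
  define \<Delta> where "\<Delta> \<alpha> t s y = g (y + (\<alpha> + t) * s) - g (y + \<alpha> * s)" for \<alpha> t s y
  have res: "shift_diff z \<tau> (resample I e \<zeta> s) = \<Delta> (dot I z e) \<tau> s (dot I (\<lambda>r. z r - dot I z e * e r) \<zeta>)" for z \<tau> \<zeta> s
  proof -
    have ze: "dot I (\<lambda>r. z r + \<tau> * e r) e = dot I z e + \<tau>" by (simp add: dot_add_left dot_scale_left e_dot)
    have "(\<lambda>r. z r + \<tau> * e r - (dot I z e + \<tau>) * e r) = (\<lambda>r. z r - dot I z e * e r)"
      by (simp add: fun_eq_iff algebra_simps)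
    then show ?thesis unfolding shift_diff_def \<Delta>_def resample_dot[OF I] ze by simp
  qed
  have nn12: "(\<integral>\<^sup>+\<zeta>. ennreal \<bar>shift_diff x t \<zeta> * shift_diff x' t' \<zeta>\<bar> \<partial>gauss I) < \<infinity>"
  proof -
    have "(\<integral>\<^sup>+\<zeta>. ennreal \<bar>shift_diff x t \<zeta> * shift_diff x' t' \<zeta>\<bar> \<partial>gauss I) \<le>
        (\<integral>\<^sup>+\<zeta>. ennreal (\<bar>shift_diff x t \<zeta>\<bar> ^ 2) + ennreal (\<bar>shift_diff x' t' \<zeta>\<bar> ^ 2) \<partial>gauss I)"
    proof (intro nn_integral_mono)
      fix \<zeta>
      have "\<bar>a * b\<bar> \<le> \<bar>a\<bar>\<^sup>2 + \<bar>b\<bar>\<^sup>2" for a b :: real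
      proof -
        have "2 * \<bar>a * b\<bar> \<le> \<bar>a\<bar>\<^sup>2 + \<bar>b\<bar>\<^sup>2"
          using zero_le_power2[of "\<bar>a\<bar> - \<bar>b\<bar>"] by (simp add: power2_diff abs_mult)
        then show ?thesis using abs_ge_zero[of "a * b"] by linarith
      qed
      then show "ennreal \<bar>shift_diff x t \<zeta> * shift_diff x' t' \<zeta>\<bar> \<le> ennreal (\<bar>shift_diff x t \<zeta>\<bar> ^ 2) + ennreal (\<bar>shift_diff x' t' \<zeta>\<bar> ^ 2)"
        by (simp add: ennreal_leI flip: ennreal_plus)
    qed
    also have "\<dots> = (\<integral>\<^sup>+\<zeta>. ennreal (\<bar>shift_diff x t \<zeta>\<bar> ^ 2) \<partial>gauss I) + (\<integral>\<^sup>+\<zeta>. ennreal (\<bar>shift_diff x' t' \<zeta>\<bar> ^ 2) \<partial>gauss I)"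
      using measurable_shift_diff by (intro nn_integral_add) auto
    also have "\<dots> < \<infinity>"
      using le_less_trans[OF shift_diff_power_moment[OF x \<alpha>(1) t(1), of 2] ennreal_less_top]
        le_less_trans[OF shift_diff_power_moment[OF x' \<alpha>(2) t(2), of 2] ennreal_less_top]
      by simp
    finally show ?thesis .
  qed
  have int: "integrable (gauss I) (\<lambda>\<zeta>. shift_diff x t \<zeta> * shift_diff x' t' \<zeta>)"
    using measurable_shift_diff nn12 by (intro integrableI_bounded) auto
  \<comment> \<open>The conditional mean given the component \<open>s\<close>.\<close>
  define Is where "Is s = (\<integral>\<zeta>. \<Delta> \<alpha>1 t s (dot I u \<zeta>) * \<Delta> \<alpha>2 t' s (dot I u' \<zeta>) \<partial>gauss I)" for s
  have E: "(\<integral>\<zeta>. shift_diff x t \<zeta> * shift_diff x' t' \<zeta> \<partial>gauss I) = (\<integral>s. Is s \<partial>gam)" and Iint: "integrable gam Is"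
    using integral_gauss_resample[OF I e1 int] unfolding res Is_def \<alpha>1_def \<alpha>2_def u_def u'_def by auto
  define K where "K = A * (24 * exp ((8 * c + 1)\<^sup>2)) * (8 * A + 16 * C0)"
  \<comment> \<open>Sum of the exponents \<open>1 + 2 * c\<close> of the first factor and
    \<open>1 + 2 * c + c0\<close>, which covers both terms of the second.\<close>
  define k where "k = 2 + 4 * c + c0"
  have K0: "K \<ge> 0" using A_nonneg C0 by (simp add: K_def)
  have inner: "\<bar>Is s\<bar> \<le> (K * \<epsilon> ^ 3) * exp (k * \<bar>s\<bar>)" for s
  proof -
    \<comment> \<open>Removing components of size \<epsilon> changes inner products only by their
      products, of order \<epsilon> squared, which is the precision already available.\<close>
    have uu: "dot I u u = dot I x x - \<alpha>1 * \<alpha>1" "dot I u' u' = dot I x' x' - \<alpha>2 * \<alpha>2" "dot I u u' = dot I x x' - \<alpha>1 * \<alpha>2"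
      unfolding u_def u'_def \<alpha>1_def \<alpha>2_def by (rule dot_project[OF e_dot])+
    have aa: "\<bar>\<alpha>1 * \<alpha>1\<bar> \<le> \<epsilon>\<^sup>2" "\<bar>\<alpha>2 * \<alpha>2\<bar> \<le> \<epsilon>\<^sup>2" "\<bar>\<alpha>1 * \<alpha>2\<bar> \<le> \<epsilon>\<^sup>2"
    proof -
      have h: "\<bar>a * b\<bar> \<le> \<epsilon>\<^sup>2" if "\<bar>a\<bar> \<le> \<epsilon>" "\<bar>b\<bar> \<le> \<epsilon>" for a b :: real
        unfolding abs_mult power2_eq_square by (rule mult_mono[OF that \<epsilon>0 abs_ge_zero])
      show "\<bar>\<alpha>1 * \<alpha>1\<bar> \<le> \<epsilon>\<^sup>2" "\<bar>\<alpha>2 * \<alpha>2\<bar> \<le> \<epsilon>\<^sup>2" "\<bar>\<alpha>1 * \<alpha>2\<bar> \<le> \<epsilon>\<^sup>2"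
        by (rule h[OF \<alpha>(1) \<alpha>(1), folded \<alpha>1_def] h[OF \<alpha>(2) \<alpha>(2), folded \<alpha>2_def] h[OF \<alpha>(1) \<alpha>(2), folded \<alpha>1_def \<alpha>2_def])+
    qed
    have u1: "1 / 2 \<le> dot I u u" "dot I u u \<le> 2" using uu(1) aa(1) x \<epsilon>2 by linarith+
    have u2: "dot I u' u' \<le> 2" using uu(2) aa(2) x' \<epsilon>2 by linarith
    have u3: "\<bar>dot I u' u' - 1\<bar> \<le> 2 * \<epsilon>\<^sup>2" using uu(2) aa(2) x' by linarith
    have u4: "\<bar>dot I u u'\<bar> \<le> 2 * \<epsilon>\<^sup>2" using uu(3) aa(3) xx' by linarith
    have sh: "\<bar>\<alpha> + \<tau>\<bar> * \<bar>s\<bar> + \<bar>\<alpha>\<bar> * \<bar>s\<bar> \<le> 2 * \<bar>s\<bar>" "\<bar>\<alpha> + \<tau>\<bar> * \<bar>s\<bar> \<le> \<bar>s\<bar>" "\<bar>\<alpha>\<bar> * \<bar>s\<bar> \<le> \<bar>s\<bar>"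
      if "\<bar>\<alpha>\<bar> \<le> \<epsilon>" "\<bar>\<tau>\<bar> \<le> \<epsilon>" for \<alpha> \<tau>
    proof -
      have "\<bar>\<alpha> + \<tau>\<bar> \<le> 1" "\<bar>\<alpha>\<bar> \<le> 1" using that \<epsilon> by linarith+
      then show a: "\<bar>\<alpha> + \<tau>\<bar> * \<bar>s\<bar> \<le> \<bar>s\<bar>" and b: "\<bar>\<alpha>\<bar> * \<bar>s\<bar> \<le> \<bar>s\<bar>"
        by (auto intro: mult_left_le_one_le)
      show "\<bar>\<alpha> + \<tau>\<bar> * \<bar>s\<bar> + \<bar>\<alpha>\<bar> * \<bar>s\<bar> \<le> 2 * \<bar>s\<bar>" using a b by linarith
    qed
    have \<Delta>b: "\<bar>\<Delta> \<alpha> \<tau> s y\<bar> \<le> (A * \<epsilon> * exp ((1 + 2 * c) * \<bar>s\<bar>)) * exp (2 * c * \<bar>y\<bar>)"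
      if *: "\<bar>\<alpha>\<bar> \<le> \<epsilon>" "\<bar>\<tau>\<bar> \<le> \<epsilon>" for \<alpha> \<tau> y
    proof -
      have "\<bar>\<Delta> \<alpha> \<tau> s y\<bar> \<le> A * \<bar>\<tau> * s\<bar> * exp (c * (\<bar>y + (\<alpha> + \<tau>) * s\<bar> + \<bar>y + \<alpha> * s\<bar>))"
        using exp_lipD(2)[OF g, of "y + (\<alpha> + \<tau>) * s" "y + \<alpha> * s"] by (simp add: \<Delta>_def algebra_simps)
      also have "\<dots> \<le> A * (\<epsilon> * exp \<bar>s\<bar>) * exp (c * (2 * \<bar>y\<bar> + 2 * \<bar>s\<bar>))"
      proof (intro mult_mono)
        show "\<bar>\<tau> * s\<bar> \<le> \<epsilon> * exp \<bar>s\<bar>" unfolding abs_mult using * \<epsilon>0 by (intro mult_mono abs_le_exp) auto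
        have "\<bar>y + (\<alpha> + \<tau>) * s\<bar> + \<bar>y + \<alpha> * s\<bar> \<le> 2 * \<bar>y\<bar> + 2 * \<bar>s\<bar>"
          using sh(1)[OF *] abs_triangle_ineq[of y "(\<alpha> + \<tau>) * s"] abs_triangle_ineq[of y "\<alpha> * s"]
          unfolding abs_mult by linarith
        then show "exp (c * (\<bar>y + (\<alpha> + \<tau>) * s\<bar> + \<bar>y + \<alpha> * s\<bar>)) \<le> exp (c * (2 * \<bar>y\<bar> + 2 * \<bar>s\<bar>))"
          using c by (simp add: mult_left_mono)
      qed (use A_nonneg \<epsilon>0 in auto)
      also have "\<dots> = (A * \<epsilon> * exp ((1 + 2 * c) * \<bar>s\<bar>)) * exp (2 * c * \<bar>y\<bar>)"
        by (simp add: algebra_simps flip: exp_add)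
      finally show ?thesis .
    qed
    have B0: "A * \<epsilon> * exp ((1 + 2 * c) * \<bar>s\<bar>) \<le> 2 * A * exp ((1 + 2 * c) * \<bar>s\<bar>)"
      using mult_left_mono[of \<epsilon> 2 A] A_nonneg \<epsilon> by (intro mult_right_mono) auto
    \<comment> \<open>The Lipschitz constant in \<open>y\<close> does not shrink with \<epsilon>,
      since \<open>g\<close> may have kinks. Its coefficient in the covariance bound supplies the
      two powers of \<epsilon>.\<close>
    have lip: "exp_lip (2 * A * exp ((1 + 2 * c) * \<bar>s\<bar>)) (2 * c) (\<Delta> \<alpha>2 t' s)"
      unfolding exp_lip_def
    proof (intro conjI allI)
      fix y y' :: real
      note * = \<alpha>(2)[folded \<alpha>2_def] t(2)
      show "\<bar>\<Delta> \<alpha>2 t' s y\<bar> \<le> 2 * A * exp ((1 + 2 * c) * \<bar>s\<bar>) * exp (2 * c * \<bar>y\<bar>)"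
        using \<Delta>b[OF *, of y] mult_right_mono[OF B0, of "exp (2 * c * \<bar>y\<bar>)"] by (simp add: mult.assoc)
      have one: "\<bar>g (y + q) - g (y' + q)\<bar> \<le> A * \<bar>y - y'\<bar> * exp (2 * c * \<bar>s\<bar>) * exp (2 * c * (\<bar>y\<bar> + \<bar>y'\<bar>))" if q: "\<bar>q\<bar> \<le> \<bar>s\<bar>" for q
      proof -
        have "\<bar>g (y + q) - g (y' + q)\<bar> \<le> A * \<bar>y - y'\<bar> * exp (c * (\<bar>y + q\<bar> + \<bar>y' + q\<bar>))"
          using exp_lipD(2)[OF g, of "y + q" "y' + q"] by simp
        also have "\<dots> \<le> A * \<bar>y - y'\<bar> * exp (c * ((\<bar>y\<bar> + \<bar>y'\<bar>) + 2 * \<bar>s\<bar>))"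
        proof -
          have "\<bar>y + q\<bar> + \<bar>y' + q\<bar> \<le> (\<bar>y\<bar> + \<bar>y'\<bar>) + 2 * \<bar>s\<bar>" using q by linarith
          then show ?thesis using c A_nonneg by (intro mult_left_mono) (auto intro: mult_left_mono)
        qed
        also have "\<dots> = A * \<bar>y - y'\<bar> * exp (2 * c * \<bar>s\<bar>) * exp (c * (\<bar>y\<bar> + \<bar>y'\<bar>))"
          by (simp add: algebra_simps flip: exp_add)
        also have "\<dots> \<le> A * \<bar>y - y'\<bar> * exp (2 * c * \<bar>s\<bar>) * exp (2 * c * (\<bar>y\<bar> + \<bar>y'\<bar>))"
          using A_nonneg c by (intro mult_left_mono) (auto intro: mult_right_mono)
        finally show ?thesis .
      qed
      have "\<bar>\<Delta> \<alpha>2 t' s y - \<Delta> \<alpha>2 t' s y'\<bar> \<le>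
          \<bar>g (y + (\<alpha>2 + t') * s) - g (y' + (\<alpha>2 + t') * s)\<bar> + \<bar>g (y + \<alpha>2 * s) - g (y' + \<alpha>2 * s)\<bar>"
        unfolding \<Delta>_def by linarith
      also have "\<dots> \<le> 2 * (A * \<bar>y - y'\<bar> * exp (2 * c * \<bar>s\<bar>) * exp (2 * c * (\<bar>y\<bar> + \<bar>y'\<bar>)))"
        using one[of "(\<alpha>2 + t') * s"] one[of "\<alpha>2 * s"] sh(2,3)[OF *] unfolding abs_mult by linarith
      also have "\<dots> = (2 * A * \<bar>y - y'\<bar> * exp (2 * c * (\<bar>y\<bar> + \<bar>y'\<bar>))) * exp (2 * c * \<bar>s\<bar>)" by simp
      also have "\<dots> \<le> (2 * A * \<bar>y - y'\<bar> * exp (2 * c * (\<bar>y\<bar> + \<bar>y'\<bar>))) * exp ((1 + 2 * c) * \<bar>s\<bar>)"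
        using A_nonneg by (intro mult_left_mono) (auto intro: mult_right_mono)
      finally show "\<bar>\<Delta> \<alpha>2 t' s y - \<Delta> \<alpha>2 t' s y'\<bar> \<le> 2 * A * exp ((1 + 2 * c) * \<bar>s\<bar>) * \<bar>y - y'\<bar> * exp (2 * c * (\<bar>y\<bar> + \<bar>y'\<bar>))"
        by (simp add: mult_ac)
    qed
    \<comment> \<open>Both arguments are shifts by at most
      \<open>2 * \<epsilon> * \<bar>s\<bar>\<close>, and shifted means of \<open>g\<close> are
      quadratic in the shift. With \<open>s\<^sup>2\<close> at most
      \<open>2 * exp \<bar>s\<bar>\<close> this gives 8 for each of the two terms.\<close>
    have mean: "\<bar>\<integral>r. \<Delta> \<alpha>2 t' s r \<partial>gam\<bar> \<le> 16 * C0 * \<epsilon>\<^sup>2 * exp ((1 + c0) * \<bar>s\<bar>)"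
    proof -
      note * = \<alpha>(2)[folded \<alpha>2_def] t(2)
      have ig: "integrable gam (\<lambda>r. g (r + q))" for q
      proof (rule integrable_gam_bound(1))
        show "\<bar>g (r + q)\<bar> \<le> A * exp (c * \<bar>q\<bar>) * exp (c * \<bar>r\<bar>)" for r
        proof -
          have "\<bar>g (r + q)\<bar> \<le> A * exp (c * \<bar>r + q\<bar>)" by (rule exp_lipD[OF g])
          also have "\<dots> \<le> A * exp (c * (\<bar>q\<bar> + \<bar>r\<bar>))"
            using A_nonneg c by (intro mult_left_mono) (auto intro: mult_left_mono)
          finally show ?thesis by (simp add: distrib_left exp_add mult.assoc)
        qed
      qed measurable
      have q: "\<bar>\<integral>r. g (r + q) \<partial>gam\<bar> \<le> 8 * C0 * \<epsilon>\<^sup>2 * exp ((1 + c0) * \<bar>s\<bar>)" if q: "\<bar>q\<bar> \<le> 2 * \<epsilon> * \<bar>s\<bar>" for q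
      proof -
        have qs: "\<bar>q\<bar> \<le> \<bar>s\<bar>" using q \<epsilon> mult_right_mono[of "2 * \<epsilon>" 1 "\<bar>s\<bar>"] by simp
        have "q\<^sup>2 \<le> (2 * \<epsilon> * \<bar>s\<bar>)\<^sup>2" using q by (metis abs_ge_zero power2_abs power_mono)
        also have "\<dots> = 4 * \<epsilon>\<^sup>2 * s\<^sup>2" by (simp add: power_mult_distrib)
        also have "s\<^sup>2 \<le> 2 * exp \<bar>s\<bar>"
        proof -
          have "1 + \<bar>s\<bar> + \<bar>s\<bar>\<^sup>2 / 2 \<le> exp \<bar>s\<bar>" by (rule exp_lower_Taylor_quadratic) simp
          then show ?thesis using abs_ge_zero[of s] unfolding power2_abs by linarith
        qed
        finally have q2: "q\<^sup>2 \<le> 8 * \<epsilon>\<^sup>2 * exp \<bar>s\<bar>" by (simp add: mult_left_mono)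
        have "\<bar>\<integral>r. g (r + q) \<partial>gam\<bar> \<le> C0 * q\<^sup>2 * exp (c0 * \<bar>q\<bar>)" by (rule \<Phi>)
        also have "\<dots> \<le> C0 * (8 * \<epsilon>\<^sup>2 * exp \<bar>s\<bar>) * exp (c0 * \<bar>s\<bar>)"
          using C0 q2 qs c0 by (intro mult_mono) (auto intro: mult_left_mono)
        also have "\<dots> = 8 * C0 * \<epsilon>\<^sup>2 * (exp \<bar>s\<bar> * exp (c0 * \<bar>s\<bar>))" by simp
        also have "exp \<bar>s\<bar> * exp (c0 * \<bar>s\<bar>) = exp ((1 + c0) * \<bar>s\<bar>)" by (simp add: distrib_right exp_add)
        finally show ?thesis .
      qed
      have "(\<integral>r. \<Delta> \<alpha>2 t' s r \<partial>gam) = (\<integral>r. g (r + (\<alpha>2 + t') * s) \<partial>gam) - (\<integral>r. g (r + \<alpha>2 * s) \<partial>gam)"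
        unfolding \<Delta>_def by (rule Bochner_Integration.integral_diff[OF ig ig])
      moreover have "\<bar>(\<alpha>2 + t') * s\<bar> \<le> 2 * \<epsilon> * \<bar>s\<bar>" "\<bar>\<alpha>2 * s\<bar> \<le> 2 * \<epsilon> * \<bar>s\<bar>"
        unfolding abs_mult using * \<epsilon>0 by (auto intro!: mult_right_mono)
      ultimately show ?thesis using q[of "(\<alpha>2 + t') * s"] q[of "\<alpha>2 * s"] by linarith
    qed
    have mF: "\<Delta> \<alpha>1 t s \<in> borel_measurable borel" unfolding \<Delta>_def[abs_def] by measurable
    have "\<bar>Is s\<bar> \<le> (A * \<epsilon> * exp ((1 + 2 * c) * \<bar>s\<bar>)) * (24 * exp ((4 * (2 * c) + 1)\<^sup>2)) *
       ((2 * A * exp ((1 + 2 * c) * \<bar>s\<bar>)) * (\<bar>dot I u' u' - 1\<bar> + \<bar>dot I u u'\<bar>) + \<bar>\<integral>r. \<Delta> \<alpha>2 t' s r \<partial>gam\<bar>)"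
      unfolding Is_def
      by (rule gauss_covariance_bound[OF I _ u1 u2 mF \<Delta>b lip]) (use c \<alpha> t in \<open>auto simp: \<alpha>1_def\<close>)
    also have "\<dots> \<le> (A * \<epsilon> * exp ((1 + 2 * c) * \<bar>s\<bar>)) * (24 * exp ((4 * (2 * c) + 1)\<^sup>2)) *
       ((2 * A * exp ((1 + 2 * c) * \<bar>s\<bar>)) * (2 * \<epsilon>\<^sup>2 + 2 * \<epsilon>\<^sup>2) + 16 * C0 * \<epsilon>\<^sup>2 * exp ((1 + c0) * \<bar>s\<bar>))"
      using A_nonneg \<epsilon>0 by (intro mult_left_mono add_mono u3 u4 mean) auto
    also have "\<dots> \<le> (A * \<epsilon> * exp ((1 + 2 * c) * \<bar>s\<bar>)) * (24 * exp ((4 * (2 * c) + 1)\<^sup>2)) *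
       ((2 * A * exp ((1 + 2 * c + c0) * \<bar>s\<bar>)) * (2 * \<epsilon>\<^sup>2 + 2 * \<epsilon>\<^sup>2) + 16 * C0 * \<epsilon>\<^sup>2 * exp ((1 + 2 * c + c0) * \<bar>s\<bar>))"
    proof -
      have e1: "exp ((1 + 2 * c) * \<bar>s\<bar>) \<le> exp ((1 + 2 * c + c0) * \<bar>s\<bar>)" using c0 by (simp add: mult_right_mono)
      have e2: "exp ((1 + c0) * \<bar>s\<bar>) \<le> exp ((1 + 2 * c + c0) * \<bar>s\<bar>)" using c by (simp add: mult_right_mono)
      show ?thesis using A_nonneg \<epsilon>0 C0 by (intro mult_left_mono[OF add_mono] mult_right_mono mult_left_mono e1 e2) simp_all
    qed
    also have "\<dots> = (K * \<epsilon> ^ 3) * (exp ((1 + 2 * c) * \<bar>s\<bar>) * exp ((1 + 2 * c + c0) * \<bar>s\<bar>))"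
    proof -
      have gen: "(A * \<epsilon> * E1) * (24 * X) * ((2 * A * E2) * (2 * \<epsilon>\<^sup>2 + 2 * \<epsilon>\<^sup>2) + 16 * C0 * \<epsilon>\<^sup>2 * E2) =
         (A * (24 * X) * (8 * A + 16 * C0) * \<epsilon> ^ 3) * (E1 * E2)" for E1 E2 X
        by (simp add: power2_eq_square power3_eq_cube algebra_simps)
      have c8: "4 * (2 * c) = 8 * c" by simp
      show ?thesis unfolding K_def c8 by (rule gen)
    qed
    also have "exp ((1 + 2 * c) * \<bar>s\<bar>) * exp ((1 + 2 * c + c0) * \<bar>s\<bar>) = exp (k * \<bar>s\<bar>)"
      by (simp add: k_def algebra_simps flip: exp_add)
    finally show ?thesis .
  qed
  have Ism: "Is \<in> borel_measurable borel" using Iint by auto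
  have "\<bar>\<integral>s. Is s \<partial>gam\<bar> \<le> K * \<epsilon> ^ 3 * (2 * exp (k\<^sup>2 / 2))"
    by (rule integrable_gam_bound(2)[OF Ism inner])
  then show ?thesis unfolding E cross_bias_const_def K_def k_def by (simp add: mult_ac)
qed

lemma shift_diff_product_bounds:
  assumes x: "\<bar>dot I x x - 1\<bar> \<le> \<epsilon>\<^sup>2" and x': "\<bar>dot I x' x' - 1\<bar> \<le> \<epsilon>\<^sup>2"
    and \<alpha>: "\<bar>dot I x e\<bar> \<le> \<epsilon>" "\<bar>dot I x' e\<bar> \<le> \<epsilon>" and t: "\<bar>t\<bar> \<le> \<epsilon>" "\<bar>t'\<bar> \<le> \<epsilon>" and s: "s > 0"
  shows "(\<integral>\<^sup>+\<zeta>. ennreal ((shift_diff x t \<zeta> / s * (shift_diff x' t' \<zeta> / s)) ^ 6) \<partial>gauss I) \<le>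
      ennreal ((cross_moment_const A c * \<epsilon>\<^sup>2 / s\<^sup>2) ^ 6)"
    and "\<bar>\<integral>\<zeta>. shift_diff x t \<zeta> / s * (shift_diff x t \<zeta> / s) \<partial>gauss I\<bar> \<le> cross_moment_const A c * \<epsilon>\<^sup>2 / s\<^sup>2"
proof -
  have \<epsilon>0: "\<epsilon> \<ge> 0" using t by simp
  note [measurable] = measurable_shift_diff
  let ?E = "(A * \<epsilon>) ^ 12 * (6 * exp (9 * (real 12)\<^sup>2 * (1 + c\<^sup>2)))"
  have "(\<integral>\<^sup>+\<zeta>. ennreal ((shift_diff x t \<zeta> / s * (shift_diff x' t' \<zeta> / s)) ^ 6) \<partial>gauss I) \<le>
    (\<integral>\<^sup>+\<zeta>. ennreal (1 / (2 * (s\<^sup>2) ^ 6)) * (ennreal (\<bar>shift_diff x t \<zeta>\<bar> ^ 12) + ennreal (\<bar>shift_diff x' t' \<zeta>\<bar> ^ 12)) \<partial>gauss I)"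
  proof (intro nn_integral_mono)
    fix \<zeta>
    have "2 * (a * b) ^ 6 \<le> \<bar>a\<bar> ^ 12 + \<bar>b\<bar> ^ 12" for a b :: real
    proof -
      have "0 \<le> (a ^ 6 - b ^ 6)\<^sup>2" by auto
      moreover have "(a ^ 6 - b ^ 6)\<^sup>2 = a ^ 12 + b ^ 12 - 2 * (a * b) ^ 6"
        by (simp add: power2_diff power_mult_distrib flip: power_mult)
      ultimately show ?thesis by simp
    qed
    from this[of "shift_diff x t \<zeta>" "shift_diff x' t' \<zeta>"]
    have "2 * (shift_diff x t \<zeta> * shift_diff x' t' \<zeta>) ^ 6 / (2 * (s\<^sup>2) ^ 6) \<le> (\<bar>shift_diff x t \<zeta>\<bar> ^ 12 + \<bar>shift_diff x' t' \<zeta>\<bar> ^ 12) / (2 * (s\<^sup>2) ^ 6)"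
      by (rule divide_right_mono) simp
    also have "2 * (shift_diff x t \<zeta> * shift_diff x' t' \<zeta>) ^ 6 / (2 * (s\<^sup>2) ^ 6) = (shift_diff x t \<zeta> / s * (shift_diff x' t' \<zeta> / s)) ^ 6"
      by (simp add: power_divide power2_eq_square)
    finally show "ennreal ((shift_diff x t \<zeta> / s * (shift_diff x' t' \<zeta> / s)) ^ 6) \<le>
      ennreal (1 / (2 * (s\<^sup>2) ^ 6)) * (ennreal (\<bar>shift_diff x t \<zeta>\<bar> ^ 12) + ennreal (\<bar>shift_diff x' t' \<zeta>\<bar> ^ 12))"
      by (simp add: ennreal_leI flip: ennreal_mult ennreal_plus)
  qed
  also have "\<dots> = ennreal (1 / (2 * (s\<^sup>2) ^ 6)) * ((\<integral>\<^sup>+\<zeta>. ennreal (\<bar>shift_diff x t \<zeta>\<bar> ^ 12) \<partial>gauss I) + (\<integral>\<^sup>+\<zeta>. ennreal (\<bar>shift_diff x' t' \<zeta>\<bar> ^ 12) \<partial>gauss I))"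
    by (simp add: nn_integral_cmult nn_integral_add)
  also have "\<dots> \<le> ennreal (1 / (2 * (s\<^sup>2) ^ 6)) * (ennreal ?E + ennreal ?E)"
    using x x' \<alpha> t by (intro mult_left_mono add_mono shift_diff_power_moment) auto
  also have "\<dots> = ennreal (?E / (s\<^sup>2) ^ 6)"
  proof -
    have eq: "ennreal (1 / (2 * b)) * (ennreal q + ennreal q) = ennreal (q / b)" if "b \<ge> 0" "q \<ge> 0" for b q
    proof -
      have "ennreal (1 / (2 * b)) * (ennreal q + ennreal q) = ennreal (1 / (2 * b) * (q + q))"
        using that by (simp only: ennreal_plus ennreal_mult add_nonneg_nonneg zero_le_divide_1_iff mult_nonneg_nonneg zero_le_numeral)
      also have "1 / (2 * b) * (q + q) = q / b" by simp
      finally show ?thesis .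
    qed
    have "?E \<ge> 0" using A_nonneg \<epsilon>0 by (intro mult_nonneg_nonneg zero_le_power) auto
    then show ?thesis by (intro eq) auto
  qed
  also have "\<dots> \<le> ennreal ((cross_moment_const A c * \<epsilon>\<^sup>2 / s\<^sup>2) ^ 6)"
  proof (rule ennreal_leI)
    have "?E \<le> 6 ^ 6 * ((A * \<epsilon>) ^ 12 * exp (1296 * (1 + c\<^sup>2)))"
      using A_nonneg \<epsilon>0 by (simp add: power2_eq_square)
    also have "\<dots> = (cross_moment_const A c * \<epsilon>\<^sup>2) ^ 6"
      unfolding cross_moment_const_def
      by (simp add: power_mult_distrib exp_of_nat_mult[symmetric] flip: power_mult)
    finally show "?E / (s\<^sup>2) ^ 6 \<le> (cross_moment_const A c * \<epsilon>\<^sup>2 / s\<^sup>2) ^ 6"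
      unfolding power_divide by (intro divide_right_mono) auto
  qed
  finally show "(\<integral>\<^sup>+\<zeta>. ennreal ((shift_diff x t \<zeta> / s * (shift_diff x' t' \<zeta> / s)) ^ 6) \<partial>gauss I) \<le>
      ennreal ((cross_moment_const A c * \<epsilon>\<^sup>2 / s\<^sup>2) ^ 6)" .
  have K0: "cross_moment_const A c * \<epsilon>\<^sup>2 \<ge> 0" by (simp add: cross_moment_const_def)
  have nn: "(\<integral>\<^sup>+\<zeta>. ennreal \<bar>(shift_diff x t \<zeta>)\<^sup>2\<bar> \<partial>gauss I) \<le> ennreal (cross_moment_const A c * \<epsilon>\<^sup>2)"
  proof -
    have "(\<integral>\<^sup>+\<zeta>. ennreal \<bar>(shift_diff x t \<zeta>)\<^sup>2\<bar> \<partial>gauss I) \<le> ennreal ((A * \<epsilon>) ^ 2 * (6 * exp (9 * (real 2)\<^sup>2 * (1 + c\<^sup>2))))"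
      using shift_diff_power_moment[OF x \<alpha>(1) t(1), of 2] by simp
    also have "\<dots> \<le> ennreal (cross_moment_const A c * \<epsilon>\<^sup>2)"
    proof (rule ennreal_leI)
      have "exp (9 * (real 2)\<^sup>2 * (1 + c\<^sup>2)) \<le> exp (216 * (1 + c\<^sup>2))" by (simp add: power2_eq_square mult_right_mono)
      then have "(6 * A\<^sup>2 * \<epsilon>\<^sup>2) * exp (9 * (real 2)\<^sup>2 * (1 + c\<^sup>2)) \<le> (6 * A\<^sup>2 * \<epsilon>\<^sup>2) * exp (216 * (1 + c\<^sup>2))"
        by (rule mult_left_mono) simp
      then show "(A * \<epsilon>) ^ 2 * (6 * exp (9 * (real 2)\<^sup>2 * (1 + c\<^sup>2))) \<le> cross_moment_const A c * \<epsilon>\<^sup>2"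
        by (simp add: cross_moment_const_def power_mult_distrib mult_ac)
    qed
    finally show ?thesis .
  qed
  have "\<bar>\<integral>\<zeta>. (shift_diff x t \<zeta>)\<^sup>2 \<partial>gauss I\<bar> \<le> cross_moment_const A c * \<epsilon>\<^sup>2"
    by (rule integral_bound_nn(2)[OF _ nn K0]) measurable
  moreover have "\<bar>\<integral>\<zeta>. shift_diff x t \<zeta> / s * (shift_diff x t \<zeta> / s) \<partial>gauss I\<bar> = \<bar>\<integral>\<zeta>. (shift_diff x t \<zeta>)\<^sup>2 \<partial>gauss I\<bar> / s\<^sup>2"
    by (simp add: power2_eq_square abs_divide)
  ultimately show "\<bar>\<integral>\<zeta>. shift_diff x t \<zeta> / s * (shift_diff x t \<zeta> / s) \<partial>gauss I\<bar> \<le> cross_moment_const A c * \<epsilon>\<^sup>2 / s\<^sup>2"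
    using s by (simp add: divide_right_mono)
qed

end

text \<open>Conditioning on a whole block of columns; the shift on the cross block involves all
  columns of the support at once.\<close>

lemma nn_integral_PiM_le_merge:
  assumes N: "prob_space N" and UJ: "finite U" "finite J" "U \<inter> J = {}"
    and \<Phi>: "\<Phi> \<in> borel_measurable (Pi\<^sub>M (U \<union> J) (\<lambda>_. N))"
    and le: "\<And>a. a \<in> space (Pi\<^sub>M U (\<lambda>_. N)) \<Longrightarrow> (\<integral>\<^sup>+y. \<Phi> (merge U J (a, y)) \<partial>Pi\<^sub>M J (\<lambda>_. N)) \<le> C"
  shows "(\<integral>\<^sup>+z. \<Phi> z \<partial>Pi\<^sub>M (U \<union> J) (\<lambda>_. N)) \<le> C"
proof -
  interpret N: prob_space N by fact
  interpret product_sigma_finite "\<lambda>_. N"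
    by (simp add: product_sigma_finite_def N.sigma_finite_measure_axioms)
  interpret PU: prob_space "Pi\<^sub>M U (\<lambda>_. N)" by (intro prob_space_PiM N)
  have "(\<integral>\<^sup>+z. \<Phi> z \<partial>Pi\<^sub>M (U \<union> J) (\<lambda>_. N)) = (\<integral>\<^sup>+a. \<integral>\<^sup>+y. \<Phi> (merge U J (a, y)) \<partial>Pi\<^sub>M J (\<lambda>_. N) \<partial>Pi\<^sub>M U (\<lambda>_. N))"
    by (rule product_nn_integral_fold[OF UJ(3,1,2) \<Phi>])
  also have "\<dots> \<le> (\<integral>\<^sup>+a. C \<partial>Pi\<^sub>M U (\<lambda>_. N))" using le by (intro nn_integral_mono)
  also have "\<dots> = C" by (simp add: PU.emeasure_space_1)
  finally show ?thesis .
qed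

definition scov :: "nat set \<Rightarrow> real \<Rightarrow> (nat \<Rightarrow> nat \<Rightarrow> real) \<Rightarrow> nat \<Rightarrow> nat \<Rightarrow> real" where
  "scov I s z i k = dot I (z i) (z k) / s\<^sup>2"

text \<open>For a column \<open>j\<close> outside the support \<open>v j\<close> vanishes, and of
  the spiked covariance only the sample entry and the term with factor \<open>v i\<close>
  survive.\<close>

definition cross_kernel :: "nat set \<Rightarrow> real \<Rightarrow> nat set \<Rightarrow> (nat \<Rightarrow> real) \<Rightarrow> real \<Rightarrow> (real \<Rightarrow> real) \<Rightarrow> (nat \<Rightarrow> nat \<Rightarrow> real) \<Rightarrow> nat \<Rightarrow> nat \<Rightarrow> real" where
  "cross_kernel I s U v \<mu> g z i j =
     (g (s * (scov I s z i j + \<mu> * v i * (\<Sum>k\<in>U. v k * scov I s z k j))) - g (s * scov I s z i j)) / s"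

definition cov_spike :: "nat set \<Rightarrow> real \<Rightarrow> nat set \<Rightarrow> (nat \<Rightarrow> real) \<Rightarrow> (nat \<Rightarrow> nat \<Rightarrow> real) \<Rightarrow> nat \<Rightarrow> real" where
  "cov_spike I s U v z i = (\<Sum>k\<in>U. v k * scov I s z i k)"

text \<open>Up to scaling the squared norm of the combination of columns with weights
  \<open>v\<close>; its positivity is what permits normalising that combination to a unit
  vector.\<close>

definition spike_quad :: "nat set \<Rightarrow> real \<Rightarrow> nat set \<Rightarrow> (nat \<Rightarrow> real) \<Rightarrow> (nat \<Rightarrow> nat \<Rightarrow> real) \<Rightarrow> real" where
  "spike_quad I s U v z = (\<Sum>i\<in>U. v i * cov_spike I s U v z i)"

text \<open>The first bound is on the component of row \<open>i\<close> along the normalised spike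
  direction, the second on the length of its shift. All conditions concern columns in
  \<open>U\<close>, so freezing those columns decides the event.\<close>

definition cross_good :: "nat set \<Rightarrow> real \<Rightarrow> nat set \<Rightarrow> (nat \<Rightarrow> real) \<Rightarrow> real \<Rightarrow> real \<Rightarrow> (nat \<Rightarrow> nat \<Rightarrow> real) \<Rightarrow> bool" where
  "cross_good I s U v \<mu> \<epsilon> z \<longleftrightarrow> spike_quad I s U v z > 0 \<and>
     (\<forall>i\<in>U. \<bar>cov_spike I s U v z i / sqrt (spike_quad I s U v z)\<bar> \<le> \<epsilon> \<and>
       \<bar>\<mu> * v i * sqrt (spike_quad I s U v z)\<bar> \<le> \<epsilon>) \<and> gram_good I s U (\<epsilon>\<^sup>2) z"

section \<open>Measurability and moments of the cross block\<close>

lemma measurable_scov: "i \<in> P \<Longrightarrow> j \<in> P \<Longrightarrow> (\<lambda>z. scov I s z i j) \<in> borel_measurable (gaussian_matrix I P)"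
  using measurable_dot_columns[of i P j I] unfolding scov_def by measurable

lemma measurable_cov_spike:
  "U \<subseteq> P \<Longrightarrow> i \<in> P \<Longrightarrow> (\<lambda>z. cov_spike I s U v z i) \<in> borel_measurable (gaussian_matrix I P)"
  unfolding cov_spike_def using measurable_scov[of i P _ I s]
  by (intro borel_measurable_sum borel_measurable_times) auto

lemma measurable_spike_quad:
  "U \<subseteq> P \<Longrightarrow> (\<lambda>z. spike_quad I s U v z) \<in> borel_measurable (gaussian_matrix I P)"
  unfolding spike_quad_def using measurable_cov_spike[of U P _ I s v]
  by (intro borel_measurable_sum borel_measurable_times) auto

lemma measurable_cross_kernel:
  assumes "U \<subseteq> P" "i \<in> U" "j \<in> P" and g [measurable]: "g \<in> borel_measurable borel"
  shows "(\<lambda>z. cross_kernel I s U v \<mu> g z i j) \<in> borel_measurable (gaussian_matrix I P)"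
proof -
  have [measurable]: "(\<lambda>z. scov I s z i j) \<in> borel_measurable (gaussian_matrix I P)"
    using assms by (intro measurable_scov) auto
  have [measurable]: "(\<lambda>z. \<Sum>k\<in>U. v k * scov I s z k j) \<in> borel_measurable (gaussian_matrix I P)"
    using assms by (intro borel_measurable_sum borel_measurable_times measurable_scov) auto
  show ?thesis unfolding cross_kernel_def by measurable
qed

lemma sets_cross_good:
  assumes "U \<subseteq> P" "finite U"
  shows "{z \<in> space (gaussian_matrix I P). cross_good I s U v \<mu> \<epsilon> z} \<in> sets (gaussian_matrix I P)"
proof -
  let ?Q = "gaussian_matrix I P"
  have q [measurable]: "(\<lambda>z. spike_quad I s U v z) \<in> borel_measurable ?Q" using assms(1) by (rule measurable_spike_quad)
  have "{z \<in> space ?Q. cross_good I s U v \<mu> \<epsilon> z} =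
    {z \<in> space ?Q. spike_quad I s U v z > 0} \<inter>
    {z \<in> space ?Q. \<forall>i\<in>U. \<bar>cov_spike I s U v z i / sqrt (spike_quad I s U v z)\<bar> \<le> \<epsilon> \<and> \<bar>\<mu> * v i * sqrt (spike_quad I s U v z)\<bar> \<le> \<epsilon>} \<inter>
    {z \<in> space ?Q. gram_good I s U (\<epsilon>\<^sup>2) z}"
    by (auto simp: cross_good_def)
  moreover have "{z \<in> space ?Q. spike_quad I s U v z > 0} \<in> sets ?Q" by measurable
  moreover have "{z \<in> space ?Q. \<forall>i\<in>U. \<bar>cov_spike I s U v z i / sqrt (spike_quad I s U v z)\<bar> \<le> \<epsilon> \<and> \<bar>\<mu> * v i * sqrt (spike_quad I s U v z)\<bar> \<le> \<epsilon>} \<in> sets ?Q"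
  proof (intro sets.sets_Collect_finite_All assms(2))
    fix i assume "i \<in> U"
    then have [measurable]: "(\<lambda>z. cov_spike I s U v z i) \<in> borel_measurable ?Q"
      using assms by (intro measurable_cov_spike) auto
    show "{z \<in> space ?Q. \<bar>cov_spike I s U v z i / sqrt (spike_quad I s U v z)\<bar> \<le> \<epsilon> \<and> \<bar>\<mu> * v i * sqrt (spike_quad I s U v z)\<bar> \<le> \<epsilon>} \<in> sets ?Q"
      by measurable
  qed
  ultimately show ?thesis using sets_gram_good[OF assms] by simp
qed

text \<open>With all columns of the support frozen, row \<open>i\<close> of the cross block applies
  one fixed \<open>shift_diff\<close> to each remaining column, and these columns are independent.
  The bias lemma is used for distinct rows, plain second moments on the diagonal.\<close>

lemma cross_kernel_expectation:
  assumes I: "finite I" and c: "c \<ge> 0" and c0: "c0 \<ge> 0" and s: "s > 0" and \<epsilon>: "0 \<le> \<epsilon>" "\<epsilon> \<le> 1 / 2"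
    and UJ: "finite U" "finite J" "U \<inter> J = {}"
    and g: "exp_lip A c g" and \<Phi>: "\<And>\<theta>. \<bar>\<integral>r. g (r + \<theta>) \<partial>gam\<bar> \<le> C0 * \<theta>\<^sup>2 * exp (c0 * \<bar>\<theta>\<bar>)"
  defines "m \<equiv> real (card U)" and "q \<equiv> real (card J)"
    and "K2 \<equiv> cross_moment_const A c * \<epsilon>\<^sup>2 / s\<^sup>2" and "K3 \<equiv> cross_bias_const A c C0 c0 * \<epsilon> ^ 3 / s\<^sup>2"
  shows "(\<integral>\<^sup>+z. ennreal (gram_bound U J (cross_kernel I s U v \<mu> g z)) *
      indicator {z \<in> space (gaussian_matrix I (U \<union> J)). cross_good I s U v \<mu> \<epsilon> z} z \<partial>gaussian_matrix I (U \<union> J)) \<le>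
    ennreal (m * (32 * (q * K2) ^ 6 + 30720 * q ^ 3 * K2 ^ 6) + m ^ 6 * (32 * (q * K3) ^ 6 + 30720 * q ^ 3 * K2 ^ 6))"
proof -
  let ?Q = "gaussian_matrix I (U \<union> J)"
  let ?G = "{z \<in> space ?Q. cross_good I s U v \<mu> \<epsilon> z}"
  let ?M = "cross_kernel I s U v \<mu> g"
  have G: "?G \<in> sets ?Q" by (rule sets_cross_good) (use UJ in auto)
  have mM: "(\<lambda>z. ?M z i j) \<in> borel_measurable ?Q" if "i \<in> U" "j \<in> J" for i j
    using that exp_lip_measurable[OF g] by (intro measurable_cross_kernel) auto
  have K2: "K2 \<ge> 0" by (simp add: K2_def cross_moment_const_def)
  have q0: "q \<ge> 0" "m \<ge> 0" by (simp_all add: q_def m_def)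
  have P: "finite J" "J \<subseteq> J" using UJ by auto
  have main: "(\<integral>\<^sup>+z. ennreal ((\<Sum>j\<in>J. ?M z i j * ?M z k j) ^ 6) * indicator ?G z \<partial>?Q) \<le>
      ennreal (32 * (q * (if i = k then K2 else K3)) ^ 6 + 30720 * q ^ 3 * K2 ^ 6)" if ik: "i \<in> U" "k \<in> U" for i k
  proof (rule nn_integral_PiM_le_merge[OF prob_space_gauss UJ])
    show "(\<lambda>z. ennreal ((\<Sum>j\<in>J. ?M z i j * ?M z k j) ^ 6) * indicator ?G z) \<in> borel_measurable ?Q"
      using G mM ik by measurable
    fix a assume "a \<in> space (gaussian_matrix I U)"
    show "(\<integral>\<^sup>+y. ennreal ((\<Sum>j\<in>J. ?M (merge U J (a, y)) i j * ?M (merge U J (a, y)) k j) ^ 6) * indicator ?G (merge U J (a, y)) \<partial>gaussian_matrix I J) \<le>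
      ennreal (32 * (q * (if i = k then K2 else K3)) ^ 6 + 30720 * q ^ 3 * K2 ^ 6)"
    proof (cases "cross_good I s U v \<mu> \<epsilon> a")
      case False
      have "cross_good I s U v \<mu> \<epsilon> (merge U J (a, y)) = cross_good I s U v \<mu> \<epsilon> a" for y
        using UJ by (simp add: cross_good_def spike_quad_def cov_spike_def gram_good_def scov_def cong: sum.cong)
      then have "indicator ?G (merge U J (a, y)) = (0 :: ennreal)" for y using False by (simp add: indicator_def)
      then show ?thesis by simp
    next
      case True
      define x where "x i = (\<lambda>r. a i r / s)" for i
      define w where "w = (\<lambda>r. \<Sum>k\<in>U. v k * x k r)"
      define n where "n = sqrt (spike_quad I s U v a)"
      define e where "e = (\<lambda>r. w r / n)"
      \<comment> \<open>The length of \<open>w\<close> is moved into \<open>t i\<close>, so that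
        \<open>t i * e r\<close> equals \<open>\<mu> * v i * w r\<close> with \<open>e\<close> a
        unit vector.\<close>
      define t where "t i = \<mu> * v i * n" for i
      have n: "n > 0" "n * n = spike_quad I s U v a" using True by (auto simp: n_def cross_good_def)
      have xx: "dot I (x i) (x k) = scov I s a i k" for i k
        by (simp add: x_def scov_def dot_divide_left dot_commute[of I "a i" "\<lambda>r. a k r / s"] dot_commute[of I "a k" "a i"] power2_eq_square)
      have wx: "dot I w y = (\<Sum>k\<in>U. v k * dot I (x k) y)" for y
        by (simp add: w_def dot_sum_left dot_scale_left)
      have xw: "dot I (x i) w = cov_spike I s U v a i" for i
        unfolding dot_commute[of I "x i"] wx cov_spike_def xx by (simp add: scov_def dot_commute)
      have ww: "dot I w w = n * n"
        unfolding wx xw n(2) spike_quad_def ..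
      have xe: "dot I (x i) e = cov_spike I s U v a i / n" for i
      proof -
        have "dot I (x i) e = dot I e (x i)" by (rule dot_commute)
        also have "\<dots> = dot I w (x i) / n" unfolding e_def by (rule dot_divide_left)
        also have "dot I w (x i) = dot I (x i) w" by (rule dot_commute)
        finally show ?thesis unfolding xw .
      qed
      have e1: "(\<Sum>r\<in>I. (e r)\<^sup>2) = 1"
      proof -
        have "(\<Sum>r\<in>I. (e r)\<^sup>2) = dot I w w / (n * n)"
          by (simp add: e_def dot_def power2_eq_square sum_divide_distrib)
        then show ?thesis using n(1) ww by simp
      qed
      note fixed = I e1 c c0 g \<epsilon>(2) \<Phi>
      let ?d = "shift_diff I e g"
      have hyp: "\<bar>dot I (x i) (x i) - 1\<bar> \<le> \<epsilon>\<^sup>2" "\<bar>dot I (x i) e\<bar> \<le> \<epsilon>" "\<bar>t i\<bar> \<le> \<epsilon>" if "i \<in> U" for i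
      proof -
        have G: "gram_good I s U (\<epsilon>\<^sup>2) a" and E: "\<bar>dot I (x i) e\<bar> \<le> \<epsilon>" "\<bar>t i\<bar> \<le> \<epsilon>"
          using True that unfolding xe t_def by (auto simp: cross_good_def n_def)
        show "\<bar>dot I (x i) e\<bar> \<le> \<epsilon>" "\<bar>t i\<bar> \<le> \<epsilon>" by fact+
        have "\<bar>dot I (a i) (a i) / s\<^sup>2 - (if i = i then 1 else 0)\<bar> \<le> \<epsilon>\<^sup>2"
          using G that unfolding gram_good_def by blast
        then show "\<bar>dot I (x i) (x i) - 1\<bar> \<le> \<epsilon>\<^sup>2" unfolding xx scov_def by simp
      qed
      have hyp2: "\<bar>dot I (x i) (x k)\<bar> \<le> \<epsilon>\<^sup>2" if "i \<in> U" "k \<in> U" "i \<noteq> k" for i k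
      proof -
        have "\<bar>dot I (a i) (a k) / s\<^sup>2 - (if i = k then 1 else 0)\<bar> \<le> \<epsilon>\<^sup>2"
          using True that(1,2) unfolding cross_good_def gram_good_def by blast
        then show ?thesis using that(3) unfolding xx scov_def by simp
      qed
      have ker: "?M (merge U J (a, y)) i j = ?d (x i) (t i) (y j) / s" if "i \<in> U" "j \<in> J" for i j y
      proof -
        have sc: "scov I s (merge U J (a, y)) k j = dot I (x k) (y j) / s" if "k \<in> U" for k
          using that \<open>j \<in> J\<close> UJ by (simp add: scov_def x_def dot_divide_left power2_eq_square)
        have "(\<Sum>k\<in>U. v k * scov I s (merge U J (a, y)) k j) = dot I w (y j) / s"
          unfolding wx sum_divide_distrib using sc by (intro sum.cong) auto
        moreover have "dot I (\<lambda>r. x i r + t i * e r) (y j) = dot I (x i) (y j) + \<mu> * v i * dot I w (y j)"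
          using n(1) by (simp add: dot_add_left dot_scale_left e_def dot_divide_left t_def)
        ultimately show ?thesis
          using s that by (simp add: cross_kernel_def sc shift_diff_def[OF fixed] distrib_left)
      qed
      have "(\<integral>\<^sup>+y. ennreal ((\<Sum>j\<in>J. ?M (merge U J (a, y)) i j * ?M (merge U J (a, y)) k j) ^ 6) * indicator ?G (merge U J (a, y)) \<partial>gaussian_matrix I J) \<le>
        (\<integral>\<^sup>+y. ennreal ((\<Sum>j\<in>J. ?d (x i) (t i) (y j) / s * (?d (x k) (t k) (y j) / s)) ^ 6) \<partial>gaussian_matrix I J)"
      proof (intro nn_integral_mono)
        fix y
        have "(\<Sum>j\<in>J. ?M (merge U J (a, y)) i j * ?M (merge U J (a, y)) k j) =
            (\<Sum>j\<in>J. ?d (x i) (t i) (y j) / s * (?d (x k) (t k) (y j) / s))"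
          using ik by (intro sum.cong) (simp_all only: ker)
        then show "ennreal ((\<Sum>j\<in>J. ?M (merge U J (a, y)) i j * ?M (merge U J (a, y)) k j) ^ 6) * indicator ?G (merge U J (a, y)) \<le>
            ennreal ((\<Sum>j\<in>J. ?d (x i) (t i) (y j) / s * (?d (x k) (t k) (y j) / s)) ^ 6)"
          by (auto simp: indicator_def)
      qed
      also have "\<dots> \<le> ennreal (32 * (q * (if i = k then K2 else K3)) ^ 6 + 30720 * q ^ 3 * K2 ^ 6)"
        unfolding q_def
      proof (rule sixth_moment_PiM_sum[OF prob_space_gauss P _ K2])
        fix j assume "j \<in> J"
        show "(\<lambda>\<zeta>. ?d (x i) (t i) \<zeta> / s * (?d (x k) (t k) \<zeta> / s)) \<in> borel_measurable (gauss I)"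
          using measurable_shift_diff[OF fixed] by (intro borel_measurable_times borel_measurable_divide) auto
        show "(\<integral>\<^sup>+\<zeta>. ennreal ((?d (x i) (t i) \<zeta> / s * (?d (x k) (t k) \<zeta> / s)) ^ 6) \<partial>gauss I) \<le> ennreal (K2 ^ 6)"
          unfolding K2_def using ik by (intro shift_diff_product_bounds(1)[OF fixed] hyp s)
        show "\<bar>\<integral>\<zeta>. ?d (x i) (t i) \<zeta> / s * (?d (x k) (t k) \<zeta> / s) \<partial>gauss I\<bar> \<le> (if i = k then K2 else K3)"
        proof (cases "i = k")
          case True
          have "\<bar>\<integral>\<zeta>. ?d (x i) (t i) \<zeta> / s * (?d (x i) (t i) \<zeta> / s) \<partial>gauss I\<bar> \<le> K2"
            unfolding K2_def using ik(1)
            by (intro shift_diff_product_bounds(2)[OF fixed _ hyp(1) _ hyp(2) _ hyp(3)] hyp s)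
          then show ?thesis using True by simp
        next
          case False
          have "\<bar>\<integral>\<zeta>. ?d (x i) (t i) \<zeta> * ?d (x k) (t k) \<zeta> \<partial>gauss I\<bar> \<le> cross_bias_const A c C0 c0 * \<epsilon> ^ 3"
            using ik False by (intro shift_diff_bias[OF fixed] hyp hyp2)
          moreover have "\<bar>\<integral>\<zeta>. ?d (x i) (t i) \<zeta> / s * (?d (x k) (t k) \<zeta> / s) \<partial>gauss I\<bar> =
              \<bar>\<integral>\<zeta>. ?d (x i) (t i) \<zeta> * ?d (x k) (t k) \<zeta> \<partial>gauss I\<bar> / s\<^sup>2"
            by (simp add: power2_eq_square abs_divide)
          ultimately show ?thesis using s False by (simp add: K3_def power2_eq_square divide_right_mono)
        qed
      qed
      finally show ?thesis .
    qed
  qed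
  show ?thesis
    unfolding m_def
  proof (rule gram_bound_expectation[OF UJ(1) G])
    show "0 \<le> 32 * (q * K2) ^ 6 + 30720 * q ^ 3 * K2 ^ 6" "0 \<le> 32 * (q * K3) ^ 6 + 30720 * q ^ 3 * K2 ^ 6"
      using K2 q0 by auto
    fix i assume i: "i \<in> U"
    show "(\<lambda>z. ?M z i j) \<in> borel_measurable ?Q" if "j \<in> J" for j using mM i that .
    show "(\<integral>\<^sup>+z. ennreal ((\<Sum>j\<in>J. ?M z i j * ?M z i j) ^ 6) * indicator ?G z \<partial>?Q) \<le> ennreal (32 * (q * K2) ^ 6 + 30720 * q ^ 3 * K2 ^ 6)"
      using main[OF i i] by (simp only: simp_thms if_True)
    fix k assume "k \<in> U" "i \<noteq> k"
    then show "(\<integral>\<^sup>+z. ennreal ((\<Sum>j\<in>J. ?M z i j * ?M z k j) ^ 6) * indicator ?G z \<partial>?Q) \<le> ennreal (32 * (q * K3) ^ 6 + 30720 * q ^ 3 * K2 ^ 6)"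
      using main[OF i, of k] by (simp only: simp_thms if_False)
  qed
qed

section \<open>Hermite expansion of shifted means\<close>

lemma pderiv_hermite_monic: "pderiv (hermite_monic (Suc k)) = Polynomial.smult (real (Suc k)) (hermite_monic k)"
proof (induction k)
  case 0
  show ?case by (simp add: pderiv_pCons)
next
  case (Suc k)
  have X: "pderiv ([:0, 1:] * p) = p + [:0, 1:] * pderiv p" for p :: "real poly"
    by (simp add: pderiv_mult pderiv_pCons)
  have "pderiv (hermite_monic (Suc (Suc k))) =
      hermite_monic (Suc k) + [:0, 1:] * pderiv (hermite_monic (Suc k)) - pderiv (pderiv (hermite_monic (Suc k)))"
    by (simp only: hermite_monic.simps(2)[of "Suc k"] pderiv_diff X)
  also have "\<dots> = hermite_monic (Suc k) + Polynomial.smult (real (Suc k)) ([:0, 1:] * hermite_monic k - pderiv (hermite_monic k))"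
    unfolding Suc.IH by (simp add: pderiv_smult smult_diff_right)
  also have "\<dots> = Polynomial.smult (real (Suc (Suc k))) (hermite_monic (Suc k))"
  proof -
    have "p + Polynomial.smult (real (Suc k)) p = Polynomial.smult (real (Suc (Suc k))) p" for p :: "real poly"
      using smult_add_left[of 1 "real (Suc k)" p] by simp
    then show ?thesis by (simp only: hermite_monic.simps(2)[symmetric])
  qed
  finally show ?case .
qed

lemma poly_hermite_monic_Suc:
  "poly (hermite_monic (Suc (Suc k))) x = x * poly (hermite_monic (Suc k)) x - real (Suc k) * poly (hermite_monic k) x"
proof -
  have "hermite_monic (Suc (Suc k)) = [:0, 1:] * hermite_monic (Suc k) - Polynomial.smult (real (Suc k)) (hermite_monic k)"
    by (simp only: hermite_monic.simps(2)[of "Suc k"] pderiv_hermite_monic)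
  then show ?thesis by (simp del: hermite_monic.simps)
qed

text \<open>The series of \<open>exp y\<close> spread over the even indices. For
  \<open>y = - \<theta>\<^sup>2 / 2\<close> the index is then the power of \<theta>, as a Cauchy
  product with the series of \<open>exp (\<theta> * x)\<close> requires.\<close>

definition even_exp_coeff :: "real \<Rightarrow> nat \<Rightarrow> real" where
  "even_exp_coeff y k = (if even k then y ^ (k div 2) / fact (k div 2) else 0)"

lemma even_exp_coeff_sums: "even_exp_coeff y sums exp y"
proof -
  have "(\<lambda>n. even_exp_coeff y (2 * n)) sums exp y"
    using exp_converges[of y] by (simp add: even_exp_coeff_def divide_inverse mult.commute)
  moreover have "strict_mono (\<lambda>n::nat. 2 * n)" by (simp add: strict_mono_def)
  moreover have "even_exp_coeff y n = 0" if "n \<notin> range (\<lambda>n. 2 * n)" for n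
    using that by (auto simp: even_exp_coeff_def elim!: evenE)
  ultimately show ?thesis
    using sums_mono_reindex[of "\<lambda>n. 2 * n" "even_exp_coeff y" "exp y"] by blast
qed

lemma abs_even_exp_coeff: "\<bar>even_exp_coeff y k\<bar> = even_exp_coeff \<bar>y\<bar> k"
  by (simp add: even_exp_coeff_def power_abs)

text \<open>The Taylor coefficients of \<open>exp (\<theta>x - \<theta>\<^sup>2/2) = exp (\<theta>x) \<cdot> exp (-\<theta>\<^sup>2/2)\<close>.\<close>

lemma hermite_cauchy_product:
  "poly (hermite_monic k) x * \<theta> ^ k / fact k =
    (\<Sum>i\<le>k. (\<theta> * x) ^ i / fact i * even_exp_coeff (- \<theta>\<^sup>2 / 2) (k - i))"
proof -
  define a where "a i = (\<theta> * x) ^ i / fact i" for i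
  define b where "b = even_exp_coeff (- \<theta>\<^sup>2 / 2)"
  define C where "C k = (\<Sum>i\<le>k. a i * b (k - i))" for k
  have a_Suc: "real (Suc i) * a (Suc i) = \<theta> * x * a i" for i
    by (simp add: a_def field_simps del: of_nat_Suc)
  have b0: "b 0 = 1" "b (Suc 0) = 0" by (simp_all add: b_def even_exp_coeff_def)
  have b_Suc: "real (Suc (Suc j)) * b (Suc (Suc j)) = - \<theta>\<^sup>2 * b j" for j
  proof (cases "even j")
    case True
    then obtain l where l: "j = 2 * l" by (elim evenE)
    have "real (Suc (Suc (2 * l))) * ((- \<theta>\<^sup>2 / 2) ^ Suc l / fact (Suc l)) = - \<theta>\<^sup>2 * ((- \<theta>\<^sup>2 / 2) ^ l / fact l)"
    proof -
      have "2 * N * (y * y ^ l / (N * fact l)) = 2 * y * (y ^ l / fact l)" if "N \<noteq> 0" for N y :: real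
        using that by simp
      from this[of "real (Suc l)" "- \<theta>\<^sup>2 / 2"] show ?thesis by (simp add: algebra_simps)
    qed
    then show ?thesis by (simp add: b_def even_exp_coeff_def l)
  qed (simp add: b_def even_exp_coeff_def)
  have C_rev: "C k = (\<Sum>j\<le>k. b j * a (k - j))" for k
    unfolding C_def by (rule sum.reindex_bij_witness[of _ "\<lambda>j. k - j" "\<lambda>i. k - i"]) auto
  \<comment> \<open>Coefficientwise form of \<theta> times the \<theta>-derivative of the generating
    function: the weight \<open>Suc k\<close> is split as \<open>i + (Suc k - i)\<close> over the
    two factors. The result is the three-term recurrence of the Hermite polynomials.\<close>
  have "real (Suc k) * C (Suc k) = \<theta> * x * C k - \<theta>\<^sup>2 * (if k = 0 then 0 else C (k - 1))" for k
  proof -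
    have 1: "(\<Sum>i\<le>Suc k. real i * a i * b (Suc k - i)) = \<theta> * x * C k"
    proof -
      have "(\<Sum>i\<le>Suc k. real i * a i * b (Suc k - i)) = (\<Sum>i\<le>k. real (Suc i) * a (Suc i) * b (k - i))"
        by (subst sum.atMost_Suc_shift) simp
      also have "\<dots> = \<theta> * x * C k" unfolding a_Suc C_def by (simp add: sum_distrib_left mult.assoc)
      finally show ?thesis .
    qed
    have 2: "(\<Sum>j\<le>Suc k. real j * b j * a (Suc k - j)) = - \<theta>\<^sup>2 * (if k = 0 then 0 else C (k - 1))"
    proof (cases k)
      case 0
      then show ?thesis by (simp add: b0)
    next
      case (Suc k')
      have "(\<Sum>j\<le>Suc k. real j * b j * a (Suc k - j)) = (\<Sum>j\<le>k'. real (Suc (Suc j)) * b (Suc (Suc j)) * a (k' - j))"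
        unfolding Suc by (subst sum.atMost_Suc_shift, subst sum.atMost_Suc_shift) (simp add: b0 del: of_nat_Suc)
      also have "\<dots> = - \<theta>\<^sup>2 * C k'" unfolding b_Suc C_rev by (simp add: sum_distrib_left sum_negf mult.assoc)
      finally show ?thesis using Suc by simp
    qed
    have "real (Suc k) * C (Suc k) = (\<Sum>i\<le>Suc k. real i * a i * b (Suc k - i)) + (\<Sum>i\<le>Suc k. real (Suc k - i) * a i * b (Suc k - i))"
      unfolding C_def sum_distrib_left sum.distrib[symmetric]
      by (intro sum.cong refl) (simp add: of_nat_diff algebra_simps)
    also have "(\<Sum>i\<le>Suc k. real (Suc k - i) * a i * b (Suc k - i)) = (\<Sum>j\<le>Suc k. real j * b j * a (Suc k - j))"
      by (rule sum.reindex_bij_witness[of _ "\<lambda>j. Suc k - j" "\<lambda>i. Suc k - i"]) auto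
    finally show ?thesis unfolding 1 2 by simp
  qed
  note rec = this
  have "poly (hermite_monic k) x * \<theta> ^ k / fact k = C k"
  proof (induction k rule: less_induct)
    case (less k)
    consider "k = 0" | "k = Suc 0" | k' where "k = Suc (Suc k')" by (metis not0_implies_Suc)
    then show ?case
    proof cases
      case 1
      then show ?thesis by (simp add: C_def a_def b0)
    next
      case 2
      then show ?thesis using rec[of 0] by (simp add: C_def a_def b0 pderiv_1)
    next
      case 3
      have "real (Suc (Suc k')) * C k = \<theta> * x * C (Suc k') - \<theta>\<^sup>2 * C k'"
        using rec[of "Suc k'"] 3 by simp
      also have "\<dots> = \<theta> * x * (poly (hermite_monic (Suc k')) x * \<theta> ^ Suc k' / fact (Suc k')) - \<theta>\<^sup>2 * (poly (hermite_monic k') x * \<theta> ^ k' / fact k')"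
        using less.IH[of "Suc k'"] less.IH[of k'] 3 by simp
      also have "\<dots> = real (Suc (Suc k')) * (poly (hermite_monic k) x * \<theta> ^ k / fact k)"
      proof -
        have "\<theta> * x * (H1 * (\<theta> * T) / (N1 * F)) - \<theta>\<^sup>2 * (H0 * T / F) = N2 * ((x * H1 - N1 * H0) * (\<theta> * (\<theta> * T)) / (N2 * (N1 * F)))"
          if "N1 \<noteq> 0" "N2 \<noteq> 0" "F \<noteq> 0" for H1 H0 T N1 N2 F :: real
          using that by (simp add: field_simps power2_eq_square)
        from this[of "real (Suc k')" "real (Suc (Suc k'))" "fact k'" "poly (hermite_monic (Suc k')) x" "\<theta> ^ k'" "poly (hermite_monic k') x"]
        show ?thesis unfolding 3 poly_hermite_monic_Suc by (simp only: fact_Suc power_Suc of_nat_mult of_nat_fact) simp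
      qed
      finally have "real (Suc (Suc k')) * C k = real (Suc (Suc k')) * (poly (hermite_monic k) x * \<theta> ^ k / fact k)" .
      then show ?thesis by (simp only: mult_cancel_left of_nat_eq_0_iff) simp
    qed
  qed
  then show ?thesis by (simp add: C_def a_def b_def)
qed

lemma hermite_generating_function:
  "(\<lambda>k. poly (hermite_monic k) x * \<theta> ^ k / fact k) sums exp (\<theta> * x - \<theta>\<^sup>2 / 2)"
proof -
  have ea: "(\<lambda>i. y ^ i / fact i) sums exp y" for y :: real
    using exp_converges[of y] by (simp add: divide_inverse mult.commute)
  have "(\<lambda>k. \<Sum>i\<le>k. (\<theta> * x) ^ i / fact i * even_exp_coeff (- \<theta>\<^sup>2 / 2) (k - i)) sums
      ((\<Sum>k. (\<theta> * x) ^ k / fact k) * (\<Sum>k. even_exp_coeff (- \<theta>\<^sup>2 / 2) k))"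
  proof (rule Cauchy_product_sums)
    show "summable (\<lambda>k. norm ((\<theta> * x) ^ k / fact k))"
      using ea[of "\<bar>\<theta> * x\<bar>"] by (simp add: power_abs abs_mult sums_iff)
    show "summable (\<lambda>k. norm (even_exp_coeff (- \<theta>\<^sup>2 / 2) k))"
      using even_exp_coeff_sums[of "\<bar>- \<theta>\<^sup>2 / 2\<bar>"] unfolding real_norm_def abs_even_exp_coeff by (simp only: sums_iff)
  qed
  also have "(\<Sum>k. (\<theta> * x) ^ k / fact k) * (\<Sum>k. even_exp_coeff (- \<theta>\<^sup>2 / 2) k) = exp (\<theta> * x - \<theta>\<^sup>2 / 2)"
    using ea[of "\<theta> * x"] even_exp_coeff_sums[of "- \<theta>\<^sup>2 / 2"] by (simp add: sums_iff flip: exp_add)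
  finally show ?thesis unfolding hermite_cauchy_product .
qed

text \<open>Absolute values turn the factor \<open>exp (- \<theta>\<^sup>2 / 2)\<close> into its
  counterpart with positive sign. The bound is uniform in \<open>n\<close> and serves as the
  dominating function for termwise integration.\<close>

lemma hermite_generating_function_abs:
  "(\<Sum>k<n. \<bar>poly (hermite_monic k) x * \<theta> ^ k / fact k\<bar>) \<le> exp (\<bar>\<theta>\<bar> * \<bar>x\<bar> + \<theta>\<^sup>2 / 2)"
proof -
  let ?u = "\<lambda>k. \<Sum>i\<le>k. (\<bar>\<theta>\<bar> * \<bar>x\<bar>) ^ i / fact i * even_exp_coeff (\<theta>\<^sup>2 / 2) (k - i)"
  have ea: "(\<lambda>i. y ^ i / fact i) sums exp y" for y :: real
    using exp_converges[of y] by (simp add: divide_inverse mult.commute)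
  have ee: "even_exp_coeff (\<theta>\<^sup>2 / 2) k \<ge> 0" for k by (simp add: even_exp_coeff_def)
  have "?u sums ((\<Sum>k. (\<bar>\<theta>\<bar> * \<bar>x\<bar>) ^ k / fact k) * (\<Sum>k. even_exp_coeff (\<theta>\<^sup>2 / 2) k))"
  proof (rule Cauchy_product_sums)
    show "summable (\<lambda>k. norm ((\<bar>\<theta>\<bar> * \<bar>x\<bar>) ^ k / fact k))"
      using ea[of "\<bar>\<theta>\<bar> * \<bar>x\<bar>"] by (simp add: sums_iff)
    show "summable (\<lambda>k. norm (even_exp_coeff (\<theta>\<^sup>2 / 2) k))"
      using even_exp_coeff_sums[of "\<theta>\<^sup>2 / 2"] ee by (simp add: sums_iff)
  qed
  also have "(\<Sum>k. (\<bar>\<theta>\<bar> * \<bar>x\<bar>) ^ k / fact k) * (\<Sum>k. even_exp_coeff (\<theta>\<^sup>2 / 2) k) = exp (\<bar>\<theta>\<bar> * \<bar>x\<bar> + \<theta>\<^sup>2 / 2)"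
    using ea[of "\<bar>\<theta>\<bar> * \<bar>x\<bar>"] even_exp_coeff_sums[of "\<theta>\<^sup>2 / 2"] by (simp add: sums_iff flip: exp_add)
  finally have u: "?u sums exp (\<bar>\<theta>\<bar> * \<bar>x\<bar> + \<theta>\<^sup>2 / 2)" .
  have "(\<Sum>k<n. \<bar>poly (hermite_monic k) x * \<theta> ^ k / fact k\<bar>) \<le> (\<Sum>k<n. ?u k)"
  proof (rule sum_mono)
    fix k
    have h: "\<bar>even_exp_coeff (- (\<theta>\<^sup>2 / 2)) j\<bar> = even_exp_coeff (\<theta>\<^sup>2 / 2) j" for j
      unfolding abs_even_exp_coeff by simp
    show "\<bar>poly (hermite_monic k) x * \<theta> ^ k / fact k\<bar> \<le> ?u k"
      unfolding hermite_cauchy_product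
      by (rule order_trans[OF sum_abs]) (simp add: abs_mult h power_abs power_mult_distrib)
  qed
  also have "\<dots> \<le> exp (\<bar>\<theta>\<bar> * \<bar>x\<bar> + \<theta>\<^sup>2 / 2)"
    using u ee by (intro sum_le_suminf[THEN order_trans]) (auto simp: sums_iff intro!: sum_nonneg)
  finally show ?thesis .
qed

text \<open>Cameron--Martin: a shift of the argument is traded for a density, which is exactly the
  Hermite generating function.\<close>

lemma integral_gam_shift:
  assumes [measurable]: "f \<in> borel_measurable borel"
  shows "(\<integral>r. f (r + \<theta>) \<partial>gam) = (\<integral>y. f y * exp (\<theta> * y - \<theta>\<^sup>2 / 2) \<partial>gam)"
proof -
  have "(\<integral>r. f (r + \<theta>) \<partial>gam) = (\<integral>r. std_normal_density r * f (r + \<theta>) \<partial>lborel)"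
    by (subst integral_density) auto
  also have "\<dots> = (\<integral>y. std_normal_density (y - \<theta>) * f y \<partial>lborel)"
    using lborel_integral_real_affine[of 1 "\<lambda>y. std_normal_density (y - \<theta>) * f y" \<theta>] by (simp add: add.commute)
  also have "\<dots> = (\<integral>y. std_normal_density y * (f y * exp (\<theta> * y - \<theta>\<^sup>2 / 2)) \<partial>lborel)"
  proof (rule Bochner_Integration.integral_cong)
    fix y
    have "- (y - \<theta>)\<^sup>2 / 2 = - y\<^sup>2 / 2 + (\<theta> * y - \<theta>\<^sup>2 / 2)" by (simp add: power2_eq_square field_simps)
    then have "exp (- (y - \<theta>)\<^sup>2 / 2) = exp (- y\<^sup>2 / 2) * exp (\<theta> * y - \<theta>\<^sup>2 / 2)" by (simp only: exp_add)
    then show "std_normal_density (y - \<theta>) * f y = std_normal_density y * (f y * exp (\<theta> * y - \<theta>\<^sup>2 / 2))"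
      by (simp add: std_normal_density_def)
  qed simp
  also have "\<dots> = (\<integral>y. f y * exp (\<theta> * y - \<theta>\<^sup>2 / 2) \<partial>gam)"
    by (subst integral_density) auto
  finally show ?thesis .
qed

lemma inner_gauss_gam: "f \<in> borel_measurable borel \<Longrightarrow> h \<in> borel_measurable borel \<Longrightarrow> inner_gauss f h = (\<integral>x. f x * h x \<partial>gam)"
  unfolding inner_gauss_def by (subst integral_density) (auto simp: mult_ac)

lemma measurable_poly [measurable]: "poly p \<in> borel_measurable borel" for p :: "real poly"
  by (intro borel_measurable_continuous_onI continuous_intros) 

text \<open>The shifted mean is the pairing of \<open>f\<close> with the generating function. One
  integrable majorant of all absolute partial sums justifies the interchange of sum and integral and
  yields absolute convergence as well.\<close>

lemma hermite_expansion:
  assumes [measurable]: "f \<in> borel_measurable borel" and f: "\<And>x. \<bar>f x\<bar> \<le> A * exp (c * \<bar>x\<bar>)"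
  shows "(\<lambda>k. hermite_coeff f k * \<theta> ^ k / sqrt (fact k)) sums (\<integral>r. f (r + \<theta>) \<partial>gam)"
    and "summable (\<lambda>k. \<bar>hermite_coeff f k * \<theta> ^ k / sqrt (fact k)\<bar>)"
proof -
  define F where "F k y = f y * (poly (hermite_monic k) y * \<theta> ^ k / fact k)" for k y
  define D where "D y = (A * exp (\<theta>\<^sup>2 / 2)) * exp ((c + \<bar>\<theta>\<bar>) * \<bar>y\<bar>)" for y
  have A: "A \<ge> 0" using f[of 0] by simp
  have [measurable]: "F k \<in> borel_measurable borel" for k unfolding F_def by measurable
  have part: "(\<Sum>k<n. \<bar>F k y\<bar>) \<le> D y" for n y
  proof -
    have "(\<Sum>k<n. \<bar>F k y\<bar>) = \<bar>f y\<bar> * (\<Sum>k<n. \<bar>poly (hermite_monic k) y * \<theta> ^ k / fact k\<bar>)"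
      unfolding F_def abs_mult[of "f y"] sum_distrib_left ..
    also have "\<dots> \<le> (A * exp (c * \<bar>y\<bar>)) * exp (\<bar>\<theta>\<bar> * \<bar>y\<bar> + \<theta>\<^sup>2 / 2)"
      using A by (intro mult_mono f hermite_generating_function_abs) (auto intro: sum_nonneg)
    also have "\<dots> = D y" by (simp add: D_def algebra_simps flip: exp_add)
    finally show ?thesis .
  qed
  have Fb: "\<bar>F k y\<bar> \<le> D y" for k y
  proof -
    have "0 \<le> (\<Sum>l<k. \<bar>F l y\<bar>)" by (rule sum_nonneg) simp
    then show ?thesis using part[of y "Suc k"] unfolding sum.lessThan_Suc by linarith
  qed
  have F_int: "integrable gam (F k)" for k
    by (rule integrable_gam_bound(1)[OF _ Fb[unfolded D_def]]) measurable
  have D_int: "integrable gam D"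
    by (rule integrable_gam_bound(1)[of _ "A * exp (\<theta>\<^sup>2 / 2)" "c + \<bar>\<theta>\<bar>"]) (auto simp: D_def[abs_def] A abs_mult)
  have eqF: "(\<integral>y. F k y \<partial>gam) = hermite_coeff f k * \<theta> ^ k / sqrt (fact k)" for k
  proof -
    have mh: "hermite k \<in> borel_measurable borel" unfolding hermite_def[abs_def] by measurable
    have "F k y = f y * hermite k y * (\<theta> ^ k / sqrt (fact k))" for y
      by (simp add: F_def hermite_def real_sqrt_mult_self field_simps flip: power2_eq_square)
    then have "(\<integral>y. F k y \<partial>gam) = (\<integral>y. f y * hermite k y \<partial>gam) * (\<theta> ^ k / sqrt (fact k))" by simp
    then show ?thesis unfolding hermite_coeff_def by (simp add: inner_gauss_gam[OF _ mh])
  qed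
  have summ: "summable (\<lambda>k. \<integral>y. norm (F k y) \<partial>gam)"
  proof (rule bounded_imp_summable)
    show "0 \<le> (\<integral>y. norm (F k y) \<partial>gam)" for k by simp
    show "(\<Sum>k\<le>n. \<integral>y. norm (F k y) \<partial>gam) \<le> (\<integral>y. D y \<partial>gam)" for n
    proof -
      have "(\<Sum>k\<le>n. \<integral>y. norm (F k y) \<partial>gam) = (\<integral>y. (\<Sum>k\<le>n. norm (F k y)) \<partial>gam)"
        using F_int by (intro Bochner_Integration.integral_sum[symmetric]) auto
      also have "\<dots> \<le> (\<integral>y. D y \<partial>gam)"
        using F_int D_int part[of _ "Suc n"] by (intro integral_mono) (auto simp: lessThan_Suc_atMost)
      finally show ?thesis .
    qed
  qed
  have pt: "F k y = f y * (poly (hermite_monic k) y * \<theta> ^ k / fact k)" for k y by (simp add: F_def)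
  have ptsum: "summable (\<lambda>k. norm (F k y))" for y
    by (rule bounded_imp_summable[of _ "D y"]) (use part[of y "Suc n" for n] in \<open>auto simp: lessThan_Suc_atMost\<close>)
  have "(\<lambda>k. \<integral>y. F k y \<partial>gam) sums (\<integral>y. (\<Sum>k. F k y) \<partial>gam)"
    using F_int ptsum summ by (intro sums_integral) auto
  also have "(\<lambda>y. \<Sum>k. F k y) = (\<lambda>y. f y * exp (\<theta> * y - \<theta>\<^sup>2 / 2))"
  proof
    fix y
    show "(\<Sum>k. F k y) = f y * exp (\<theta> * y - \<theta>\<^sup>2 / 2)"
      unfolding pt suminf_mult[OF sums_summable[OF hermite_generating_function]]
        sums_unique[OF hermite_generating_function, symmetric] ..
  qed
  finally show "(\<lambda>k. hermite_coeff f k * \<theta> ^ k / sqrt (fact k)) sums (\<integral>r. f (r + \<theta>) \<partial>gam)"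
    unfolding eqF by (simp add: integral_gam_shift)
  show "summable (\<lambda>k. \<bar>hermite_coeff f k * \<theta> ^ k / sqrt (fact k)\<bar>)"
  proof (rule summable_comparison_test'[OF summ])
    fix k
    show "norm \<bar>hermite_coeff f k * \<theta> ^ k / sqrt (fact k)\<bar> \<le> (\<integral>y. norm (F k y) \<partial>gam)"
      unfolding eqF[symmetric] using integral_abs_bound[of gam "F k"] by simp
  qed
qed

section \<open>Parity and the constant \<tau>\<close>

lemma integral_gam_uminus:
  fixes f :: "real \<Rightarrow> real"
  assumes [measurable]: "f \<in> borel_measurable borel"
  shows "(\<integral>r. f (- r) \<partial>gam) = (\<integral>r. f r \<partial>gam)"
proof -
  have "(\<integral>r. f r \<partial>gam) = (\<integral>r. std_normal_density r * f r \<partial>lborel)"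
    by (subst integral_density) auto
  also have "\<dots> = (\<integral>r. std_normal_density (- r) * f (- r) \<partial>lborel)"
    using lborel_integral_real_affine[of "-1" "\<lambda>r. std_normal_density r * f r" 0] by simp
  also have "\<dots> = (\<integral>r. std_normal_density r * f (- r) \<partial>lborel)" by (simp add: normal_density_def)
  also have "\<dots> = (\<integral>r. f (- r) \<partial>gam)" by (subst integral_density) auto
  finally show ?thesis by simp
qed

lemma integral_gam_odd:
  fixes f :: "real \<Rightarrow> real"
  assumes "f \<in> borel_measurable borel" "\<And>x. f (- x) = - f x"
  shows "(\<integral>r. f r \<partial>gam) = 0"
  using integral_gam_uminus[OF assms(1)] by (simp add: assms(2))

lemma hermite_coeff_even_of_odd:
  assumes [measurable]: "f \<in> borel_measurable borel" and odd: "\<And>x. f (- x) = - f x"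
  shows "hermite_coeff f 0 = 0" "hermite_coeff f 2 = 0"
proof -
  have mh: "hermite k \<in> borel_measurable borel" for k unfolding hermite_def[abs_def] by measurable
  have h: "hermite 0 x = 1" "hermite 2 x = (x\<^sup>2 - 1) / sqrt 2" for x
    by (simp_all add: hermite_def numeral_2_eq_2 pderiv_pCons power2_eq_square)
  have "(\<integral>x. f x * hermite 0 x \<partial>gam) = 0" "(\<integral>x. f x * hermite 2 x \<partial>gam) = 0"
    by (rule integral_gam_odd; use mh in \<open>simp add: h odd\<close>)+
  then show "hermite_coeff f 0 = 0" "hermite_coeff f 2 = 0"
    unfolding hermite_coeff_def by (simp_all add: inner_gauss_gam[OF _ mh])
qed

text \<open>Oddness kills the terms of order 0 and 2, and subtracting the linear part kills order 1.
  This is why the series, and with it \<open>tau\<close>, begins at order 3.\<close>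

lemma shifted_mean_expansion:
  assumes m [measurable]: "f \<in> borel_measurable borel" and f: "\<And>x. \<bar>f x\<bar> \<le> A * exp (c * \<bar>x\<bar>)"
    and odd: "\<And>x. f (- x) = - f x"
  defines "g \<equiv> \<lambda>x. f x - hermite_coeff f 1 * x"
  shows "(\<lambda>k. hermite_coeff f (k + 3) * \<theta> ^ (k + 3) / sqrt (fact (k + 3))) sums (\<integral>r. g (r + \<theta>) \<partial>gam)"
proof -
  let ?t = "\<lambda>k. hermite_coeff f k * \<theta> ^ k / sqrt (fact k)"
  have fi: "integrable gam (\<lambda>r. f (r + \<theta>))"
  proof (rule integrable_gam_bound(1))
    have A: "A \<ge> 0" using f[of 0] by simp
    show "\<bar>f (r + \<theta>)\<bar> \<le> A * exp (\<bar>c\<bar> * \<bar>\<theta>\<bar>) * exp (\<bar>c\<bar> * \<bar>r\<bar>)" for r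
    proof -
      have "c * \<bar>r + \<theta>\<bar> \<le> \<bar>c\<bar> * (\<bar>\<theta>\<bar> + \<bar>r\<bar>)" by (intro mult_mono) auto
      then have "A * exp (c * \<bar>r + \<theta>\<bar>) \<le> A * exp (\<bar>c\<bar> * (\<bar>\<theta>\<bar> + \<bar>r\<bar>))" using A by (intro mult_left_mono) auto
      then show ?thesis using f[of "r + \<theta>"] by (simp add: distrib_left exp_add mult.assoc)
    qed
  qed measurable
  have ri: "integrable gam (\<lambda>r::real. r)"
    by (rule integrable_gam_bound(1)[of _ 1 1]) (auto simp: abs_le_exp)
  have r0: "(\<integral>r. r \<partial>gam) = 0" by (rule integral_gam_odd) auto
  have "(\<integral>r. g (r + \<theta>) \<partial>gam) = (\<integral>r. f (r + \<theta>) - hermite_coeff f 1 * (r + \<theta>) \<partial>gam)" by (simp add: g_def)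
  also have "\<dots> = (\<integral>r. f (r + \<theta>) \<partial>gam) - (\<integral>r. hermite_coeff f 1 * (r + \<theta>) \<partial>gam)"
    using fi ri by (intro Bochner_Integration.integral_diff) auto
  also have "(\<integral>r. hermite_coeff f 1 * (r + \<theta>) \<partial>gam) = hermite_coeff f 1 * \<theta>"
    using ri r0 gam.prob_space by (simp add: distrib_left)
  finally have eq: "(\<integral>r. g (r + \<theta>) \<partial>gam) = (\<integral>r. f (r + \<theta>) \<partial>gam) - hermite_coeff f 1 * \<theta>" .
  have "(\<lambda>k. ?t (k + 3)) sums ((\<integral>r. f (r + \<theta>) \<partial>gam) - (\<Sum>k<3. ?t k))"
    by (rule sums_split_initial_segment[OF hermite_expansion(1)[OF m f]])
  also have "(\<Sum>k<3. ?t k) = hermite_coeff f 1 * \<theta>"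
    using hermite_coeff_even_of_odd[OF m odd] by (simp add: numeral_3_eq_3 lessThan_Suc numeral_2_eq_2)
  finally show ?thesis unfolding eq .
qed

text \<open>Evaluation at the limiting shift \<open>(lam - 1) / \<beta>\<close>. The factor \<beta>
  in front is the limit of \<open>m / sqrt n\<close> and lowers the power of \<beta> in each
  denominator by one.\<close>

lemma tau_eq:
  assumes "f \<in> borel_measurable borel" and "\<And>x. \<bar>f x\<bar> \<le> A * exp (c * \<bar>x\<bar>)" and "\<And>x. f (- x) = - f x" and "\<beta> > 0"
  shows "tau f \<beta> lam = \<beta> * (\<integral>r. (\<lambda>x. f x - hermite_coeff f 1 * x) (r + (lam - 1) / \<beta>) \<partial>gam)"
proof -
  have "(\<lambda>k. \<beta> * (hermite_coeff f (k + 3) * ((lam - 1) / \<beta>) ^ (k + 3) / sqrt (fact (k + 3)))) sums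
     (\<beta> * (\<integral>r. (\<lambda>x. f x - hermite_coeff f 1 * x) (r + (lam - 1) / \<beta>) \<partial>gam))"
    by (rule sums_mult[OF shifted_mean_expansion[OF assms(1-3)]])
  moreover have "\<beta> * (hermite_coeff f (k + 3) * ((lam - 1) / \<beta>) ^ (k + 3) / sqrt (fact (k + 3))) =
      hermite_coeff f (k + 3) * (lam - 1) ^ (k + 3) / (sqrt (fact (k + 3)) * \<beta> ^ (k + 2))" for k
    using assms(4) by (simp add: power_divide power_add field_simps power_numeral_reduce)
  ultimately show ?thesis unfolding tau_def by (simp only: sums_iff)
qed

text \<open>For \<open>\<bar>\<theta>\<bar> \<le> 1\<close> every term of the series has a power of
  at least three, hence is at most its coefficient times \<open>\<theta>\<^sup>2\<close>. For larger
  \<theta> the growth of \<open>g\<close> suffices, as \<open>\<theta>\<^sup>2\<close> exceeds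
  1.\<close>

lemma shifted_mean_quadratic_bound:
  assumes m: "f \<in> borel_measurable borel" and f: "\<And>x. \<bar>f x\<bar> \<le> A * exp (c * \<bar>x\<bar>)" and odd: "\<And>x. f (- x) = - f x"
    and g: "exp_lip B c (\<lambda>x. f x - hermite_coeff f 1 * x)" and c: "c \<ge> 0"
  shows "\<exists>C0. \<forall>\<theta>. \<bar>\<integral>r. (\<lambda>x. f x - hermite_coeff f 1 * x) (r + \<theta>) \<partial>gam\<bar> \<le> C0 * \<theta>\<^sup>2 * exp (c * \<bar>\<theta>\<bar>)"
proof -
  define g where "g = (\<lambda>x. f x - hermite_coeff f 1 * x)"
  define t where "t k = hermite_coeff f (k + 3) / sqrt (fact (k + 3))" for k
  have st: "summable (\<lambda>k. \<bar>t k\<bar>)"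
    using hermite_expansion(2)[OF m f, of 1, THEN summable_ignore_initial_segment, of 3] by (simp add: t_def)
  define C1 where "C1 = (\<Sum>k. \<bar>t k\<bar>)"
  define C2 where "C2 = B * (2 * exp (c\<^sup>2 / 2))"
  have C1: "C1 \<ge> 0" using st by (simp add: C1_def suminf_nonneg)
  have B: "B \<ge> 0" using g by (rule exp_lip_nonneg)
  then have C2: "C2 \<ge> 0" by (simp add: C2_def)
  have "\<bar>\<integral>r. g (r + \<theta>) \<partial>gam\<bar> \<le> (C1 + C2) * \<theta>\<^sup>2 * exp (c * \<bar>\<theta>\<bar>)" for \<theta>
  proof (cases "\<bar>\<theta>\<bar> \<le> 1")
    case True
    have s: "(\<lambda>k. t k * \<theta> ^ (k + 3)) sums (\<integral>r. g (r + \<theta>) \<partial>gam)"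
      using shifted_mean_expansion[OF m f odd, of \<theta>] unfolding g_def t_def by (simp add: mult_ac)
    have le: "norm (t k * \<theta> ^ (k + 3)) \<le> \<bar>t k\<bar> * \<theta>\<^sup>2" for k
    proof -
      have "\<bar>\<theta>\<bar> ^ (k + 3) \<le> \<bar>\<theta>\<bar> ^ 2" using True by (intro power_decreasing) auto
      then show ?thesis by (simp add: abs_mult power_abs mult_left_mono)
    qed
    have "\<bar>\<integral>r. g (r + \<theta>) \<partial>gam\<bar> = norm (\<Sum>k. t k * \<theta> ^ (k + 3))" using s by (simp add: sums_iff)
    also have "\<dots> \<le> (\<Sum>k. \<bar>t k\<bar> * \<theta>\<^sup>2)"
      by (rule norm_suminf_le[OF le]) (use st in \<open>simp add: summable_mult2\<close>)
    also have "\<dots> = C1 * \<theta>\<^sup>2" using st by (simp add: C1_def suminf_mult2)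
    also have "\<dots> \<le> (C1 + C2) * \<theta>\<^sup>2 * 1" using C2 by (simp add: mult_right_mono)
    also have "\<dots> \<le> (C1 + C2) * \<theta>\<^sup>2 * exp (c * \<bar>\<theta>\<bar>)"
      using C1 C2 c by (intro mult_left_mono) auto
    finally show ?thesis .
  next
    case False
    have gb: "\<bar>g (r + \<theta>)\<bar> \<le> (B * exp (c * \<bar>\<theta>\<bar>)) * exp (c * \<bar>r\<bar>)" for r
    proof -
      have "\<bar>g (r + \<theta>)\<bar> \<le> B * exp (c * \<bar>r + \<theta>\<bar>)" using exp_lipD(1)[OF g] by (simp add: g_def)
      also have "\<dots> \<le> B * exp (c * (\<bar>\<theta>\<bar> + \<bar>r\<bar>))" using B c by (intro mult_left_mono) (auto intro: mult_left_mono)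
      finally show ?thesis by (simp add: distrib_left exp_add mult.assoc)
    qed
    have [measurable]: "g \<in> borel_measurable borel" unfolding g_def by (rule exp_lip_measurable[OF g])
    have mg: "(\<lambda>r. g (r + \<theta>)) \<in> borel_measurable borel" by measurable
    have "\<bar>\<integral>r. g (r + \<theta>) \<partial>gam\<bar> \<le> C2 * 1 * exp (c * \<bar>\<theta>\<bar>)"
      using integrable_gam_bound(2)[OF mg gb] by (simp add: C2_def mult_ac)
    also have "\<dots> \<le> (C1 + C2) * \<theta>\<^sup>2 * exp (c * \<bar>\<theta>\<bar>)"
    proof -
      have "1 \<le> \<theta>\<^sup>2" using False power_mono[of 1 "\<bar>\<theta>\<bar>" 2] by simp
      then show ?thesis using C1 C2 by (intro mult_right_mono mult_mono) auto
    qed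
    finally show ?thesis .
  qed
  then show ?thesis unfolding g_def by blast
qed

section \<open>Calculus of functions of exponential growth\<close>

lemma exp_lip_mono:
  assumes "exp_lip A c H" "A \<le> A'" "c \<le> c'"
  shows "exp_lip A' c' H"
proof -
  have A: "A \<ge> 0" using assms(1) by (rule exp_lip_nonneg)
  have e: "exp (c * t) \<le> exp (c' * t)" if "t \<ge> 0" for t using assms that by (simp add: mult_right_mono)
  show ?thesis unfolding exp_lip_def
  proof (intro conjI allI)
    fix x y
    have "\<bar>H x\<bar> \<le> A * exp (c * \<bar>x\<bar>)" by (rule exp_lipD[OF assms(1)])
    also have "\<dots> \<le> A' * exp (c' * \<bar>x\<bar>)" using A assms e by (intro mult_mono) auto
    finally show "\<bar>H x\<bar> \<le> A' * exp (c' * \<bar>x\<bar>)" .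
    have "\<bar>H x - H y\<bar> \<le> A * \<bar>x - y\<bar> * exp (c * (\<bar>x\<bar> + \<bar>y\<bar>))" by (rule exp_lipD[OF assms(1)])
    also have "\<dots> \<le> A' * \<bar>x - y\<bar> * exp (c' * (\<bar>x\<bar> + \<bar>y\<bar>))" using A assms e by (intro mult_mono) auto
    finally show "\<bar>H x - H y\<bar> \<le> A' * \<bar>x - y\<bar> * exp (c' * (\<bar>x\<bar> + \<bar>y\<bar>))" .
  qed
qed

lemma exp_lip_diff:
  assumes "exp_lip A c H" "exp_lip A' c H'"
  shows "exp_lip (A + A') c (\<lambda>x. H x - H' x)"
  unfolding exp_lip_def
proof (intro conjI allI)
  fix x y
  have "\<bar>H x - H' x\<bar> \<le> \<bar>H x\<bar> + \<bar>H' x\<bar>" by simp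
  also have "\<dots> \<le> A * exp (c * \<bar>x\<bar>) + A' * exp (c * \<bar>x\<bar>)" using assms by (intro add_mono exp_lipD(1))
  finally show "\<bar>H x - H' x\<bar> \<le> (A + A') * exp (c * \<bar>x\<bar>)" by (simp add: distrib_right)
  have "\<bar>H x - H' x - (H y - H' y)\<bar> \<le> \<bar>H x - H y\<bar> + \<bar>H' x - H' y\<bar>" by simp
  also have "\<dots> \<le> A * \<bar>x - y\<bar> * exp (c * (\<bar>x\<bar> + \<bar>y\<bar>)) + A' * \<bar>x - y\<bar> * exp (c * (\<bar>x\<bar> + \<bar>y\<bar>))"
    using assms by (intro add_mono exp_lipD(2))
  finally show "\<bar>H x - H' x - (H y - H' y)\<bar> \<le> (A + A') * \<bar>x - y\<bar> * exp (c * (\<bar>x\<bar> + \<bar>y\<bar>))"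
    by (simp add: distrib_right)
qed

lemma exp_lip_linear: "exp_lip \<bar>a\<bar> 1 (\<lambda>x. a * x)"
  unfolding exp_lip_def
proof (intro conjI allI)
  fix x y :: real
  show "\<bar>a * x\<bar> \<le> \<bar>a\<bar> * exp (1 * \<bar>x\<bar>)" unfolding abs_mult by (intro mult_left_mono) (simp_all add: abs_le_exp)
  have "\<bar>a * x - a * y\<bar> = \<bar>a\<bar> * \<bar>x - y\<bar> * 1" by (simp add: abs_mult flip: right_diff_distrib)
  also have "\<dots> \<le> \<bar>a\<bar> * \<bar>x - y\<bar> * exp (1 * (\<bar>x\<bar> + \<bar>y\<bar>))" by (intro mult_left_mono) auto
  finally show "\<bar>a * x - a * y\<bar> \<le> \<bar>a\<bar> * \<bar>x - y\<bar> * exp (1 * (\<bar>x\<bar> + \<bar>y\<bar>))" .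
qed

lemma exp_lip_const: "c \<ge> 0 \<Longrightarrow> exp_lip \<bar>a\<bar> c (\<lambda>_. a)"
  using mult_left_mono[of 1 "exp (c * t)" "\<bar>a\<bar>" for t] by (auto simp: exp_lip_def)

lemma exp_lip_shift:
  assumes H: "exp_lip A c H" and c: "c \<ge> 0" and \<theta>: "\<bar>\<theta>\<bar> \<le> \<Theta>"
  shows "exp_lip (A * exp (2 * c * \<Theta>)) c (\<lambda>x. H (x + \<theta>))"
  unfolding exp_lip_def
proof (intro conjI allI)
  have A: "A \<ge> 0" using H by (rule exp_lip_nonneg)
  fix x y
  have "\<bar>H (x + \<theta>)\<bar> \<le> A * exp (c * \<bar>x + \<theta>\<bar>)" by (rule exp_lipD[OF H])
  also have "\<dots> \<le> A * exp (c * (2 * \<Theta> + \<bar>x\<bar>))"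
    using A c \<theta> by (intro mult_left_mono) (auto intro: mult_left_mono)
  finally show "\<bar>H (x + \<theta>)\<bar> \<le> A * exp (2 * c * \<Theta>) * exp (c * \<bar>x\<bar>)" by (simp add: algebra_simps exp_add)
  have "\<bar>H (x + \<theta>) - H (y + \<theta>)\<bar> \<le> A * \<bar>x - y\<bar> * exp (c * (\<bar>x + \<theta>\<bar> + \<bar>y + \<theta>\<bar>))"
    using exp_lipD(2)[OF H, of "x + \<theta>" "y + \<theta>"] by simp
  also have "\<dots> \<le> A * \<bar>x - y\<bar> * exp (c * (2 * \<Theta> + (\<bar>x\<bar> + \<bar>y\<bar>)))"
    using A c \<theta> by (intro mult_left_mono) (auto intro: mult_left_mono)
  also have "\<dots> = A * exp (2 * c * \<Theta>) * \<bar>x - y\<bar> * exp (c * (\<bar>x\<bar> + \<bar>y\<bar>))"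
    by (simp add: algebra_simps flip: exp_add)
  finally show "\<bar>H (x + \<theta>) - H (y + \<theta>)\<bar> \<le> A * exp (2 * c * \<Theta>) * \<bar>x - y\<bar> * exp (c * (\<bar>x\<bar> + \<bar>y\<bar>))" .
qed

lemma twice_differentiable_at_imp:
  assumes "twice_differentiable_at f x" shows "f differentiable (at x)"
  using assms eventually_nhds_x_imp_x[of "\<lambda>y. f differentiable (at y)" x] by (simp add: twice_differentiable_at_def)

text \<open>The derivative bound is integrated between the two points. Continuity together with
  finitely many exceptional points is what the fundamental theorem of calculus for the gauge
  integral tolerates.\<close>

lemma exp_lip_of_deriv:
  assumes cont: "continuous_on UNIV f" and fin: "finite {x. \<not> twice_differentiable_at f x}" and c: "c > 0"
    and f0: "\<And>x. \<bar>f x\<bar> \<le> c * exp (c * \<bar>x\<bar>)"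
    and f1: "\<And>x. f differentiable (at x) \<Longrightarrow> \<bar>deriv f x\<bar> \<le> c * exp (c * \<bar>x\<bar>)"
  shows "exp_lip c c f"
proof -
  define S where "S = {x. \<not> twice_differentiable_at f x}"
  have le: "\<bar>f b - f a\<bar> \<le> c * \<bar>a - b\<bar> * exp (c * (\<bar>a\<bar> + \<bar>b\<bar>))" if ab: "a \<le> b" for a b
  proof -
    have d: "f differentiable (at x)" if "x \<notin> S" for x using that twice_differentiable_at_imp by (auto simp: S_def)
    have int: "(deriv f has_integral (f b - f a)) {a..b}"
    proof (rule fundamental_theorem_of_calculus_interior_strong[where S=S])
      show "finite S" using fin by (simp add: S_def)
      show "continuous_on {a..b} f" using cont continuous_on_subset by blast
      fix x assume "x \<in> {a<..<b} - S"
      then have "(f has_real_derivative deriv f x) (at x)"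
        using d by (simp add: DERIV_deriv_iff_real_differentiable)
      then show "(f has_vector_derivative deriv f x) (at x)"
        by (simp add: has_real_derivative_iff_has_vector_derivative)
    qed (rule ab)
    have "norm (f b - f a) \<le> (c * exp (c * (\<bar>a\<bar> + \<bar>b\<bar>))) * Henstock_Kurzweil_Integration.content {a..b}"
    proof (rule has_integral_bound_real[OF _ _ int, where S=S])
      fix x assume x: "x \<in> {a..b} - S"
      then have "\<bar>deriv f x\<bar> \<le> c * exp (c * \<bar>x\<bar>)" using d f1 by auto
      also have "\<dots> \<le> c * exp (c * (\<bar>a\<bar> + \<bar>b\<bar>))"
        using x c by (intro mult_left_mono) (auto intro!: mult_left_mono)
      finally show "norm (deriv f x) \<le> c * exp (c * (\<bar>a\<bar> + \<bar>b\<bar>))" by simp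
    qed (use fin c in \<open>auto simp: S_def\<close>)
    then show ?thesis using ab by (simp add: mult_ac)
  qed
  show ?thesis unfolding exp_lip_def
  proof (intro conjI allI f0)
    fix x y
    show "\<bar>f x - f y\<bar> \<le> c * \<bar>x - y\<bar> * exp (c * (\<bar>x\<bar> + \<bar>y\<bar>))"
      using le[of x y] le[of y x] by (cases "x \<le> y") (auto simp: abs_minus_commute add.commute)
  qed
qed

text \<open>For \<sigma> = -1 the reflection of the Gaussian variable turns the shift by
  \<open>- \<theta>\<close> into a shift by \<theta>, and oddness of \<open>g\<close> brings out the
  sign.\<close>

lemma integral_gam_shift_sign:
  fixes g :: "real \<Rightarrow> real"
  assumes [measurable]: "g \<in> borel_measurable borel" and odd: "\<And>x. g (- x) = - g x" and \<sigma>: "\<sigma> \<in> {-1, 1}"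
  shows "(\<integral>r. g (r + \<theta> * \<sigma>) \<partial>gam) = \<sigma> * (\<integral>r. g (r + \<theta>) \<partial>gam)"
proof (cases "\<sigma> = 1")
  case False
  then have s: "\<sigma> = -1" using \<sigma> by auto
  have "(\<integral>r. g (r + \<theta> * \<sigma>) \<partial>gam) = (\<integral>r. g (- r + \<theta> * \<sigma>) \<partial>gam)"
    by (rule integral_gam_uminus[of "\<lambda>r. g (r + \<theta> * \<sigma>)", symmetric]) measurable
  also have "\<dots> = (\<integral>r. - g (r + \<theta>) \<partial>gam)"
  proof (rule Bochner_Integration.integral_cong[OF refl])
    fix r show "g (- r + \<theta> * \<sigma>) = - g (r + \<theta>)" using odd[of "r + \<theta>"] by (simp add: s)
  qed
  finally show ?thesis by (simp add: s)
qed simp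

text \<open>For \<open>\<sigma> = \<plusminus>1\<close> and odd \<open>g\<close> the mean of \<open>g (u + \<theta>\<sigma>)\<close> is \<open>\<sigma>\<close> times its value at \<open>\<sigma> = 1\<close>: subtracted, it leaves
  a centred function, and on the support of the spike it contributes a multiple of \<open>v v\<^sup>T\<close>.\<close>

definition block_function :: "(real \<Rightarrow> real) \<Rightarrow> real \<Rightarrow> real \<Rightarrow> real \<Rightarrow> real" where
  "block_function g \<theta> \<sigma> u = g (u + \<theta> * \<sigma>) - \<sigma> * (\<integral>r. g (r + \<theta>) \<partial>gam) - g u"

lemma exp_lip_integrable: "exp_lip A c g \<Longrightarrow> integrable gam g"
  using integrable_gam_bound(1)[of g A c] exp_lip_measurable exp_lipD(1) by blast

lemma exp_lip_integral_le: "exp_lip A c g \<Longrightarrow> \<bar>\<integral>r. g r \<partial>gam\<bar> \<le> A * (2 * exp (c\<^sup>2 / 2))"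
  using integrable_gam_bound(2)[of g A c] exp_lip_measurable exp_lipD(1) by blast

lemma block_function_mean:
  assumes g: "exp_lip A c g" and c: "c \<ge> 0" and odd: "\<And>x. g (- x) = - g x" and \<sigma>: "\<sigma> \<in> {-1, 1}"
  shows "(\<integral>r. block_function g \<theta> \<sigma> r \<partial>gam) = 0"
proof -
  note m = exp_lip_measurable[OF g]
  have i: "integrable gam (\<lambda>r. g (r + q))" for q
    by (rule exp_lip_integrable[OF exp_lip_shift[OF g c order_refl]])
  have "(\<integral>r. block_function g \<theta> \<sigma> r \<partial>gam) = (\<integral>r. g (r + \<theta> * \<sigma>) \<partial>gam) - \<sigma> * (\<integral>r. g (r + \<theta>) \<partial>gam) - (\<integral>r. g r \<partial>gam)"
    unfolding block_function_def using i exp_lip_integrable[OF g] gam.prob_space by simp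
  then show ?thesis by (simp add: integral_gam_shift_sign[OF m odd \<sigma>] integral_gam_odd[OF m odd])
qed

text \<open>The constant depends on the shift only through its bound \<open>\<Theta>\<close>. As the
  shifts converge with growing size, one constant then serves all sizes and both signs.\<close>

lemma block_function_exp_lip:
  assumes g: "exp_lip A c g" and c: "c \<ge> 0" and \<sigma>: "\<sigma> \<in> {-1, 1}" and \<theta>: "\<bar>\<theta>\<bar> \<le> \<Theta>"
  shows "exp_lip (A * exp (2 * c * \<Theta>) + A * exp (2 * c * \<Theta>) * (2 * exp (c\<^sup>2 / 2)) + A) c (block_function g \<theta> \<sigma>)"
proof -
  have s: "\<bar>\<theta> * \<sigma>\<bar> \<le> \<Theta>" using \<theta> \<sigma> by auto
  have "\<bar>\<sigma> * (\<integral>r. g (r + \<theta>) \<partial>gam)\<bar> \<le> A * exp (2 * c * \<Theta>) * (2 * exp (c\<^sup>2 / 2))"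
    using exp_lip_integral_le[OF exp_lip_shift[OF g c \<theta>]] \<sigma> by (auto simp: abs_mult)
  then have k: "exp_lip (A * exp (2 * c * \<Theta>) * (2 * exp (c\<^sup>2 / 2))) c (\<lambda>_. \<sigma> * (\<integral>r. g (r + \<theta>) \<partial>gam))"
    by (rule exp_lip_mono[OF exp_lip_const[OF c] _ order_refl])
  show ?thesis unfolding block_function_def[abs_def]
    by (rule exp_lip_diff[OF exp_lip_diff[OF exp_lip_shift[OF g c s] k] g])
qed

text \<open>Lets the shift of finite size be replaced by its limit in the coefficient of the
  rank-one part.\<close>

lemma continuous_shifted_mean:
  assumes g: "exp_lip A c g" and c: "c \<ge> 0"
  shows "isCont (\<lambda>\<theta>. \<integral>r. g (r + \<theta>) \<partial>gam) \<theta>0"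
proof -
  have i: "integrable gam (\<lambda>r. g (r + q))" for q
    by (rule exp_lip_integrable[OF exp_lip_shift[OF g c order_refl]])
  let ?K = "\<lambda>\<theta>. A * \<bar>\<theta> - \<theta>0\<bar> * exp (c * (\<bar>\<theta>\<bar> + \<bar>\<theta>0\<bar>)) * (2 * exp ((2 * c)\<^sup>2 / 2))"
  have le: "\<bar>(\<integral>r. g (r + \<theta>) \<partial>gam) - (\<integral>r. g (r + \<theta>0) \<partial>gam)\<bar> \<le> ?K \<theta>" for \<theta>
  proof -
    have A: "A \<ge> 0" using g by (rule exp_lip_nonneg)
    note [measurable] = exp_lip_measurable[OF g]
    have "(\<integral>r. g (r + \<theta>) \<partial>gam) - (\<integral>r. g (r + \<theta>0) \<partial>gam) = (\<integral>r. g (r + \<theta>) - g (r + \<theta>0) \<partial>gam)"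
      using i by (intro Bochner_Integration.integral_diff[symmetric])
    also have "\<bar>\<dots>\<bar> \<le> ?K \<theta>"
    proof (rule integrable_gam_bound(2))
      fix r
      have "\<bar>g (r + \<theta>) - g (r + \<theta>0)\<bar> \<le> A * \<bar>\<theta> - \<theta>0\<bar> * exp (c * (\<bar>r + \<theta>\<bar> + \<bar>r + \<theta>0\<bar>))"
        using exp_lipD(2)[OF g, of "r + \<theta>" "r + \<theta>0"] by simp
      also have "\<dots> \<le> A * \<bar>\<theta> - \<theta>0\<bar> * exp (c * ((\<bar>\<theta>\<bar> + \<bar>\<theta>0\<bar>) + 2 * \<bar>r\<bar>))"
        using A c by (intro mult_left_mono) (auto intro: mult_left_mono)
      also have "\<dots> = A * \<bar>\<theta> - \<theta>0\<bar> * exp (c * (\<bar>\<theta>\<bar> + \<bar>\<theta>0\<bar>)) * exp ((2 * c) * \<bar>r\<bar>)"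
        by (simp add: algebra_simps flip: exp_add)
      finally show "\<bar>g (r + \<theta>) - g (r + \<theta>0)\<bar> \<le> A * \<bar>\<theta> - \<theta>0\<bar> * exp (c * (\<bar>\<theta>\<bar> + \<bar>\<theta>0\<bar>)) * exp ((2 * c) * \<bar>r\<bar>)" .
    qed measurable
    finally show ?thesis .
  qed
  have "((\<lambda>\<theta>. (\<integral>r. g (r + \<theta>) \<partial>gam) - (\<integral>r. g (r + \<theta>0) \<partial>gam)) \<longlongrightarrow> 0) (at \<theta>0)"
  proof (rule Lim_null_comparison)
    show "\<forall>\<^sub>F \<theta> in at \<theta>0. norm ((\<integral>r. g (r + \<theta>) \<partial>gam) - (\<integral>r. g (r + \<theta>0) \<partial>gam)) \<le> ?K \<theta>"
      using le by simp
    have "(?K \<longlongrightarrow> ?K \<theta>0) (at \<theta>0)" by (intro tendsto_intros)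
    then show "(?K \<longlongrightarrow> 0) (at \<theta>0)" by simp
  qed
  then show ?thesis by (simp add: isCont_def LIM_zero_iff)
qed

section \<open>The spiked sample covariance\<close>

lemma outer_square_carrier: "v \<in> carrier_vec p \<Longrightarrow> outer_square v \<in> carrier_mat p p"
  by (simp add: outer_square_def)

lemma outer_square_idem:
  assumes "v \<in> carrier_vec p" "v \<bullet> v = 1"
  shows "outer_square v * outer_square v = outer_square v"
proof (intro eq_matI)
  fix i j assume ij: "i < dim_row (outer_square v)" "j < dim_col (outer_square v)"
  then have "(outer_square v * outer_square v) $$ (i, j) = (\<Sum>k<dim_vec v. v $ i * v $ k * (v $ k * v $ j))"
    by (simp add: outer_square_def scalar_prod_def atLeast0LessThan)
  also have "\<dots> = v $ i * v $ j * (v \<bullet> v)"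
    by (simp add: scalar_prod_def sum_distrib_left mult_ac atLeast0LessThan)
  finally show "(outer_square v * outer_square v) $$ (i, j) = outer_square v $$ (i, j)"
    using ij assms by (simp add: outer_square_def)
qed (simp_all add: outer_square_def)

definition spike_sqrt :: "real \<Rightarrow> real vec \<Rightarrow> real mat" where
  "spike_sqrt lam v = (sqrt lam - 1) \<cdot>\<^sub>m outer_square v + 1\<^sub>m (dim_vec v)"

lemma scalar_prod_self_nonneg: "(x :: real vec) \<bullet> x \<ge> 0"
  by (simp add: scalar_prod_def sum_nonneg)

text \<open>For \<open>lam \<ge> 1\<close> the form dominates \<open>x \<bullet> x\<close>. This
  gives positivity of the root and also the strict definiteness on which its uniqueness
  rests.\<close>

lemma spike_quadratic_form:
  assumes v: "v \<in> carrier_vec p" and x: "x \<in> carrier_vec p"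
  shows "x \<bullet> (spike_sqrt lam v *\<^sub>v x) = (sqrt lam - 1) * (v \<bullet> x)\<^sup>2 + x \<bullet> x"
proof -
  have dims: "dim_vec v = p" "dim_vec x = p" using v x by auto
  have row: "(spike_sqrt lam v *\<^sub>v x) $ i = (sqrt lam - 1) * (v \<bullet> x) * v $ i + x $ i" if i: "i < p" for i
  proof -
    have "(spike_sqrt lam v *\<^sub>v x) $ i = (\<Sum>j<p. ((sqrt lam - 1) * (v $ i * v $ j) + (if j = i then 1 else 0)) * x $ j)"
      using i dims by (auto simp: spike_sqrt_def outer_square_def scalar_prod_def atLeast0LessThan intro!: sum.cong)
    also have "\<dots> = (\<Sum>j<p. (sqrt lam - 1) * v $ i * (v $ j * x $ j) + (if j = i then x $ j else 0))"
      by (intro sum.cong) (auto simp: algebra_simps)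
    also have "\<dots> = (sqrt lam - 1) * v $ i * (\<Sum>j<p. v $ j * x $ j) + x $ i"
      using i by (simp add: sum.distrib sum_distrib_left)
    finally show ?thesis using dims by (simp add: scalar_prod_def atLeast0LessThan mult_ac)
  qed
  have "dim_vec (spike_sqrt lam v *\<^sub>v x) = p" using dims by (simp add: spike_sqrt_def outer_square_def)
  then have "x \<bullet> (spike_sqrt lam v *\<^sub>v x) = (\<Sum>i<p. x $ i * ((sqrt lam - 1) * (v \<bullet> x) * v $ i + x $ i))"
    using row by (simp add: scalar_prod_def[of x "spike_sqrt lam v *\<^sub>v x"] atLeast0LessThan)
  also have "\<dots> = (sqrt lam - 1) * (v \<bullet> x) * (\<Sum>i<p. v $ i * x $ i) + (\<Sum>i<p. x $ i * x $ i)"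
    by (simp add: distrib_left sum.distrib sum_distrib_left mult_ac)
  also have "(\<Sum>i<p. v $ i * x $ i) = v \<bullet> x" using dims by (simp add: scalar_prod_def atLeast0LessThan)
  also have "(\<Sum>i<p. x $ i * x $ i) = x \<bullet> x" using dims by (simp add: scalar_prod_def atLeast0LessThan)
  finally show ?thesis by (simp add: power2_eq_square mult.assoc)
qed

lemma spike_sqrt_carrier: "v \<in> carrier_vec p \<Longrightarrow> spike_sqrt lam v \<in> carrier_mat p p"
  using outer_square_carrier[of v p] by (auto simp: spike_sqrt_def)

lemma spike_sqrt_psd:
  assumes v: "v \<in> carrier_vec p" and lam: "lam \<ge> 1"
  shows "psd (spike_sqrt lam v)"
  unfolding psd_def
proof (intro conjI ballI)
  have C: "spike_sqrt lam v \<in> carrier_mat p p" using v by (rule spike_sqrt_carrier)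
  show "square_mat (spike_sqrt lam v)" using C by auto
  show "(spike_sqrt lam v)\<^sup>T = spike_sqrt lam v"
    by (intro eq_matI) (auto simp: spike_sqrt_def outer_square_def)
  fix x :: "real vec" assume "x \<in> carrier_vec (dim_row (spike_sqrt lam v))"
  then have x: "x \<in> carrier_vec p" using C by simp
  show "0 \<le> x \<bullet> (spike_sqrt lam v *\<^sub>v x)"
    unfolding spike_quadratic_form[OF v x] using lam scalar_prod_self_nonneg[of x] by simp
qed

lemma spike_sqrt_square:
  assumes v: "v \<in> carrier_vec p" "v \<bullet> v = 1" and lam: "lam \<ge> 1"
  shows "spike_sqrt lam v * spike_sqrt lam v = spike_cov lam v"
proof -
  let ?V = "outer_square v" let ?\<mu> = "sqrt lam - 1"
  have V: "?V \<in> carrier_mat p p" using v(1) by (rule outer_square_carrier)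
  have dv: "dim_vec v = p" using v by auto
  have "spike_sqrt lam v * spike_sqrt lam v =
     (?\<mu> \<cdot>\<^sub>m ?V) * (?\<mu> \<cdot>\<^sub>m ?V + 1\<^sub>m p) + 1\<^sub>m p * (?\<mu> \<cdot>\<^sub>m ?V + 1\<^sub>m p)"
    unfolding spike_sqrt_def dv using V by (intro add_mult_distrib_mat) auto
  also have "(?\<mu> \<cdot>\<^sub>m ?V) * (?\<mu> \<cdot>\<^sub>m ?V + 1\<^sub>m p) = (?\<mu> \<cdot>\<^sub>m ?V) * (?\<mu> \<cdot>\<^sub>m ?V) + (?\<mu> \<cdot>\<^sub>m ?V) * 1\<^sub>m p"
    using V by (intro mult_add_distrib_mat) auto
  also have "(?\<mu> \<cdot>\<^sub>m ?V) * (?\<mu> \<cdot>\<^sub>m ?V) = (?\<mu> * ?\<mu>) \<cdot>\<^sub>m ?V"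
  proof -
    have "(?\<mu> \<cdot>\<^sub>m ?V) * (?\<mu> \<cdot>\<^sub>m ?V) = ?\<mu> \<cdot>\<^sub>m (?\<mu> \<cdot>\<^sub>m (?V * ?V))"
      using V by (simp add: mult_smult_distrib[of _ p p _ p] mult_smult_assoc_mat[of _ p p _ p])
    also have "\<dots> = (?\<mu> * ?\<mu>) \<cdot>\<^sub>m ?V"
      unfolding outer_square_idem[OF v] by (intro eq_matI) (use V in auto)
    finally show ?thesis .
  qed
  finally have e: "spike_sqrt lam v * spike_sqrt lam v = (?\<mu> * ?\<mu>) \<cdot>\<^sub>m ?V + ?\<mu> \<cdot>\<^sub>m ?V + (?\<mu> \<cdot>\<^sub>m ?V + 1\<^sub>m p)"
    using V by simp
  have s: "?\<mu> * ?\<mu> + ?\<mu> + ?\<mu> = lam - 1" using lam by (simp add: algebra_simps)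
  show ?thesis unfolding e spike_cov_def dv
  proof (intro eq_matI)
    fix i j assume "i < dim_row ((lam - 1) \<cdot>\<^sub>m ?V + 1\<^sub>m p)" "j < dim_col ((lam - 1) \<cdot>\<^sub>m ?V + 1\<^sub>m p)"
    then have ij: "i < p" "j < p" by auto
    then show "((?\<mu> * ?\<mu>) \<cdot>\<^sub>m ?V + ?\<mu> \<cdot>\<^sub>m ?V + (?\<mu> \<cdot>\<^sub>m ?V + 1\<^sub>m p)) $$ (i, j) = ((lam - 1) \<cdot>\<^sub>m ?V + 1\<^sub>m p) $$ (i, j)"
    proof -
      have "(\<mu> * \<mu>) * w + \<mu> * w + (\<mu> * w + d) = (\<mu> * \<mu> + \<mu> + \<mu>) * w + d" for \<mu> w d :: real
        by (simp only: distrib_right add.assoc)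
      from this[of ?\<mu> "?V $$ (i, j)" "1\<^sub>m p $$ (i, j)"] show ?thesis
        unfolding s using ij V by (simp del: index_one_mat(1))
    qed
  qed (use V in auto)
qed

text \<open>A positive semidefinite root commutes with its square, hence with \<open>v v\<^sup>T\<close>; two commuting roots
  whose sum is positive definite agree.\<close>

lemma psd_sqrt_spike:
  assumes v: "v \<in> carrier_vec p" "v \<bullet> v = 1" and lam: "lam \<ge> 1"
  shows "psd_sqrt (spike_cov lam v) = spike_sqrt lam v"
  unfolding psd_sqrt_def
proof (rule the_equality)
  let ?V = "outer_square v" let ?C = "spike_sqrt lam v"
  have V: "?V \<in> carrier_mat p p" using v(1) by (rule outer_square_carrier)
  have C: "?C \<in> carrier_mat p p" using v(1) by (rule spike_sqrt_carrier)
  have dv: "dim_vec v = p" using v by auto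
  have dS: "dim_row (spike_cov lam v) = p" using V dv by (simp add: spike_cov_def)
  show "?C \<in> carrier_mat (dim_row (spike_cov lam v)) (dim_row (spike_cov lam v)) \<and> psd ?C \<and> ?C * ?C = spike_cov lam v"
    unfolding dS using C spike_sqrt_psd[OF v(1) lam] spike_sqrt_square[OF v lam] by simp
  fix B assume "B \<in> carrier_mat (dim_row (spike_cov lam v)) (dim_row (spike_cov lam v)) \<and> psd B \<and> B * B = spike_cov lam v"
  then have B: "B \<in> carrier_mat p p" and Bp: "psd B" and BB: "B * B = spike_cov lam v" unfolding dS by auto
  have BS: "B * spike_cov lam v = spike_cov lam v * B"
    unfolding BB[symmetric] by (rule assoc_mult_mat[OF B B B, symmetric])
  have BC: "B * ?C = ?C * B"
  proof -
    have o: "1\<^sub>m p \<in> carrier_mat p p" "a \<cdot>\<^sub>m ?V \<in> carrier_mat p p" for a using V by auto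
    have l: "B * (a \<cdot>\<^sub>m ?V + 1\<^sub>m p) = a \<cdot>\<^sub>m (B * ?V) + B" for a
      unfolding mult_add_distrib_mat[OF B o(2) o(1)] mult_smult_distrib[OF B V] right_mult_one_mat[OF B] ..
    have r: "(a \<cdot>\<^sub>m ?V + 1\<^sub>m p) * B = a \<cdot>\<^sub>m (?V * B) + B" for a
      unfolding add_mult_distrib_mat[OF o(2) o(1) B] mult_smult_assoc_mat[OF V B] left_mult_one_mat[OF B] ..
    show ?thesis
    proof (cases "lam = 1")
      \<comment> \<open>For \<open>lam = 1\<close> the covariance is the identity and commutation
        with it says nothing about \<open>?V\<close>; but then the candidate root is the identity as
        well.\<close>
      case True
      have "0 \<cdot>\<^sub>m (B * ?V) = 0 \<cdot>\<^sub>m (?V * B)" using B V by (intro eq_matI) auto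
      then show ?thesis unfolding spike_sqrt_def dv l r using True by simp
    next
      case False
      have eq: "(lam - 1) \<cdot>\<^sub>m (B * ?V) + B = (lam - 1) \<cdot>\<^sub>m (?V * B) + B"
        using BS unfolding spike_cov_def dv l r .
      have "B * ?V = ?V * B"
      proof (intro eq_matI)
        fix i j assume "i < dim_row (?V * B)" "j < dim_col (?V * B)"
        then have ij: "i < p" "j < p" using B V by auto
        have "((lam - 1) \<cdot>\<^sub>m (B * ?V) + B) $$ (i, j) = ((lam - 1) \<cdot>\<^sub>m (?V * B) + B) $$ (i, j)" unfolding eq ..
        then have "(lam - 1) * (B * ?V) $$ (i, j) = (lam - 1) * (?V * B) $$ (i, j)"
        proof -
          have B': "B * ?V \<in> carrier_mat p p" "?V * B \<in> carrier_mat p p" using B V by auto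
          have e: "((lam - 1) \<cdot>\<^sub>m X + B) $$ (i, j) = (lam - 1) * X $$ (i, j) + B $$ (i, j)" if "X \<in> carrier_mat p p" for X
            using that B ij by simp
          show "((lam - 1) \<cdot>\<^sub>m (B * ?V) + B) $$ (i, j) = ((lam - 1) \<cdot>\<^sub>m (?V * B) + B) $$ (i, j) \<Longrightarrow> ?thesis"
            unfolding e[OF B'(1)] e[OF B'(2)] by (rule add_right_imp_eq)
        qed
        then show "(B * ?V) $$ (i, j) = (?V * B) $$ (i, j)" using False by (simp only: mult_cancel_left) simp
      qed (use B V in auto)
      then show ?thesis unfolding spike_sqrt_def dv l r by simp
    qed
  qed
  \<comment> \<open>Commutation makes the mixed products cancel, and both squares equal the spiked
    covariance.\<close>
  have zero: "(B + ?C) * (B - ?C) = 0\<^sub>m p p"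
  proof -
    have "(B + ?C) * (B - ?C) = B * (B - ?C) + ?C * (B - ?C)"
      using B C by (intro add_mult_distrib_mat[of _ p p _ _ p]) auto
    also have "B * (B - ?C) = B * B - B * ?C" using B C by (intro mult_minus_distrib_mat[of _ p p _ p]) auto
    also have "?C * (B - ?C) = ?C * B - ?C * ?C" using B C by (intro mult_minus_distrib_mat[of _ p p _ p]) auto
    also have "B * B - B * ?C + (?C * B - ?C * ?C) = 0\<^sub>m p p"
    proof -
      have aux: "X - Y + (Y - X) = 0\<^sub>m p p" if "X \<in> carrier_mat p p" "Y \<in> carrier_mat p p" for X Y :: "real mat"
        using that by (intro eq_matI) auto
      have "spike_cov lam v \<in> carrier_mat p p" unfolding BB[symmetric] by (rule mult_carrier_mat[OF B B])
      then show ?thesis unfolding BC BB spike_sqrt_square[OF v lam] using mult_carrier_mat[OF C B] by (rule aux)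
    qed
    finally show ?thesis .
  qed
  show "B = ?C"
  proof (intro eq_matI)
    fix i j assume "i < dim_row ?C" "j < dim_col ?C"
    then have ij: "i < p" "j < p" using C by auto
    \<comment> \<open>\<open>B + ?C\<close> annihilates every column of the difference, while its
      quadratic form dominates the squared norm; so the column is zero.\<close>
    define y where "y = col (B - ?C) j"
    have y: "y \<in> carrier_vec p" by (intro carrier_vecI) (use B C in \<open>simp add: y_def\<close>)
    have "(B + ?C) *\<^sub>v y = col ((B + ?C) * (B - ?C)) j"
      using B C ij unfolding y_def by (intro col_mult2[symmetric, of _ p p _ p]) auto
    then have "(B + ?C) *\<^sub>v y = 0\<^sub>v p" unfolding zero using ij by (intro eq_vecI) auto
    then have "B *\<^sub>v y + ?C *\<^sub>v y = 0\<^sub>v p"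
      using B C y by (simp add: add_mult_distrib_mat_vec[of _ p p])
    then have "y \<bullet> (B *\<^sub>v y + ?C *\<^sub>v y) = 0" using y by simp
    moreover have "y \<bullet> (B *\<^sub>v y + ?C *\<^sub>v y) = y \<bullet> (B *\<^sub>v y) + y \<bullet> (?C *\<^sub>v y)"
      using B C y by (intro scalar_prod_add_distrib[of _ p]) auto
    moreover have "y \<bullet> (B *\<^sub>v y) \<ge> 0" using Bp B y by (auto simp: psd_def)
    moreover have "y \<bullet> (?C *\<^sub>v y) \<ge> y \<bullet> y"
      unfolding spike_quadratic_form[OF v(1) y] using lam by simp
    ultimately have "y \<bullet> y = 0" using scalar_prod_self_nonneg[of y] by linarith
    then have "(\<Sum>k<p. y $ k * y $ k) = 0" using y by (simp add: scalar_prod_def atLeast0LessThan)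
    then have "y $ i = 0" using ij by (simp add: sum_nonneg_eq_0_iff)
    then show "B $$ (i, j) = ?C $$ (i, j)" using ij B C by (simp add: y_def)
  qed (use B C in auto)
qed

lemma spiked_sample_cov_entry:
  assumes v: "v \<in> carrier_vec p" "v \<bullet> v = 1" and lam: "lam \<ge> 1" and Z: "Z \<in> carrier_mat n p" and ij: "i < p" "j < p"
  defines "S \<equiv> \<lambda>i j. sample_cov Z $$ (i, j)"
  defines "u \<equiv> \<lambda>j. \<Sum>k<p. v $ k * S k j"
  shows "spiked_sample_cov lam v Z $$ (i, j) =
    S i j + (sqrt lam - 1) * (v $ i * u j + u i * v $ j) + (sqrt lam - 1)\<^sup>2 * (\<Sum>k<p. v $ k * u k) * (v $ i * v $ j)"
proof -
  let ?C = "spike_sqrt lam v" let ?S = "sample_cov Z" let ?\<mu> = "sqrt lam - 1"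
  have C: "?C \<in> carrier_mat p p" using v(1) by (rule spike_sqrt_carrier)
  have S: "?S \<in> carrier_mat p p" using Z by (simp add: sample_cov_def)
  have Cij: "?C $$ (a, b) = ?\<mu> * (v $ a * v $ b) + (if a = b then 1 else 0)" if "a < p" "b < p" for a b
    using that v by (simp add: spike_sqrt_def outer_square_def)
  have Ssym: "S a b = S b a" if "a < p" "b < p" for a b
    using that Z unfolding S_def by (simp add: sample_cov_def scalar_prod_def mult.commute)
  have CS: "(?C * ?S) $$ (a, b) = S a b + ?\<mu> * (v $ a * u b)" if ab: "a < p" "b < p" for a b
  proof -
    have "(?C * ?S) $$ (a, b) = (\<Sum>k<p. ?C $$ (a, k) * S k b)"
      using C S ab by (simp add: scalar_prod_def atLeast0LessThan S_def)
    also have "\<dots> = (\<Sum>k<p. ?\<mu> * v $ a * (v $ k * S k b) + (if a = k then S k b else 0))"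
      using ab by (intro sum.cong) (auto simp: Cij algebra_simps)
    also have "\<dots> = S a b + ?\<mu> * (v $ a * u b)"
      using ab by (simp add: sum.distrib u_def sum_distrib_left mult_ac)
    finally show ?thesis .
  qed
  have ua: "(\<Sum>k<p. v $ k * S i k) = u i" unfolding u_def using ij Ssym by (intro sum.cong) auto
  have "spiked_sample_cov lam v Z $$ (i, j) = (?C * ?S * ?C) $$ (i, j)"
    by (simp add: spiked_sample_cov_def psd_sqrt_spike[OF v lam])
  also have "\<dots> = (\<Sum>k<p. (?C * ?S) $$ (i, k) * ?C $$ (k, j))"
  proof -
    have "(A * B) $$ (i, j) = (\<Sum>k<p. A $$ (i, k) * B $$ (k, j))" if "A \<in> carrier_mat p p" "B \<in> carrier_mat p p" for A B :: "real mat"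
      using that ij by (simp add: scalar_prod_def atLeast0LessThan)
    from this[OF mult_carrier_mat[OF C S] C] show ?thesis .
  qed
  also have "\<dots> = (\<Sum>k<p. ?\<mu> * v $ j * (v $ k * S i k) + (?\<mu>\<^sup>2 * (v $ i * v $ j)) * (v $ k * u k) + (if k = j then S i k + ?\<mu> * (v $ i * u k) else 0))"
    using ij by (intro sum.cong) (auto simp: CS Cij algebra_simps power2_eq_square)
  also have "\<dots> = ?\<mu> * v $ j * u i + (?\<mu>\<^sup>2 * (v $ i * v $ j)) * (\<Sum>k<p. v $ k * u k) + (S i j + ?\<mu> * (v $ i * u j))"
    unfolding sum.distrib sum_distrib_left[symmetric] ua using ij by simp
  finally show ?thesis by (simp add: algebra_simps)
qed

lemma sample_cov_entry:
  assumes Z: "Z \<in> carrier_mat n p" and n: "n \<ge> 1" and ij: "i < p" "j < p"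
  shows "sample_cov Z $$ (i, j) = scov {..<n} (sqrt (real n)) (\<lambda>j r. Z $$ (r, j)) i j"
  using assms by (simp add: sample_cov_def scov_def dot_def scalar_prod_def atLeast0LessThan)

text \<open>Borel--Cantelli in integrated form: summable integrals make the sum finite almost
  everywhere, and then its terms tend to 0. The hypothesis holds only for large \<open>n\<close>, so
  the sequence is shifted before summing.\<close>

lemma AE_eventually_less_1:
  fixes f :: "nat \<Rightarrow> 'a \<Rightarrow> ennreal"
  assumes f: "\<forall>\<^sub>F n in sequentially. f n \<in> borel_measurable M \<and> (\<integral>\<^sup>+\<omega>. f n \<omega> \<partial>M) \<le> ennreal (e n)"
    and e: "summable e" "\<And>n. e n \<ge> 0"
  shows "AE \<omega> in M. \<forall>\<^sub>F n in sequentially. f n \<omega> < 1"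
proof -
  obtain N where N: "\<And>n. n \<ge> N \<Longrightarrow> f n \<in> borel_measurable M" "\<And>n. n \<ge> N \<Longrightarrow> (\<integral>\<^sup>+\<omega>. f n \<omega> \<partial>M) \<le> ennreal (e n)"
    using f by (auto simp: eventually_sequentially)
  define h where "h n = f (n + N)" for n
  have [measurable]: "h n \<in> borel_measurable M" for n using N(1) by (simp add: h_def)
  have se: "summable (\<lambda>n. e (n + N))" using e(1) by (rule summable_ignore_initial_segment)
  have "(\<integral>\<^sup>+\<omega>. (\<Sum>n. h n \<omega>) \<partial>M) = (\<Sum>n. \<integral>\<^sup>+\<omega>. h n \<omega> \<partial>M)" by (rule nn_integral_suminf) measurable
  also have "\<dots> \<le> (\<Sum>n. ennreal (e (n + N)))" unfolding h_def using N(2) by (intro suminf_le) auto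
  also have "\<dots> < \<infinity>" using suminf_ennreal_eq[OF e(2), of "\<lambda>n. n + N" "\<Sum>n. e (n + N)" for n] se e(2)
    by (simp add: suminf_ennreal2 less_top[symmetric])
  finally have "(\<integral>\<^sup>+\<omega>. (\<Sum>n. h n \<omega>) \<partial>M) \<noteq> \<infinity>" by simp
  then have "AE \<omega> in M. (\<Sum>n. h n \<omega>) \<noteq> \<infinity>" by (intro nn_integral_PInf_AE) measurable
  then show ?thesis
  proof eventually_elim
    case (elim \<omega>)
    have fin: "h n \<omega> < \<infinity>" for n
      using elim ennreal_suminf_lessD[of "\<lambda>n. h n \<omega>" "\<infinity>" n] by (simp add: less_top)
    have "summable (\<lambda>n. enn2real (h n \<omega>))"
    proof -
      have e: "ennreal (enn2real (h n \<omega>)) = h n \<omega>" for n using fin[of n] by (simp add: less_top)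
      show ?thesis
        by (rule summable_suminf_not_top) (use elim in \<open>simp_all add: e infinity_ennreal_def\<close>)
    qed
    then have "(\<lambda>n. enn2real (h n \<omega>)) \<longlonglongrightarrow> 0" by (rule summable_LIMSEQ_zero)
    then have "\<forall>\<^sub>F n in sequentially. enn2real (h n \<omega>) < 1" by (rule order_tendstoD) simp
    then have "\<forall>\<^sub>F n in sequentially. h n \<omega> < 1"
    proof eventually_elim
      case (elim n)
      then have "ennreal (enn2real (h n \<omega>)) < 1" by (simp add: ennreal_less_one_iff)
      then show ?case using fin[of n] by (simp add: less_top)
    qed
    then show ?case unfolding h_def by (rule eventually_sequentially_seg[THEN iffD1])
  qed
qed

text \<open>Column index first, to match the product of Gaussian columns. Restriction in both
  indices makes the value a point of that product space.\<close>

definition columns :: "nat \<Rightarrow> nat \<Rightarrow> real mat \<Rightarrow> nat \<Rightarrow> nat \<Rightarrow> real" where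
  "columns n p Z = (\<lambda>j\<in>{..<p}. \<lambda>r\<in>{..<n}. Z $$ (r, j))"

section \<open>Joint law of the columns\<close>

lemma (in prob_space) indep_vars_reindex:
  assumes h: "inj_on h J" and X: "indep_vars N X (h ` J)"
  shows "indep_vars (\<lambda>j. N (h j)) (\<lambda>j. X (h j)) J"
  unfolding indep_vars_def2
proof (intro conjI ballI indep_setsI)
  fix j assume "j \<in> J"
  then show "random_variable (N (h j)) (X (h j))" using X by (auto simp: indep_vars_def2)
next
  fix j assume "j \<in> J"
  then show "{X (h j) -` A \<inter> space M |A. A \<in> sets (N (h j))} \<subseteq> events"
    using X by (auto simp: indep_vars_def2 intro: measurable_sets)
next
  fix A K assume K: "K \<noteq> {}" "K \<subseteq> J" "finite K"
    and A: "\<forall>j\<in>K. A j \<in> {X (h j) -` B \<inter> space M |B. B \<in> sets (N (h j))}"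
  define A' where "A' i = A (the_inv_into J h i)" for i
  have A': "A' (h j) = A j" if "j \<in> K" for j using K that h by (auto simp: A'_def the_inv_into_f_f)
  have "prob (\<Inter>i\<in>h ` K. A' i) = (\<Prod>i\<in>h ` K. prob (A' i))"
  proof (rule indep_setsD)
    show "indep_sets (\<lambda>i. {X i -` B \<inter> space M |B. B \<in> sets (N i)}) (h ` J)" using X by (simp add: indep_vars_def2)
    show "\<forall>i\<in>h ` K. A' i \<in> {X i -` B \<inter> space M |B. B \<in> sets (N i)}" using A A' by auto
  qed (use K in auto)
  moreover have "(\<Inter>i\<in>h ` K. A' i) = (\<Inter>j\<in>K. A j)" using A' by auto
  moreover have "(\<Prod>i\<in>h ` K. prob (A' i)) = (\<Prod>j\<in>K. prob (A j))"
    using A' inj_on_subset[OF h K(2)] by (subst prod.reindex) auto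
  ultimately show "prob (\<Inter>j\<in>K. A j) = (\<Prod>j\<in>K. prob (A j))" by simp
qed

text \<open>Independence is used twice: inside a column to identify its law, and between columns
  after grouping the entries by their second index.\<close>

lemma (in prob_space) distr_columns:
  assumes n: "n \<ge> 1" and p: "p \<ge> 1"
    and dist: "\<And>i j. i < n \<Longrightarrow> j < p \<Longrightarrow> distributed M lborel (\<lambda>\<omega>. Z \<omega> $$ (i, j)) (\<lambda>x. ennreal (std_normal_density x))"
    and ind: "indep_vars (\<lambda>_. borel) (\<lambda>(i, j) \<omega>. Z \<omega> $$ (i, j)) ({..<n} \<times> {..<p})"
  shows "(\<lambda>\<omega>. columns n p (Z \<omega>)) \<in> M \<rightarrow>\<^sub>M gaussian_matrix {..<n} {..<p}"
    and "distr M (gaussian_matrix {..<n} {..<p}) (\<lambda>\<omega>. columns n p (Z \<omega>)) = gaussian_matrix {..<n} {..<p}"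
proof -
  let ?X = "\<lambda>(i, j) \<omega>. Z \<omega> $$ (i, j)"
  let ?B = "Pi\<^sub>M {..<n} (\<lambda>_. borel :: real measure)"
  define C where "C j \<omega> = (\<lambda>r\<in>{..<n}. Z \<omega> $$ (r, j))" for j \<omega>
  have ne: "{..<n} \<noteq> {}" "{..<p} \<noteq> {}" using n p by (auto simp: lessThan_empty_iff)
  have sB: "sets ?B = sets (gauss {..<n})" by (intro sets_PiM_cong) auto
  have rv: "(\<lambda>\<omega>. Z \<omega> $$ (i, j)) \<in> borel_measurable M" if "i < n" "j < p" for i j
    using distributed_measurable[OF dist[OF that]] by simp
  have law1: "distr M borel (\<lambda>\<omega>. Z \<omega> $$ (i, j)) = gam" if "i < n" "j < p" for i j
  proof -
    have "distr M borel (\<lambda>\<omega>. Z \<omega> $$ (i, j)) = distr M lborel (\<lambda>\<omega>. Z \<omega> $$ (i, j))"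
      by (rule distr_cong) auto
    then show ?thesis using distributed_distr_eq_density[OF dist[OF that]] by simp
  qed
  have rvC: "C j \<in> M \<rightarrow>\<^sub>M ?B" if "j < p" for j
    unfolding C_def using rv that by (intro measurable_restrict) auto
  have lawC: "distr M ?B (C j) = gauss {..<n}" if j: "j < p" for j
  proof -
    have "indep_vars (\<lambda>_. borel) (\<lambda>r. ?X (r, j)) {..<n}"
      by (rule indep_vars_reindex[where N = "\<lambda>_. borel" and X = ?X and h = "\<lambda>r. (r, j)"])
        (use j in \<open>auto intro!: inj_onI indep_vars_subset[OF ind]\<close>)
    then have "indep_vars (\<lambda>_. borel) (\<lambda>r \<omega>. Z \<omega> $$ (r, j)) {..<n}" by simp
    then have "distr M ?B (\<lambda>\<omega>. \<lambda>r\<in>{..<n}. Z \<omega> $$ (r, j)) = Pi\<^sub>M {..<n} (\<lambda>r. distr M borel (\<lambda>\<omega>. Z \<omega> $$ (r, j)))"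
      using ne rv j by (subst (asm) indep_vars_iff_distr_eq_PiM') auto
    also have "\<dots> = gauss {..<n}" using j by (intro PiM_cong) (auto simp: law1)
    finally show ?thesis by (simp add: C_def[abs_def])
  qed
  have "indep_vars (\<lambda>j. Pi\<^sub>M ({..<n} \<times> {j}) (\<lambda>_. borel)) (\<lambda>j \<omega>. restrict (\<lambda>i. ?X i \<omega>) ({..<n} \<times> {j})) {..<p}"
    by (rule indep_vars_restrict[OF ind]) (auto simp: disjoint_family_on_def)
  then have "indep_vars (\<lambda>_. ?B) (\<lambda>j \<omega>. (\<lambda>x. \<lambda>r\<in>{..<n}. x (r, j)) (restrict (\<lambda>i. ?X i \<omega>) ({..<n} \<times> {j}))) {..<p}"
    by (rule indep_vars_compose2) (rule measurable_restrict, rule measurable_component_singleton, simp)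
  moreover have "(\<lambda>x. \<lambda>r\<in>{..<n}. x (r, j)) (restrict (\<lambda>i. ?X i \<omega>) ({..<n} \<times> {j})) = C j \<omega>" for j \<omega>
    by (auto simp: C_def fun_eq_iff restrict_def)
  ultimately have indC: "indep_vars (\<lambda>_. ?B) C {..<p}" by (simp cong: indep_vars_cong)
  have PB: "sets (Pi\<^sub>M {..<p} (\<lambda>_. ?B)) = sets (gaussian_matrix {..<n} {..<p})" by (intro sets_PiM_cong sB refl)
  have cols: "(\<lambda>\<omega>. columns n p (Z \<omega>)) = (\<lambda>\<omega>. \<lambda>j\<in>{..<p}. C j \<omega>)" by (simp add: columns_def C_def fun_eq_iff)
  have "(\<lambda>\<omega>. \<lambda>j\<in>{..<p}. C j \<omega>) \<in> M \<rightarrow>\<^sub>M Pi\<^sub>M {..<p} (\<lambda>_. ?B)"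
    using rvC by (intro measurable_restrict) auto
  then show "(\<lambda>\<omega>. columns n p (Z \<omega>)) \<in> M \<rightarrow>\<^sub>M gaussian_matrix {..<n} {..<p}"
    unfolding cols by (simp only: measurable_cong_sets[OF refl PB])
  have "distr M (gaussian_matrix {..<n} {..<p}) (\<lambda>\<omega>. columns n p (Z \<omega>)) = distr M (Pi\<^sub>M {..<p} (\<lambda>_. ?B)) (\<lambda>\<omega>. \<lambda>j\<in>{..<p}. C j \<omega>)"
    unfolding cols by (rule distr_cong) (auto simp: PB)
  also have "\<dots> = Pi\<^sub>M {..<p} (\<lambda>j. distr M ?B (C j))"
    using indC ne rvC by (subst (asm) indep_vars_iff_distr_eq_PiM') auto
  also have "\<dots> = gaussian_matrix {..<n} {..<p}" by (intro PiM_cong) (auto simp: lawC)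
  finally show "distr M (gaussian_matrix {..<n} {..<p}) (\<lambda>\<omega>. columns n p (Z \<omega>)) = gaussian_matrix {..<n} {..<p}" .
qed

text \<open>Borel--Cantelli, transported to the canonical matrix measure: no relation between the
  matrices of different \<open>n\<close> is used.\<close>

lemma (in prob_space) AE_eventually_columns:
  assumes p: "\<And>n. n \<ge> 1 \<Longrightarrow> p n \<ge> 1"
    and dist: "\<And>n i j. n \<ge> 1 \<Longrightarrow> i < n \<Longrightarrow> j < p n \<Longrightarrow> distributed M lborel (\<lambda>\<omega>. Z n \<omega> $$ (i, j)) (\<lambda>x. ennreal (std_normal_density x))"
    and ind: "\<And>n. n \<ge> 1 \<Longrightarrow> indep_vars (\<lambda>_. borel) (\<lambda>(i, j) \<omega>. Z n \<omega> $$ (i, j)) ({..<n} \<times> {..<p n})"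
    and X: "\<forall>\<^sub>F n in sequentially. X n \<in> borel_measurable (gaussian_matrix {..<n} {..<p n}) \<and>
       (\<integral>\<^sup>+z. X n z \<partial>gaussian_matrix {..<n} {..<p n}) \<le> ennreal (e n)"
    and e: "summable e" "\<And>n. e n \<ge> 0"
  shows "AE \<omega> in M. \<forall>\<^sub>F n in sequentially. X n (columns n (p n) (Z n \<omega>)) < 1"
proof (rule AE_eventually_less_1[OF _ e])
  show "\<forall>\<^sub>F n in sequentially. (\<lambda>\<omega>. X n (columns n (p n) (Z n \<omega>))) \<in> borel_measurable M \<and>
     (\<integral>\<^sup>+\<omega>. X n (columns n (p n) (Z n \<omega>)) \<partial>M) \<le> ennreal (e n)"
    using X eventually_ge_at_top[of 1]
  proof eventually_elim
    case (elim n)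
    have d: "\<And>i j. i < n \<Longrightarrow> j < p n \<Longrightarrow> distributed M lborel (\<lambda>\<omega>. Z n \<omega> $$ (i, j)) (\<lambda>x. ennreal (std_normal_density x))"
      using dist elim by blast
    have c: "(\<lambda>\<omega>. columns n (p n) (Z n \<omega>)) \<in> M \<rightarrow>\<^sub>M gaussian_matrix {..<n} {..<p n}"
      "distr M (gaussian_matrix {..<n} {..<p n}) (\<lambda>\<omega>. columns n (p n) (Z n \<omega>)) = gaussian_matrix {..<n} {..<p n}"
      by (rule distr_columns[OF elim(2) p[OF elim(2)] d ind[OF elim(2)]]; assumption)+
    have m: "X n \<in> borel_measurable (gaussian_matrix {..<n} {..<p n})" using elim by simp
    have "(\<integral>\<^sup>+\<omega>. X n (columns n (p n) (Z n \<omega>)) \<partial>M) = (\<integral>\<^sup>+z. X n z \<partial>distr M (gaussian_matrix {..<n} {..<p n}) (\<lambda>\<omega>. columns n (p n) (Z n \<omega>)))"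
      by (rule nn_integral_distr[symmetric]) (use c m in auto)
    then show ?case using elim measurable_compose[OF c(1) m] unfolding c(2) by simp
  qed
qed

section \<open>Decomposition of the error matrix\<close>

text \<open>Meant for \<open>a\<close> the spike, \<open>b\<close> the deviation of
  \<open>S v\<close> from it, and \<open>k\<close> the deviation of the quadratic form from 1. Every
  term then carries one small factor of size at most \<rho>.\<close>

lemma sum_products_square_le:
  fixes a b d :: "'i \<Rightarrow> real"
  assumes "finite U" and a: "(\<Sum>i\<in>U. (a i)\<^sup>2) \<le> 1" and b: "(\<Sum>i\<in>U. (b i)\<^sup>2) \<le> \<rho>\<^sup>2" and k: "\<bar>k\<bar> \<le> \<rho>" and \<mu>: "\<mu> \<ge> 0"
  shows "(\<Sum>i\<in>U. \<Sum>j\<in>U. (\<mu> * (\<bar>a i\<bar> * \<bar>b j\<bar> + \<bar>b i\<bar> * \<bar>a j\<bar>) + \<mu>\<^sup>2 * \<bar>k\<bar> * (\<bar>a i\<bar> * \<bar>a j\<bar>))\<^sup>2) \<le> (3 * \<rho> * (\<mu> + \<mu>\<^sup>2))\<^sup>2"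
proof -
  let ?A = "\<Sum>i\<in>U. (a i)\<^sup>2" let ?B = "\<Sum>i\<in>U. (b i)\<^sup>2"
  have A0: "?A \<ge> 0" "?B \<ge> 0" by (auto intro: sum_nonneg)
  have three: "(x + y + w)\<^sup>2 \<le> 3 * (x\<^sup>2 + y\<^sup>2 + w\<^sup>2)" for x y w :: real
  proof -
    have "0 \<le> (x - y)\<^sup>2 + (y - w)\<^sup>2 + (x - w)\<^sup>2" by simp
    then show ?thesis by (simp add: power2_eq_square algebra_simps)
  qed
  have le: "(\<mu> * (\<bar>a i\<bar> * \<bar>b j\<bar> + \<bar>b i\<bar> * \<bar>a j\<bar>) + \<mu>\<^sup>2 * \<bar>k\<bar> * (\<bar>a i\<bar> * \<bar>a j\<bar>))\<^sup>2 \<le>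
      3 * \<mu>\<^sup>2 * ((a i)\<^sup>2 * (b j)\<^sup>2) + 3 * \<mu>\<^sup>2 * ((b i)\<^sup>2 * (a j)\<^sup>2) + 3 * (\<mu>\<^sup>2 * k)\<^sup>2 * ((a i)\<^sup>2 * (a j)\<^sup>2)" for i j
    using three[of "\<mu> * (\<bar>a i\<bar> * \<bar>b j\<bar>)" "\<mu> * (\<bar>b i\<bar> * \<bar>a j\<bar>)" "\<mu>\<^sup>2 * \<bar>k\<bar> * (\<bar>a i\<bar> * \<bar>a j\<bar>)"]
    by (simp add: power_mult_distrib distrib_left mult_ac)
  have pr: "(\<Sum>i\<in>U. \<Sum>j\<in>U. K * (f i * h j)) = K * ((\<Sum>i\<in>U. f i) * (\<Sum>j\<in>U. h j))" for K :: real and f h :: "'i \<Rightarrow> real"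
    unfolding sum_product by (simp only: sum_distrib_left)
  have "(\<Sum>i\<in>U. \<Sum>j\<in>U. (\<mu> * (\<bar>a i\<bar> * \<bar>b j\<bar> + \<bar>b i\<bar> * \<bar>a j\<bar>) + \<mu>\<^sup>2 * \<bar>k\<bar> * (\<bar>a i\<bar> * \<bar>a j\<bar>))\<^sup>2) \<le>
     (\<Sum>i\<in>U. \<Sum>j\<in>U. 3 * \<mu>\<^sup>2 * ((a i)\<^sup>2 * (b j)\<^sup>2) + 3 * \<mu>\<^sup>2 * ((b i)\<^sup>2 * (a j)\<^sup>2) + 3 * (\<mu>\<^sup>2 * k)\<^sup>2 * ((a i)\<^sup>2 * (a j)\<^sup>2))"
    by (intro sum_mono le)
  also have "\<dots> = 3 * \<mu>\<^sup>2 * (?A * ?B) + 3 * \<mu>\<^sup>2 * (?B * ?A) + 3 * (\<mu>\<^sup>2 * k)\<^sup>2 * (?A * ?A)"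
    by (simp only: sum.distrib pr)
  also have "\<dots> \<le> 3 * \<mu>\<^sup>2 * (1 * \<rho>\<^sup>2) + 3 * \<mu>\<^sup>2 * (\<rho>\<^sup>2 * 1) + 3 * (\<mu>\<^sup>2 * k)\<^sup>2 * (1 * 1)"
    using a b A0 by (intro add_mono mult_left_mono mult_mono) auto
  also have "\<dots> \<le> 9 * \<rho>\<^sup>2 * (\<mu> + \<mu>\<^sup>2)\<^sup>2"
  proof -
    have "k\<^sup>2 \<le> \<rho>\<^sup>2" using k by (metis abs_ge_zero power2_abs power_mono)
    then have "(\<mu>\<^sup>2 * k)\<^sup>2 \<le> \<mu> ^ 4 * \<rho>\<^sup>2" by (simp add: power_mult_distrib mult_left_mono flip: power_mult)
    moreover have "9 * \<rho>\<^sup>2 * (\<mu> + \<mu>\<^sup>2)\<^sup>2 - (6 * (\<mu>\<^sup>2 * \<rho>\<^sup>2) + 3 * (\<mu> ^ 4 * \<rho>\<^sup>2)) = \<rho>\<^sup>2 * (3 * \<mu>\<^sup>2 + 18 * \<mu> ^ 3 + 6 * \<mu> ^ 4)"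
      by (simp add: algebra_simps power_numeral_reduce)
    moreover have "\<rho>\<^sup>2 * (3 * \<mu>\<^sup>2 + 18 * \<mu> ^ 3 + 6 * \<mu> ^ 4) \<ge> 0" using \<mu> by simp
    ultimately show ?thesis by linarith
  qed
  finally show ?thesis by (simp add: power_mult_distrib)
qed

section \<open>Deterministic consequences of the good events\<close>

context
  fixes I :: "nat set" and m p :: nat and s \<delta> r :: real and w :: "nat \<Rightarrow> real" and z :: "nat \<Rightarrow> nat \<Rightarrow> real"
  assumes m: "0 < m" "m \<le> p"
    and w1: "\<And>i. i < m \<Longrightarrow> sqrt (real m) * w i \<in> {-1, 1}" and w0: "\<And>i. m \<le> i \<Longrightarrow> i < p \<Longrightarrow> w i = 0"
    and good: "gram_good I s {..<p} \<delta> z"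
    and r1: "bilin_le {..<m} {..<m} (offdiag_kernel I s (\<lambda>_ _ u. u) z) r" and r0: "r \<ge> 0"
begin

private definition "S = scov I s z"
private definition "u j = (\<Sum>k<m. w k * S k j)"
private definition "Q = (\<Sum>k<m. w k * u k)"
private definition "\<rho> = r + \<delta>"

private lemma \<delta>0: "\<delta> \<ge> 0"
proof -
  have "\<bar>dot I (z 0) (z 0) / s\<^sup>2 - (if (0::nat) = 0 then 1 else 0)\<bar> \<le> \<delta>"
    using good m unfolding gram_good_def by (elim ballE[of _ _ 0]) auto
  then show ?thesis using abs_ge_zero order_trans by blast
qed

private lemma \<rho>0: "\<rho> \<ge> 0" using r0 \<delta>0 by (simp add: \<rho>_def)

private lemma S_sym: "S i j = S j i" by (simp add: S_def scov_def dot_commute)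

private lemma S_diag: "i < p \<Longrightarrow> \<bar>S i i - 1\<bar> \<le> \<delta>"
  using good unfolding gram_good_def S_def scov_def by (auto dest!: bspec[where x=i])

private lemma S_off: "i < p \<Longrightarrow> j < p \<Longrightarrow> i \<noteq> j \<Longrightarrow> \<bar>S i j\<bar> \<le> \<delta>"
proof -
  assume ij: "i < p" "j < p" "i \<noteq> j"
  have "\<bar>dot I (z i) (z j) / s\<^sup>2 - (if i = j then 1 else 0)\<bar> \<le> \<delta>"
    using good ij(1,2) unfolding gram_good_def by blast
  then show ?thesis using ij(3) by (simp add: S_def scov_def)
qed

private lemma w_sq: "i < m \<Longrightarrow> real m * (w i * w i) = 1"
proof -
  assume "i < m"
  then have "(sqrt (real m) * w i) * (sqrt (real m) * w i) = 1" using w1[of i] by auto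
  then show ?thesis by (simp add: mult_ac flip: power2_eq_square) (simp add: power2_eq_square mult_ac)
qed

private lemma w_abs: "i < m \<Longrightarrow> \<bar>w i\<bar> = 1 / sqrt (real m)"
proof -
  assume "i < m"
  then have "\<bar>sqrt (real m) * w i\<bar> = 1" using w1[of i] by auto
  then show ?thesis using m by (simp add: abs_mult field_simps)
qed

private lemma w_norm: "(\<Sum>k<m. (w k)\<^sup>2) = 1"
proof -
  have "(\<Sum>k<m. (w k)\<^sup>2) = (\<Sum>k<m. 1 / real m)"
    using w_sq m by (intro sum.cong) (auto simp: power2_eq_square field_simps)
  then show ?thesis using m by simp
qed

private lemma w_L2: "L2_set w {..<m} = 1" by (simp add: L2_set_def w_norm)

private definition "d j = u j - w j"

private lemma d_eq: "j < m \<Longrightarrow> d j = (\<Sum>k<m. (S j k - (if j = k then 1 else 0)) * w k)"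
proof -
  assume j: "j < m"
  have "(\<Sum>k<m. (S j k - (if j = k then 1 else 0)) * w k) = (\<Sum>k<m. w k * S k j) - (\<Sum>k<m. if j = k then w k else 0)"
    unfolding sum_subtractf[symmetric] by (intro sum.cong) (auto simp: S_sym[of j] algebra_simps)
  then show ?thesis using j by (simp add: d_def u_def)
qed

text \<open>The kernel matrix of the identity function is the off-diagonal part of \<open>S\<close>.
  The norm bound for kernel matrices therefore shows that \<open>S\<close> is close to the identity
  on the support.\<close>

private lemma centered_bilin: "bilin_le {..<m} {..<m} (\<lambda>i j. S i j - (if i = j then 1 else 0)) \<rho>"
proof -
  have "bilin_le {..<m} {..<m} (\<lambda>i j. offdiag_kernel I s (\<lambda>_ _ u. u) z i j + (if i = j then S i i - 1 else 0)) (r + \<delta>)"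
    using m by (intro bilin_le_add r1 bilin_le_diagonal S_diag) auto
  moreover have "offdiag_kernel I s (\<lambda>_ _ u. u) z i j + (if i = j then S i i - 1 else 0) = S i j - (if i = j then 1 else 0)" for i j
    by (simp add: offdiag_kernel_def S_def scov_def power2_eq_square)
  ultimately show ?thesis by (simp add: \<rho>_def)
qed

text \<open>On the support \<open>d\<close> is the image of the unit vector \<open>w\<close> under
  \<open>S\<close> minus the identity, and the form is tested with \<open>d\<close> itself.\<close>

private lemma d_L2: "L2_set d {..<m} \<le> \<rho>"
proof -
  let ?n = "L2_set d {..<m}"
  have "?n * ?n = (\<Sum>j<m. d j * d j)" by (simp add: L2_set_def sum_nonneg flip: power2_eq_square)
  also have "\<dots> = (\<Sum>j<m. \<Sum>k<m. d j * (S j k - (if j = k then 1 else 0)) * w k)"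
    by (intro sum.cong refl) (simp only: d_eq lessThan_iff sum_distrib_left mult.assoc)
  also have "\<dots> \<le> \<rho> * (?n * L2_set w {..<m})"
    using bilin_leD[OF centered_bilin, of d w] by linarith
  finally have "?n * ?n \<le> \<rho> * ?n" by (simp add: w_L2)
  then show ?thesis using \<rho>0 L2_set_nonneg[of d "{..<m}"] by (cases "?n = 0") (auto simp: mult_le_cancel_right)
qed

private lemma d_norm: "(\<Sum>k<m. (d k)\<^sup>2) \<le> \<rho>\<^sup>2"
  using power_mono[OF d_L2, of 2] by (simp add: L2_set_def sum_nonneg)

private lemma d_abs: "j < m \<Longrightarrow> \<bar>d j\<bar> \<le> \<rho>"
proof -
  assume "j < m"
  then have "\<bar>d j\<bar> \<le> L2_set d {..<m}" using member_le_L2_set[of "{..<m}" j "\<lambda>i. \<bar>d i\<bar>"] by (simp add: L2_set_def)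
  then show ?thesis using d_L2 by linarith
qed

text \<open>An entrywise bound from near-orthogonality alone. Multiplied by an entry of
  \<open>w\<close> it gives \<delta>, which keeps the arguments of the kernel logarithmic inside the
  exponential factor.\<close>

private lemma d_crude: "j < m \<Longrightarrow> \<bar>d j\<bar> \<le> sqrt (real m) * \<delta>"
proof -
  assume j: "j < m"
  have "\<bar>d j\<bar> \<le> (\<Sum>k<m. \<delta> * (1 / sqrt (real m)))"
    unfolding d_eq[OF j]
  proof (rule order_trans[OF sum_abs sum_mono])
    fix k assume k: "k \<in> {..<m}"
    have "\<bar>S j k - (if j = k then 1 else 0)\<bar> \<le> \<delta>"
      using S_diag[of j] S_off[of j k] j k m by (cases "j = k") auto
    then show "\<bar>(S j k - (if j = k then 1 else 0)) * w k\<bar> \<le> \<delta> * (1 / sqrt (real m))"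
      unfolding abs_mult using k w_abs[of k] by (intro mult_mono) (auto simp: \<delta>0)
  qed
  also have "\<dots> = sqrt (real m) * \<delta>" using m by (simp add: real_div_sqrt field_simps)
  finally show ?thesis .
qed

private lemma Q_dev: "\<bar>Q - 1\<bar> \<le> \<rho>"
proof -
  have "Q - 1 = (\<Sum>k<m. w k * d k)"
    using w_norm by (simp add: Q_def d_def right_diff_distrib sum_subtractf power2_eq_square)
  then have "\<bar>Q - 1\<bar> \<le> L2_set w {..<m} * L2_set d {..<m}" using abs_sum_mult_le_L2 by simp
  then show ?thesis using d_L2 by (simp add: w_L2)
qed

lemmas spike_quad_deviation = Q_dev[unfolded Q_def u_def S_def \<rho>_def]

section \<open>The error matrix for a fixed kernel\<close>

context
  fixes \<mu> A c \<theta> \<tau> a1 :: real and g :: "real \<Rightarrow> real"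
  assumes s: "s > 0" and \<mu>: "\<mu> \<ge> 0" and g: "exp_lip A c g" and c: "c \<ge> 0"
    and r2: "bilin_le {..<m} {..<m} (offdiag_kernel I s (\<lambda>i j. block_function g \<theta> (real m * w i * w j)) z) r"
    and r3: "bilin_le {..<m} {m..<p} (cross_kernel I s {..<m} w \<mu> g z) r"
    and \<theta>: "\<theta> = s / real m * (2 * \<mu> + \<mu>\<^sup>2)" and \<rho>1: "r + \<delta> \<le> 1"
begin

private definition "Y i j = S i j + \<mu> * (w i * u j + u i * w j) + \<mu>\<^sup>2 * Q * (w i * w j)"

private lemma Y_diag: "i < p \<Longrightarrow> \<bar>Y i i - 1\<bar> \<le> \<delta> + 2 * \<mu> * (\<rho> + 1 / sqrt (real m)) / sqrt (real m) + \<mu>\<^sup>2 * (1 + \<rho>) / real m"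
proof -
  assume i: "i < p"
  show ?thesis
  proof (cases "i < m")
    case False
    then have "Y i i = S i i" using w0[of i] i by (simp add: Y_def)
    moreover have "0 \<le> 2 * \<mu> * (\<rho> + 1 / sqrt (real m)) / sqrt (real m)" "0 \<le> \<mu>\<^sup>2 * (1 + \<rho>) / real m"
      using \<mu> \<rho>0 by auto
    ultimately show ?thesis using S_diag[OF i] by linarith
  next
    case True
    have "\<bar>u i\<bar> \<le> \<rho> + 1 / sqrt (real m)"
      using d_abs[OF True] w_abs[OF True] abs_triangle_ineq[of "d i" "w i"] by (simp add: d_def)
    then have "\<bar>w i * u i\<bar> \<le> (1 / sqrt (real m)) * (\<rho> + 1 / sqrt (real m))"
      unfolding abs_mult w_abs[OF True] by (rule mult_left_mono) simp
    then have 1: "\<bar>2 * \<mu> * (w i * u i)\<bar> \<le> 2 * \<mu> * ((1 / sqrt (real m)) * (\<rho> + 1 / sqrt (real m)))"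
    proof -
      have "\<bar>2 * \<mu> * (w i * u i)\<bar> = 2 * \<mu> * \<bar>w i * u i\<bar>" using \<mu> by (simp add: abs_mult)
      also have "\<dots> \<le> 2 * \<mu> * ((1 / sqrt (real m)) * (\<rho> + 1 / sqrt (real m)))"
        using \<mu> \<open>\<bar>w i * u i\<bar> \<le> _\<close> by (intro mult_left_mono) auto
      finally show ?thesis .
    qed
    have "\<bar>Q\<bar> \<le> 1 + \<rho>" using Q_dev by linarith
    then have "\<bar>\<mu>\<^sup>2 * Q * (w i * w i)\<bar> \<le> \<mu>\<^sup>2 * (1 + \<rho>) * (1 / real m)"
      using w_sq[OF True] m unfolding abs_mult[of "\<mu>\<^sup>2 * Q"] abs_mult[of "\<mu>\<^sup>2"]
      by (intro mult_mono) (auto simp: field_simps \<rho>0)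
    moreover have "Y i i - 1 = (S i i - 1) + 2 * \<mu> * (w i * u i) + \<mu>\<^sup>2 * Q * (w i * w i)" by (simp add: Y_def algebra_simps)
    ultimately show ?thesis using 1 S_diag[OF i] by simp
  qed
qed

text \<open>Bound for the exponential in the Lipschitz estimate on the block. Since
  \<open>s * \<delta>\<close> will be \<eta> times \<open>ln n\<close>, it amounts to a small power
  of \<open>n\<close>.\<close>

private definition "\<Xi> = exp (c * ((2 + 2 * \<mu>) * (s * \<delta>) + 2 * \<bar>\<theta>\<bar> + \<mu>\<^sup>2 * (s / real m)))"

text \<open>The spiked entry differs from the sample entry with its deterministic shift by products
  of \<open>w\<close> and \<open>d\<close> and by a multiple of \<open>Q - 1\<close>. Pointwise
  Lipschitz bounds then give a small Frobenius norm.\<close>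

private lemma remainder_bilin:
  "bilin_le {..<m} {..<m} (\<lambda>i j. if i = j then 0 else (g (s * Y i j) - g (s * S i j + \<theta> * (real m * w i * w j))) / s)
    (A * \<Xi> * (3 * \<rho> * (\<mu> + \<mu>\<^sup>2)))"
proof (rule bilin_le_frobenius)
  have A: "A \<ge> 0" using g by (rule exp_lip_nonneg)
  have \<Xi>0: "\<Xi> \<ge> 0" by (simp add: \<Xi>_def)
  show "A * \<Xi> * (3 * \<rho> * (\<mu> + \<mu>\<^sup>2)) \<ge> 0" using A \<Xi>0 \<rho>0 \<mu> by simp
  define B where "B i j = \<mu> * (\<bar>w i\<bar> * \<bar>d j\<bar> + \<bar>d i\<bar> * \<bar>w j\<bar>) + \<mu>\<^sup>2 * \<bar>Q - 1\<bar> * (\<bar>w i\<bar> * \<bar>w j\<bar>)" for i j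
  have B0: "B i j \<ge> 0" for i j using \<mu> by (simp add: B_def)
  have key: "\<bar>(g (s * Y i j) - g (s * S i j + \<theta> * (real m * w i * w j))) / s\<bar> \<le> A * \<Xi> * B i j"
    if ij: "i < m" "j < m" "i \<noteq> j" for i j
  proof -
    define y where "y = s * Y i j" define q where "q = s * S i j + \<theta> * (real m * w i * w j)"
    \<comment> \<open>The shift is what the spike terms become when \<open>u\<close> is replaced by
      \<open>w\<close> and \<open>Q\<close> by 1; hence the difference contains only
      \<open>d\<close> and \<open>Q - 1\<close>.\<close>
    have "\<theta> * (real m * w i * w j) = s * ((2 * \<mu> + \<mu>\<^sup>2) * (w i * w j))" using m by (simp add: \<theta>)
    then have yq: "y - q = s * (\<mu> * (w i * d j + d i * w j) + \<mu>\<^sup>2 * (Q - 1) * (w i * w j))"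
      by (simp add: y_def q_def Y_def d_def algebra_simps)
    have "\<bar>\<mu> * (w i * d j + d i * w j) + \<mu>\<^sup>2 * (Q - 1) * (w i * w j)\<bar> \<le> B i j"
    proof -
      have "\<bar>\<mu> * (w i * d j + d i * w j)\<bar> \<le> \<mu> * (\<bar>w i\<bar> * \<bar>d j\<bar> + \<bar>d i\<bar> * \<bar>w j\<bar>)"
        unfolding abs_mult[of \<mu>] using \<mu> abs_triangle_ineq[of "w i * d j" "d i * w j"] by (simp add: abs_mult mult_left_mono)
      moreover have "\<bar>\<mu>\<^sup>2 * (Q - 1) * (w i * w j)\<bar> = \<mu>\<^sup>2 * \<bar>Q - 1\<bar> * (\<bar>w i\<bar> * \<bar>w j\<bar>)" by (simp add: abs_mult)
      ultimately show ?thesis unfolding B_def by linarith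
    qed
    then have dyq: "\<bar>y - q\<bar> \<le> s * B i j" unfolding yq abs_mult[of s] using s by (simp add: mult_left_mono)
    have Bc: "s * B i j \<le> 2 * \<mu> * (s * \<delta>) + \<mu>\<^sup>2 * (s / real m)"
    proof -
      have wd: "\<bar>w i'\<bar> * \<bar>d j'\<bar> \<le> \<delta>" if "i' < m" "j' < m" for i' j'
      proof -
        have "\<bar>w i'\<bar> * \<bar>d j'\<bar> \<le> (1 / sqrt (real m)) * (sqrt (real m) * \<delta>)"
          unfolding w_abs[OF that(1)] using d_crude[OF that(2)] by (intro mult_left_mono) auto
        then show ?thesis using m by simp
      qed
      have ww: "\<bar>w i\<bar> * \<bar>w j\<bar> = 1 / real m" using w_abs ij m by simp
      have "\<mu> * (\<bar>w i\<bar> * \<bar>d j\<bar> + \<bar>d i\<bar> * \<bar>w j\<bar>) \<le> \<mu> * (\<delta> + \<delta>)"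
        using wd[of i j] wd[of j i] ij \<mu> by (intro mult_left_mono) (auto simp: mult.commute)
      moreover have "\<mu>\<^sup>2 * \<bar>Q - 1\<bar> * (1 / real m) \<le> \<mu>\<^sup>2 * 1 * (1 / real m)"
        using Q_dev \<rho>1 by (intro mult_right_mono mult_left_mono) (auto simp: \<rho>_def)
      ultimately have "B i j \<le> 2 * \<mu> * \<delta> + \<mu>\<^sup>2 / real m" unfolding B_def ww by simp
      then have "s * B i j \<le> s * (2 * \<mu> * \<delta> + \<mu>\<^sup>2 / real m)" using s by (intro mult_left_mono) auto
      then show ?thesis by (simp add: algebra_simps)
    qed
    have sq: "\<bar>q\<bar> \<le> s * \<delta> + \<bar>\<theta>\<bar>"
    proof -
      have "\<bar>s * S i j\<bar> \<le> s * \<delta>" unfolding abs_mult using s S_off[of i j] ij m by simp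
      moreover have "\<bar>real m * w i * w j\<bar> = 1" using w_abs ij m by (simp add: abs_mult)
      then have "\<bar>\<theta> * (real m * w i * w j)\<bar> = \<bar>\<theta>\<bar>" by (simp add: abs_mult)
      ultimately show ?thesis unfolding q_def by linarith
    qed
    have "\<bar>y\<bar> + \<bar>q\<bar> \<le> (2 + 2 * \<mu>) * (s * \<delta>) + 2 * \<bar>\<theta>\<bar> + \<mu>\<^sup>2 * (s / real m)"
    proof -
      have "\<bar>y\<bar> \<le> \<bar>q\<bar> + \<bar>y - q\<bar>" by simp
      then show ?thesis using dyq Bc sq unfolding distrib_right by linarith
    qed
    then have "exp (c * (\<bar>y\<bar> + \<bar>q\<bar>)) \<le> \<Xi>" unfolding \<Xi>_def using c by (simp add: mult_left_mono)
    then have "A * \<bar>y - q\<bar> * exp (c * (\<bar>y\<bar> + \<bar>q\<bar>)) \<le> A * (s * B i j) * \<Xi>"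
      using A dyq s B0[of i j] by (intro mult_mono) auto
    then have "\<bar>g y - g q\<bar> \<le> A * (s * B i j) * \<Xi>" using exp_lipD(2)[OF g, of y q] by linarith
    then have "\<bar>g y - g q\<bar> / s \<le> A * (s * B i j) * \<Xi> / s" using s by (intro divide_right_mono) auto
    then show ?thesis using s by (simp add: y_def q_def abs_divide mult_ac)
  qed
  have "(\<Sum>i<m. \<Sum>j<m. (if i = j then 0 else (g (s * Y i j) - g (s * S i j + \<theta> * (real m * w i * w j))) / s)\<^sup>2) \<le>
      (\<Sum>i<m. \<Sum>j<m. (A * \<Xi>)\<^sup>2 * (B i j)\<^sup>2)"
  proof (intro sum_mono)
    fix i j assume "i \<in> {..<m}" "j \<in> {..<m}"
    then show "(if i = j then 0 else (g (s * Y i j) - g (s * S i j + \<theta> * (real m * w i * w j))) / s)\<^sup>2 \<le> (A * \<Xi>)\<^sup>2 * (B i j)\<^sup>2"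
      using power_mono[OF key[of i j], of 2] by (cases "i = j") (auto simp: power_mult_distrib simp del: abs_divide)
  qed
  also have "\<dots> = (A * \<Xi>)\<^sup>2 * (\<Sum>i<m. \<Sum>j<m. (B i j)\<^sup>2)" by (simp add: sum_distrib_left)
  also have "\<dots> \<le> (A * \<Xi>)\<^sup>2 * (3 * \<rho> * (\<mu> + \<mu>\<^sup>2))\<^sup>2"
    unfolding B_def using w_norm d_norm Q_dev \<mu> by (intro mult_left_mono sum_products_square_le) auto
  finally show "(\<Sum>i<m. \<Sum>j<m. (if i = j then 0 else (g (s * Y i j) - g (s * S i j + \<theta> * (real m * w i * w j))) / s)\<^sup>2) \<le>
      (A * \<Xi> * (3 * \<rho> * (\<mu> + \<mu>\<^sup>2)))\<^sup>2" by (simp add: power_mult_distrib)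
qed

text \<open>\<open>3 * r\<close> stands for the centred block and the two transposed cross blocks.
  \<kappa> is the mismatch between the mean of the block at finite size and its limit \<tau>; the
  last group bounds the diagonal.\<close>

lemma error_bilin:
  defines "\<kappa> \<equiv> real m * (\<integral>x. g (x + \<theta>) \<partial>gam) / s - \<tau>"
  shows "bilin_le {..<p} {..<p}
    (\<lambda>i j. if i = j then - a1 * (Y i i - 1) - \<tau> * (w i * w i) else (g (s * Y i j) - g (s * S i j)) / s - \<tau> * (w i * w j))
    (3 * r + \<bar>\<kappa>\<bar> + A * \<Xi> * (3 * \<rho> * (\<mu> + \<mu>\<^sup>2)) +
      (\<bar>a1\<bar> * (\<delta> + 2 * \<mu> * (\<rho> + 1 / sqrt (real m)) / sqrt (real m) + \<mu>\<^sup>2 * (1 + \<rho>) / real m) + \<bar>\<tau>\<bar> / real m + \<bar>\<kappa>\<bar> / real m))"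
proof -
  let ?U = "{..<m}" let ?J = "{m..<p}" let ?P = "{..<p}"
  let ?R = "\<lambda>i j. if i = j then 0 else (g (s * Y i j) - g (s * S i j + \<theta> * (real m * w i * w j))) / s"
  let ?B = "offdiag_kernel I s (\<lambda>i j. block_function g \<theta> (real m * w i * w j)) z"
  let ?X = "cross_kernel I s ?U w \<mu> g z"
  \<comment> \<open>The rank-one matrix with factor \<kappa> is added on the whole square, so its
    diagonal is taken away here.\<close>
  let ?D = "\<lambda>i. - a1 * (Y i i - 1) - \<tau> * (w i * w i) - \<kappa> * (w i * w i)"
  have A: "A \<ge> 0" using g by (rule exp_lip_nonneg)
  define b where "b = \<bar>a1\<bar> * (\<delta> + 2 * \<mu> * (\<rho> + 1 / sqrt (real m)) / sqrt (real m) + \<mu>\<^sup>2 * (1 + \<rho>) / real m) + \<bar>\<tau>\<bar> / real m + \<bar>\<kappa>\<bar> / real m"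
  define rb where "rb = A * \<Xi> * (3 * \<rho> * (\<mu> + \<mu>\<^sup>2))"
  have rb0: "rb \<ge> 0" using A \<rho>0 \<mu> by (simp add: rb_def \<Xi>_def)
  have UP: "?U \<subseteq> ?P" "?J \<subseteq> ?P" using m by auto
  have e1: "bilin_le ?P ?P (\<lambda>i j. if i < m \<and> j < m then ?R i j else 0) rb"
    by (rule bilin_le_extend[OF iffD1[OF bilin_le_cong remainder_bilin[folded rb_def]] UP(1) UP(1)]) (use rb0 in auto)
  have e2: "bilin_le ?P ?P (\<lambda>i j. if i < m \<and> j < m then ?B i j else 0) r"
    by (rule bilin_le_extend[OF iffD1[OF bilin_le_cong r2] UP(1) UP(1)]) (use r0 in auto)
  have e3: "bilin_le ?P ?P (\<lambda>i j. if i < m \<and> m \<le> j then ?X i j else 0) r"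
    by (rule bilin_le_extend[OF iffD1[OF bilin_le_cong r3] UP(1) UP(2)]) (use r0 in auto)
  have e4: "bilin_le ?P ?P (\<lambda>i j. if j < m \<and> m \<le> i then ?X j i else 0) r"
    by (rule bilin_le_transpose[OF e3])
  have wP: "L2_set w ?P = 1"
  proof -
    have "(\<Sum>i<p. (w i)\<^sup>2) = (\<Sum>i<m. (w i)\<^sup>2)" using w0 m by (intro sum.mono_neutral_right) auto
    then show ?thesis by (simp add: L2_set_def w_norm)
  qed
  have e5: "bilin_le ?P ?P (\<lambda>i j. \<kappa> * w i * w j) \<bar>\<kappa>\<bar>"
    by (rule bilin_le_rank_one) (simp add: wP)
  have e6: "bilin_le ?P ?P (\<lambda>i j. if i = j then ?D i else 0) b"
  proof (rule bilin_le_diagonal)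
    fix i assume i: "i \<in> ?P"
    have ww: "w i * w i \<le> 1 / real m" "0 \<le> w i * w i"
      using w_sq[of i] w0[of i] i m by (cases "i < m") (auto simp: field_simps)
    have "\<bar>- a1 * (Y i i - 1)\<bar> \<le> \<bar>a1\<bar> * (\<delta> + 2 * \<mu> * (\<rho> + 1 / sqrt (real m)) / sqrt (real m) + \<mu>\<^sup>2 * (1 + \<rho>) / real m)"
      unfolding abs_mult abs_minus_cancel using Y_diag[of i] i by (intro mult_left_mono) auto
    moreover have "\<bar>\<tau> * (w i * w i)\<bar> \<le> \<bar>\<tau>\<bar> * (1 / real m)" "\<bar>\<kappa> * (w i * w i)\<bar> \<le> \<bar>\<kappa>\<bar> * (1 / real m)"
      unfolding abs_mult[of _ "w i * w i"] using ww by (intro mult_left_mono; simp)+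
    ultimately show "\<bar>?D i\<bar> \<le> b" unfolding b_def times_divide_eq_right mult_1_right by linarith
  qed simp
  have sum: "bilin_le ?P ?P (\<lambda>i j. (if i < m \<and> j < m then ?R i j else 0) + ((if i < m \<and> j < m then ?B i j else 0) +
      ((if i < m \<and> m \<le> j then ?X i j else 0) + ((if j < m \<and> m \<le> i then ?X j i else 0) + (\<kappa> * w i * w j + (if i = j then ?D i else 0))))))
      (rb + (r + (r + (r + (\<bar>\<kappa>\<bar> + b)))))"
    by (intro bilin_le_add e1 e2 e3 e4 e5 e6)
  have cross: "?X i j = (g (s * Y i j) - g (s * S i j)) / s" if "i < m" "m \<le> j" "j < p" for i j
  proof -
    have "w j = 0" using w0 that by simp
    then have "Y i j = S i j + \<mu> * w i * u j" by (simp add: Y_def)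
    then show ?thesis by (simp add: cross_kernel_def S_def u_def)
  qed
  have Ysym: "Y i j = Y j i" for i j using S_sym[of i j] by (simp add: Y_def algebra_simps)
  have eq: "(if i < m \<and> j < m then ?R i j else 0) + ((if i < m \<and> j < m then ?B i j else 0) +
      ((if i < m \<and> m \<le> j then ?X i j else 0) + ((if j < m \<and> m \<le> i then ?X j i else 0) + (\<kappa> * w i * w j + (if i = j then ?D i else 0))))) =
      (if i = j then - a1 * (Y i i - 1) - \<tau> * (w i * w i) else (g (s * Y i j) - g (s * S i j)) / s - \<tau> * (w i * w j))"
    if ij: "i < p" "j < p" for i j
  proof (cases "i = j")
    case True
    then show ?thesis by (simp add: offdiag_kernel_def)
  next
    case False
    consider "i < m" "j < m" | "i < m" "m \<le> j" | "j < m" "m \<le> i" | "m \<le> i" "m \<le> j" by linarith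
    then show ?thesis
    proof cases
      case 1
      have "dot I (z i) (z j) / s = s * S i j" using s by (simp add: S_def scov_def power2_eq_square)
      \<comment> \<open>The sign \<open>real m * w i * w j\<close> times the mean, divided by
        \<open>s\<close>, equals \<kappa> + \<tau> times \<open>w i * w j\<close>; adding the
        \<kappa> part leaves exactly the term with \<tau>.\<close>
      then have "?B i j = (g (s * S i j + \<theta> * (real m * w i * w j)) - (real m * w i * w j) * (\<integral>x. g (x + \<theta>) \<partial>gam) - g (s * S i j)) / s"
        using False by (simp add: offdiag_kernel_def block_function_def)
      then show ?thesis using False 1 by (simp add: \<kappa>_def diff_divide_distrib left_diff_distrib right_diff_distrib mult_ac)
    next
      case 2
      then have "w j = 0" using w0 ij by simp
      then show ?thesis using False 2 cross[of i j] ij by simp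
    next
      case 3
      then have "w i = 0" using w0 ij by simp
      then show ?thesis using False 3 cross[of j i] ij Ysym[of i j] S_sym[of i j] by simp
    next
      case 4
      then have "w i = 0" "w j = 0" using w0 ij by auto
      then show ?thesis using False 4 by (simp add: Y_def)
    qed
  qed
  have eb: "rb + (r + (r + (r + (\<bar>\<kappa>\<bar> + b)))) = 3 * r + \<bar>\<kappa>\<bar> + rb + b" by simp
  show ?thesis
    by (rule iffD1[OF bilin_le_cong sum[unfolded eb, unfolded rb_def b_def]]) (use eq in auto)
qed

lemmas error_bilin_unfolded = error_bilin[unfolded Y_def Q_def u_def S_def \<Xi>_def \<rho>_def]

end

end

section \<open>Rates of the moment bounds\<close>

lemma gram_bound_nonneg: "gram_bound U J M \<ge> 0"
  unfolding gram_bound_def by (intro add_nonneg_nonneg mult_nonneg_nonneg sum_nonneg) auto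

lemma measurable_gram_bound:
  assumes "\<And>i j. i \<in> U \<Longrightarrow> j \<in> J \<Longrightarrow> (\<lambda>z. X z i j) \<in> borel_measurable N"
  shows "(\<lambda>z. gram_bound U J (X z)) \<in> borel_measurable N"
  unfolding gram_bound_def
  by (intro borel_measurable_add borel_measurable_times borel_measurable_sum borel_measurable_power borel_measurable_const)
    (auto intro: assms)

text \<open>With \<open>M\<close> of order \<open>s\<close>, the dominant term is
  \<open>M ^ 9 / s ^ 12\<close>, the fluctuation of the off-diagonal Gram entries. The power 18 of
  the logarithm is chosen to agree with the cross block.\<close>

lemma offdiag_rate:
  fixes M B R L s :: real
  assumes M: "0 \<le> M" "M \<le> B * s" and s: "s \<ge> 1" and R: "R \<ge> 0" and L: "L \<ge> 0"
  shows "M * (32 * (M * (R / s\<^sup>2)) ^ 6 + 30720 * M ^ 3 * (R / s\<^sup>2) ^ 6) +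
      M ^ 6 * (32 * (M * (R / s\<^sup>2 * (L / s))) ^ 6 + 30720 * M ^ 3 * (R / s\<^sup>2) ^ 6)
    \<le> R ^ 6 * (32 * B ^ 7 + 30720 * B ^ 4 + 32 * B ^ 12 + 30720 * B ^ 9) * (1 + L) ^ 18 / s ^ 3"
proof -
  have s0: "s > 0" using s by simp
  have "0 \<le> B * s" using M by linarith
  then have B: "B \<ge> 0" using s0 by (simp add: zero_le_mult_iff)
  have "M * (32 * (M * (R / s\<^sup>2)) ^ 6 + 30720 * M ^ 3 * (R / s\<^sup>2) ^ 6) +
      M ^ 6 * (32 * (M * (R / s\<^sup>2 * (L / s))) ^ 6 + 30720 * M ^ 3 * (R / s\<^sup>2) ^ 6) \<le>
    (B * s) * (32 * ((B * s) * (R / s\<^sup>2)) ^ 6 + 30720 * (B * s) ^ 3 * (R / s\<^sup>2) ^ 6) +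
      (B * s) ^ 6 * (32 * ((B * s) * (R / s\<^sup>2 * (L / s))) ^ 6 + 30720 * (B * s) ^ 3 * (R / s\<^sup>2) ^ 6)"
    using M B s0 R L by (intro add_mono mult_mono power_mono order_refl add_nonneg_nonneg mult_nonneg_nonneg zero_le_power divide_nonneg_nonneg) auto
  also have "\<dots> = R ^ 6 * (32 * B ^ 7 * (1 / s ^ 2) + 30720 * B ^ 4 * (1 / s ^ 5) + 32 * B ^ 12 * (L ^ 6 / s ^ 3) + 30720 * B ^ 9) / s ^ 3"
    using s0 by (simp add: field_simps power_mult_distrib power_divide power_numeral_reduce)
  also have "\<dots> \<le> R ^ 6 * (32 * B ^ 7 * (1 + L) ^ 18 + 30720 * B ^ 4 * (1 + L) ^ 18 + 32 * B ^ 12 * (1 + L) ^ 18 + 30720 * B ^ 9 * (1 + L) ^ 18) / s ^ 3"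
  proof -
    have one: "1 \<le> (1 + L) ^ 18" using L by simp
    have inv: "1 / s ^ k \<le> 1" for k using s by (simp add: one_le_power)
    have "L ^ 6 \<le> (1 + L) ^ 6" using L by (intro power_mono) auto
    also have "\<dots> \<le> (1 + L) ^ 18" using L by (intro power_increasing) auto
    finally have "L ^ 6 / s ^ 3 \<le> (1 + L) ^ 18 / 1" using s L by (intro frac_le) (auto simp: one_le_power)
    moreover have "1 / s ^ 2 \<le> (1 + L) ^ 18" "1 / s ^ 5 \<le> (1 + L) ^ 18" using one inv order_trans by blast+
    moreover have "30720 * B ^ 9 * 1 \<le> 30720 * B ^ 9 * (1 + L) ^ 18" using one B by (intro mult_left_mono) auto
    ultimately show ?thesis using s0 R B
      by (intro divide_right_mono mult_left_mono add_mono) auto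
  qed
  finally show ?thesis by (simp add: distrib_right mult.assoc)
qed

text \<open>Here \<open>t\<close> is the fourth root of \<open>n\<close>: \<open>M\<close> is of
  order \<open>t ^ 2\<close>, \<open>N\<close> at most \<open>t ^ 4\<close>, and \<epsilon> of order
  \<open>1 / t\<close>. The bias term dominates with \<open>t ^ 12 * (1 / t ^ 3) ^ 6\<close>, and
  the cube of \<epsilon> raised to the sixth power explains the exponent 18.\<close>

lemma cross_rate:
  fixes M N B E R2 R3 L t :: real
  assumes M: "0 \<le> M" "M \<le> B * t\<^sup>2" and N: "0 \<le> N" "N \<le> B * t ^ 4" and t: "t \<ge> 1"
    and R: "R2 \<ge> 0" "R3 \<ge> 0" and L: "L \<ge> 0" and E: "E \<ge> 0"
  defines "\<epsilon> \<equiv> E * (1 + L) / t" and "s \<equiv> t\<^sup>2"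
  shows "M * (32 * (N * (R2 * \<epsilon>\<^sup>2 / s\<^sup>2)) ^ 6 + 30720 * N ^ 3 * (R2 * \<epsilon>\<^sup>2 / s\<^sup>2) ^ 6) +
      M ^ 6 * (32 * (N * (R3 * \<epsilon> ^ 3 / s\<^sup>2)) ^ 6 + 30720 * N ^ 3 * (R2 * \<epsilon>\<^sup>2 / s\<^sup>2) ^ 6)
    \<le> (32 * B ^ 7 * (R2 * E\<^sup>2) ^ 6 + 30720 * B ^ 4 * (R2 * E\<^sup>2) ^ 6 + 32 * B ^ 12 * (R3 * E ^ 3) ^ 6 + 30720 * B ^ 9 * (R2 * E\<^sup>2) ^ 6)
        * (1 + L) ^ 18 / s ^ 3"
proof -
  have t0: "t > 0" using t by simp
  have "0 \<le> B * t\<^sup>2" using M by linarith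
  then have B: "B \<ge> 0" using t0 by (simp add: zero_le_mult_iff)
  define l where "l = 1 + L"
  have l: "l \<ge> 1" using L by (simp add: l_def)
  define a where "a = (R2 * E\<^sup>2) ^ 6" define b where "b = (R3 * E ^ 3) ^ 6"
  have ab: "a \<ge> 0" "b \<ge> 0" using R E by (auto simp: a_def b_def)
  have K2: "R2 * \<epsilon>\<^sup>2 / s\<^sup>2 = R2 * E\<^sup>2 * l\<^sup>2 / t ^ 6" and K3: "R3 * \<epsilon> ^ 3 / s\<^sup>2 = R3 * E ^ 3 * l ^ 3 / t ^ 7"
    by (simp_all add: \<epsilon>_def s_def l_def power_mult_distrib power_divide divide_divide_eq_left flip: power_mult power_add)
  have K0: "R2 * E\<^sup>2 * l\<^sup>2 / t ^ 6 \<ge> 0" "R3 * E ^ 3 * l ^ 3 / t ^ 7 \<ge> 0" using R E l t0 by auto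
  have p6: "(R2 * E\<^sup>2 * l\<^sup>2 / t ^ 6) ^ 6 = a * l ^ 12 / t ^ 36" "(R3 * E ^ 3 * l ^ 3 / t ^ 7) ^ 6 = b * l ^ 18 / t ^ 42"
    by (simp_all add: a_def b_def power_mult_distrib power_divide flip: power_mult)
  have "M * (32 * (N * (R2 * E\<^sup>2 * l\<^sup>2 / t ^ 6)) ^ 6 + 30720 * N ^ 3 * (R2 * E\<^sup>2 * l\<^sup>2 / t ^ 6) ^ 6) +
      M ^ 6 * (32 * (N * (R3 * E ^ 3 * l ^ 3 / t ^ 7)) ^ 6 + 30720 * N ^ 3 * (R2 * E\<^sup>2 * l\<^sup>2 / t ^ 6) ^ 6) \<le>
    (B * t\<^sup>2) * (32 * ((B * t ^ 4) * (R2 * E\<^sup>2 * l\<^sup>2 / t ^ 6)) ^ 6 + 30720 * (B * t ^ 4) ^ 3 * (R2 * E\<^sup>2 * l\<^sup>2 / t ^ 6) ^ 6) +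
      (B * t\<^sup>2) ^ 6 * (32 * ((B * t ^ 4) * (R3 * E ^ 3 * l ^ 3 / t ^ 7)) ^ 6 + 30720 * (B * t ^ 4) ^ 3 * (R2 * E\<^sup>2 * l\<^sup>2 / t ^ 6) ^ 6)"
    using M N B t0 K0 by (intro add_mono mult_mono power_mono order_refl add_nonneg_nonneg mult_nonneg_nonneg zero_le_power) auto
  also have "\<dots> = (32 * B ^ 7 * a * (l ^ 12 / t ^ 4) + 30720 * B ^ 4 * a * (l ^ 12 / t ^ 16) + 32 * B ^ 12 * b * l ^ 18 + 30720 * B ^ 9 * a * (l ^ 12 / t ^ 6)) / t ^ 6"
  proof -
    have h1: "(B * t\<^sup>2) * (32 * ((B * t ^ 4) ^ 6 * (a * l ^ 12 / t ^ 36))) = 32 * B ^ 7 * a * (l ^ 12 / t ^ 4) / t ^ 6"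
      using t0 by (simp add: divide_simps power_mult_distrib flip: power_mult) (simp add: power_numeral_reduce)
    have h2: "(B * t\<^sup>2) * (30720 * (B * t ^ 4) ^ 3 * (a * l ^ 12 / t ^ 36)) = 30720 * B ^ 4 * a * (l ^ 12 / t ^ 16) / t ^ 6"
      using t0 by (simp add: divide_simps power_mult_distrib flip: power_mult) (simp add: power_numeral_reduce)
    have h3: "(B * t\<^sup>2) ^ 6 * (32 * ((B * t ^ 4) ^ 6 * (b * l ^ 18 / t ^ 42))) = 32 * B ^ 12 * b * l ^ 18 / t ^ 6"
      using t0 by (simp add: divide_simps power_mult_distrib flip: power_mult) (simp add: power_numeral_reduce)
    have h4: "(B * t\<^sup>2) ^ 6 * (30720 * (B * t ^ 4) ^ 3 * (a * l ^ 12 / t ^ 36)) = 30720 * B ^ 9 * a * (l ^ 12 / t ^ 6) / t ^ 6"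
      using t0 by (simp add: divide_simps power_mult_distrib flip: power_mult) (simp add: power_numeral_reduce)
    show ?thesis
      unfolding power_mult_distrib[of "B * t ^ 4" "_ / _"] p6 distrib_left h1 h2 h3 h4 add_divide_distrib by (simp only: add.assoc)
  qed
  also have "\<dots> \<le> (32 * B ^ 7 * a * l ^ 18 + 30720 * B ^ 4 * a * l ^ 18 + 32 * B ^ 12 * b * l ^ 18 + 30720 * B ^ 9 * a * l ^ 18) / t ^ 6"
  proof -
    have "l ^ 12 / t ^ k \<le> l ^ 18 / 1" for k using l t by (intro frac_le power_increasing) (auto simp: one_le_power)
    then show ?thesis using t0 ab B by (intro divide_right_mono mult_left_mono add_mono) auto
  qed
  finally show ?thesis unfolding K2 K3 by (simp add: l_def a_def b_def s_def distrib_right flip: power_mult)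
qed

text \<open>Entries of the spike are of order \<open>n powr (-1/4)\<close>, and so is an entry of
  \<open>S v\<close>: its diagonal term has that size and the others sum to at most
  \<open>sqrt m * L / s\<close>. The factor 2 pays for the root of the quadratic form, which lies
  between 1/2 and 2.\<close>

lemma cross_good_of_gram_good:
  fixes w :: "nat \<Rightarrow> real"
  assumes m: "0 < m" and w: "\<And>i. i < m \<Longrightarrow> sqrt (real m) * w i \<in> {-1, 1}"
    and good: "gram_good I s {..<m} (L / s) z" and Q: "\<bar>spike_quad I s {..<m} w z - 1\<bar> \<le> 1 / 2"
    and B: "B \<ge> 1" "real m \<le> B * s" "s \<le> B * real m" and s: "s \<ge> 1" and L: "L \<ge> 0" and \<mu>: "\<mu> \<ge> 0"
  shows "cross_good I s {..<m} w \<mu> (2 * B * (1 + \<mu>) * (1 + L) / sqrt s) z"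
proof -
  let ?q = "spike_quad I s {..<m} w z"
  define t where "t = sqrt s"
  have t: "t > 0" "t * t = s" using s by (auto simp: t_def)
  have q: "1 / 2 \<le> ?q" "?q \<le> 3 / 2" using Q by linarith+
  have q0: "?q \<ge> 0" using q by linarith
  have sq: "1 / 2 \<le> sqrt ?q" "sqrt ?q \<le> 2"
    using real_sqrt_le_mono[of "1 / 4" ?q] real_sqrt_le_mono[of ?q 4] q by (auto simp: real_sqrt_divide)
  have sB: "sqrt B \<le> B" using B(1) by (intro real_le_lsqrt) (auto simp: power2_eq_square)
  have wa: "\<bar>w i\<bar> = 1 / sqrt (real m)" if "i < m" for i
  proof -
    have "\<bar>sqrt (real m) * w i\<bar> = 1" using w[OF that] by auto
    then show ?thesis using m by (simp add: abs_mult field_simps)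
  qed
  have m1: "sqrt (real m) \<le> B * t"
  proof -
    have "sqrt (real m) \<le> sqrt B * t" using B s unfolding t_def real_sqrt_mult[symmetric] by (intro real_sqrt_le_mono) auto
    also have "\<dots> \<le> B * t" using sB t by (intro mult_right_mono) auto
    finally show ?thesis .
  qed
  have m2: "1 / sqrt (real m) \<le> B / t"
  proof -
    have "t \<le> sqrt B * sqrt (real m)" using B s unfolding t_def real_sqrt_mult[symmetric] by (intro real_sqrt_le_mono) auto
    also have "\<dots> \<le> B * sqrt (real m)" using sB by (intro mult_right_mono) auto
    finally show ?thesis using t m by (simp add: field_simps)
  qed
  have cov: "\<bar>cov_spike I s {..<m} w z i\<bar> \<le> B * (1 + L) / t" if i: "i < m" for i
  proof -
    have "\<bar>cov_spike I s {..<m} w z i\<bar> \<le> (\<Sum>k<m. (L / s + (if i = k then 1 else 0)) * (1 / sqrt (real m)))"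
      unfolding cov_spike_def
    proof (rule order_trans[OF sum_abs sum_mono])
      fix k assume k: "k \<in> {..<m}"
      have "\<bar>scov I s z i k - (if i = k then 1 else 0)\<bar> \<le> L / s"
        using good i k by (auto simp: gram_good_def scov_def)
      then have "\<bar>scov I s z i k\<bar> \<le> L / s + (if i = k then 1 else 0)" by (auto split: if_splits)
      then have "\<bar>scov I s z i k\<bar> * \<bar>w k\<bar> \<le> (L / s + (if i = k then 1 else 0)) * \<bar>w k\<bar>" by (rule mult_right_mono) simp
      then show "\<bar>w k * scov I s z i k\<bar> \<le> (L / s + (if i = k then 1 else 0)) * (1 / sqrt (real m))"
        using k by (simp add: wa abs_mult mult.commute)
    qed
    also have "\<dots> = (real m * (L / s) + 1) * (1 / sqrt (real m))"
      using i by (simp add: sum.distrib flip: sum_distrib_right sum_divide_distrib)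
    also have "\<dots> = sqrt (real m) * (L / s) + 1 / sqrt (real m)"
      using m real_sqrt_mult_self[of "real m"] by (simp add: field_simps)
    also have "\<dots> \<le> B * t * (L / s) + B / t"
      using m1 m2 L s by (intro add_mono mult_right_mono) auto
    also have "\<dots> = B * (1 + L) / t" using t unfolding t(2)[symmetric] by (simp add: field_simps)
    finally show ?thesis .
  qed
  define \<epsilon> where "\<epsilon> = 2 * B * (1 + \<mu>) * (1 + L) / t"
  have up: "2 * B * x / t \<le> \<epsilon>" if "x \<le> (1 + \<mu>) * (1 + L)" for x
    unfolding \<epsilon>_def mult.assoc using that B t by (intro divide_right_mono mult_left_mono) auto
  have "\<bar>cov_spike I s {..<m} w z i / sqrt ?q\<bar> \<le> \<epsilon>" if i: "i < m" for i
  proof -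
    have "\<bar>cov_spike I s {..<m} w z i / sqrt ?q\<bar> = \<bar>cov_spike I s {..<m} w z i\<bar> / sqrt ?q" using q by simp
    also have "\<dots> \<le> (B * (1 + L) / t) / (1 / 2)" using cov[OF i] sq B L t by (intro frac_le) auto
    also have "\<dots> = 2 * B * (1 + L) / t" by simp
    also have "\<dots> \<le> \<epsilon>" using \<mu> L by (intro up) (auto simp: algebra_simps)
    finally show ?thesis .
  qed
  moreover have "\<bar>\<mu> * w i * sqrt ?q\<bar> \<le> \<epsilon>" if i: "i < m" for i
  proof -
    have "\<bar>\<mu> * w i * sqrt ?q\<bar> = \<mu> * (1 / sqrt (real m)) * sqrt ?q" using q0 \<mu> by (simp add: abs_mult wa[OF i])
    also have "\<dots> \<le> \<mu> * (B / t) * 2" using m2 sq q0 \<mu> B(1) t(1) by (intro mult_mono mult_left_mono) auto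
    also have "\<dots> = 2 * B * \<mu> / t" by simp
    also have "\<dots> \<le> \<epsilon>" using \<mu> L by (intro up) (auto simp: algebra_simps)
    finally show ?thesis .
  qed
  moreover have "L / s \<le> \<epsilon>\<^sup>2"
  proof -
    have "1 + L \<le> 2 * B * (1 + \<mu>) * (1 + L)"
    proof -
      have "1 * 1 \<le> (2 * B) * (1 + \<mu>)" using B \<mu> by (intro mult_mono) auto
      then have "1 * (1 + L) \<le> ((2 * B) * (1 + \<mu>)) * (1 + L)" using L by (intro mult_right_mono) auto
      then show ?thesis by simp
    qed
    then have "(1 + L)\<^sup>2 \<le> (2 * B * (1 + \<mu>) * (1 + L))\<^sup>2" using L by (intro power_mono) auto
    moreover have "L \<le> (1 + L)\<^sup>2" using L by (simp add: power2_eq_square algebra_simps)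
    ultimately have "L / s \<le> (2 * B * (1 + \<mu>) * (1 + L))\<^sup>2 / s" using s by (intro divide_right_mono) auto
    also have "\<dots> = \<epsilon>\<^sup>2" by (simp add: \<epsilon>_def power_divide power2_eq_square[of t] t(2))
    finally show ?thesis .
  qed
  then have "gram_good I s {..<m} (\<epsilon>\<^sup>2) z" using good unfolding gram_good_def by (meson order_trans)
  ultimately show ?thesis
    using q unfolding cross_good_def \<epsilon>_def t_def by auto
qed

section \<open>Almost sure convergence\<close>

text \<open>\<open>g\<close> is the kernel without its linear part and \<mu> is
  \<open>sqrt lam - 1\<close>. Orthogonality of \<open>g\<close> to the low Hermite polynomials
  enters through oddness and \<open>bias\<close>; \<eta> stays free because its choice depends on
  the growth rate \<open>c\<close>.\<close>

locale spiked_model = prob_space M for M :: "'a measure" +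
  fixes p m :: "nat \<Rightarrow> nat" and \<gamma> \<beta> \<mu> A c \<eta> C0 :: real and w :: "nat \<Rightarrow> nat \<Rightarrow> real"
    and Z :: "nat \<Rightarrow> 'a \<Rightarrow> real mat" and g :: "real \<Rightarrow> real"
  assumes dims: "\<And>n. n \<ge> 1 \<Longrightarrow> 0 < m n \<and> m n \<le> p n"
    and w_sign: "\<And>n i. n \<ge> 1 \<Longrightarrow> i < m n \<Longrightarrow> sqrt (real (m n)) * w n i \<in> {-1, 1}"
    and w_zero: "\<And>n i. n \<ge> 1 \<Longrightarrow> m n \<le> i \<Longrightarrow> i < p n \<Longrightarrow> w n i = 0"
    and dist: "\<And>n i j. n \<ge> 1 \<Longrightarrow> i < n \<Longrightarrow> j < p n \<Longrightarrow>
      distributed M lborel (\<lambda>\<omega>. Z n \<omega> $$ (i, j)) (\<lambda>x. ennreal (std_normal_density x))"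
    and ind: "\<And>n. n \<ge> 1 \<Longrightarrow> indep_vars (\<lambda>_. borel) (\<lambda>(i, j) \<omega>. Z n \<omega> $$ (i, j)) ({..<n} \<times> {..<p n})"
    and p_lim: "(\<lambda>n. real (p n) / real n) \<longlonglongrightarrow> \<gamma>"
    and m_lim: "(\<lambda>n. real (m n) / sqrt (real n)) \<longlonglongrightarrow> \<beta>" and \<beta>: "\<beta> > 0"
    and \<mu>: "\<mu> \<ge> 0" and \<eta>: "\<eta> > 0"
    and g: "exp_lip A c g" and c: "c \<ge> 0" and odd: "\<And>x. g (- x) = - g x"
    and bias: "\<And>\<theta>. \<bar>\<integral>x. g (x + \<theta>) \<partial>gam\<bar> \<le> C0 * \<theta>\<^sup>2 * exp (c * \<bar>\<theta>\<bar>)"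
begin

abbreviation "z n \<omega> \<equiv> columns n (p n) (Z n \<omega>)"
abbreviation "N n \<equiv> gaussian_matrix {..<n} {..<p n}"
text \<open>The moment bounds are of order \<open>n powr (-3/2)\<close> up to logarithms; they stay summable after multiplication by
  \<open>n powr (1/4) = r n powr (-12)\<close>, and twelve is the power lost in \<open>bilin_le_gram\<close>.\<close>

definition "\<delta> n = \<eta> * ln (real n) / sqrt (real n)"
definition "r n = real n powr (- 1 / 48)"

lemma growth:
  obtains B where "B \<ge> 1" "\<forall>\<^sub>F n in sequentially. real (m n) \<le> B * sqrt (real n)"
    "\<forall>\<^sub>F n in sequentially. sqrt (real n) \<le> B * real (m n)" "\<forall>\<^sub>F n in sequentially. real (p n) \<le> B * real n"
proof -
  define B where "B = max 1 (max (\<beta> + 1) (max (2 / \<beta>) (\<gamma> + 1)))"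
  have B: "B \<ge> 1" "\<beta> + 1 \<le> B" "2 / \<beta> \<le> B" "\<gamma> + 1 \<le> B" by (auto simp: B_def)
  have "\<forall>\<^sub>F n in sequentially. real (m n) / sqrt (real n) < \<beta> + 1" by (rule order_tendstoD(2)[OF m_lim]) simp
  then have 1: "\<forall>\<^sub>F n in sequentially. real (m n) \<le> B * sqrt (real n)"
    using eventually_ge_at_top[of 1]
  proof eventually_elim
    case (elim n)
    then have "real (m n) / sqrt (real n) \<le> B" using B by linarith
    then show ?case using elim by (simp add: field_simps)
  qed
  have "\<forall>\<^sub>F n in sequentially. \<beta> / 2 < real (m n) / sqrt (real n)" by (rule order_tendstoD(1)[OF m_lim]) (use \<beta> in simp)
  then have 2: "\<forall>\<^sub>F n in sequentially. sqrt (real n) \<le> B * real (m n)"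
    using eventually_ge_at_top[of 1]
  proof eventually_elim
    case (elim n)
    then have "sqrt (real n) \<le> 2 / \<beta> * real (m n)" using \<beta> by (simp add: field_simps)
    also have "\<dots> \<le> B * real (m n)" using B by (intro mult_right_mono) auto
    finally show ?case .
  qed
  have "\<forall>\<^sub>F n in sequentially. real (p n) / real n < \<gamma> + 1" by (rule order_tendstoD(2)[OF p_lim]) simp
  then have 3: "\<forall>\<^sub>F n in sequentially. real (p n) \<le> B * real n"
    using eventually_ge_at_top[of 1]
  proof eventually_elim
    case (elim n)
    then have "real (p n) / real n \<le> B" using B by linarith
    then show ?case using elim by (simp add: field_simps)
  qed
  show ?thesis using that[OF B(1) 1 2 3] .
qed

lemma p_pos: "n \<ge> 1 \<Longrightarrow> p n \<ge> 1"
  using dims[of n] by linarith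

lemma Borel_Cantelli_columns:
  assumes "\<forall>\<^sub>F n in sequentially. X n \<in> borel_measurable (N n) \<and> (\<integral>\<^sup>+z. X n z \<partial>N n) \<le> ennreal (e n)"
    and "summable e" "\<And>n. e n \<ge> 0"
  shows "AE \<omega> in M. \<forall>\<^sub>F n in sequentially. X n (z n \<omega>) < 1"
  using p_pos dist ind assms by (rule AE_eventually_columns)

lemma \<delta>_small: "\<forall>\<^sub>F n in sequentially. \<delta> n \<le> 1 / 2"
proof -
  have "\<delta> \<longlonglongrightarrow> 0" unfolding \<delta>_def using \<eta> by real_asymp
  then have "\<forall>\<^sub>F n in sequentially. \<delta> n < 1 / 2" by (rule order_tendstoD) simp
  then show ?thesis by eventually_elim simp
qed

lemma \<delta>_nonneg: "\<delta> n \<ge> 0" using \<eta> by (cases "n = 0") (auto simp: \<delta>_def)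

lemma eventually_gram_good: "AE \<omega> in M. \<forall>\<^sub>F n in sequentially. gram_good {..<n} (sqrt (real n)) {..<p n} (\<delta> n) (z n \<omega>)"
proof -
  obtain B where B: "B \<ge> 1" "\<forall>\<^sub>F n in sequentially. real (p n) \<le> B * real n" using growth by metis
  define X where "X n = (indicator {z. \<not> gram_good {..<n} (sqrt (real n)) {..<p n} (\<delta> n) z} :: _ \<Rightarrow> ennreal)" for n
  \<comment> \<open>this choice makes the Chernoff exponent \<open>4t\<^sup>2 - 4 ln n\<close>\<close>
  define t where "t = 4 / \<eta>"
  have t: "t > 0" using \<eta> by (simp add: t_def)
  define K where "K = 4 * B\<^sup>2 * exp (4 * t\<^sup>2)"
  have "\<forall>\<^sub>F n in sequentially. t \<le> sqrt (real n) / 4" using t by real_asymp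
  then have "\<forall>\<^sub>F n in sequentially. X n \<in> borel_measurable (N n) \<and> (\<integral>\<^sup>+z. X n z \<partial>N n) \<le> ennreal (K / (real n)\<^sup>2)"
    using B(2) \<delta>_small eventually_ge_at_top[of 1]
  proof eventually_elim
    case (elim n)
    have n: "real n > 0" using elim by simp
    have "Measurable.pred (N n) (\<lambda>z. \<not> gram_good {..<n} (sqrt (real n)) {..<p n} (\<delta> n) z)"
      unfolding pred_def by (intro sets.sets_Collect_neg sets_gram_good) auto
    then have meas: "X n \<in> borel_measurable (N n)"
      unfolding X_def by (rule borel_measurable_indicator_Collect)
    have "t * \<delta> n * sqrt (real n) = 4 * ln (real n)" using n \<eta> by (simp add: t_def \<delta>_def)
    then have "exp (4 * t\<^sup>2 - t * \<delta> n * sqrt (real n)) = exp (4 * t\<^sup>2) / real n ^ 4"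
      using n by (simp add: exp_diff exp_of_nat_mult[of 4, simplified])
    moreover have "(\<integral>\<^sup>+z. X n z \<partial>N n) \<le> ennreal (4 * (real (card {..<p n}))\<^sup>2 * exp (4 * t\<^sup>2 - t * \<delta> n * sqrt (real n)))"
      unfolding X_def using elim t by (intro not_gram_good_probability) auto
    ultimately have "(\<integral>\<^sup>+z. X n z \<partial>N n) \<le> ennreal (4 * (real (p n))\<^sup>2 * (exp (4 * t\<^sup>2) / real n ^ 4))" by simp
    also have "\<dots> \<le> ennreal (4 * (B * real n)\<^sup>2 * (exp (4 * t\<^sup>2) / real n ^ 4))"
      using elim by (intro ennreal_leI mult_right_mono mult_left_mono power_mono) auto
    also have "4 * (B * real n)\<^sup>2 * (exp (4 * t\<^sup>2) / real n ^ 4) = K / (real n)\<^sup>2"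
      using n by (simp add: K_def field_simps power_numeral_reduce)
    finally show ?case using meas by simp
  qed
  moreover have "summable (\<lambda>n. K / (real n)\<^sup>2)"
  proof -
    have "summable (\<lambda>n. K * inverse ((real n)\<^sup>2))" by (intro summable_mult inverse_power_summable) simp
    then show ?thesis by (simp add: divide_inverse)
  qed
  moreover have "0 \<le> K / (real n)\<^sup>2" for n by (simp add: K_def)
  ultimately have "AE \<omega> in M. \<forall>\<^sub>F n in sequentially. X n (z n \<omega>) < 1"
    by (rule Borel_Cantelli_columns)
  then show ?thesis
    by eventually_elim (auto elim!: eventually_mono simp: X_def indicator_def of_bool_def split: if_splits)
qed

text \<open>Markov's inequality on the good event and Borel--Cantelli; as the good event eventually
  holds almost surely, the truncation then disappears.\<close>

lemma truncated_bound:
  assumes K: "K \<ge> 0"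
    and G: "\<forall>\<^sub>F n in sequentially. G n \<in> borel_measurable (N n) \<and> (\<forall>z. G n z \<ge> 0) \<and> S n \<in> sets (N n) \<and>
      (\<integral>\<^sup>+z. ennreal (G n z) * indicator (S n) z \<partial>N n) \<le> ennreal (K * (1 + \<eta> * ln (real n)) ^ 18 / sqrt (real n) ^ 3)"
    and S: "AE \<omega> in M. \<forall>\<^sub>F n in sequentially. z n \<omega> \<in> S n"
  shows "AE \<omega> in M. \<forall>\<^sub>F n in sequentially. 64 * G n (z n \<omega>) \<le> r n ^ 12"
proof -
  define X where "X n z = ennreal (64 * real n powr (1 / 4)) * (ennreal (G n z) * indicator (S n) z)" for n z
  define e where "e n = 64 * real n powr (1 / 4) * (K * (1 + \<eta> * ln (real n)) ^ 18 / sqrt (real n) ^ 3)" for n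
  have "summable (\<lambda>n. real n powr (1 / 4) * ((1 + \<eta> * ln (real n)) ^ 18 / sqrt (real n) ^ 3))"
  proof (rule summable_comparison_test_bigo)
    \<comment> \<open>The terms decay like \<open>n powr (-5/4)\<close> times a power of the
      logarithm; -9/8 lies strictly between -5/4 and -1.\<close>
    show "summable (\<lambda>n. norm (real n powr (- 9 / 8)))" by (simp add: summable_real_powr_iff)
    have "(\<lambda>n. real n powr (1 / 4) * ((1 + \<eta> * ln (real n)) ^ 18 / sqrt (real n) ^ 3)) \<in> O(\<lambda>n. real n powr (- 9 / 8))"
      using \<eta> by real_asymp
    then show "(\<lambda>n. real n powr (1 / 4) * ((1 + \<eta> * ln (real n)) ^ 18 / sqrt (real n) ^ 3)) \<in> O(\<lambda>n. real n powr (- 9 / 8))" .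
  qed
  then have "summable (\<lambda>n. (64 * K) * (real n powr (1 / 4) * ((1 + \<eta> * ln (real n)) ^ 18 / sqrt (real n) ^ 3)))"
    by (rule summable_mult)
  then have "summable e" by (simp add: e_def[abs_def] mult_ac)
  moreover have "e n \<ge> 0" for n
  proof -
    have "ln (real n) \<ge> 0" by (cases "n = 0") auto
    then show ?thesis unfolding e_def using K \<eta> by (intro mult_nonneg_nonneg divide_nonneg_nonneg zero_le_power) auto
  qed
  moreover have "\<forall>\<^sub>F n in sequentially. X n \<in> borel_measurable (N n) \<and> (\<integral>\<^sup>+z. X n z \<partial>N n) \<le> ennreal (e n)"
    using G
  proof eventually_elim
    case (elim n)
    have [measurable]: "G n \<in> borel_measurable (N n)" "S n \<in> sets (N n)" using elim by auto
    have "X n \<in> borel_measurable (N n)" unfolding X_def by measurable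
    moreover {
    have "(\<integral>\<^sup>+z. X n z \<partial>N n) = ennreal (64 * real n powr (1 / 4)) * (\<integral>\<^sup>+z. ennreal (G n z) * indicator (S n) z \<partial>N n)"
      unfolding X_def by (rule nn_integral_cmult) measurable
    also have "\<dots> \<le> ennreal (64 * real n powr (1 / 4)) * ennreal (K * (1 + \<eta> * ln (real n)) ^ 18 / sqrt (real n) ^ 3)"
      using elim by (intro mult_left_mono) auto
    also have "\<dots> = ennreal (e n)" unfolding e_def by (rule ennreal_mult'[symmetric]) simp
    finally have "(\<integral>\<^sup>+z. X n z \<partial>N n) \<le> ennreal (e n)" .
    }
    ultimately show ?case by simp
  qed
  ultimately have "AE \<omega> in M. \<forall>\<^sub>F n in sequentially. X n (z n \<omega>) < 1"
    by (rule Borel_Cantelli_columns[rotated])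
  with S show ?thesis
  proof eventually_elim
    case (elim \<omega>)
    from elim(1) elim(2) G eventually_ge_at_top[of 1] show ?case
    proof eventually_elim
      case (elim n)
      have n: "real n > 0" using elim by simp
      have "X n (z n \<omega>) = ennreal (64 * real n powr (1 / 4) * G n (z n \<omega>))"
        using elim by (simp add: X_def ennreal_mult')
      then have "64 * real n powr (1 / 4) * G n (z n \<omega>) < 1" using elim by (simp add: ennreal_less_one_iff)
      then have "64 * G n (z n \<omega>) \<le> 1 / real n powr (1 / 4)" using n by (simp add: field_simps)
      also have "\<dots> = real n powr (- (1 / 4))" by (rule powr_minus_divide[symmetric])
      also have "\<dots> = r n ^ 12" using n by (simp add: r_def powr_power)
      finally show ?case .
    qed
  qed
qed

lemma eventually_columns_space: "AE \<omega> in M. \<forall>\<^sub>F n in sequentially. z n \<omega> \<in> space (N n)"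
proof (rule AE_I2)
  fix \<omega> assume \<omega>: "\<omega> \<in> space M"
  show "\<forall>\<^sub>F n in sequentially. z n \<omega> \<in> space (N n)"
    using eventually_ge_at_top[of 1]
  proof eventually_elim
    case (elim n)
    have "p n \<ge> 1" using dims[OF elim] by linarith
    from distr_columns(1)[OF elim this dist[OF elim] ind[OF elim]] have "(\<lambda>\<omega>. z n \<omega>) \<in> M \<rightarrow>\<^sub>M N n" .
    then show ?case
      by (rule measurable_space) (rule \<omega>)
  qed
qed

text \<open>Applied twice: to the identity function, which controls \<open>S\<close> on the support,
  and to the centred block functions, whose kernels change with \<open>n\<close>. Hence a family
  \<open>H n\<close> with a single constant \<open>R\<close>.\<close>

lemma eventually_offdiag:
  assumes c': "c' \<ge> 0" and H: "\<forall>\<^sub>F n in sequentially. \<forall>i j. i < m n \<longrightarrow> j < m n \<longrightarrow> exp_lip R c' (H n i j) \<and> (\<integral>x. H n i j x \<partial>gam) = 0"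
  shows "AE \<omega> in M. \<forall>\<^sub>F n in sequentially.
    bilin_le {..<m n} {..<m n} (offdiag_kernel {..<n} (sqrt (real n)) (H n) (z n \<omega>)) (r n)"
proof -
  obtain B where B: "B \<ge> 1" "\<forall>\<^sub>F n in sequentially. real (m n) \<le> B * sqrt (real n)" using growth by metis
  define R' where "R' = row_const R c'"
  have R': "R' \<ge> 0" by (simp add: R'_def row_const_def)
  define K where "K = R' ^ 6 * (32 * B ^ 7 + 30720 * B ^ 4 + 32 * B ^ 12 + 30720 * B ^ 9)"
  define G where "G n z = gram_bound {..<m n} {..<m n} (offdiag_kernel {..<n} (sqrt (real n)) (H n) z)" for n z
  define S where "S n = {z \<in> space (N n). gram_good {..<n} (sqrt (real n)) {..<m n} (\<delta> n) z}" for n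
  have "AE \<omega> in M. \<forall>\<^sub>F n in sequentially. 64 * G n (z n \<omega>) \<le> r n ^ 12"
  proof (rule truncated_bound[where K = K and S = S])
    show "K \<ge> 0" using B R' by (simp add: K_def)
    show "AE \<omega> in M. \<forall>\<^sub>F n in sequentially. z n \<omega> \<in> S n"
      using eventually_gram_good eventually_columns_space
    proof eventually_elim
      case (elim \<omega>)
      from elim eventually_ge_at_top[of 1] show ?case
      proof eventually_elim
        case (elim n)
        then show ?case using dims[of n] by (auto simp: S_def gram_good_def)
      qed
    qed
    show "\<forall>\<^sub>F n in sequentially. G n \<in> borel_measurable (N n) \<and> (\<forall>z. G n z \<ge> 0) \<and> S n \<in> sets (N n) \<and>
      (\<integral>\<^sup>+z. ennreal (G n z) * indicator (S n) z \<partial>N n) \<le> ennreal (K * (1 + \<eta> * ln (real n)) ^ 18 / sqrt (real n) ^ 3)"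
      using H B(2) \<delta>_small eventually_ge_at_top[of 1]
    proof eventually_elim
      case (elim n)
      have n: "n \<ge> 1" using elim by simp
      have sub: "{..<m n} \<subseteq> {..<p n}" using dims[OF n] by auto
      have "G n \<in> borel_measurable (N n)"
        unfolding G_def using elim(1) sub
        by (intro measurable_gram_bound measurable_offdiag_kernel exp_lip_measurable) auto
      moreover have "S n \<in> sets (N n)" unfolding S_def by (rule sets_gram_good[OF sub]) simp
      moreover have "(\<integral>\<^sup>+z. ennreal (G n z) * indicator (S n) z \<partial>N n) \<le> ennreal (K * (1 + \<eta> * ln (real n)) ^ 18 / sqrt (real n) ^ 3)"
      proof (rule order_trans)
      show "(\<integral>\<^sup>+z. ennreal (G n z) * indicator (S n) z \<partial>N n) \<le>
        ennreal (real (card {..<m n}) * (32 * (real (card {..<m n}) * (R' / (sqrt (real n))\<^sup>2)) ^ 6 + 30720 * real (card {..<m n}) ^ 3 * (R' / (sqrt (real n))\<^sup>2) ^ 6) +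
          real (card {..<m n}) ^ 6 * (32 * (real (card {..<m n}) * (R' / (sqrt (real n))\<^sup>2 * \<delta> n)) ^ 6 + 30720 * real (card {..<m n}) ^ 3 * (R' / (sqrt (real n))\<^sup>2) ^ 6))"
        unfolding G_def S_def R'_def using elim sub n c' \<delta>_nonneg
        by (intro offdiag_kernel_expectation) auto
      have "real (m n) * (32 * (real (m n) * (R' / (sqrt (real n))\<^sup>2)) ^ 6 + 30720 * real (m n) ^ 3 * (R' / (sqrt (real n))\<^sup>2) ^ 6) +
          real (m n) ^ 6 * (32 * (real (m n) * (R' / (sqrt (real n))\<^sup>2 * (\<eta> * ln (real n) / sqrt (real n)))) ^ 6 + 30720 * real (m n) ^ 3 * (R' / (sqrt (real n))\<^sup>2) ^ 6)
         \<le> K * (1 + \<eta> * ln (real n)) ^ 18 / sqrt (real n) ^ 3"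
        unfolding K_def using elim n \<eta> R' by (intro offdiag_rate) auto
      then show "ennreal (real (card {..<m n}) * (32 * (real (card {..<m n}) * (R' / (sqrt (real n))\<^sup>2)) ^ 6 + 30720 * real (card {..<m n}) ^ 3 * (R' / (sqrt (real n))\<^sup>2) ^ 6) +
          real (card {..<m n}) ^ 6 * (32 * (real (card {..<m n}) * (R' / (sqrt (real n))\<^sup>2 * \<delta> n)) ^ 6 + 30720 * real (card {..<m n}) ^ 3 * (R' / (sqrt (real n))\<^sup>2) ^ 6))
        \<le> ennreal (K * (1 + \<eta> * ln (real n)) ^ 18 / sqrt (real n) ^ 3)"
        unfolding \<delta>_def card_lessThan by (rule ennreal_leI)
      qed
      ultimately show ?case by (simp add: G_def gram_bound_nonneg)
    qed
  qed
  then show ?thesis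
  proof eventually_elim
    case (elim \<omega>)
    then show ?case
    proof eventually_elim
      case (elim n)
      show ?case by (rule bilin_le_gram) (use elim in \<open>auto simp: G_def r_def\<close>)
    qed
  qed
qed

lemma eventually_offdiag_id: "AE \<omega> in M. \<forall>\<^sub>F n in sequentially.
    bilin_le {..<m n} {..<m n} (offdiag_kernel {..<n} (sqrt (real n)) (\<lambda>_ _ u. u) (z n \<omega>)) (r n)"
proof (rule eventually_offdiag[where c' = 1])
  have "exp_lip 1 1 (\<lambda>u. u)" using exp_lip_linear[of 1] by simp
  moreover have "(\<integral>u. u \<partial>gam) = 0" by (rule integral_gam_odd) auto
  ultimately show "\<forall>\<^sub>F n in sequentially. \<forall>i j. i < m n \<longrightarrow> j < m n \<longrightarrow> exp_lip 1 1 (\<lambda>u. u) \<and> (\<integral>u. u \<partial>gam) = 0" by simp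
qed simp

lemma r_tendsto: "r \<longlonglongrightarrow> 0" unfolding r_def by real_asymp

lemma \<delta>_tendsto: "\<delta> \<longlonglongrightarrow> 0" unfolding \<delta>_def using \<eta> by real_asymp

lemma \<rho>_small: assumes "e > 0" shows "\<forall>\<^sub>F n in sequentially. r n + \<delta> n \<le> e"
proof -
  have "(\<lambda>n. r n + \<delta> n) \<longlonglongrightarrow> 0 + 0" by (intro tendsto_add r_tendsto \<delta>_tendsto)
  then have "\<forall>\<^sub>F n in sequentially. r n + \<delta> n < e" by (rule order_tendstoD) (use assms in simp)
  then show ?thesis by eventually_elim simp
qed

lemma eventually_cross: "AE \<omega> in M. \<forall>\<^sub>F n in sequentially.
    bilin_le {..<m n} {m n..<p n} (cross_kernel {..<n} (sqrt (real n)) {..<m n} (w n) \<mu> g (z n \<omega>)) (r n)"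
proof -
  obtain B where B: "B \<ge> 1" "\<forall>\<^sub>F n in sequentially. real (m n) \<le> B * sqrt (real n)"
    "\<forall>\<^sub>F n in sequentially. sqrt (real n) \<le> B * real (m n)" "\<forall>\<^sub>F n in sequentially. real (p n) \<le> B * real n" using growth .
  \<comment> \<open>Chosen so that \<epsilon> is the bound of \<open>cross_good_of_gram_good\<close>
    for \<open>L = \<eta> * ln n\<close> and \<open>s = sqrt n\<close>.\<close>
  define E where "E = 2 * B * (1 + \<mu>)"
  define \<epsilon> where "\<epsilon> n = E * (1 + \<eta> * ln (real n)) / sqrt (sqrt (real n))" for n
  have E: "E > 0" using B \<mu> by (simp add: E_def)
  have C0: "C0 \<ge> 0"
  proof -
    have "0 \<le> C0 * exp (c * 1)" using order_trans[OF abs_ge_zero bias[of 1]] by simp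
    then show ?thesis by (simp add: zero_le_mult_iff)
  qed
  have A: "A \<ge> 0" using g by (rule exp_lip_nonneg)
  define R2 where "R2 = cross_moment_const A c" define R3 where "R3 = cross_bias_const A c C0 c"
  have R: "R2 \<ge> 0" "R3 \<ge> 0" using A C0 by (auto simp: R2_def R3_def cross_moment_const_def cross_bias_const_def)
  define K where "K = 32 * B ^ 7 * (R2 * E\<^sup>2) ^ 6 + 30720 * B ^ 4 * (R2 * E\<^sup>2) ^ 6 + 32 * B ^ 12 * (R3 * E ^ 3) ^ 6 + 30720 * B ^ 9 * (R2 * E\<^sup>2) ^ 6"
  define G where "G n z = gram_bound {..<m n} {m n..<p n} (cross_kernel {..<n} (sqrt (real n)) {..<m n} (w n) \<mu> g z)" for n z
  define S where "S n = {z \<in> space (N n). cross_good {..<n} (sqrt (real n)) {..<m n} (w n) \<mu> (\<epsilon> n) z}" for n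
  have "\<epsilon> \<longlonglongrightarrow> 0" unfolding \<epsilon>_def using E \<eta> by real_asymp
  then have \<epsilon>_small: "\<forall>\<^sub>F n in sequentially. \<epsilon> n < 1 / 2" by (rule order_tendstoD) simp
  have "AE \<omega> in M. \<forall>\<^sub>F n in sequentially. 64 * G n (z n \<omega>) \<le> r n ^ 12"
  proof (rule truncated_bound[where K = K and S = S])
    show "K \<ge> 0" using B R E by (simp add: K_def)
    show "AE \<omega> in M. \<forall>\<^sub>F n in sequentially. z n \<omega> \<in> S n"
      using eventually_gram_good eventually_columns_space eventually_offdiag_id
    proof eventually_elim
      case (elim \<omega>)
      from elim eventually_ge_at_top[of 1] B(2,3) \<rho>_small[of "1/2", simplified] show ?case
      proof eventually_elim
        case (elim n)
        have s: "sqrt (real n) \<ge> 1" using elim by simp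
        have mp: "0 < m n" "m n \<le> p n" using dims elim by auto
        have \<rho>1: "r n + \<delta> n \<le> 1" using elim by simp
        have "\<bar>spike_quad {..<n} (sqrt (real n)) {..<m n} (w n) (z n \<omega>) - 1\<bar> \<le> 1 / 2"
        proof -
          \<comment> \<open>Norm control of \<open>S\<close> on the support is what keeps the
            quadratic form near 1; near-orthogonality alone would leave an error of logarithmic
            size.\<close>
          have "\<bar>(\<Sum>k<m n. w n k * (\<Sum>l<m n. w n l * scov {..<n} (sqrt (real n)) (z n \<omega>) l k)) - 1\<bar> \<le> r n + \<delta> n"
            by (rule spike_quad_deviation[OF mp _ _ elim(1) elim(3)]) (use w_sign[of n] w_zero[of n] elim in \<open>auto simp: r_def\<close>)
          moreover have "scov {..<n} (sqrt (real n)) (z n \<omega>) l k = scov {..<n} (sqrt (real n)) (z n \<omega>) k l" for k l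
            by (simp add: scov_def dot_commute)
          ultimately show ?thesis using elim by (simp add: spike_quad_def cov_spike_def)
        qed
        moreover have "gram_good {..<n} (sqrt (real n)) {..<m n} (\<eta> * ln (real n) / sqrt (real n)) (z n \<omega>)"
          using elim(1) mp unfolding gram_good_def \<delta>_def by auto
        ultimately have "cross_good {..<n} (sqrt (real n)) {..<m n} (w n) \<mu> (\<epsilon> n) (z n \<omega>)"
          unfolding \<epsilon>_def E_def using mp w_sign[of n] elim B(1) s \<mu> \<eta>
          by (intro cross_good_of_gram_good) auto
        then show ?case using elim by (simp add: S_def)
      qed
    qed
    show "\<forall>\<^sub>F n in sequentially. G n \<in> borel_measurable (N n) \<and> (\<forall>z. G n z \<ge> 0) \<and> S n \<in> sets (N n) \<and>
      (\<integral>\<^sup>+z. ennreal (G n z) * indicator (S n) z \<partial>N n) \<le> ennreal (K * (1 + \<eta> * ln (real n)) ^ 18 / sqrt (real n) ^ 3)"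
      using B(2,4) \<epsilon>_small eventually_ge_at_top[of 1]
    proof eventually_elim
      case (elim n)
      have n: "n \<ge> 1" using elim by simp
      have sub: "{..<m n} \<subseteq> {..<p n}" "{m n..<p n} \<subseteq> {..<p n}" and un: "{..<m n} \<union> {m n..<p n} = {..<p n}"
        using dims[OF n] by auto
      have \<epsilon>0: "\<epsilon> n \<ge> 0" using E \<eta> n by (simp add: \<epsilon>_def)
      have "G n \<in> borel_measurable (N n)"
        unfolding G_def using sub exp_lip_measurable[OF g]
        by (intro measurable_gram_bound measurable_cross_kernel) auto
      moreover have "S n \<in> sets (N n)" unfolding S_def by (rule sets_cross_good[OF sub(1)]) simp
      moreover have "(\<integral>\<^sup>+z. ennreal (G n z) * indicator (S n) z \<partial>N n) \<le> ennreal (K * (1 + \<eta> * ln (real n)) ^ 18 / sqrt (real n) ^ 3)"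
      proof (rule order_trans)
        let ?U = "real (card {..<m n})" and ?J = "real (card {m n..<p n})" and ?s = "sqrt (real n)"
        let ?b = "?U * (32 * (?J * (R2 * (\<epsilon> n)\<^sup>2 / ?s\<^sup>2)) ^ 6 + 30720 * ?J ^ 3 * (R2 * (\<epsilon> n)\<^sup>2 / ?s\<^sup>2) ^ 6) +
            ?U ^ 6 * (32 * (?J * (R3 * (\<epsilon> n) ^ 3 / ?s\<^sup>2)) ^ 6 + 30720 * ?J ^ 3 * (R2 * (\<epsilon> n)\<^sup>2 / ?s\<^sup>2) ^ 6)"
        have "(\<integral>\<^sup>+z. ennreal (gram_bound {..<m n} {m n..<p n} (cross_kernel {..<n} ?s {..<m n} (w n) \<mu> g z)) *
            indicator {z \<in> space (gaussian_matrix {..<n} ({..<m n} \<union> {m n..<p n})). cross_good {..<n} ?s {..<m n} (w n) \<mu> (\<epsilon> n) z} z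
            \<partial>gaussian_matrix {..<n} ({..<m n} \<union> {m n..<p n})) \<le> ennreal ?b"
          unfolding R2_def R3_def
          by (rule cross_kernel_expectation[OF _ c c]) (use n elim \<epsilon>0 g bias in auto)
        then show "(\<integral>\<^sup>+z. ennreal (G n z) * indicator (S n) z \<partial>N n) \<le> ennreal ?b"
          unfolding un G_def S_def .
        have t: "sqrt (sqrt (real n)) \<ge> 1" and t2: "sqrt (sqrt (real n)) ^ 2 = sqrt (real n)" using n by auto
        have t4: "sqrt (sqrt (real n)) ^ 4 = real n"
          using power_mult[of "sqrt (sqrt (real n))" 2 2] by (simp add: t2)
        have "?b \<le> K * (1 + \<eta> * ln (real n)) ^ 18 / sqrt (real n) ^ 3"
        proof -
          have "?U \<le> B * sqrt (sqrt (real n)) ^ 2" "?J \<le> B * sqrt (sqrt (real n)) ^ 4"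
            using elim by (auto simp: t2 t4)
          from cross_rate[OF _ this(1) _ this(2) t R, of "\<eta> * ln (real n)" E] show ?thesis
            using n \<eta> E unfolding K_def \<epsilon>_def t2 by auto
        qed
        then show "ennreal ?b \<le> ennreal (K * (1 + \<eta> * ln (real n)) ^ 18 / sqrt (real n) ^ 3)"
          by (rule ennreal_leI)
      qed
      ultimately show ?case by (simp add: G_def gram_bound_nonneg)
    qed
  qed
  then show ?thesis
  proof eventually_elim
    case (elim \<omega>)
    then show ?case
    proof eventually_elim
      case (elim n)
      show ?case by (rule bilin_le_gram) (use elim in \<open>auto simp: G_def r_def\<close>)
    qed
  qed
qed

definition "\<theta> n = sqrt (real n) / real (m n) * (2 * \<mu> + \<mu>\<^sup>2)"

definition "\<kappa> \<tau> n = real (m n) * (\<integral>x. g (x + \<theta> n) \<partial>gam) / sqrt (real n) - \<tau>"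

definition "error_bound \<tau> a1 n = 3 * r n + \<bar>\<kappa> \<tau> n\<bar> +
   A * exp (c * ((2 + 2 * \<mu>) * (sqrt (real n) * \<delta> n) + 2 * \<bar>\<theta> n\<bar> + \<mu>\<^sup>2 * (sqrt (real n) / real (m n)))) *
     (3 * (r n + \<delta> n) * (\<mu> + \<mu>\<^sup>2)) +
   (\<bar>a1\<bar> * (\<delta> n + 2 * \<mu> * (r n + \<delta> n + 1 / sqrt (real (m n))) / sqrt (real (m n)) + \<mu>\<^sup>2 * (1 + (r n + \<delta> n)) / real (m n)) +
    \<bar>\<tau>\<bar> / real (m n) + \<bar>\<kappa> \<tau> n\<bar> / real (m n))"

section \<open>Limits of the deterministic quantities\<close>

lemma ratio_tendsto: "(\<lambda>n. sqrt (real n) / real (m n)) \<longlonglongrightarrow> 1 / \<beta>"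
  using tendsto_inverse[OF m_lim] \<beta> by (simp add: inverse_eq_divide)

lemma \<theta>_tendsto: "\<theta> \<longlonglongrightarrow> (2 * \<mu> + \<mu>\<^sup>2) / \<beta>"
  unfolding \<theta>_def using tendsto_mult_right[OF ratio_tendsto, of "2 * \<mu> + \<mu>\<^sup>2"] by simp

lemma \<kappa>_tendsto:
  assumes "\<tau> = \<beta> * (\<integral>x. g (x + (2 * \<mu> + \<mu>\<^sup>2) / \<beta>) \<partial>gam)"
  shows "\<kappa> \<tau> \<longlonglongrightarrow> 0"
proof -
  have "isCont (\<lambda>\<theta>. \<integral>x. g (x + \<theta>) \<partial>gam) ((2 * \<mu> + \<mu>\<^sup>2) / \<beta>)" using g c by (rule continuous_shifted_mean)
  then have "(\<lambda>n. \<integral>x. g (x + \<theta> n) \<partial>gam) \<longlonglongrightarrow> (\<integral>x. g (x + (2 * \<mu> + \<mu>\<^sup>2) / \<beta>) \<partial>gam)"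
    using \<theta>_tendsto by (rule isCont_tendsto_compose)
  then have "(\<lambda>n. real (m n) / sqrt (real n) * (\<integral>x. g (x + \<theta> n) \<partial>gam) - \<tau>) \<longlonglongrightarrow> \<beta> * (\<integral>x. g (x + (2 * \<mu> + \<mu>\<^sup>2) / \<beta>) \<partial>gam) - \<tau>"
    by (intro tendsto_diff tendsto_mult m_lim tendsto_const)
  then show ?thesis by (simp add: \<kappa>_def[abs_def] assms)
qed

lemma inverse_m_tendsto: "(\<lambda>n. 1 / real (m n)) \<longlonglongrightarrow> 0"
proof -
  have "(\<lambda>n. 1 / sqrt (real n)) \<longlonglongrightarrow> 0" by real_asymp
  then have "(\<lambda>n. sqrt (real n) / real (m n) * (1 / sqrt (real n))) \<longlonglongrightarrow> 1 / \<beta> * 0"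
    by (intro tendsto_mult ratio_tendsto)
  moreover have "\<forall>\<^sub>F n in sequentially. sqrt (real n) / real (m n) * (1 / sqrt (real n)) = 1 / real (m n)"
    using eventually_ge_at_top[of 1] by eventually_elim auto
  ultimately show ?thesis by (simp add: tendsto_cong)
qed

lemma inverse_sqrt_m_tendsto: "(\<lambda>n. 1 / sqrt (real (m n))) \<longlonglongrightarrow> 0"
  using tendsto_real_sqrt[OF inverse_m_tendsto] by (simp add: real_sqrt_divide)

text \<open>The exponential factor grows at most like \<open>n powr (1/96)\<close> by the smallness
  of \<eta>, whereas \<open>r n + \<delta> n\<close> decays like \<open>n powr (-1/48)\<close>; half
  of the rate survives.\<close>

lemma error_bound_tendsto:
  assumes \<tau>: "\<tau> = \<beta> * (\<integral>x. g (x + (2 * \<mu> + \<mu>\<^sup>2) / \<beta>) \<partial>gam)" and small: "c * (2 + 2 * \<mu>) * \<eta> \<le> 1 / 96"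
  shows "error_bound \<tau> a1 \<longlonglongrightarrow> 0"
proof -
  let ?X = "\<lambda>n. exp (c * ((2 + 2 * \<mu>) * (sqrt (real n) * \<delta> n) + 2 * \<bar>\<theta> n\<bar> + \<mu>\<^sup>2 * (sqrt (real n) / real (m n))))"
  define F where "F n = exp (c * (2 * \<bar>\<theta> n\<bar> + \<mu>\<^sup>2 * (sqrt (real n) / real (m n))))" for n
  have F: "F \<longlonglongrightarrow> exp (c * (2 * \<bar>(2 * \<mu> + \<mu>\<^sup>2) / \<beta>\<bar> + \<mu>\<^sup>2 * (1 / \<beta>)))"
    unfolding F_def by (intro tendsto_intros \<theta>_tendsto ratio_tendsto)
  have "(\<lambda>n. real n powr (1 / 96) * (r n + \<delta> n)) \<longlonglongrightarrow> 0"
    unfolding r_def \<delta>_def using \<eta> by real_asymp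
  then have "(\<lambda>n. real n powr (1 / 96) * (r n + \<delta> n) * F n) \<longlonglongrightarrow>
      0 * exp (c * (2 * \<bar>(2 * \<mu> + \<mu>\<^sup>2) / \<beta>\<bar> + \<mu>\<^sup>2 * (1 / \<beta>)))"
    by (intro tendsto_mult F)
  then have G: "(\<lambda>n. real n powr (1 / 96) * (r n + \<delta> n) * F n) \<longlonglongrightarrow> 0" by simp
  have X: "(\<lambda>n. ?X n * (r n + \<delta> n)) \<longlonglongrightarrow> 0"
  proof (rule tendsto_sandwich[OF _ _ tendsto_const G])
    show "\<forall>\<^sub>F n in sequentially. 0 \<le> ?X n * (r n + \<delta> n)" by (simp add: r_def \<delta>_nonneg)
    show "\<forall>\<^sub>F n in sequentially. ?X n * (r n + \<delta> n) \<le> real n powr (1 / 96) * (r n + \<delta> n) * F n"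
      using eventually_ge_at_top[of 1]
    proof eventually_elim
      case (elim n)
      have n: "real n \<ge> 1" using elim by simp
      have "?X n = exp (c * (2 + 2 * \<mu>) * \<eta> * ln (real n)) * F n"
        using n by (simp add: F_def \<delta>_def algebra_simps flip: exp_add)
      also have "\<dots> \<le> exp (1 / 96 * ln (real n)) * F n"
      proof -
        have "c * (2 + 2 * \<mu>) * \<eta> * ln (real n) \<le> 1 / 96 * ln (real n)"
          using n by (intro mult_right_mono[OF small]) simp
        then show ?thesis unfolding F_def by (intro mult_right_mono) auto
      qed
      also have "exp (1 / 96 * ln (real n)) = real n powr (1 / 96)" using n by (simp add: powr_def)
      finally have "?X n * (r n + \<delta> n) \<le> (real n powr (1 / 96) * F n) * (r n + \<delta> n)"
        by (rule mult_right_mono) (simp add: r_def \<delta>_nonneg)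
      then show ?case by (simp add: mult_ac)
    qed
  qed
  have lim: "(\<lambda>n. 3 * r n + \<bar>\<kappa> \<tau> n\<bar> + A * (3 * (?X n * (r n + \<delta> n)) * (\<mu> + \<mu>\<^sup>2)) +
     (\<bar>a1\<bar> * (\<delta> n + 2 * \<mu> * ((r n + \<delta> n + 1 / sqrt (real (m n))) * (1 / sqrt (real (m n)))) + \<mu>\<^sup>2 * ((1 + (r n + \<delta> n)) * (1 / real (m n)))) +
      \<bar>\<tau>\<bar> * (1 / real (m n)) + \<bar>\<kappa> \<tau> n\<bar> * (1 / real (m n)))) \<longlonglongrightarrow>
    3 * 0 + \<bar>0\<bar> + A * (3 * 0 * (\<mu> + \<mu>\<^sup>2)) + (\<bar>a1\<bar> * (0 + 2 * \<mu> * ((0 + 0 + 0) * 0) + \<mu>\<^sup>2 * ((1 + (0 + 0)) * 0)) + \<bar>\<tau>\<bar> * 0 + \<bar>0\<bar> * 0)"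
    by (intro tendsto_add tendsto_mult tendsto_const tendsto_rabs r_tendsto \<delta>_tendsto \<kappa>_tendsto[OF \<tau>] X inverse_m_tendsto inverse_sqrt_m_tendsto)
  have eq: "A * ?X n * (3 * (r n + \<delta> n) * (\<mu> + \<mu>\<^sup>2)) = A * (3 * (?X n * (r n + \<delta> n)) * (\<mu> + \<mu>\<^sup>2))" for n
    by (simp only: mult_ac)
  show ?thesis using lim unfolding error_bound_def[abs_def] eq by simp
qed

lemma eventually_error_bilin:
  "AE \<omega> in M. \<forall>\<^sub>F n in sequentially. bilin_le {..<p n} {..<p n} (\<lambda>i j.
     let S = scov {..<n} (sqrt (real n)) (z n \<omega>); u = (\<lambda>j. \<Sum>k<m n. w n k * S k j);
         Y = (\<lambda>i j. S i j + \<mu> * (w n i * u j + u i * w n j) + \<mu>\<^sup>2 * (\<Sum>k<m n. w n k * u k) * (w n i * w n j))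
     in if i = j then - a1 * (Y i i - 1) - \<tau> * (w n i * w n i)
        else (g (sqrt (real n) * Y i j) - g (sqrt (real n) * S i j)) / sqrt (real n) - \<tau> * (w n i * w n j))
    (error_bound \<tau> a1 n)"
proof -
  \<comment> \<open>Convergence of the shifts provides the bound that makes the constant of the
    block functions uniform in \<open>n\<close>.\<close>
  obtain \<Theta> where \<Theta>: "\<And>n. \<bar>\<theta> n\<bar> \<le> \<Theta>"
    using convergent_imp_Bseq[OF convergentI[OF \<theta>_tendsto]] by (auto simp: Bseq_def)
  define R where "R = A * exp (2 * c * \<Theta>) + A * exp (2 * c * \<Theta>) * (2 * exp (c\<^sup>2 / 2)) + A"
  have "AE \<omega> in M. \<forall>\<^sub>F n in sequentially. bilin_le {..<m n} {..<m n}
      (offdiag_kernel {..<n} (sqrt (real n)) (\<lambda>i j. block_function g (\<theta> n) (real (m n) * w n i * w n j)) (z n \<omega>)) (r n)"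
  proof (rule eventually_offdiag[OF c])
    show "\<forall>\<^sub>F n in sequentially. \<forall>i j. i < m n \<longrightarrow> j < m n \<longrightarrow>
       exp_lip R c (block_function g (\<theta> n) (real (m n) * w n i * w n j)) \<and>
       (\<integral>x. block_function g (\<theta> n) (real (m n) * w n i * w n j) x \<partial>gam) = 0"
      using eventually_ge_at_top[of 1]
    proof (eventually_elim, intro allI impI)
      fix n i j assume n: "1 \<le> n" and ij: "i < m n" "j < m n"
      have "real (m n) * w n i * w n j = (sqrt (real (m n)) * w n i) * (sqrt (real (m n)) * w n j)"
        by (simp add: mult_ac flip: mult.assoc[of "sqrt (real (m n))" "sqrt (real (m n))"])
      moreover have "(sqrt (real (m n)) * w n i) * (sqrt (real (m n)) * w n j) \<in> {-1, 1}"
        using w_sign[OF n ij(1)] w_sign[OF n ij(2)] by auto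
      ultimately have "real (m n) * w n i * w n j \<in> {-1, 1}" by (simp only:)
      then show "exp_lip R c (block_function g (\<theta> n) (real (m n) * w n i * w n j)) \<and>
         (\<integral>x. block_function g (\<theta> n) (real (m n) * w n i * w n j) x \<partial>gam) = 0"
        unfolding R_def using block_function_exp_lip[OF g c _ \<Theta>] block_function_mean[OF g c odd] by blast
    qed
  qed
  then show ?thesis
    using eventually_gram_good eventually_offdiag_id eventually_cross
  proof eventually_elim
    case (elim \<omega>)
    from elim eventually_ge_at_top[of 1] \<rho>_small[of 1, simplified] show ?case
    proof eventually_elim
      case (elim n)
      have mp: "0 < m n" "m n \<le> p n" using dims elim by auto
      have s: "sqrt (real n) > 0" using elim by simp
      have r0: "r n \<ge> 0" by (simp add: r_def)
      show ?case
        unfolding error_bound_def \<kappa>_def Let_def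
        by (rule error_bilin_unfolded[OF mp w_sign[OF elim(5)] w_zero[OF elim(5)] elim(2) elim(3) r0 s \<mu> g c elim(1) elim(4) \<theta>_def elim(6)])
    qed
  qed
qed

end

section \<open>Return to matrices\<close>

lemma scov_columns:
  "i < p \<Longrightarrow> j < p \<Longrightarrow> scov {..<n} s (columns n p Z) i j = scov {..<n} s (\<lambda>j r. Z $$ (r, j)) i j"
  unfolding scov_def dot_def columns_def by (intro arg_cong2[where f = "(/)"] sum.cong) auto

lemma bilin_le_nonneg:
  assumes "bilin_le I J M b" "finite I" "finite J" "I \<noteq> {}" "J \<noteq> {}"
  shows "b \<ge> 0"
proof -
  have "0 \<le> b * (L2_set (\<lambda>_. 1) I * L2_set (\<lambda>_. 1) J)"
    using order_trans[OF abs_ge_zero bilin_leD[OF assms(1), of "\<lambda>_. 1" "\<lambda>_. 1"]] .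
  moreover have "L2_set (\<lambda>_. 1) I * L2_set (\<lambda>_. 1) J > 0"
    using assms by (simp add: L2_set_def card_gt_0_iff)
  ultimately show ?thesis by (simp add: zero_le_mult_iff)
qed

lemma sample_cov_carrier: "Z \<in> carrier_mat n p \<Longrightarrow> sample_cov Z \<in> carrier_mat p p"
  by (simp add: sample_cov_def)

lemma spiked_sample_cov_carrier:
  assumes "v \<in> carrier_vec p" "v \<bullet> v = 1" "lam \<ge> 1" "Z \<in> carrier_mat n p"
  shows "spiked_sample_cov lam v Z \<in> carrier_mat p p"
  unfolding spiked_sample_cov_def psd_sqrt_spike[OF assms(1-3)]
  by (intro mult_carrier_mat[of _ p p] spike_sqrt_carrier assms(1) sample_cov_carrier[OF assms(4)])

lemma unit_spike:
  assumes m: "0 < m" "m \<le> p" and v: "v \<in> carrier_vec p"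
    and sgn: "\<And>i. i < m \<Longrightarrow> sqrt (real m) * v $ i \<in> {-1, 1}" and zero: "\<And>i. m \<le> i \<Longrightarrow> i < p \<Longrightarrow> v $ i = 0"
  shows "v \<bullet> v = 1"
proof -
  have sq: "v $ i * v $ i = 1 / real m" if "i < m" for i
  proof -
    have "(sqrt (real m) * v $ i) * (sqrt (real m) * v $ i) = 1" using sgn[OF that] by auto
    then have "real m * (v $ i * v $ i) = 1" by (simp add: mult_ac flip: mult.assoc[of "sqrt (real m)" "sqrt (real m)"])
    then show ?thesis using m by (simp add: field_simps)
  qed
  have "v \<bullet> v = (\<Sum>i<p. v $ i * v $ i)" using v by (simp add: scalar_prod_def atLeast0LessThan)
  also have "\<dots> = (\<Sum>i<m. v $ i * v $ i)" using m zero by (intro sum.mono_neutral_right) auto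
  also have "\<dots> = (\<Sum>i<m. 1 / real m)" using sq by (intro sum.cong) auto
  finally show ?thesis using m by simp
qed

text \<open>Off the diagonal the linear part of \<open>f\<close> at the spiked covariance cancels
  against the term with \<open>a1\<close>, and only differences of \<open>g\<close> remain. The
  kernel matrices have zero diagonal, which leaves the linear and rank-one terms there.\<close>

lemma error_entry:
  fixes Z :: "real mat" and v :: "real vec" and n p m :: nat and lam a1 \<tau> \<mu> :: real and f g :: "real \<Rightarrow> real"
  assumes \<mu>: "\<mu> = sqrt lam - 1" and g: "\<And>x. g x = f x - a1 * x" and m: "m \<le> p" and v: "v \<in> carrier_vec p" "v \<bullet> v = 1" and zero: "\<And>i. m \<le> i \<Longrightarrow> i < p \<Longrightarrow> v $ i = 0"
    and lam: "lam \<ge> 1" and Z: "Z \<in> carrier_mat n p" and n: "n \<ge> 1" and ij: "i < p" "j < p"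
  defines "E \<equiv> kernel_mat n f (spiked_sample_cov lam v Z) -
      (a1 \<cdot>\<^sub>m (spiked_sample_cov lam v Z - 1\<^sub>m p) + \<tau> \<cdot>\<^sub>m outer_square v + kernel_mat n (\<lambda>x. f x - a1 * hermite 1 x) (sample_cov Z))"
  shows "E $$ (i, j) =
    (let S = scov {..<n} (sqrt (real n)) (columns n p Z); u = (\<lambda>j. \<Sum>k<m. v $ k * S k j);
         Y = (\<lambda>i j. S i j + \<mu> * (v $ i * u j + u i * v $ j) + \<mu>\<^sup>2 * (\<Sum>k<m. v $ k * u k) * (v $ i * v $ j))
     in if i = j then - a1 * (Y i i - 1) - \<tau> * (v $ i * v $ i)
        else (g (sqrt (real n) * Y i j) - g (sqrt (real n) * S i j)) / sqrt (real n) - \<tau> * (v $ i * v $ j))"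
    and "E \<in> carrier_mat p p"
proof -
  define S where "S = scov {..<n} (sqrt (real n)) (columns n p Z)"
  define u where "u j = (\<Sum>k<m. v $ k * S k j)" for j
  define Y where "Y i j = S i j + \<mu> * (v $ i * u j + u i * v $ j) + \<mu>\<^sup>2 * (\<Sum>k<m. v $ k * u k) * (v $ i * v $ j)" for i j
  note CS = sample_cov_carrier[OF Z] and CY = spiked_sample_cov_carrier[OF v lam Z]
  have restrict: "(\<Sum>k<p. v $ k * h k) = (\<Sum>k<m. v $ k * h k)" for h :: "nat \<Rightarrow> real"
    using m zero by (intro sum.mono_neutral_right) auto
  have S: "sample_cov Z $$ (a, b) = S a b" if "a < p" "b < p" for a b
    using sample_cov_entry[OF Z n that] that by (simp add: S_def scov_columns)
  have u: "(\<Sum>k<p. v $ k * sample_cov Z $$ (k, b)) = u b" if "b < p" for b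
    unfolding restrict u_def using that m by (intro sum.cong) (auto simp: S)
  have Q: "(\<Sum>k<p. v $ k * (\<Sum>l<p. v $ l * sample_cov Z $$ (l, k))) = (\<Sum>k<m. v $ k * u k)"
    unfolding restrict[of "\<lambda>k. \<Sum>l<p. v $ l * sample_cov Z $$ (l, k)"] using m by (intro sum.cong) (auto simp: u)
  have Y: "spiked_sample_cov lam v Z $$ (a, b) = Y a b" if "a < p" "b < p" for a b
    using spiked_sample_cov_entry[OF v lam Z that] unfolding Q u[OF that(1)] u[OF that(2)] S[OF that] Y_def \<mu> .
  have O: "outer_square v \<in> carrier_mat p p" using v(1) by (rule outer_square_carrier)
  have dv: "dim_vec v = p" using v by auto
  have K: "kernel_mat n h X \<in> carrier_mat p p" if "X \<in> carrier_mat p p" for h X using that by (auto simp: kernel_mat_def)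
  have Ke: "kernel_mat n h X $$ (i, j) = (if i = j then 0 else h (sqrt (real n) * X $$ (i, j)) / sqrt (real n))" if "X \<in> carrier_mat p p" for h X
    using that ij by (auto simp: kernel_mat_def)
  have "E $$ (i, j) = kernel_mat n f (spiked_sample_cov lam v Z) $$ (i, j) -
     (a1 * (Y i j - (if i = j then 1 else 0)) + \<tau> * (v $ i * v $ j) + kernel_mat n (\<lambda>x. f x - a1 * hermite 1 x) (sample_cov Z) $$ (i, j))"
    using ij dv carrier_matD[OF CY] carrier_matD[OF CS] unfolding E_def
    by (simp add: Y carrier_matD[OF K[OF CY]] carrier_matD[OF K[OF CS]] outer_square_def del: One_nat_def)
  then have "E $$ (i, j) = (if i = j then - a1 * (Y i i - 1) - \<tau> * (v $ i * v $ i)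
        else (g (sqrt (real n) * Y i j) - g (sqrt (real n) * S i j)) / sqrt (real n) - \<tau> * (v $ i * v $ j))"
    unfolding Ke[OF CY] Ke[OF CS] hermite_1 using n ij by (auto simp: Y S g field_simps)
  then show "E $$ (i, j) =
    (let S = scov {..<n} (sqrt (real n)) (columns n p Z); u = (\<lambda>j. \<Sum>k<m. v $ k * S k j);
         Y = (\<lambda>i j. S i j + \<mu> * (v $ i * u j + u i * v $ j) + \<mu>\<^sup>2 * (\<Sum>k<m. v $ k * u k) * (v $ i * v $ j))
     in if i = j then - a1 * (Y i i - 1) - \<tau> * (v $ i * v $ i)
        else (g (sqrt (real n) * Y i j) - g (sqrt (real n) * S i j)) / sqrt (real n) - \<tau> * (v $ i * v $ j))"
    unfolding Let_def Y_def u_def S_def .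
  show "E \<in> carrier_mat p p" unfolding E_def by (intro minus_carrier_mat add_carrier_mat K[OF CS])
qed

theorem theorem2p3:
  fixes M :: "'a measure"
    and p m :: "nat \<Rightarrow> nat"
    and lam \<gamma> \<beta> c :: real
    and v :: "nat \<Rightarrow> real vec"
    and Z :: "nat \<Rightarrow> 'a \<Rightarrow> real mat"
    and f :: "real \<Rightarrow> real"
  assumes "prob_space M"
    and "\<And>n. n \<ge> 1 \<Longrightarrow> 0 < m n \<and> m n \<le> p n"
    and "lam \<ge> 1"
    and "\<And>n. n \<ge> 1 \<Longrightarrow> v n \<in> carrier_vec (p n)"
    and "\<And>n i. n \<ge> 1 \<Longrightarrow> i < m n \<Longrightarrow> sqrt (real (m n)) * v n $ i \<in> {-1, 1}"
    and "\<And>n i. n \<ge> 1 \<Longrightarrow> m n \<le> i \<Longrightarrow> i < p n \<Longrightarrow> v n $ i = 0"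
    and "\<And>n \<omega>. n \<ge> 1 \<Longrightarrow> \<omega> \<in> space M \<Longrightarrow> Z n \<omega> \<in> carrier_mat n (p n)"
    and "\<And>n i j. n \<ge> 1 \<Longrightarrow> i < n \<Longrightarrow> j < p n \<Longrightarrow>
           distributed M lborel (\<lambda>\<omega>. Z n \<omega> $$ (i, j)) (\<lambda>x. ennreal (std_normal_density x))"
    and "\<And>n. n \<ge> 1 \<Longrightarrow>
           prob_space.indep_vars M (\<lambda>_. borel) (\<lambda>(i, j) \<omega>. Z n \<omega> $$ (i, j)) ({..<n} \<times> {..<p n})"
    and "(\<lambda>n. real (p n) / real n) \<longlonglongrightarrow> \<gamma>" and "\<gamma> > 0"
    and "(\<lambda>n. real (m n) / sqrt (real n)) \<longlonglongrightarrow> \<beta>" and "\<beta> > 0"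
    and "\<And>x. f (- x) = - f x"
    and "continuous_on UNIV f"
    and "finite {x. \<not> twice_differentiable_at f x}"
    and "c > 0"
    and "\<And>x. \<bar>f x\<bar> \<le> c * exp (c * \<bar>x\<bar>)"
    and "\<And>x. f differentiable (at x) \<Longrightarrow> \<bar>deriv f x\<bar> \<le> c * exp (c * \<bar>x\<bar>)"
    and "\<And>x. twice_differentiable_at f x \<Longrightarrow> \<bar>deriv (deriv f) x\<bar> \<le> c * exp (c * \<bar>x\<bar>)"
  shows "AE \<omega> in M.
    (\<lambda>n. let S = sample_cov (Z n \<omega>);
             Y = spiked_sample_cov lam (v n) (Z n \<omega>);
             a1 = hermite_coeff f 1;
             A = a1 \<cdot>\<^sub>m (Y - 1\<^sub>m (p n))
                 + tau f \<beta> lam \<cdot>\<^sub>m outer_square (v n)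
                 + kernel_mat n (\<lambda>x. f x - a1 * hermite 1 x) S
         in op_norm (kernel_mat n f Y - A)) \<longlonglongrightarrow> 0"
proof -
  define a1 where "a1 = hermite_coeff f 1"
  define \<tau> where "\<tau> = tau f \<beta> lam"
  define \<mu> where "\<mu> = sqrt lam - 1"
  define g where "g x = f x - a1 * x" for x
  \<comment> \<open>Growth rate 1 is needed to accommodate the linear function \<open>a1 * x\<close>
    that is subtracted from \<open>f\<close>.\<close>
  define C where "C = max c 1"
  \<comment> \<open>Makes \<open>C * (2 + 2 * \<mu>) * \<eta>\<close> equal to 1/96, half of the
    exponent 1/48 of \<open>r\<close>.\<close>
  define \<eta> where "\<eta> = 1 / (96 * (C * (2 + 2 * \<mu>)))"
  have C: "C \<ge> c" "C \<ge> 1" by (auto simp: C_def)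
  have \<mu>: "\<mu> \<ge> 0" using \<open>lam \<ge> 1\<close> by (simp add: \<mu>_def)
  have lam\<mu>: "2 * \<mu> + \<mu>\<^sup>2 = lam - 1"
    using \<open>lam \<ge> 1\<close> by (simp add: \<mu>_def power2_eq_square algebra_simps)
  have "exp_lip c c f" by (rule exp_lip_of_deriv) (fact assms)+
  then have f: "exp_lip C C f" by (rule exp_lip_mono) (use C in auto)
  have fm: "f \<in> borel_measurable borel" using f by (rule exp_lip_measurable)
  have fb: "\<bar>f x\<bar> \<le> C * exp (C * \<bar>x\<bar>)" for x using f by (rule exp_lipD(1))
  have "exp_lip \<bar>a1\<bar> C (\<lambda>x. a1 * x)" using C by (intro exp_lip_mono[OF exp_lip_linear]) auto
  then have g: "exp_lip (C + \<bar>a1\<bar>) C g" unfolding g_def[abs_def] using f by (intro exp_lip_diff)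
  have "\<exists>C0. \<forall>\<theta>. \<bar>\<integral>x. g (x + \<theta>) \<partial>gam\<bar> \<le> C0 * \<theta>\<^sup>2 * exp (C * \<bar>\<theta>\<bar>)"
    unfolding g_def a1_def
  proof (rule shifted_mean_quadratic_bound[OF fm fb])
    show "f (- x) = - f x" for x by fact
    show "exp_lip (C + \<bar>a1\<bar>) C (\<lambda>x. f x - hermite_coeff f 1 * x)" using g unfolding g_def[abs_def] a1_def .
    show "0 \<le> C" using C by simp
  qed
  then obtain C0 where C0: "\<And>\<theta>. \<bar>\<integral>x. g (x + \<theta>) \<partial>gam\<bar> \<le> C0 * \<theta>\<^sup>2 * exp (C * \<bar>\<theta>\<bar>)" by blast
  interpret prob_space M by fact
  interpret spiked_model M p m \<gamma> \<beta> \<mu> "C + \<bar>a1\<bar>" C \<eta> C0 "\<lambda>n i. v n $ i" Z g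
  proof unfold_locales
    show "\<eta> > 0" using C \<mu> by (simp add: \<eta>_def)
    show "g (- x) = - g x" for x using assms by (simp add: g_def)
    show "C \<ge> 0" using C by simp
  qed (fact assms \<mu> g C0)+
  have \<tau>: "\<tau> = \<beta> * (\<integral>x. g (x + (2 * \<mu> + \<mu>\<^sup>2) / \<beta>) \<partial>gam)"
    unfolding \<tau>_def lam\<mu> g_def a1_def by (rule tau_eq[OF fm fb]) (fact assms)+
  have lim: "error_bound \<tau> a1 \<longlonglongrightarrow> 0"
    using \<tau> by (rule error_bound_tendsto) (use C \<mu> in \<open>simp add: \<eta>_def\<close>)
  have unit: "v n \<bullet> v n = 1" if "n \<ge> 1" for n
    using assms that by (intro unit_spike[of "m n" "p n"]) auto
  have "AE \<omega> in M. \<omega> \<in> space M" by (rule AE_space)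
  with eventually_error_bilin[of a1 \<tau>] show ?thesis
  proof eventually_elim
    case (elim \<omega>)
    let ?E = "\<lambda>n. kernel_mat n f (spiked_sample_cov lam (v n) (Z n \<omega>)) -
      (a1 \<cdot>\<^sub>m (spiked_sample_cov lam (v n) (Z n \<omega>) - 1\<^sub>m (p n)) + \<tau> \<cdot>\<^sub>m outer_square (v n) +
        kernel_mat n (\<lambda>x. f x - a1 * hermite 1 x) (sample_cov (Z n \<omega>)))"
    have bound: "\<forall>\<^sub>F n in sequentially. 0 \<le> op_norm (?E n) \<and> op_norm (?E n) \<le> error_bound \<tau> a1 n"
      using elim(1) eventually_ge_at_top[of 1]
    proof eventually_elim
      case (elim n)
      have n: "n \<ge> 1" using elim by simp
      have Z: "Z n \<omega> \<in> carrier_mat n (p n)" using assms(7)[OF n] \<open>\<omega> \<in> space M\<close> by blast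
      have mp: "m n \<le> p n" and v: "v n \<in> carrier_vec (p n)" using assms n by auto
      have zero: "\<And>i. m n \<le> i \<Longrightarrow> i < p n \<Longrightarrow> v n $ i = 0" using assms(6)[OF n] .
      note entry = error_entry[OF \<mu>_def g_def mp v unit[OF n] zero assms(3) Z n]
      have p0: "0 < p n" using p_pos[OF n] by simp
      have E: "?E n \<in> carrier_mat (p n) (p n)" by (rule entry(2)[OF _ _ p0 p0])
      have b0: "0 \<le> error_bound \<tau> a1 n" using elim(1) p0 by (intro bilin_le_nonneg) auto
      have "bilin_le {..<p n} {..<p n} (\<lambda>i j. ?E n $$ (i, j)) (error_bound \<tau> a1 n)"
        by (rule iffD2[OF bilin_le_cong elim(1)], rule entry(1)) auto
      then show ?case using op_norm_le[OF E b0] by simp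
    qed
    have "(\<lambda>n. op_norm (?E n)) \<longlonglongrightarrow> 0"
    proof (rule tendsto_sandwich[OF _ _ tendsto_const lim])
      show "\<forall>\<^sub>F n in sequentially. 0 \<le> op_norm (?E n)" using bound by eventually_elim simp
      show "\<forall>\<^sub>F n in sequentially. op_norm (?E n) \<le> error_bound \<tau> a1 n" using bound by eventually_elim simp
    qed
    then show ?case by (simp add: Let_def a1_def \<tau>_def)
  qed
qed

end
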